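(* Consider asymptotics as $n\to\infty$ ($p$ may depend on $n$), and let the tuning parameters be $\lambda=A_0^\dagger\{\log(p)/n\}^{1/2}$ for $\hat\gamma$ and $\lambda=A_1^\dagger\{\log(p)/n\}^{1/2}$ for $\hat\alpha$, with constants $A_0^\dagger,A_1^\dagger$. Suppose that Assumptions 1 and 2 (stated in the context) hold and that $(|S_\gamma|+|S_\alpha|)\log(p)=o(n^{1/2})$. Then, for sufficiently large constants $A_0^\dagger$ and $A_1^\dagger$, if either the logistic propensity score model is correctly specified (i.e. $\pi^*(X)=\pi(X;\gamma^* )$ for some $\gamma^*$) or the linear outcome model is correctly specified (i.e. $E(Y\mid T=1,X)=\alpha^{*\top}f(X)$ for some $\alpha^*$), the following hold: (i) $n^{1/2}\{\hat\mu^1(\hat m,\hat\pi)-\mu^1\}\to_{\mathcal D}\mathrm N(0,V)$, where $V=\mathrm{var}\{\varphi(Y,T,X;\bar m,\bar\pi)\}$; (ii) a consistent estimator of $V$ is $\hat V=\tilde E[\{\varphi(Y,T,X;\hat m,\hat\pi)-\hat\mu^1(\hat m,\hat\pi)\}^2]$; (iii) an asymptotic $(1-c)$ confidence interval for $\mu^1$ is $\hat\mu^1(\hat m,\hat\pi)\pm z_{c/2}\sqrt{\hat V/n}$, where $z_{c/2}$ is the $(1-c/2)$ quantile of $\mathrm N(0,1)$.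
   Context: **Setup.** $(Y_i,T_i,X_i)$, $i=1,\dots,n$, are i.i.d. copies of $(Y,T,X)$, where $T\in\{0,1\}$ is a treatment, $X$ is a covariate vector, and $Y=(1-T)Y^0+TY^1$ with potential outcomes $Y^0,Y^1$. Standing assumptions: $T\perp Y^0\mid X$, $T\perp Y^1\mid X$, and $0<\pi^*(x)<1$ for all $x$, where $\pi^*(x)=P(T=1\mid X=x)$. Let $\mu^1=E(Y^1)$. $\tilde E(\cdot)$ denotes the sample average over $i=1,\dots,n$. $f(x)=(f_0(x),f_1(x),\dots,f_p(x))^\top$ is a vector of known functions with $f_0\equiv1$; for $b=(b_0,\dots,b_p)^\top$, $b_{1:p}=(b_1,\dots,b_p)^\top$; $|S|$ is the size of a set $S$. **Propensity score.** $\pi(x;\gamma)=\{1+e^{-\gamma^\top f(x)}\}^{-1}$, $w(x;\gamma)=e^{-\gamma^\top f(x)}=\{1-\pi(x;\gamma)\}/\pi(x;\gamma)$, and $\ell_{\rm CAL}(\gamma)=\tilde E\{Te^{-\gamma^\top f(X)}+(1-T)\gamma^\top f(X)\}$. $\hat\gamma$ minimizes $\ell_{\rm CAL}(\gamma)+\lambda\|\gamma_{1:p}\|_1$; $\bar\gamma$ minimizes $E\{\ell_{\rm CAL}(\gamma)\}$. $\hat\pi=\pi(\cdot;\hat\gamma)$, $\bar\pi=\pi(\cdot;\bar\gamma)$. **Linear outcome regression.** $\ell_{\rm WL}(\alpha;\gamma)=\tilde E[T\,w(X;\gamma)\{Y-\alpha^\top f(X)\}^2]/2$. $\hat\alpha$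 minimizes $\ell_{\rm WL}(\alpha;\hat\gamma)+\lambda\|\alpha_{1:p}\|_1$; $\bar\alpha$ minimizes $E\{\ell_{\rm WL}(\alpha;\bar\gamma)\}$. $\hat m=\hat\alpha^\top f$, $\bar m=\bar\alpha^\top f$. **Augmented IPW estimator.** $\varphi(Y,T,X;m,\pi)=\frac{TY}{\pi(X)}-\{\frac{T}{\pi(X)}-1\}m(X)$ and $\hat\mu^1(m,\pi)=\tilde E\{\varphi(Y,T,X;m,\pi)\}$. $S_\gamma=\{0\}\cup\{j\ge1:\bar\gamma_j\ne0\}$, $S_\alpha=\{0\}\cup\{j\ge1:\bar\alpha_j\ne0\}$, $\Sigma_\gamma=E[T\,w(X;\bar\gamma)f(X)f(X)^\top]$. **Compatibility condition.** It holds for a matrix $\Sigma$ with subset $S\subset\{0,\dots,p\}$ and constants $\nu>0,\xi>1$ if $\nu^2(\sum_{j\in S}|b_j|)^2\le|S|\,b^\top\Sigma b$ for all $b\in\mathbb R^{1+p}$ with $\sum_{j\notin S}|b_j|\le\xi\sum_{j\in S}|b_j|$. **Rates.** $\lambda_0=C_{01}\sqrt{\log\{(1+p)/\epsilon\}/n}$ with $C_{01}=\max\{\sqrt2(e^{-B_0}+1)C_0,\,4e^{-B_0}C_0^2\}$, and $\lambda_1=\max\{\lambda_0,\ e^{-B_0}C_0\sqrt{8(D_0^2+D_1^2)}\sqrt{\log\{(1+p)/\epsilon\}/n}\}$, with $\epsilon=1/(1+p)$. **Assumption 1.** (i) $\max_{0\le j\le p}|f_j(X)|\le C_0$ a.s.,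 $C_0\ge1$; (ii) $\bar\gamma^\top f(X)\ge B_0$ a.s., $B_0\in\mathbb R$; (iii) the compatibility condition holds for $\Sigma_\gamma$ with $S_\gamma$ and constants $\nu_0>0,\xi_0>1$; (iv) $|S_\gamma|\lambda_0\le\eta_0$ for a sufficiently small constant $\eta_0>0$, depending only on $(A_0,C_0,\xi_0,\nu_0)$, where $A_0>1$ is the constant such that the tuning parameter for $\hat\gamma$ is $A_0\lambda_0$. **Assumption 2.** (i) $D_0^2E(\exp[\{Y^1-\bar m(X)\}^2/D_0^2]-1\mid X)\le D_1^2$ for positive constants $D_0,D_1$; (ii) the compatibility condition holds for $\Sigma_\gamma$ with $S_\alpha$ and constants $\nu_1>0,\xi_1>1$; (iii) $(1+\xi_1)^2\nu_1^{-2}|S_\alpha|\lambda_1\le\eta_1$ for a constant $0<\eta_1<1$. All constants in Assumptions 1 and 2 are fixed (not depending on $n$).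
   Formalization: Claim (iii) is stated for V bounded away from 0 as n grows; this excludes only outcomes Y^1 that are almost surely constant, where V = 0 and the interval's coverage tends to 1 instead of 1-c. *)

theory Defs
  imports "HOL-Probability.Probability" "HOL-Library.Landau_Symbols"
begin

section \<open>Probabilistic notions\<close>

text \<open>Conditional independence of two real random variables given a sub-sigma-algebra \<open>F\<close>.\<close>

definition cond_indep_given :: "'w measure \<Rightarrow> 'w measure \<Rightarrow> ('w \<Rightarrow> real) \<Rightarrow> ('w \<Rightarrow> real) \<Rightarrow> bool" where
  "cond_indep_given P F U V \<longleftrightarrow>
     (\<forall>A\<in>sets borel. \<forall>B\<in>sets borel. AE \<omega> in P.
        real_cond_exp P F (indicat_real {\<omega>\<in>space P. U \<omega> \<in> A \<and> V \<omega> \<in> B}) \<omega> =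
        real_cond_exp P F (indicat_real {\<omega>\<in>space P. U \<omega> \<in> A}) \<omega> *
        real_cond_exp P F (indicat_real {\<omega>\<in>space P. V \<omega> \<in> B}) \<omega>)"

text \<open>
  Convergence in distribution towards a target law that is itself allowed to vary with the index.
  For a constant target this is weak convergence, see \<open>conv_in_law_const\<close>.
\<close>

definition conv_in_law :: "(nat \<Rightarrow> real measure) \<Rightarrow> (nat \<Rightarrow> real measure) \<Rightarrow> bool" where
  "conv_in_law \<mu> \<nu> \<longleftrightarrow>
     (\<forall>g::real \<Rightarrow> real. continuous_on UNIV g \<longrightarrow> bounded (range g) \<longrightarrow>
        (\<lambda>n. integral\<^sup>L (\<mu> n) g - integral\<^sup>L (\<nu> n) g) \<longlonglongrightarrow> 0)"

lemma conv_in_law_const: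
  assumes "\<And>n. real_distribution (\<mu> n)" "real_distribution \<nu>"
  shows "conv_in_law \<mu> (\<lambda>_. \<nu>) \<longleftrightarrow> weak_conv_m \<mu> \<nu>"
proof
  assume c: "conv_in_law \<mu> (\<lambda>_. \<nu>)"
  show "weak_conv_m \<mu> \<nu>"
  proof (rule integral_bdd_continuous_conv_imp_weak_conv[OF assms])
    fix g :: "real \<Rightarrow> real"
    assume g: "\<And>x. isCont g x" "\<And>x. \<bar>g x\<bar> \<le> 1"
    then have "continuous_on UNIV g" "bounded (range g)"
      by (auto simp: continuous_at_imp_continuous_on bounded_iff)
    with c show "(\<lambda>n. integral\<^sup>L (\<mu> n) g) \<longlonglongrightarrow> integral\<^sup>L \<nu> g"
      unfolding conv_in_law_def by (subst LIM_zero_iff[symmetric]) blast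
  qed
next
  assume w: "weak_conv_m \<mu> \<nu>"
  show "conv_in_law \<mu> (\<lambda>_. \<nu>)"
    unfolding conv_in_law_def
  proof (intro allI impI)
    fix g :: "real \<Rightarrow> real"
    assume g: "continuous_on UNIV g" "bounded (range g)"
    then obtain B where "\<And>x. norm (g x) \<le> B"
      by (auto simp: bounded_iff)
    moreover have "\<And>x. isCont g x"
      using g(1) by (simp add: continuous_on_eq_continuous_at)
    ultimately show "(\<lambda>n. integral\<^sup>L (\<mu> n) g - integral\<^sup>L \<nu> g) \<longlonglongrightarrow> 0"
      by (intro LIM_zero weak_conv_imp_integral_bdd_continuous_conv[OF assms w])
  qed
qed

text \<open>The law \<open>N(0,v)\<close>, including the point mass at 0 for \<open>v = 0\<close>.\<close>

definition normal0 :: "real \<Rightarrow> real measure" where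
  "normal0 v = distr std_normal_distribution borel (\<lambda>z. sqrt v * z)"

definition quantile :: "real measure \<Rightarrow> real \<Rightarrow> real" where
  "quantile \<mu> q = Inf {x. q \<le> cdf \<mu> x}"


section \<open>Data\<close>

text \<open>
  \<open>P\<close> carries the population variables, \<open>M\<close> carries the i.i.d. sample, of which the observations
  with index \<open>i < n\<close> form the sample of size \<open>n\<close>. Covariates take values in an arbitrary measurable
  space \<open>N\<close>. As \<open>\<pi>\<^sup>*(x) = P(T = 1 | X = x)\<close> is only determined up to null sets, a version
  \<open>pistar\<close> with values in \<open>(0,1)\<close> is part of the data.
\<close>

abbreviation sigma_X :: "'w measure \<Rightarrow> 'x measure \<Rightarrow> ('w \<Rightarrow> 'x) \<Rightarrow> 'w measure" where
  "sigma_X P N X \<equiv> vimage_algebra (space P) X N"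

abbreviation sigma_TX ::
  "'w measure \<Rightarrow> 'x measure \<Rightarrow> ('w \<Rightarrow> real) \<Rightarrow> ('w \<Rightarrow> 'x) \<Rightarrow> 'w measure" where
  "sigma_TX P N T X \<equiv> vimage_algebra (space P) (\<lambda>\<omega>. (T \<omega>, X \<omega>)) (borel \<Otimes>\<^sub>M N)"

definition observed :: "('w \<Rightarrow> real) \<Rightarrow> ('w \<Rightarrow> real) \<Rightarrow> ('w \<Rightarrow> real) \<Rightarrow> 'w \<Rightarrow> real" where
  "observed Y0 Y1 T \<omega> = (1 - T \<omega>) * Y0 \<omega> + T \<omega> * Y1 \<omega>"

locale causal_sample = P: prob_space P + M: prob_space M
  for P :: "'w measure" and M :: "'s measure" +
  fixes N :: "'x measure"
    and Y0 Y1 T :: "'w \<Rightarrow> real" and X :: "'w \<Rightarrow> 'x"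
    and pistar :: "'x \<Rightarrow> real"
    and Ys Ts :: "nat \<Rightarrow> 's \<Rightarrow> real" and Xs :: "nat \<Rightarrow> 's \<Rightarrow> 'x"
  assumes Y0_meas: "Y0 \<in> borel_measurable P"
    and Y1_meas: "Y1 \<in> borel_measurable P"
    and T_meas: "T \<in> borel_measurable P"
    and X_meas: "X \<in> P \<rightarrow>\<^sub>M N"
    and T_binary: "\<And>\<omega>. \<omega> \<in> space P \<Longrightarrow> T \<omega> \<in> {0, 1}"
    and unconfounded0: "cond_indep_given P (sigma_X P N X) T Y0"
    and unconfounded1: "cond_indep_given P (sigma_X P N X) T Y1"
    and pistar_meas: "pistar \<in> borel_measurable N"
    and pistar_version: "AE \<omega> in P.
          real_cond_exp P (sigma_X P N X) (indicat_real {\<omega>\<in>space P. T \<omega> = 1}) \<omega> = pistar (X \<omega>)"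
    and overlap: "\<And>x. x \<in> space N \<Longrightarrow> 0 < pistar x \<and> pistar x < 1"
    and sample_indep: "prob_space.indep_vars M (\<lambda>_. borel \<Otimes>\<^sub>M (borel \<Otimes>\<^sub>M N))
          (\<lambda>i \<omega>. (Ys i \<omega>, Ts i \<omega>, Xs i \<omega>)) UNIV"
    and sample_distr: "\<And>i. distr M (borel \<Otimes>\<^sub>M (borel \<Otimes>\<^sub>M N)) (\<lambda>\<omega>. (Ys i \<omega>, Ts i \<omega>, Xs i \<omega>)) =
          distr P (borel \<Otimes>\<^sub>M (borel \<Otimes>\<^sub>M N)) (\<lambda>\<omega>. (observed Y0 Y1 T \<omega>, T \<omega>, X \<omega>))"


section \<open>Models, losses and estimators\<close>

text \<open>
  Vectors of length \<open>1 + p\<close> are functions \<open>nat \<Rightarrow> real\<close> of which only the coordinates \<open>0,\<dots>,p\<close>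
  are used.
\<close>

definition linpred :: "nat \<Rightarrow> (nat \<Rightarrow> 'x \<Rightarrow> real) \<Rightarrow> (nat \<Rightarrow> real) \<Rightarrow> 'x \<Rightarrow> real" where
  "linpred p f b x = (\<Sum>j\<le>p. b j * f j x)"

definition propensity :: "nat \<Rightarrow> (nat \<Rightarrow> 'x \<Rightarrow> real) \<Rightarrow> (nat \<Rightarrow> real) \<Rightarrow> 'x \<Rightarrow> real" where
  "propensity p f \<gamma> x = 1 / (1 + exp (- linpred p f \<gamma> x))"

definition weight :: "nat \<Rightarrow> (nat \<Rightarrow> 'x \<Rightarrow> real) \<Rightarrow> (nat \<Rightarrow> real) \<Rightarrow> 'x \<Rightarrow> real" where
  "weight p f \<gamma> x = exp (- linpred p f \<gamma> x)"

definition sample_avg :: "nat \<Rightarrow> (nat \<Rightarrow> real) \<Rightarrow> real" where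
  "sample_avg n z = (\<Sum>i<n. z i) / real n"

definition loss_cal :: "nat \<Rightarrow> (nat \<Rightarrow> 'x \<Rightarrow> real) \<Rightarrow> nat \<Rightarrow> (nat \<Rightarrow> real) \<Rightarrow> (nat \<Rightarrow> 'x) \<Rightarrow>
    (nat \<Rightarrow> real) \<Rightarrow> real" where
  "loss_cal p f n t x \<gamma> = sample_avg n
     (\<lambda>i. t i * exp (- linpred p f \<gamma> (x i)) + (1 - t i) * linpred p f \<gamma> (x i))"

definition loss_wl :: "nat \<Rightarrow> (nat \<Rightarrow> 'x \<Rightarrow> real) \<Rightarrow> nat \<Rightarrow> (nat \<Rightarrow> real) \<Rightarrow> (nat \<Rightarrow> real) \<Rightarrow>
    (nat \<Rightarrow> 'x) \<Rightarrow> (nat \<Rightarrow> real) \<Rightarrow> (nat \<Rightarrow> real) \<Rightarrow> real" where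
  "loss_wl p f n y t x \<gamma> \<alpha> = sample_avg n
     (\<lambda>i. t i * weight p f \<gamma> (x i) * (y i - linpred p f \<alpha> (x i))\<^sup>2) / 2"

definition l1_pen :: "nat \<Rightarrow> (nat \<Rightarrow> real) \<Rightarrow> real" where
  "l1_pen p b = (\<Sum>j=1..p. \<bar>b j\<bar>)"

abbreviation minimizes :: "((nat \<Rightarrow> real) \<Rightarrow> real) \<Rightarrow> (nat \<Rightarrow> real) \<Rightarrow> bool" where
  "minimizes obj b \<equiv> is_arg_min obj (\<lambda>_. True) b"

definition aipw :: "('x \<Rightarrow> real) \<Rightarrow> ('x \<Rightarrow> real) \<Rightarrow> real \<Rightarrow> real \<Rightarrow> 'x \<Rightarrow> real" where
  "aipw m \<pi> y t x = t * y / \<pi> x - (t / \<pi> x - 1) * m x"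

definition mu1_hat :: "nat \<Rightarrow> (nat \<Rightarrow> real) \<Rightarrow> (nat \<Rightarrow> real) \<Rightarrow> (nat \<Rightarrow> 'x) \<Rightarrow>
    ('x \<Rightarrow> real) \<Rightarrow> ('x \<Rightarrow> real) \<Rightarrow> real" where
  "mu1_hat n y t x m \<pi> = sample_avg n (\<lambda>i. aipw m \<pi> (y i) (t i) (x i))"

definition V_hat :: "nat \<Rightarrow> (nat \<Rightarrow> real) \<Rightarrow> (nat \<Rightarrow> real) \<Rightarrow> (nat \<Rightarrow> 'x) \<Rightarrow>
    ('x \<Rightarrow> real) \<Rightarrow> ('x \<Rightarrow> real) \<Rightarrow> real" where
  "V_hat n y t x m \<pi> =
     sample_avg n (\<lambda>i. (aipw m \<pi> (y i) (t i) (x i) - mu1_hat n y t x m \<pi>)\<^sup>2)"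

definition correct_ps :: "'w measure \<Rightarrow> ('w \<Rightarrow> 'x) \<Rightarrow> ('x \<Rightarrow> real) \<Rightarrow> nat \<Rightarrow>
    (nat \<Rightarrow> 'x \<Rightarrow> real) \<Rightarrow> bool" where
  "correct_ps P X pistar p f \<longleftrightarrow>
     (\<exists>\<gamma>. AE \<omega> in P. pistar (X \<omega>) = propensity p f \<gamma> (X \<omega>))"

text \<open>\<open>E(Y | T = 1, X)\<close> is \<open>E(Y | T, X)\<close> on the event \<open>T = 1\<close>.\<close>

definition correct_or :: "'w measure \<Rightarrow> 'x measure \<Rightarrow> ('w \<Rightarrow> real) \<Rightarrow> ('w \<Rightarrow> real) \<Rightarrow> ('w \<Rightarrow> 'x) \<Rightarrow>
    nat \<Rightarrow> (nat \<Rightarrow> 'x \<Rightarrow> real) \<Rightarrow> bool" where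
  "correct_or P N Y T X p f \<longleftrightarrow>
     (\<exists>\<alpha>. AE \<omega> in P. T \<omega> = 1 \<longrightarrow>
        real_cond_exp P (sigma_TX P N T X) Y \<omega> = linpred p f \<alpha> (X \<omega>))"


section \<open>Assumptions\<close>

definition active :: "nat \<Rightarrow> (nat \<Rightarrow> real) \<Rightarrow> nat set" where
  "active p b = {0} \<union> {j\<in>{1..p}. b j \<noteq> 0}"

definition Sigma_gamma :: "'w measure \<Rightarrow> ('w \<Rightarrow> real) \<Rightarrow> ('w \<Rightarrow> 'x) \<Rightarrow> nat \<Rightarrow>
    (nat \<Rightarrow> 'x \<Rightarrow> real) \<Rightarrow> (nat \<Rightarrow> real) \<Rightarrow> nat \<Rightarrow> nat \<Rightarrow> real" where
  "Sigma_gamma P T X p f \<gamma> j k =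
     (\<integral>\<omega>. T \<omega> * weight p f \<gamma> (X \<omega>) * f j (X \<omega>) * f k (X \<omega>) \<partial>P)"

definition compatibility :: "nat \<Rightarrow> (nat \<Rightarrow> nat \<Rightarrow> real) \<Rightarrow> nat set \<Rightarrow> real \<Rightarrow> real \<Rightarrow> bool" where
  "compatibility p \<Sigma> S \<nu> \<xi> \<longleftrightarrow>
     (\<forall>b::nat \<Rightarrow> real. (\<Sum>j\<in>{..p} - S. \<bar>b j\<bar>) \<le> \<xi> * (\<Sum>j\<in>S. \<bar>b j\<bar>) \<longrightarrow>
        \<nu>\<^sup>2 * (\<Sum>j\<in>S. \<bar>b j\<bar>)\<^sup>2 \<le> real (card S) * (\<Sum>j\<le>p. \<Sum>k\<le>p. b j * \<Sigma> j k * b k))"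

text \<open>The rates are used with \<open>\<epsilon> = 1 / (1 + p)\<close>.\<close>

definition log_rate :: "nat \<Rightarrow> nat \<Rightarrow> real" where
  "log_rate p n = (let \<epsilon> = 1 / (1 + real p) in sqrt (ln ((1 + real p) / \<epsilon>) / real n))"

definition lambda0 :: "real \<Rightarrow> real \<Rightarrow> nat \<Rightarrow> nat \<Rightarrow> real" where
  "lambda0 B0 C0 p n =
     max (sqrt 2 * (exp (- B0) + 1) * C0) (4 * exp (- B0) * C0\<^sup>2) * log_rate p n"

definition lambda1 :: "real \<Rightarrow> real \<Rightarrow> real \<Rightarrow> real \<Rightarrow> nat \<Rightarrow> nat \<Rightarrow> real" where
  "lambda1 B0 C0 D0 D1 p n =
     max (lambda0 B0 C0 p n) (exp (- B0) * C0 * sqrt (8 * (D0\<^sup>2 + D1\<^sup>2)) * log_rate p n)"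

text \<open>
  The constant \<open>A\<^sub>0 > 1\<close> is determined by writing the tuning parameter \<open>lam\<close> as \<open>A\<^sub>0 \<lambda>\<^sub>0\<close>.
\<close>

definition assumption1 :: "real \<Rightarrow> real \<Rightarrow> real \<Rightarrow> real \<Rightarrow> real \<Rightarrow>
    'w measure \<Rightarrow> ('w \<Rightarrow> real) \<Rightarrow> ('w \<Rightarrow> 'x) \<Rightarrow> nat \<Rightarrow> nat \<Rightarrow> (nat \<Rightarrow> 'x \<Rightarrow> real) \<Rightarrow>
    (nat \<Rightarrow> real) \<Rightarrow> real \<Rightarrow> bool" where
  "assumption1 C0 B0 \<nu>0 \<xi>0 \<eta>0 P T X n p f \<gamma> lam \<longleftrightarrow>
     (AE \<omega> in P. \<forall>j\<le>p. \<bar>f j (X \<omega>)\<bar> \<le> C0) \<and>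
     (AE \<omega> in P. B0 \<le> linpred p f \<gamma> (X \<omega>)) \<and>
     compatibility p (Sigma_gamma P T X p f \<gamma>) (active p \<gamma>) \<nu>0 \<xi>0 \<and>
     (\<exists>A0>1. lam = A0 * lambda0 B0 C0 p n) \<and>
     real (card (active p \<gamma>)) * lambda0 B0 C0 p n \<le> \<eta>0"

definition assumption2 :: "real \<Rightarrow> real \<Rightarrow> real \<Rightarrow> real \<Rightarrow> real \<Rightarrow> real \<Rightarrow> real \<Rightarrow>
    'w measure \<Rightarrow> 'x measure \<Rightarrow> ('w \<Rightarrow> real) \<Rightarrow> ('w \<Rightarrow> real) \<Rightarrow> ('w \<Rightarrow> 'x) \<Rightarrow> nat \<Rightarrow> nat \<Rightarrow>
    (nat \<Rightarrow> 'x \<Rightarrow> real) \<Rightarrow> (nat \<Rightarrow> real) \<Rightarrow> (nat \<Rightarrow> real) \<Rightarrow> bool" where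
  "assumption2 C0 B0 D0 D1 \<nu>1 \<xi>1 \<eta>1 P N Y1 T X n p f \<gamma> \<alpha> \<longleftrightarrow>
     (AE \<omega> in P. ennreal (D0\<^sup>2) *
        nn_cond_exp P (sigma_X P N X)
          (\<lambda>\<omega>. ennreal (exp ((Y1 \<omega> - linpred p f \<alpha> (X \<omega>))\<^sup>2 / D0\<^sup>2) - 1)) \<omega> \<le> ennreal (D1\<^sup>2)) \<and>
     compatibility p (Sigma_gamma P T X p f \<gamma>) (active p \<alpha>) \<nu>1 \<xi>1 \<and>
     (1 + \<xi>1)\<^sup>2 / \<nu>1\<^sup>2 * real (card (active p \<alpha>)) * lambda1 B0 C0 D0 D1 p n \<le> \<eta>1"

end

theory Submission
  imports Defs
begin

text \<open>
  The influence function at the limiting coefficients \<open>(g, a)\<close> is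
  \<open>phi = Y1 + (T (1 + w) - 1) R\<close> with weight \<open>w = exp (- g\<^sup>T f)\<close> and residual \<open>R = Y1 - a\<^sup>T f\<close>.
  Its mean is \<open>E Y1\<close> under either model: for a correct propensity score
  \<open>E (T (1 + w) | X) = 1\<close>, for a correct outcome model the residual of the treated is centred given
  \<open>X\<close> (\<open>mean_phi_correct_ps\<close>, \<open>mean_phi_correct_or\<close>). Everything else is to show that the estimated
  coefficients may be replaced by their limits at the cost of \<open>o(n\<^bsup>-1/2\<^esup>)\<close>, after which a
  central limit theorem for triangular arrays applies.

  The replacement works because the losses are chosen so that the derivative of the estimator with
  respect to the outcome coefficients is the gradient of the calibration loss at \<open>g\<close>, and its
  derivative with respect to the propensity coefficients is the gradient of the weighted least
  squares loss at \<open>a\<close>. Both gradients are centred. With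
  \<open>u = sqrt (ln p / n)\<close> and \<open>s\<close> the total sparsity, they are of order \<open>u\<close>, the l1 errors of
  the coefficients are of order \<open>s u\<close>, and all remainders are quadratic forms of order \<open>s u\<^sup>2\<close>;
  so the error is \<open>O(s u\<^sup>2)\<close> (\<open>estimator_expansion\<close>), and \<open>sqrt n s u\<^sup>2 = s ln p / sqrt n\<close> tends to 0.

  The error bounds for the two lasso stages rest on convexity: the penalised objective exceeds its
  value at the target on a small l1 sphere, which gives at once the existence of a minimiser and its
  localisation (\<open>sublevel_inside_sphere\<close>, \<open>minimizer_exists_of_sphere\<close>).

  The delicate point is that the dimension \<open>p\<close> may stay bounded, for all or for some \<open>n\<close>. Then the
  probability that a gradient exceeds the penalty level does not vanish, whatever the tuning
  constants, and no cone condition can be enforced. Instead a gradient along \<open>b\<close> is bounded by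
  \<open>dl u |b|\<^sub>1 + R u sqrt (Q b)\<close>, where \<open>Q\<close> is the population quadratic form and only \<open>R\<close>
  depends on the confidence level; the second term is absorbed by strong convexity
  (\<open>lasso_core\<close>). To get such a bound in low dimension (\<open>good_sample_uniform\<close>) it suffices to have small
  gradients in the directions with small \<open>Q\<close>, that is, small variance in these directions. For the
  calibration loss this needs weights \<open>w\<close> that do not degenerate, which follows from its own score
  equation (\<open>large_predictor_prob\<close>).
\<close>

section \<open>Elementary inequalities\<close>

lemma exp_minus_quadratic_lower:
  fixes x :: real
  assumes "\<bar>x\<bar> \<le> 1"
  shows "x\<^sup>2 / 6 \<le> exp (- x) - 1 + x"
proof -
  obtain t where t: "\<bar>t\<bar> \<le> \<bar>- x\<bar>"
    "exp (- x) = (\<Sum>m<2. (- x) ^ m / fact m) + exp t / fact 2 * (- x) ^ 2"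
    using Maclaurin_exp_le[of "- x" 2] by blast
  have e: "exp (- x) - 1 + x = exp t / 2 * x\<^sup>2"
    using t(2) by (simp add: numeral_2_eq_2)
  have "exp t \<ge> exp (- 1)" using t(1) assms by simp
  moreover have "exp (- 1 :: real) \<ge> 1 / 3"
    using exp_le by (simp add: exp_minus field_simps)
  ultimately have "1 / 3 \<le> exp t" by linarith
  then have "1 / 3 / 2 * x\<^sup>2 \<le> exp t / 2 * x\<^sup>2"
    by (intro mult_right_mono divide_right_mono) simp_all
  with e show ?thesis by simp
qed

lemma exp_minus_quadratic_upper:
  fixes x :: real
  assumes "\<bar>x\<bar> \<le> 1"
  shows "\<bar>exp (- x) - 1 + x\<bar> \<le> 2 * x\<^sup>2"
proof -
  obtain t where t: "\<bar>t\<bar> \<le> \<bar>- x\<bar>"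
    "exp (- x) = (\<Sum>m<2. (- x) ^ m / fact m) + exp t / fact 2 * (- x) ^ 2"
    using Maclaurin_exp_le[of "- x" 2] by blast
  have e: "exp (- x) - 1 + x = exp t / 2 * x\<^sup>2"
    using t(2) by (simp add: numeral_2_eq_2)
  have "exp t \<le> exp 1" using t(1) assms by simp
  then have "exp t \<le> 3" using exp_le by linarith
  then have "exp t / 2 * x\<^sup>2 \<le> 3 / 2 * x\<^sup>2"
    by (intro mult_right_mono) auto
  moreover have "3 / 2 * x\<^sup>2 \<le> 2 * x\<^sup>2" by simp
  moreover have "exp t / 2 * x\<^sup>2 \<ge> 0" by simp
  ultimately show ?thesis using e by linarith
qed

lemma exp_half_le_2: "exp (1 / 2 :: real) \<le> 2"
proof -
  have "(exp (1 / 2 :: real))\<^sup>2 = exp 1" by (simp add: power2_eq_square flip: exp_add)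
  also have "\<dots> \<le> 2\<^sup>2" using exp_le by simp
  finally show ?thesis by (rule power2_le_imp_le) simp
qed

lemma exp_minus_linear_upper:
  fixes x :: real
  assumes "\<bar>x\<bar> \<le> 1 / 2"
  shows "\<bar>exp (- x) - 1\<bar> \<le> 2 * \<bar>x\<bar>"
proof -
  obtain t where t: "\<bar>t\<bar> \<le> \<bar>- x\<bar>"
    "exp (- x) = (\<Sum>m<1. (- x) ^ m / fact m) + exp t / fact 1 * (- x) ^ 1"
    using Maclaurin_exp_le[of "- x" 1] by blast
  have e: "\<bar>exp (- x) - 1\<bar> = exp t * \<bar>x\<bar>"
    using t(2) by (simp add: abs_mult)
  have "exp t \<le> exp (1 / 2)" using t(1) assms by simp
  then have "exp t \<le> 2" using exp_half_le_2 by linarith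
  then have "exp t * \<bar>x\<bar> \<le> 2 * \<bar>x\<bar>" by (intro mult_right_mono) auto
  with e show ?thesis by simp
qed

lemma exp_minus_bounds:
  fixes x :: real
  assumes "\<bar>x\<bar> \<le> 1 / 2"
  shows "1 / 2 \<le> exp (- x)" "exp (- x) \<le> 2"
proof -
  have "exp (- x) \<ge> exp (- (1 / 2))" using assms by simp
  moreover have "exp (- (1 / 2) :: real) \<ge> 1 / 2"
    using exp_half_le_2 by (simp add: exp_minus field_simps)
  ultimately show "1 / 2 \<le> exp (- x)" by linarith
  have "exp (- x) \<le> exp (1 / 2)" using assms by simp
  then show "exp (- x) \<le> 2" using exp_half_le_2 by linarith
qed

lemma young:
  fixes x y c :: real
  assumes "0 < c"
  shows "x * y \<le> c * x\<^sup>2 + y\<^sup>2 / (4 * c)"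
proof -
  have "0 \<le> (2 * c * x - y)\<^sup>2 / (4 * c)" using assms by simp
  also have "(2 * c * x - y)\<^sup>2 / (4 * c) = c * x\<^sup>2 - x * y + y\<^sup>2 / (4 * c)"
    using assms by (simp add: field_simps power2_eq_square)
  finally show ?thesis by simp
qed


section \<open>Sample averages and linear predictors\<close>

definition l1 :: "nat \<Rightarrow> (nat \<Rightarrow> real) \<Rightarrow> real" where
  "l1 p b = (\<Sum>j\<le>p. \<bar>b j\<bar>)"

lemma l1_nonneg [simp]: "0 \<le> l1 p b"
  by (simp add: l1_def sum_nonneg)

lemma l1_scale: "l1 p (\<lambda>j. c * b j) = \<bar>c\<bar> * l1 p b"
  by (simp add: l1_def abs_mult sum_distrib_left)

lemma abs_coord_le_l1: "j \<le> p \<Longrightarrow> \<bar>b j\<bar> \<le> l1 p b"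
  unfolding l1_def by (rule member_le_sum) auto

lemma linpred_add: "linpred p f (\<lambda>j. b j + c j) x = linpred p f b x + linpred p f c x"
  by (simp add: linpred_def algebra_simps sum.distrib)

lemma linpred_diff: "linpred p f (\<lambda>j. b j - c j) x = linpred p f b x - linpred p f c x"
  by (simp add: linpred_def algebra_simps sum_subtractf)

lemma linpred_scale: "linpred p f (\<lambda>j. c * b j) x = c * linpred p f b x"
  by (simp add: linpred_def sum_distrib_left mult.assoc)

lemma abs_linpred_le:
  assumes "\<And>j. j \<le> p \<Longrightarrow> \<bar>f j x\<bar> \<le> C"
  shows "\<bar>linpred p f b x\<bar> \<le> C * l1 p b"
proof -
  have "\<bar>linpred p f b x\<bar> \<le> (\<Sum>j\<le>p. \<bar>b j * f j x\<bar>)"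
    unfolding linpred_def by (rule sum_abs)
  also have "\<dots> \<le> (\<Sum>j\<le>p. \<bar>b j\<bar> * C)"
    using assms by (intro sum_mono) (simp add: abs_mult mult_left_mono)
  also have "\<dots> = C * l1 p b"
    by (simp add: l1_def sum_distrib_left mult.commute)
  finally show ?thesis .
qed

lemma sample_avg_add: "sample_avg n (\<lambda>i. a i + b i) = sample_avg n a + sample_avg n b"
  by (simp add: sample_avg_def sum.distrib add_divide_distrib)

lemma sample_avg_diff: "sample_avg n (\<lambda>i. a i - b i) = sample_avg n a - sample_avg n b"
  by (simp add: sample_avg_def sum_subtractf diff_divide_distrib)

lemma sample_avg_scale: "sample_avg n (\<lambda>i. c * a i) = c * sample_avg n a"
  by (simp add: sample_avg_def flip: sum_distrib_left)

lemma sample_avg_mono: "(\<And>i. i < n \<Longrightarrow> a i \<le> b i) \<Longrightarrow> sample_avg n a \<le> sample_avg n b"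
  by (auto simp: sample_avg_def intro!: divide_right_mono sum_mono)

lemma sample_avg_nonneg: "(\<And>i. i < n \<Longrightarrow> 0 \<le> a i) \<Longrightarrow> 0 \<le> sample_avg n a"
  by (auto simp: sample_avg_def intro!: divide_nonneg_nonneg sum_nonneg)

lemma sample_avg_cong: "(\<And>i. i < n \<Longrightarrow> a i = b i) \<Longrightarrow> sample_avg n a = sample_avg n b"
  by (simp add: sample_avg_def)

lemma sample_avg_const: "0 < n \<Longrightarrow> sample_avg n (\<lambda>_. c) = c"
  by (simp add: sample_avg_def)

lemma sample_avg_const_le: "0 \<le> c \<Longrightarrow> sample_avg n (\<lambda>_. c) \<le> c"
  by (cases "n = 0") (simp_all add: sample_avg_def)

lemma abs_sample_avg_le: "\<bar>sample_avg n a\<bar> \<le> sample_avg n (\<lambda>i. \<bar>a i\<bar>)"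
  by (auto simp: sample_avg_def abs_divide intro!: divide_right_mono)

lemma sample_avg_sum: "sample_avg n (\<lambda>i. \<Sum>j\<in>A. a j i) = (\<Sum>j\<in>A. sample_avg n (a j))"
  unfolding sample_avg_def by (subst sum.swap) (simp add: sum_divide_distrib)

lemma sample_avg_cauchy_schwarz:
  "sample_avg n (\<lambda>i. \<bar>a i * b i\<bar>)
     \<le> sqrt (sample_avg n (\<lambda>i. (a i)\<^sup>2)) * sqrt (sample_avg n (\<lambda>i. (b i)\<^sup>2))"
proof -
  have "(\<Sum>i<n. \<bar>a i * b i\<bar>) \<le> L2_set a {..<n} * L2_set b {..<n}"
    using L2_set_mult_ineq[of a b "{..<n}"] by (simp add: abs_mult)
  then have "(\<Sum>i<n. \<bar>a i * b i\<bar>) / real n \<le> L2_set a {..<n} * L2_set b {..<n} / real n"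
    by (rule divide_right_mono) simp
  also have "\<dots> = sqrt (sample_avg n (\<lambda>i. (a i)\<^sup>2)) * sqrt (sample_avg n (\<lambda>i. (b i)\<^sup>2))"
    by (simp add: L2_set_def sample_avg_def real_sqrt_divide)
  finally show ?thesis by (simp add: sample_avg_def)
qed

lemma sample_avg_weighted_cauchy_schwarz:
  assumes "\<And>i. i < n \<Longrightarrow> 0 \<le> v i"
  shows "sample_avg n (\<lambda>i. v i * (\<bar>a i\<bar> * \<bar>b i\<bar>))
     \<le> sqrt (sample_avg n (\<lambda>i. v i * (a i)\<^sup>2)) * sqrt (sample_avg n (\<lambda>i. v i * (b i)\<^sup>2))"
proof -
  have "sample_avg n (\<lambda>i. v i * (\<bar>a i\<bar> * \<bar>b i\<bar>))
      = sample_avg n (\<lambda>i. \<bar>(sqrt (v i) * a i) * (sqrt (v i) * b i)\<bar>)"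
  proof (rule sample_avg_cong)
    fix i assume "i < n"
    then have v: "v i = \<bar>sqrt (v i)\<bar> * \<bar>sqrt (v i)\<bar>" using assms by simp
    show "v i * (\<bar>a i\<bar> * \<bar>b i\<bar>) = \<bar>(sqrt (v i) * a i) * (sqrt (v i) * b i)\<bar>"
      by (subst v) (simp only: abs_mult mult_ac)
  qed
  also have "\<dots> \<le> sqrt (sample_avg n (\<lambda>i. (sqrt (v i) * a i)\<^sup>2)) * sqrt (sample_avg n (\<lambda>i. (sqrt (v i) * b i)\<^sup>2))"
    by (rule sample_avg_cauchy_schwarz)
  also have "sample_avg n (\<lambda>i. (sqrt (v i) * a i)\<^sup>2) = sample_avg n (\<lambda>i. v i * (a i)\<^sup>2)"
    by (rule sample_avg_cong) (simp add: power_mult_distrib assms)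
  also have "sample_avg n (\<lambda>i. (sqrt (v i) * b i)\<^sup>2) = sample_avg n (\<lambda>i. v i * (b i)\<^sup>2)"
    by (rule sample_avg_cong) (simp add: power_mult_distrib assms)
  finally show ?thesis .
qed


section \<open>Localisation of penalised minimisers\<close>

lemma l1_pen_diff_ge:
  "(\<Sum>j\<in>{..p} - active p g. \<bar>b j\<bar>) - (\<Sum>j\<in>active p g. \<bar>b j\<bar>)
     \<le> l1_pen p (\<lambda>j. g j + b j) - l1_pen p g"
proof -
  let ?S = "active p g"
  have sub: "?S \<subseteq> {..p}" "finite ?S" "0 \<in> ?S" by (auto simp: active_def)
  have split: "{1..p} = ({..p} - ?S) \<union> (?S - {0})" by (auto simp: active_def)
  have "l1_pen p (\<lambda>j. g j + b j) - l1_pen p g = (\<Sum>j=1..p. \<bar>g j + b j\<bar> - \<bar>g j\<bar>)"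
    by (simp add: l1_pen_def sum_subtractf)
  also have "\<dots> = (\<Sum>j\<in>{..p} - ?S. \<bar>g j + b j\<bar> - \<bar>g j\<bar>) + (\<Sum>j\<in>?S - {0}. \<bar>g j + b j\<bar> - \<bar>g j\<bar>)"
    unfolding split by (rule sum.union_disjoint) (use sub in auto)
  also have "(\<Sum>j\<in>{..p} - ?S. \<bar>g j + b j\<bar> - \<bar>g j\<bar>) = (\<Sum>j\<in>{..p} - ?S. \<bar>b j\<bar>)"
    by (rule sum.cong) (auto simp: active_def)
  finally have "l1_pen p (\<lambda>j. g j + b j) - l1_pen p g
      = (\<Sum>j\<in>{..p} - ?S. \<bar>b j\<bar>) + (\<Sum>j\<in>?S - {0}. \<bar>g j + b j\<bar> - \<bar>g j\<bar>)" .
  moreover have "(\<Sum>j\<in>?S - {0}. - \<bar>b j\<bar>) \<le> (\<Sum>j\<in>?S - {0}. \<bar>g j + b j\<bar> - \<bar>g j\<bar>)"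
    by (rule sum_mono) arith
  moreover have "(\<Sum>j\<in>?S - {0}. \<bar>b j\<bar>) \<le> (\<Sum>j\<in>?S. \<bar>b j\<bar>)"
    using sub by (intro sum_mono2) auto
  ultimately show ?thesis by (simp add: sum_negf)
qed

lemma l1_split_active:
  "l1 p b = (\<Sum>j\<in>active p g. \<bar>b j\<bar>) + (\<Sum>j\<in>{..p} - active p g. \<bar>b j\<bar>)"
proof -
  have "active p g \<subseteq> {..p}" by (auto simp: active_def)
  then show ?thesis
    unfolding l1_def by (subst sum.subset_diff[of "active p g"]) (simp_all add: add.commute)
qed

lemma one_le_card_active: "1 \<le> card (active p g)"
proof -
  have "finite (active p g)" "active p g \<noteq> {}" by (auto simp: active_def)
  then show ?thesis by (simp add: Suc_le_eq card_gt_0_iff)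
qed

text \<open>
  The ray from \<open>g\<close> to \<open>g + b\<close> crosses the sphere, and convexity bounds the value at the crossing by
  values that do not exceed \<open>F g\<close>.
\<close>

lemma sublevel_inside_sphere:
  fixes F :: "(nat \<Rightarrow> real) \<Rightarrow> real"
  assumes conv: "\<And>b \<theta>. 0 \<le> \<theta> \<Longrightarrow> \<theta> \<le> 1 \<Longrightarrow>
      F (\<lambda>j. g j + \<theta> * b j) \<le> (1 - \<theta>) * F g + \<theta> * F (\<lambda>j. g j + b j)"
    and sphere: "\<And>b. l1 p b = \<rho> \<Longrightarrow> F g < F (\<lambda>j. g j + b j)"
    and \<rho>: "0 < \<rho>" and le: "F (\<lambda>j. g j + b j) \<le> F g"
  shows "l1 p b < \<rho>"
proof (rule ccontr)
  assume "\<not> l1 p b < \<rho>"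
  then have b: "\<rho> \<le> l1 p b" by simp
  define \<theta> where "\<theta> = \<rho> / l1 p b"
  have l0: "l1 p b \<noteq> 0" using \<rho> b by linarith
  have \<theta>: "0 \<le> \<theta>" "\<theta> \<le> 1" using \<rho> b l0 by (simp_all add: \<theta>_def)
  have r: "l1 p (\<lambda>j. \<theta> * b j) = \<rho>"
    unfolding l1_scale using \<theta>(1) l0 \<rho> by (simp add: \<theta>_def)
  have "F (\<lambda>j. g j + \<theta> * b j) \<le> (1 - \<theta>) * F g + \<theta> * F (\<lambda>j. g j + b j)"
    using conv \<theta> by blast
  also have "\<dots> \<le> (1 - \<theta>) * F g + \<theta> * F g"
    using le \<theta> by (intro add_left_mono mult_left_mono) auto
  also have "\<dots> = F g" by (simp add: algebra_simps)
  finally show False using sphere[OF r] by simp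
qed

text \<open>
  The calibration loss is unbounded below on some samples, so that the existence of a penalised
  minimiser has to come from the sphere condition: outside of the sphere the value is at
  least \<open>F g\<close>, and a box around \<open>g\<close> in the finitely many relevant coordinates is compact.
\<close>

lemma minimizer_exists_of_sphere:
  fixes F :: "(nat \<Rightarrow> real) \<Rightarrow> real"
  assumes conv: "\<And>b \<theta>. 0 \<le> \<theta> \<Longrightarrow> \<theta> \<le> 1 \<Longrightarrow>
      F (\<lambda>j. g j + \<theta> * b j) \<le> (1 - \<theta>) * F g + \<theta> * F (\<lambda>j. g j + b j)"
    and sphere: "\<And>b. l1 p b = \<rho> \<Longrightarrow> F g < F (\<lambda>j. g j + b j)"
    and \<rho>: "0 < \<rho>"
    and cont: "continuous_on UNIV F"
    and dep: "\<And>b c. (\<And>j. j \<le> p \<Longrightarrow> b j = c j) \<Longrightarrow> F b = F c"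
  shows "\<exists>h. minimizes F h"
proof -
  define B where "B = Pi\<^sub>E UNIV (\<lambda>j. if j \<le> p then {g j - \<rho> .. g j + \<rho>} else {g j})"
  have "compactin (product_topology (\<lambda>_::nat. euclidean :: real topology) UNIV) B"
    unfolding B_def by (subst compactin_PiE) auto
  then have cB: "compact B"
    by (simp add: euclidean_product_topology)
  have "g \<in> B" using \<rho> by (auto simp: B_def)
  then obtain h where h: "h \<in> B" "\<And>y. y \<in> B \<Longrightarrow> F h \<le> F y"
    using continuous_attains_inf[OF cB _ continuous_on_subset[OF cont subset_UNIV]] by blast
  have "F h \<le> F y" for y
  proof (cases "F y \<le> F g")
    case False
    then show ?thesis using h(2)[OF \<open>g \<in> B\<close>] by simp
  next
    case True
    define b where "b j = y j - g j" for j
    have yb: "y = (\<lambda>j. g j + b j)" by (auto simp: b_def)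
    have l: "l1 p b < \<rho>"
      by (rule sublevel_inside_sphere[OF conv sphere \<rho>]) (use True yb in auto)
    define y' where "y' j = (if j \<le> p then y j else g j)" for j
    have "y' \<in> B"
      unfolding B_def
    proof (rule PiE_I)
      fix j :: nat
      show "y' j \<in> (if j \<le> p then {g j - \<rho>..g j + \<rho>} else {g j})"
        using abs_coord_le_l1[of j p b] l by (auto simp: y'_def b_def)
    qed simp
    then have "F h \<le> F y'" by (rule h(2))
    also have "F y' = F y" by (rule dep) (simp add: y'_def)
    finally show ?thesis .
  qed
  then show ?thesis
    by (auto simp: is_arg_min_def not_less intro!: exI[of _ h])
qed

text \<open>
  Here \<open>bS\<close> and \<open>bC\<close> are the l1 norms of an error vector on and off the active set, \<open>q\<close> is its
  quadratic form and \<open>E\<close> collects what is not linear in the error. Inside the cone the compatibility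
  condition absorbs \<open>bS\<close> into \<open>q\<close>; outside of it the penalty on \<open>bC\<close> dominates and the slack \<open>E\<close>
  alone controls the error, so that no cone condition has to be verified.
\<close>

lemma lasso_core:
  fixes q E u A dl \<xi> \<nu> s bS bC cq :: real
  assumes pos: "0 \<le> q" "0 \<le> E" "0 < u" "0 < A" "0 \<le> dl" "1 < \<xi>" "0 < \<nu>" "0 < cq" "0 \<le> s"
      "0 \<le> bS" "0 \<le> bC"
    and A: "8 * dl \<le> A * (1 - 1 / \<xi>)"
    and compat: "bC \<le> \<xi> * bS \<Longrightarrow> \<nu>\<^sup>2 * bS\<^sup>2 \<le> s * q"
    and ineq: "cq * q + u * ((A - 2 * dl) * bC - (A + 2 * dl) * bS) \<le> E"
  shows "bS + bC \<le> 4 * E / (A * (1 - 1 / \<xi>) * u) + 2 * A * u * s / (cq * \<nu>\<^sup>2)"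
proof -
  define \<kappa> where "\<kappa> = 1 - 1 / \<xi>"
  have \<kappa>: "0 < \<kappa>" "\<kappa> \<le> 1" using pos by (auto simp: \<kappa>_def)
  have A': "8 * dl \<le> A * \<kappa>" using A by (simp add: \<kappa>_def)
  have "A * \<kappa> \<le> A" using pos \<kappa> by simp
  then have A2: "A / 2 \<le> A - 2 * dl" using A' pos by linarith
  show ?thesis
  proof (cases "bC \<le> \<xi> * bS")
    case True
    have "(\<nu> * bS)\<^sup>2 \<le> s * q" using compat[OF True] by (simp add: power_mult_distrib)
    then have vs: "\<nu> * bS \<le> sqrt (s * q)" by (rule real_le_rsqrt)
    have "2 * A * u * bS = 2 * A * u / \<nu> * (\<nu> * bS)" using pos by simp
    also have "\<dots> \<le> 2 * A * u / \<nu> * sqrt (s * q)"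
      using vs pos by (intro mult_left_mono) auto
    also have "\<dots> = sqrt q * (2 * A * u / \<nu> * sqrt s)" by (simp add: real_sqrt_mult)
    also have "\<dots> \<le> cq * (sqrt q)\<^sup>2 + (2 * A * u / \<nu> * sqrt s)\<^sup>2 / (4 * cq)"
      using pos by (intro young) auto
    also have "\<dots> = cq * q + A\<^sup>2 * u\<^sup>2 * s / (cq * \<nu>\<^sup>2)"
      using pos by (simp add: power_mult_distrib power_divide field_simps)
    finally have b: "2 * A * u * bS \<le> cq * q + A\<^sup>2 * u\<^sup>2 * s / (cq * \<nu>\<^sup>2)" .
    have "cq * q + u * ((A - 2 * dl) * (bS + bC)) \<le> E + 2 * A * u * bS"
      using ineq by (simp add: algebra_simps)
    then have "u * ((A - 2 * dl) * (bS + bC)) \<le> E + A\<^sup>2 * u\<^sup>2 * s / (cq * \<nu>\<^sup>2)"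
      using b by linarith
    moreover have "u * (A / 2 * (bS + bC)) \<le> u * ((A - 2 * dl) * (bS + bC))"
      using A2 pos by (intro mult_left_mono mult_right_mono) auto
    moreover have "u * (A / 2 * (bS + bC)) = u * A / 2 * (bS + bC)" by simp
    ultimately have "u * A / 2 * (bS + bC) \<le> E + A\<^sup>2 * u\<^sup>2 * s / (cq * \<nu>\<^sup>2)" by linarith
    then have "bS + bC \<le> (E + A\<^sup>2 * u\<^sup>2 * s / (cq * \<nu>\<^sup>2)) / (u * A / 2)"
      using pos by (subst pos_le_divide_eq) (auto simp: mult.commute)
    also have "\<dots> = 2 * E / (A * u) + 2 * A * u * s / (cq * \<nu>\<^sup>2)"
      using pos by (simp add: field_simps power2_eq_square)
    also have "2 * E / (A * u) \<le> 4 * E / (A * \<kappa> * u)"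
    proof -
      have "2 * E / (A * u) \<le> 4 * E / (A * u)" using pos by (intro divide_right_mono) auto
      also have "\<dots> \<le> 4 * E / (A * \<kappa> * u)"
        using pos \<kappa> \<open>A * \<kappa> \<le> A\<close> by (intro divide_left_mono mult_right_mono mult_pos_pos) auto
      finally show ?thesis .
    qed
    finally show ?thesis by (simp add: \<kappa>_def)
  next
    case False
    then have bS: "bS \<le> bC / \<xi>" using pos by (simp add: field_simps)
    then have bSC: "bS \<le> bC" using pos
      by (smt (verit) divide_le_eq_1 mult_le_cancel_left1 mult_left_le divide_inverse inverse_le_1_iff)
    have "(A + 2 * dl) * bS \<le> (A + 2 * dl) * (bC / \<xi>)"
      using bS pos by (intro mult_left_mono) auto
    then have "(A - 2 * dl) * bC - (A + 2 * dl) * bS \<ge> (A * \<kappa> - 2 * dl - 2 * dl / \<xi>) * bC"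
      by (simp add: \<kappa>_def algebra_simps)
    moreover have "A * \<kappa> - 2 * dl - 2 * dl / \<xi> \<ge> A * \<kappa> / 2"
    proof -
      have "2 * dl / \<xi> \<le> 2 * dl" using pos by (simp add: divide_le_eq mult_le_cancel_left1)
      then show ?thesis using A' pos by linarith
    qed
    then have "(A * \<kappa> - 2 * dl - 2 * dl / \<xi>) * bC \<ge> A * \<kappa> / 2 * bC"
      using pos by (intro mult_right_mono) auto
    ultimately have "u * (A * \<kappa> / 2 * bC) \<le> u * ((A - 2 * dl) * bC - (A + 2 * dl) * bS)"
      using pos by (intro mult_left_mono) auto
    moreover have "cq * q \<ge> 0" using pos by simp
    ultimately have "u * (A * \<kappa> / 2 * bC) \<le> E" using ineq by linarith
    then have "bC \<le> 2 * E / (A * \<kappa> * u)"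
      using pos \<kappa> by (simp add: field_simps)
    then have "bS + bC \<le> 4 * E / (A * \<kappa> * u)" using bSC by simp
    moreover have "0 \<le> 2 * A * u * s / (cq * \<nu>\<^sup>2)" using pos by simp
    ultimately show ?thesis by (simp add: \<kappa>_def)
  qed
qed


section \<open>Error bounds on a well-behaved sample\<close>

lemma exp_convex_segment:
  fixes z b \<theta> :: real
  assumes "0 \<le> \<theta>" "\<theta> \<le> 1"
  shows "exp (- (z + \<theta> * b)) \<le> (1 - \<theta>) * exp (- z) + \<theta> * exp (- (z + b))"
proof -
  have "exp ((1 - \<theta>) *\<^sub>R (- z) + \<theta> *\<^sub>R (- (z + b))) \<le> (1 - \<theta>) * exp (- z) + \<theta> * exp (- (z + b))"
    using assms by (intro convex_onD[OF exp_convex]) auto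
  moreover have "(1 - \<theta>) *\<^sub>R (- z) + \<theta> *\<^sub>R (- (z + b)) = - (z + \<theta> * b)"
    by (simp add: algebra_simps)
  ultimately show ?thesis by simp
qed

lemma l1_pen_convex_segment:
  assumes "0 \<le> \<theta>" "\<theta> \<le> 1"
  shows "l1_pen p (\<lambda>j. g j + \<theta> * b j) \<le> (1 - \<theta>) * l1_pen p g + \<theta> * l1_pen p (\<lambda>j. g j + b j)"
proof -
  have "\<bar>g j + \<theta> * b j\<bar> \<le> (1 - \<theta>) * \<bar>g j\<bar> + \<theta> * \<bar>g j + b j\<bar>" for j
  proof -
    have "g j + \<theta> * b j = (1 - \<theta>) * g j + \<theta> * (g j + b j)" by (simp add: algebra_simps)
    also have "\<bar>\<dots>\<bar> \<le> \<bar>(1 - \<theta>) * g j\<bar> + \<bar>\<theta> * (g j + b j)\<bar>" by (rule abs_triangle_ineq)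
    finally show ?thesis using assms by (simp add: abs_mult)
  qed
  then have "l1_pen p (\<lambda>j. g j + \<theta> * b j) \<le> (\<Sum>j=1..p. (1 - \<theta>) * \<bar>g j\<bar> + \<theta> * \<bar>g j + b j\<bar>)"
    unfolding l1_pen_def by (rule sum_mono)
  then show ?thesis by (simp add: l1_pen_def sum.distrib sum_distrib_left)
qed

lemma loss_cal_convex_segment:
  assumes "0 \<le> \<theta>" "\<theta> \<le> 1" "\<And>i. i < n \<Longrightarrow> t i \<in> {0, 1 :: real}"
  shows "loss_cal p f n t x (\<lambda>j. g j + \<theta> * b j)
     \<le> (1 - \<theta>) * loss_cal p f n t x g + \<theta> * loss_cal p f n t x (\<lambda>j. g j + b j)"
  unfolding loss_cal_def linpred_add linpred_scale
  unfolding sample_avg_scale[symmetric] sample_avg_add[symmetric]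
proof (rule sample_avg_mono)
  fix i assume i: "i < n"
  let ?z = "linpred p f g (x i)" and ?b = "linpred p f b (x i)"
  have "t i * exp (- (?z + \<theta> * ?b)) \<le> t i * ((1 - \<theta>) * exp (- ?z) + \<theta> * exp (- (?z + ?b)))"
    using exp_convex_segment[OF assms(1,2)] assms(3)[OF i] by (intro mult_left_mono) auto
  then show "t i * exp (- (?z + \<theta> * ?b)) + (1 - t i) * (?z + \<theta> * ?b)
      \<le> (1 - \<theta>) * (t i * exp (- ?z) + (1 - t i) * ?z)
        + \<theta> * (t i * exp (- (?z + ?b)) + (1 - t i) * (?z + ?b))"
    by (simp add: algebra_simps)
qed

lemma loss_wl_convex_segment:
  assumes "0 \<le> \<theta>" "\<theta> \<le> 1" "\<And>i. i < n \<Longrightarrow> t i \<in> {0, 1 :: real}"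
  shows "loss_wl p f n y t x h (\<lambda>j. a j + \<theta> * b j)
     \<le> (1 - \<theta>) * loss_wl p f n y t x h a + \<theta> * loss_wl p f n y t x h (\<lambda>j. a j + b j)"
proof -
  have "sample_avg n (\<lambda>i. t i * weight p f h (x i) * (y i - linpred p f (\<lambda>j. a j + \<theta> * b j) (x i))\<^sup>2)
      \<le> sample_avg n (\<lambda>i. (1 - \<theta>) * (t i * weight p f h (x i) * (y i - linpred p f a (x i))\<^sup>2)
          + \<theta> * (t i * weight p f h (x i) * (y i - linpred p f (\<lambda>j. a j + b j) (x i))\<^sup>2))"
  proof (rule sample_avg_mono)
    fix i assume i: "i < n"
    let ?v = "t i * weight p f h (x i)" and ?r = "y i - linpred p f a (x i)" and ?b = "linpred p f b (x i)"
    have v: "0 \<le> ?v" using assms(3)[OF i] by (auto simp: weight_def)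
    have "(1 - \<theta>) * ?r\<^sup>2 + \<theta> * (?r - ?b)\<^sup>2 - (?r - \<theta> * ?b)\<^sup>2 = \<theta> * (1 - \<theta>) * ?b\<^sup>2"
      by algebra
    also have "\<dots> \<ge> 0" using assms(1,2) by simp
    finally have "?v * (?r - \<theta> * ?b)\<^sup>2 \<le> ?v * ((1 - \<theta>) * ?r\<^sup>2 + \<theta> * (?r - ?b)\<^sup>2)"
      using v by (intro mult_left_mono) auto
    then show "?v * (y i - linpred p f (\<lambda>j. a j + \<theta> * b j) (x i))\<^sup>2
       \<le> (1 - \<theta>) * (?v * ?r\<^sup>2) + \<theta> * (?v * (y i - linpred p f (\<lambda>j. a j + b j) (x i))\<^sup>2)"
      by (simp add: linpred_add linpred_scale algebra_simps)
  qed
  also have "\<dots> = (1 - \<theta>) * sample_avg n (\<lambda>i. t i * weight p f h (x i) * (y i - linpred p f a (x i))\<^sup>2)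
     + \<theta> * sample_avg n (\<lambda>i. t i * weight p f h (x i) * (y i - linpred p f (\<lambda>j. a j + b j) (x i))\<^sup>2)"
    by (simp only: sample_avg_add sample_avg_scale)
  finally show ?thesis by (simp add: loss_wl_def)
qed

lemma loss_cal_excess:
  "loss_cal p f n t x (\<lambda>j. g j + b j) - loss_cal p f n t x g =
     sample_avg n (\<lambda>i. (1 - t i - t i * weight p f g (x i)) * linpred p f b (x i))
     + sample_avg n (\<lambda>i. t i * weight p f g (x i)
         * (exp (- linpred p f b (x i)) - 1 + linpred p f b (x i)))"
  unfolding loss_cal_def sample_avg_diff[symmetric] sample_avg_add[symmetric]
proof (rule sample_avg_cong)
  fix i
  have "exp (- (linpred p f g (x i) + linpred p f b (x i)))
      = exp (- linpred p f g (x i)) * exp (- linpred p f b (x i))"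
    by (simp flip: exp_add)
  then show "t i * exp (- linpred p f (\<lambda>j. g j + b j) (x i)) + (1 - t i) * linpred p f (\<lambda>j. g j + b j) (x i)
      - (t i * exp (- linpred p f g (x i)) + (1 - t i) * linpred p f g (x i))
      = (1 - t i - t i * weight p f g (x i)) * linpred p f b (x i)
        + t i * weight p f g (x i) * (exp (- linpred p f b (x i)) - 1 + linpred p f b (x i))"
    unfolding linpred_add weight_def by algebra
qed

lemma loss_wl_excess:
  "loss_wl p f n y t x h (\<lambda>j. a j + b j) - loss_wl p f n y t x h a =
     sample_avg n (\<lambda>i. t i * weight p f h (x i) * (linpred p f b (x i))\<^sup>2) / 2
     - sample_avg n (\<lambda>i. t i * weight p f h (x i) * (y i - linpred p f a (x i)) * linpred p f b (x i))"
proof -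
  let ?v = "\<lambda>i. t i * weight p f h (x i)"
  have "sample_avg n (\<lambda>i. ?v i * (y i - linpred p f (\<lambda>j. a j + b j) (x i))\<^sup>2) =
     sample_avg n (\<lambda>i. ?v i * (y i - linpred p f a (x i))\<^sup>2 +
       (?v i * (linpred p f b (x i))\<^sup>2 - 2 * (?v i * (y i - linpred p f a (x i)) * linpred p f b (x i))))"
    unfolding linpred_add by (rule sample_avg_cong) algebra
  then show ?thesis
    unfolding loss_wl_def sample_avg_add sample_avg_diff sample_avg_scale by linarith
qed

lemma continuous_on_linpred [continuous_intros]:
  "continuous_on UNIV (\<lambda>b :: nat \<Rightarrow> real. linpred p f b x)"
  unfolding linpred_def by (intro continuous_intros) auto

text \<open>
  The sample events on which the estimators behave: \<open>u\<close> is the rate, \<open>Q\<close> the population quadratic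
  form. The gradient of a loss along \<open>b\<close> is controlled by its l1 norm with a constant \<open>dl\<close> that the
  penalty dominates, up to a term of order \<open>u \<surd>Q\<close> which strong convexity absorbs.
  The second term is what makes these events probable also when the dimension stays bounded.
\<close>

locale good_sample =
  fixes n p :: nat and f :: "nat \<Rightarrow> 'x \<Rightarrow> real" and t y :: "nat \<Rightarrow> real" and x :: "nat \<Rightarrow> 'x"
    and g a :: "nat \<Rightarrow> real" and Q :: "(nat \<Rightarrow> real) \<Rightarrow> real" and C0 W u dl R K :: real
  assumes t01: "\<And>i. i < n \<Longrightarrow> t i \<in> {0, 1}"
    and f_le: "\<And>i j. i < n \<Longrightarrow> j \<le> p \<Longrightarrow> \<bar>f j (x i)\<bar> \<le> C0"
    and w_le: "\<And>i. i < n \<Longrightarrow> weight p f g (x i) \<le> W"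
    and params: "1 \<le> C0" "0 < u" "0 < dl" "0 \<le> R" "0 \<le> K"
    and Q_nonneg: "\<And>b. 0 \<le> Q b"
    and grad_cal: "\<And>b. \<bar>sample_avg n (\<lambda>i. (1 - t i - t i * weight p f g (x i)) * linpred p f b (x i))\<bar>
        \<le> dl * u * l1 p b + R * u * sqrt (Q b)"
    and grad_wl: "\<And>b. \<bar>sample_avg n (\<lambda>i. t i * weight p f g (x i) * (y i - linpred p f a (x i))
            * linpred p f b (x i))\<bar>
        \<le> dl * u * l1 p b + R * u * sqrt (Q b)"
    and gram: "\<And>b. \<bar>sample_avg n (\<lambda>i. t i * weight p f g (x i) * (linpred p f b (x i))\<^sup>2) - Q b\<bar>
        \<le> R * u * (l1 p b)\<^sup>2"
    and resid_gram: "\<And>b. sample_avg n (\<lambda>i. t i * weight p f g (x i) * (y i - linpred p f a (x i))\<^sup>2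
            * (linpred p f b (x i))\<^sup>2)
        \<le> K * Q b + R * u * (l1 p b)\<^sup>2"
begin

definition w where "w i = weight p f g (x i)"
definition lin where "lin b i = linpred p f b (x i)"
definition r where "r i = y i - lin a i"

lemmas folds = w_def[symmetric] lin_def[symmetric] r_def[symmetric]
lemmas grad_cal' = grad_cal[unfolded folds]
lemmas grad_wl' = grad_wl[unfolded folds]
lemmas gram' = gram[unfolded folds]
lemmas resid_gram' = resid_gram[unfolded folds]

lemma w_pos: "0 < w i"
  by (simp add: w_def weight_def)

lemma tw_nonneg: "i < n \<Longrightarrow> 0 \<le> t i * w i"
  using t01[of i] w_pos[of i] by auto

lemma abs_lin_le: "i < n \<Longrightarrow> \<bar>lin b i\<bar> \<le> C0 * l1 p b"
  unfolding lin_def by (rule abs_linpred_le) (rule f_le)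

text \<open>
  Both losses satisfy the same lower bound on their excess, so that the two lasso stages differ only
  in the slack \<open>E\<close> and the curvature \<open>cq\<close>.
\<close>

lemma penalised_bound:
  fixes L :: "(nat \<Rightarrow> real) \<Rightarrow> real"
  assumes low: "cq * Q b - E - 2 * dl * u * l1 p b \<le> L (\<lambda>j. c j + b j) - L c"
    and le: "L (\<lambda>j. c j + b j) + A * u * l1_pen p (\<lambda>j. c j + b j) \<le> L c + A * u * l1_pen p c"
    and pos: "0 < cq" "0 \<le> E" "0 < A" "1 < \<xi>" "0 < \<nu>"
    and A: "8 * dl \<le> A * (1 - 1 / \<xi>)"
    and s: "real (card (active p c)) \<le> s"
    and compat: "(\<Sum>j\<in>{..p} - active p c. \<bar>b j\<bar>) \<le> \<xi> * (\<Sum>j\<in>active p c. \<bar>b j\<bar>) \<Longrightarrow>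
        \<nu>\<^sup>2 * (\<Sum>j\<in>active p c. \<bar>b j\<bar>)\<^sup>2 \<le> real (card (active p c)) * Q b"
  shows "l1 p b \<le> 4 * E / (A * (1 - 1 / \<xi>) * u) + 2 * A * u * s / (cq * \<nu>\<^sup>2)"
    and "cq * Q b \<le> E + (A + 2 * dl) * u * l1 p b"
proof -
  define bS where "bS = (\<Sum>j\<in>active p c. \<bar>b j\<bar>)"
  define bC where "bC = (\<Sum>j\<in>{..p} - active p c. \<bar>b j\<bar>)"
  have nn: "0 \<le> bS" "0 \<le> bC" by (auto simp: bS_def bC_def sum_nonneg)
  have l1: "l1 p b = bS + bC" unfolding bS_def bC_def by (rule l1_split_active)
  have "bC - bS \<le> l1_pen p (\<lambda>j. c j + b j) - l1_pen p c"
    unfolding bS_def bC_def by (rule l1_pen_diff_ge)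
  then have "A * u * (bC - bS) \<le> A * u * (l1_pen p (\<lambda>j. c j + b j) - l1_pen p c)"
    using pos params by (intro mult_left_mono) auto
  then have main: "cq * Q b + A * u * (bC - bS) \<le> E + 2 * dl * u * (bS + bC)"
    using low le l1 by (simp add: right_diff_distrib)
  have "bS + bC \<le> 4 * E / (A * (1 - 1 / \<xi>) * u) + 2 * A * u * s / (cq * \<nu>\<^sup>2)"
  proof (rule lasso_core[where dl = dl and q = "Q b"])
    show "\<nu>\<^sup>2 * bS\<^sup>2 \<le> s * Q b" if "bC \<le> \<xi> * bS"
    proof -
      have "\<nu>\<^sup>2 * bS\<^sup>2 \<le> real (card (active p c)) * Q b"
        using compat that unfolding bS_def bC_def by blast
      also have "\<dots> \<le> s * Q b" using s Q_nonneg by (intro mult_right_mono)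
      finally show ?thesis .
    qed
    show "cq * Q b + u * ((A - 2 * dl) * bC - (A + 2 * dl) * bS) \<le> E"
      using main by (simp add: algebra_simps)
    show "0 \<le> s" using s by linarith
  qed (use pos params nn A Q_nonneg in auto)
  then show "l1 p b \<le> 4 * E / (A * (1 - 1 / \<xi>) * u) + 2 * A * u * s / (cq * \<nu>\<^sup>2)"
    using l1 by simp
  have "A * u * (bS - bC) \<le> A * u * (bS + bC)"
    using pos params nn by (intro mult_left_mono) auto
  then show "cq * Q b \<le> E + (A + 2 * dl) * u * l1 p b"
    using main l1 by (simp add: algebra_simps)
qed

lemma gradient_absorbed:
  assumes "0 < c"
  shows "R * u * sqrt (Q b) \<le> c * Q b + R\<^sup>2 * u\<^sup>2 / (4 * c)"
  using young[OF assms, of "sqrt (Q b)" "R * u"] Q_nonneg[of b]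
  by (simp add: power_mult_distrib mult.commute)

text \<open>
  As the excess is sought only near the target, the exponential may be replaced by its quadratic
  minorant; half of the resulting form pays for the \<open>sqrt (Q b)\<close> part of the gradient.
\<close>

lemma cal_excess_lower:
  assumes "C0 * \<rho> \<le> 1" "R * \<rho> \<le> 6 * dl" and l: "l1 p b \<le> \<rho>"
  shows "1 / 12 * Q b - 3 * R\<^sup>2 * u\<^sup>2 - 2 * dl * u * l1 p b
     \<le> loss_cal p f n t x (\<lambda>j. g j + b j) - loss_cal p f n t x g"
proof -
  have "C0 * l1 p b \<le> C0 * \<rho>" using l params by (intro mult_left_mono) auto
  then have lin1: "\<bar>lin b i\<bar> \<le> 1" if "i < n" for i
    using abs_lin_le[OF that, of b] assms(1) by linarith
  have "sample_avg n (\<lambda>i. 1 / 6 * (t i * w i * (lin b i)\<^sup>2))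
      \<le> sample_avg n (\<lambda>i. t i * w i * (exp (- lin b i) - 1 + lin b i))"
  proof (rule sample_avg_mono)
    fix i assume i: "i < n"
    have "t i * w i * ((lin b i)\<^sup>2 / 6) \<le> t i * w i * (exp (- lin b i) - 1 + lin b i)"
      using exp_minus_quadratic_lower[OF lin1[OF i]] tw_nonneg[OF i] by (rule mult_left_mono)
    then show "1 / 6 * (t i * w i * (lin b i)\<^sup>2) \<le> t i * w i * (exp (- lin b i) - 1 + lin b i)" by simp
  qed
  then have 1: "1 / 6 * sample_avg n (\<lambda>i. t i * w i * (lin b i)\<^sup>2)
      \<le> sample_avg n (\<lambda>i. t i * w i * (exp (- lin b i) - 1 + lin b i))"
    by (simp only: sample_avg_scale)
  have 2: "Q b - R * u * (l1 p b)\<^sup>2 \<le> sample_avg n (\<lambda>i. t i * w i * (lin b i)\<^sup>2)"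
    using gram'[of b] by linarith
  have 3: "- (dl * u * l1 p b + R * u * sqrt (Q b))
      \<le> sample_avg n (\<lambda>i. (1 - t i - t i * w i) * lin b i)"
    using grad_cal'[of b] by linarith
  have 4: "R * u * sqrt (Q b) \<le> 1 / 12 * Q b + 3 * R\<^sup>2 * u\<^sup>2"
    using gradient_absorbed[of "1 / 12" b] by simp
  have "R * l1 p b \<le> R * \<rho>" using l params by (intro mult_left_mono) auto
  then have "R * l1 p b \<le> 6 * dl" using assms(2) by linarith
  then have "(R * l1 p b) * (u * l1 p b) \<le> (6 * dl) * (u * l1 p b)"
    using params by (intro mult_right_mono) auto
  then have 5: "R * u * (l1 p b)\<^sup>2 \<le> 6 * (dl * u * l1 p b)"
    by (simp add: power2_eq_square algebra_simps)
  show ?thesis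
    unfolding loss_cal_excess folds using 1 2 3 4 5 by linarith
qed

lemma propensity_localised:
  fixes A \<xi> \<nu> s \<rho> :: real
  defines "F \<equiv> \<lambda>h. loss_cal p f n t x h + A * u * l1_pen p h"
  assumes \<rho>: "C0 * \<rho> \<le> 1" "R * \<rho> \<le> 6 * dl"
      "12 * R\<^sup>2 * u / (A * (1 - 1 / \<xi>)) + 24 * A * u * s / \<nu>\<^sup>2 < \<rho>"
    and pos: "0 < A" "1 < \<xi>" "0 < \<nu>"
    and A: "8 * dl \<le> A * (1 - 1 / \<xi>)"
    and s: "real (card (active p g)) \<le> s"
    and compat: "\<And>b. (\<Sum>j\<in>{..p} - active p g. \<bar>b j\<bar>) \<le> \<xi> * (\<Sum>j\<in>active p g. \<bar>b j\<bar>) \<Longrightarrow>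
        \<nu>\<^sup>2 * (\<Sum>j\<in>active p g. \<bar>b j\<bar>)\<^sup>2 \<le> real (card (active p g)) * Q b"
  shows "\<exists>h. minimizes F h"
    and "minimizes F h \<Longrightarrow> l1 p (\<lambda>j. h j - g j) \<le> \<rho>"
    and "minimizes F h \<Longrightarrow> Q (\<lambda>j. h j - g j) \<le> 12 * (3 * R\<^sup>2 * u\<^sup>2 + (A + 2 * dl) * u * \<rho>)"
proof -
  let ?E = "3 * R\<^sup>2 * u\<^sup>2"
  have bnd: "l1 p b < \<rho> \<and> 1 / 12 * Q b \<le> ?E + (A + 2 * dl) * u * l1 p b"
    if b: "l1 p b \<le> \<rho>" "F (\<lambda>j. g j + b j) \<le> F g" for b
  proof -
    have E: "0 \<le> ?E" "0 < (1 / 12 :: real)" by simp_all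
    note pb = penalised_bound[OF cal_excess_lower[OF \<rho>(1,2) b(1)]
        b(2)[unfolded F_def] E(2,1) pos A s compat]
    have "4 * ?E / (A * (1 - 1 / \<xi>) * u) = 12 * R\<^sup>2 * u / (A * (1 - 1 / \<xi>))"
      using params by (simp add: power2_eq_square)
    then show ?thesis using pb \<rho>(3) by simp
  qed
  have "0 \<le> 12 * R\<^sup>2 * u / (A * (1 - 1 / \<xi>)) + 24 * A * u * s / \<nu>\<^sup>2"
    using pos params s by (intro add_nonneg_nonneg divide_nonneg_nonneg mult_nonneg_nonneg) auto
  then have \<rho>0: "0 < \<rho>" using \<rho>(3) by linarith
  have sphere: "F g < F (\<lambda>j. g j + b j)" if "l1 p b = \<rho>" for b
    using bnd[of b] that by force
  have conv: "F (\<lambda>j. g j + \<theta> * b j) \<le> (1 - \<theta>) * F g + \<theta> * F (\<lambda>j. g j + b j)"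
    if \<theta>: "0 \<le> \<theta>" "\<theta> \<le> 1" for b \<theta>
  proof -
    have "A * u * l1_pen p (\<lambda>j. g j + \<theta> * b j)
        \<le> A * u * ((1 - \<theta>) * l1_pen p g + \<theta> * l1_pen p (\<lambda>j. g j + b j))"
      using pos params l1_pen_convex_segment[OF \<theta>] by (intro mult_left_mono) auto
    moreover have "loss_cal p f n t x (\<lambda>j. g j + \<theta> * b j)
       \<le> (1 - \<theta>) * loss_cal p f n t x g + \<theta> * loss_cal p f n t x (\<lambda>j. g j + b j)"
      by (rule loss_cal_convex_segment[OF \<theta> t01])
    ultimately show ?thesis by (simp add: F_def algebra_simps)
  qed
  have cont: "continuous_on UNIV F"
unfolding F_def loss_cal_def sample_avg_def l1_pen_def divide_inverse
    by (intro continuous_intros continuous_on_rabs) auto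
  have dep: "F b = F c" if "\<And>j. j \<le> p \<Longrightarrow> b j = c j" for b c
  proof -
    have "linpred p f b z = linpred p f c z" for z unfolding linpred_def using that by simp
    moreover have "l1_pen p b = l1_pen p c" unfolding l1_pen_def using that by simp
    ultimately show ?thesis by (simp add: F_def loss_cal_def)
  qed
  show "\<exists>h. minimizes F h"
    by (rule minimizer_exists_of_sphere[OF conv sphere \<rho>0 cont dep])
  assume "minimizes F h"
  then have "F h \<le> F g" by (auto simp: is_arg_min_def not_less)
  then have le: "F (\<lambda>j. g j + (h j - g j)) \<le> F g" by simp
  have l: "l1 p (\<lambda>j. h j - g j) < \<rho>"
    by (rule sublevel_inside_sphere[OF conv sphere \<rho>0 le])
  then show "l1 p (\<lambda>j. h j - g j) \<le> \<rho>" by simp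
  have "1 / 12 * Q (\<lambda>j. h j - g j) \<le> ?E + (A + 2 * dl) * u * l1 p (\<lambda>j. h j - g j)"
    using bnd[OF less_imp_le[OF l] le] by simp
  also have "(A + 2 * dl) * u * l1 p (\<lambda>j. h j - g j) \<le> (A + 2 * dl) * u * \<rho>"
    using l pos params by (intro mult_left_mono) auto
  finally show "Q (\<lambda>j. h j - g j) \<le> 12 * (?E + (A + 2 * dl) * u * \<rho>)" by simp
qed

text \<open>
  Estimated weights perturb the gradient of the outcome loss. Cauchy-Schwarz puts the perturbation
  into the slack \<open>e2\<close> plus a fraction of the quadratic term.
\<close>

lemma wl_excess_lower:
  fixes h :: "nat \<Rightarrow> real"
  defines "d \<equiv> \<lambda>j. h j - g j"
  assumes d: "C0 * l1 p d \<le> 1 / 2" and e2: "K * Q d + R * u * (l1 p d)\<^sup>2 \<le> e2"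
    and b: "R * l1 p b \<le> 8 * dl"
  shows "1 / 16 * Q b - (4 * R\<^sup>2 * u\<^sup>2 + 8 * e2) - 2 * dl * u * l1 p b
     \<le> loss_wl p f n y t x h (\<lambda>j. a j + b j) - loss_wl p f n y t x h a"
proof -
  have lin1: "\<bar>lin d i\<bar> \<le> 1 / 2" if "i < n" for i
    using abs_lin_le[OF that, of d] d by linarith
  have wh: "weight p f h (x i) = w i * exp (- lin d i)" for i
    by (simp add: weight_def w_def lin_def d_def linpred_diff flip: exp_add)
  define q where "q = sample_avg n (\<lambda>i. t i * w i * (lin b i)\<^sup>2)"
  have q0: "0 \<le> q" unfolding q_def by (rule sample_avg_nonneg) (simp add: tw_nonneg)
  have 1: "q / 2 \<le> sample_avg n (\<lambda>i. t i * weight p f h (x i) * (lin b i)\<^sup>2)"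
  proof -
    have "q / 2 = sample_avg n (\<lambda>i. 1 / 2 * (t i * w i * (lin b i)\<^sup>2))"
      by (simp only: sample_avg_scale q_def)
    also have "\<dots> \<le> sample_avg n (\<lambda>i. t i * weight p f h (x i) * (lin b i)\<^sup>2)"
    proof (rule sample_avg_mono)
      fix i assume i: "i < n"
      have "1 / 2 * (t i * w i * (lin b i)\<^sup>2) \<le> exp (- lin d i) * (t i * w i * (lin b i)\<^sup>2)"
        using exp_minus_bounds(1)[OF lin1[OF i]] tw_nonneg[OF i] by (intro mult_right_mono) auto
      then show "1 / 2 * (t i * w i * (lin b i)\<^sup>2) \<le> t i * weight p f h (x i) * (lin b i)\<^sup>2"
        by (simp add: wh mult_ac)
    qed
    finally show ?thesis .
  qed
  have 2: "sample_avg n (\<lambda>i. t i * weight p f h (x i) * r i * lin b i)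
      \<le> sample_avg n (\<lambda>i. t i * w i * r i * lin b i) + 2 * (sqrt e2 * sqrt q)"
  proof -
    have "sample_avg n (\<lambda>i. t i * weight p f h (x i) * r i * lin b i)
        \<le> sample_avg n (\<lambda>i. t i * w i * r i * lin b i + 2 * (t i * w i * (\<bar>r i * lin d i\<bar> * \<bar>lin b i\<bar>)))"
    proof (rule sample_avg_mono)
      fix i assume i: "i < n"
      have "(exp (- lin d i) - 1) * (r i * lin b i) \<le> \<bar>exp (- lin d i) - 1\<bar> * \<bar>r i * lin b i\<bar>"
        by (metis abs_ge_self abs_mult)
      also have "\<dots> \<le> 2 * \<bar>lin d i\<bar> * \<bar>r i * lin b i\<bar>"
        using exp_minus_linear_upper[OF lin1[OF i]] by (intro mult_right_mono) auto
      finally have "t i * w i * ((exp (- lin d i) - 1) * (r i * lin b i))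
          \<le> t i * w i * (2 * \<bar>lin d i\<bar> * \<bar>r i * lin b i\<bar>)"
        using tw_nonneg[OF i] by (rule mult_left_mono)
      then show "t i * weight p f h (x i) * r i * lin b i
          \<le> t i * w i * r i * lin b i + 2 * (t i * w i * (\<bar>r i * lin d i\<bar> * \<bar>lin b i\<bar>))"
        by (simp add: wh abs_mult algebra_simps)
    qed
    also have "\<dots> = sample_avg n (\<lambda>i. t i * w i * r i * lin b i)
        + 2 * sample_avg n (\<lambda>i. t i * w i * (\<bar>r i * lin d i\<bar> * \<bar>lin b i\<bar>))"
      by (simp only: sample_avg_add sample_avg_scale)
    also have "sample_avg n (\<lambda>i. t i * w i * (\<bar>r i * lin d i\<bar> * \<bar>lin b i\<bar>))
        \<le> sqrt (sample_avg n (\<lambda>i. t i * w i * (r i * lin d i)\<^sup>2)) * sqrt q"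
      unfolding q_def by (rule sample_avg_weighted_cauchy_schwarz) (rule tw_nonneg)
    also have "sqrt (sample_avg n (\<lambda>i. t i * w i * (r i * lin d i)\<^sup>2)) \<le> sqrt e2"
      using resid_gram'[of d] e2 by (simp add: power_mult_distrib mult.assoc)
    finally show ?thesis using q0 by (simp add: mult_right_mono)
  qed
  have e20: "0 \<le> e2"
    using params Q_nonneg[of d] by (intro order_trans[OF _ e2] add_nonneg_nonneg mult_nonneg_nonneg) auto
  have 3: "2 * (sqrt e2 * sqrt q) \<le> q / 8 + 8 * e2"
    using young[of "1 / 8" "sqrt q" "2 * sqrt e2"] q0 e20 by (simp add: power_mult_distrib mult_ac)
  have 4: "sample_avg n (\<lambda>i. t i * w i * r i * lin b i) \<le> dl * u * l1 p b + R * u * sqrt (Q b)"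
    using grad_wl'[of b] by linarith
  have 5: "R * u * sqrt (Q b) \<le> 1 / 16 * Q b + 4 * R\<^sup>2 * u\<^sup>2"
    using gradient_absorbed[of "1 / 16" b] by simp
  have 6: "Q b - R * u * (l1 p b)\<^sup>2 \<le> q" unfolding q_def using gram'[of b] by linarith
  have "(R * l1 p b) * (u * l1 p b) \<le> (8 * dl) * (u * l1 p b)"
    using b params by (intro mult_right_mono) auto
  then have 7: "R * u * (l1 p b)\<^sup>2 \<le> 8 * (dl * u * l1 p b)"
    by (simp add: power2_eq_square algebra_simps)
  show ?thesis
    unfolding loss_wl_excess folds using 1 2 3 4 5 6 7 by linarith
qed

lemma outcome_localised:
  fixes h ah :: "nat \<Rightarrow> real" and A \<xi> \<nu> s \<rho> e2 :: real
  defines "d \<equiv> \<lambda>j. h j - g j"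
  defines "F \<equiv> \<lambda>b. loss_wl p f n y t x h b + A * u * l1_pen p b"
  assumes d: "C0 * l1 p d \<le> 1 / 2" and e2: "K * Q d + R * u * (l1 p d)\<^sup>2 \<le> e2"
    and \<rho>: "R * \<rho> \<le> 8 * dl"
      "4 * (4 * R\<^sup>2 * u\<^sup>2 + 8 * e2) / (A * (1 - 1 / \<xi>) * u) + 32 * A * u * s / \<nu>\<^sup>2 < \<rho>"
    and pos: "0 < A" "1 < \<xi>" "0 < \<nu>"
    and A: "8 * dl \<le> A * (1 - 1 / \<xi>)"
    and s: "real (card (active p a)) \<le> s"
    and compat: "\<And>b. (\<Sum>j\<in>{..p} - active p a. \<bar>b j\<bar>) \<le> \<xi> * (\<Sum>j\<in>active p a. \<bar>b j\<bar>) \<Longrightarrow>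
        \<nu>\<^sup>2 * (\<Sum>j\<in>active p a. \<bar>b j\<bar>)\<^sup>2 \<le> real (card (active p a)) * Q b"
    and ah: "minimizes F ah"
  shows "l1 p (\<lambda>j. ah j - a j) \<le> \<rho>"
    and "Q (\<lambda>j. ah j - a j) \<le> 16 * (4 * R\<^sup>2 * u\<^sup>2 + 8 * e2 + (A + 2 * dl) * u * \<rho>)"
proof -
  let ?E = "4 * R\<^sup>2 * u\<^sup>2 + 8 * e2"
  have e20: "0 \<le> e2"
    using params Q_nonneg[of d] by (intro order_trans[OF _ e2] add_nonneg_nonneg mult_nonneg_nonneg) auto
  have E: "0 \<le> ?E" "0 < (1 / 16 :: real)" using e20 by simp_all
  have bnd: "l1 p b < \<rho> \<and> 1 / 16 * Q b \<le> ?E + (A + 2 * dl) * u * l1 p b"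
    if b: "l1 p b \<le> \<rho>" "F (\<lambda>j. a j + b j) \<le> F a" for b
  proof -
    have "R * l1 p b \<le> R * \<rho>" using b(1) params by (intro mult_left_mono) auto
    then have "R * l1 p b \<le> 8 * dl" using \<rho>(1) by linarith
    note low = wl_excess_lower[OF d[unfolded d_def] e2[unfolded d_def] this]
    note pb = penalised_bound[OF low b(2)[unfolded F_def] E(2,1) pos A s compat]
    show ?thesis using pb \<rho>(2) by simp
  qed
  have "0 \<le> 4 * ?E / (A * (1 - 1 / \<xi>) * u) + 32 * A * u * s / \<nu>\<^sup>2"
    using pos params s E e20 by (intro add_nonneg_nonneg divide_nonneg_nonneg mult_nonneg_nonneg) auto
  then have \<rho>0: "0 < \<rho>" using \<rho>(2) by linarith
  have sphere: "F a < F (\<lambda>j. a j + b j)" if "l1 p b = \<rho>" for b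
    using bnd[of b] that by force
  have conv: "F (\<lambda>j. a j + \<theta> * b j) \<le> (1 - \<theta>) * F a + \<theta> * F (\<lambda>j. a j + b j)"
    if \<theta>: "0 \<le> \<theta>" "\<theta> \<le> 1" for b \<theta>
  proof -
    have "A * u * l1_pen p (\<lambda>j. a j + \<theta> * b j)
        \<le> A * u * ((1 - \<theta>) * l1_pen p a + \<theta> * l1_pen p (\<lambda>j. a j + b j))"
      using pos params l1_pen_convex_segment[OF \<theta>] by (intro mult_left_mono) auto
    moreover have "loss_wl p f n y t x h (\<lambda>j. a j + \<theta> * b j)
       \<le> (1 - \<theta>) * loss_wl p f n y t x h a + \<theta> * loss_wl p f n y t x h (\<lambda>j. a j + b j)"
      by (rule loss_wl_convex_segment[OF \<theta> t01])
    ultimately show ?thesis by (simp add: F_def algebra_simps)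
  qed
  have "F ah \<le> F a" using ah by (auto simp: is_arg_min_def not_less)
  then have le: "F (\<lambda>j. a j + (ah j - a j)) \<le> F a" by simp
  have l: "l1 p (\<lambda>j. ah j - a j) < \<rho>"
    by (rule sublevel_inside_sphere[OF conv sphere \<rho>0 le])
  then show "l1 p (\<lambda>j. ah j - a j) \<le> \<rho>" by simp
  have "1 / 16 * Q (\<lambda>j. ah j - a j) \<le> ?E + (A + 2 * dl) * u * l1 p (\<lambda>j. ah j - a j)"
    using bnd[OF less_imp_le[OF l] le] by simp
  also have "(A + 2 * dl) * u * l1 p (\<lambda>j. ah j - a j) \<le> (A + 2 * dl) * u * \<rho>"
    using l pos params by (intro mult_left_mono) auto
  finally show "Q (\<lambda>j. ah j - a j) \<le> 16 * (?E + (A + 2 * dl) * u * \<rho>)" by simp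
qed

end


lemma inverse_propensity: "t / propensity p f h z = t * (1 + weight p f h z)"
proof -
  have "0 < 1 + weight p f h z" by (simp add: weight_def add_pos_pos)
  then show ?thesis by (simp add: propensity_def weight_def)
qed

lemma aipw_eq:
  "aipw m (propensity p f h) y t z
     = t * y * (1 + weight p f h z) - (t * (1 + weight p f h z) - 1) * m z"
  unfolding aipw_def inverse_propensity
  using inverse_propensity[of "t * y" p f h z] by simp

context good_sample
begin

lemma abs_tw: "i < n \<Longrightarrow> \<bar>t i\<bar> * \<bar>w i\<bar> = t i * w i"
  using tw_nonneg[of i] by (simp flip: abs_mult)

text \<open>
  Orthogonality: to first order the errors \<open>b\<close> and \<open>d\<close> enter through the scores of the
  calibration and of the outcome loss; every other term is a product of two errors.
\<close>

lemma aipw_diff: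
  fixes h ah :: "nat \<Rightarrow> real"
  defines "d \<equiv> \<lambda>j. h j - g j" and "b \<equiv> \<lambda>j. ah j - a j"
  shows "aipw (linpred p f ah) (propensity p f h) (y i) (t i) (x i)
       - aipw (linpred p f a) (propensity p f g) (y i) (t i) (x i)
     = (1 - t i - t i * w i) * lin b i + t i * w i * (exp (- lin d i) - 1) * (r i - lin b i)"
proof -
  have wh: "weight p f h (x i) = w i * exp (- lin d i)"
    by (simp add: weight_def w_def lin_def d_def linpred_diff flip: exp_add)
  have mh: "linpred p f ah (x i) = lin a i + lin b i"
    by (simp add: lin_def b_def linpred_diff)
  show ?thesis
    unfolding aipw_eq wh mh unfolding w_def[symmetric] lin_def[symmetric] r_def by algebra
qed

lemma mu1_hat_expansion:
  fixes h ah :: "nat \<Rightarrow> real" and L B :: real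
  defines "d \<equiv> \<lambda>j. h j - g j" and "b \<equiv> \<lambda>j. ah j - a j"
  assumes L: "l1 p d \<le> L" "l1 p b \<le> L" "C0 * L \<le> 1 / 2" and B: "Q d \<le> B" "Q b \<le> B"
  shows "\<bar>mu1_hat n y t x (linpred p f ah) (propensity p f h)
          - mu1_hat n y t x (linpred p f a) (propensity p f g)\<bar>
    \<le> 2 * dl * u * L + 2 * R * u * sqrt B + (3 + K) * B + 4 * R * u * L\<^sup>2"
proof -
  have C0L: "C0 * l1 p d \<le> C0 * L" using L params by (intro mult_left_mono) auto
  then have lin1: "\<bar>lin d i\<bar> \<le> 1 / 2" if "i < n" for i
    using abs_lin_le[OF that, of d] L(3) by linarith
  let ?rem = "\<lambda>i. exp (- lin d i) - 1 + lin d i"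
  have "mu1_hat n y t x (linpred p f ah) (propensity p f h)
          - mu1_hat n y t x (linpred p f a) (propensity p f g)
      = sample_avg n (\<lambda>i. (1 - t i - t i * w i) * lin b i
          - t i * w i * r i * lin d i + t i * w i * ?rem i * r i
          - t i * w i * (exp (- lin d i) - 1) * lin b i)"
    unfolding mu1_hat_def sample_avg_diff[symmetric] aipw_diff d_def[symmetric] b_def[symmetric]
    by (rule sample_avg_cong) algebra
  also have "\<dots> = sample_avg n (\<lambda>i. (1 - t i - t i * w i) * lin b i)
       - sample_avg n (\<lambda>i. t i * w i * r i * lin d i)
       + sample_avg n (\<lambda>i. t i * w i * ?rem i * r i)
       - sample_avg n (\<lambda>i. t i * w i * (exp (- lin d i) - 1) * lin b i)"
    by (simp only: sample_avg_add sample_avg_diff)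
  finally have eq: "mu1_hat n y t x (linpred p f ah) (propensity p f h)
          - mu1_hat n y t x (linpred p f a) (propensity p f g) = \<dots>" .
  have l2: "R * u * (l1 p c)\<^sup>2 \<le> R * u * L\<^sup>2" if "l1 p c \<le> L" for c
    using that params by (intro mult_left_mono power_mono) auto
  have sq: "dl * u * l1 p c + R * u * sqrt (Q c) \<le> dl * u * L + R * u * sqrt B"
    if "l1 p c \<le> L" "Q c \<le> B" for c
    using that params by (intro add_mono mult_left_mono) auto
  have 1: "\<bar>sample_avg n (\<lambda>i. (1 - t i - t i * w i) * lin b i)\<bar> \<le> dl * u * L + R * u * sqrt B"
    using grad_cal'[of b] sq[OF L(2) B(2)] by linarith
  have 2: "\<bar>sample_avg n (\<lambda>i. t i * w i * r i * lin d i)\<bar> \<le> dl * u * L + R * u * sqrt B"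
    using grad_wl'[of d] sq[OF L(1) B(1)] by linarith
  have gd: "sample_avg n (\<lambda>i. t i * w i * (lin d i)\<^sup>2) \<le> B + R * u * L\<^sup>2"
    using gram'[of d] l2[OF L(1)] B(1) by linarith
  have gb: "sample_avg n (\<lambda>i. t i * w i * (lin b i)\<^sup>2) \<le> B + R * u * L\<^sup>2"
    using gram'[of b] l2[OF L(2)] B(2) by linarith
  have "K * Q d \<le> K * B" using B params by (intro mult_left_mono) auto
  then have rd: "sample_avg n (\<lambda>i. t i * w i * (r i)\<^sup>2 * (lin d i)\<^sup>2) \<le> K * B + R * u * L\<^sup>2"
    using resid_gram'[of d] l2[OF L(1)] by linarith
  have 3: "\<bar>sample_avg n (\<lambda>i. t i * w i * ?rem i * r i)\<bar> \<le> (1 + K) * B + 2 * R * u * L\<^sup>2"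
  proof -
    have "\<bar>sample_avg n (\<lambda>i. t i * w i * ?rem i * r i)\<bar> \<le> sample_avg n (\<lambda>i. \<bar>t i * w i * ?rem i * r i\<bar>)"
      by (rule abs_sample_avg_le)
    also have "\<dots> \<le> sample_avg n (\<lambda>i. t i * w i * (lin d i)\<^sup>2 + t i * w i * (r i)\<^sup>2 * (lin d i)\<^sup>2)"
    proof (rule sample_avg_mono)
      fix i assume i: "i < n"
      have "\<bar>?rem i\<bar> \<le> 2 * (lin d i)\<^sup>2" using lin1[OF i] by (intro exp_minus_quadratic_upper) simp
      then have "\<bar>?rem i\<bar> * \<bar>r i\<bar> \<le> 2 * (lin d i)\<^sup>2 * \<bar>r i\<bar>" by (rule mult_right_mono) simp
      also have "\<dots> \<le> (lin d i)\<^sup>2 * (1 + (r i)\<^sup>2)"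
      proof -
        have "2 * \<bar>r i\<bar> \<le> 1 + (r i)\<^sup>2" using zero_le_power2[of "\<bar>r i\<bar> - 1"] by (simp add: power2_diff)
        then have "(lin d i)\<^sup>2 * (2 * \<bar>r i\<bar>) \<le> (lin d i)\<^sup>2 * (1 + (r i)\<^sup>2)" by (rule mult_left_mono) simp
        then show ?thesis by (simp add: mult_ac)
      qed
      finally have "(t i * w i) * (\<bar>?rem i\<bar> * \<bar>r i\<bar>) \<le> (t i * w i) * ((lin d i)\<^sup>2 * (1 + (r i)\<^sup>2))"
        using tw_nonneg[OF i] by (rule mult_left_mono)
      moreover have "\<bar>t i * w i * ?rem i * r i\<bar> = (t i * w i) * (\<bar>?rem i\<bar> * \<bar>r i\<bar>)"
        by (simp add: abs_mult abs_tw[OF i])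
      ultimately show "\<bar>t i * w i * ?rem i * r i\<bar>
          \<le> t i * w i * (lin d i)\<^sup>2 + t i * w i * (r i)\<^sup>2 * (lin d i)\<^sup>2"
        by (simp add: algebra_simps)
    qed
    also have "\<dots> \<le> (B + R * u * L\<^sup>2) + (K * B + R * u * L\<^sup>2)"
      unfolding sample_avg_add using gd rd by linarith
    finally show ?thesis by (simp add: algebra_simps)
  qed
  have 4: "\<bar>sample_avg n (\<lambda>i. t i * w i * (exp (- lin d i) - 1) * lin b i)\<bar> \<le> 2 * B + 2 * R * u * L\<^sup>2"
  proof -
    have "\<bar>sample_avg n (\<lambda>i. t i * w i * (exp (- lin d i) - 1) * lin b i)\<bar>
        \<le> sample_avg n (\<lambda>i. \<bar>t i * w i * (exp (- lin d i) - 1) * lin b i\<bar>)"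
      by (rule abs_sample_avg_le)
    also have "\<dots> \<le> sample_avg n (\<lambda>i. t i * w i * (lin d i)\<^sup>2 + t i * w i * (lin b i)\<^sup>2)"
    proof (rule sample_avg_mono)
      fix i assume i: "i < n"
      have "\<bar>exp (- lin d i) - 1\<bar> * \<bar>lin b i\<bar> \<le> 2 * \<bar>lin d i\<bar> * \<bar>lin b i\<bar>"
        using exp_minus_linear_upper[OF lin1[OF i]] by (rule mult_right_mono) simp
      also have "\<dots> \<le> (lin d i)\<^sup>2 + (lin b i)\<^sup>2"
        using sum_squares_bound[of "\<bar>lin d i\<bar>" "\<bar>lin b i\<bar>"] by simp
      finally have "(t i * w i) * (\<bar>exp (- lin d i) - 1\<bar> * \<bar>lin b i\<bar>)
          \<le> (t i * w i) * ((lin d i)\<^sup>2 + (lin b i)\<^sup>2)"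
        using tw_nonneg[OF i] by (rule mult_left_mono)
      moreover have "\<bar>t i * w i * (exp (- lin d i) - 1) * lin b i\<bar>
          = (t i * w i) * (\<bar>exp (- lin d i) - 1\<bar> * \<bar>lin b i\<bar>)"
        by (simp add: abs_mult abs_tw[OF i])
      ultimately show "\<bar>t i * w i * (exp (- lin d i) - 1) * lin b i\<bar>
          \<le> t i * w i * (lin d i)\<^sup>2 + t i * w i * (lin b i)\<^sup>2"
        by (simp add: algebra_simps)
    qed
    also have "\<dots> \<le> (B + R * u * L\<^sup>2) + (B + R * u * L\<^sup>2)"
      unfolding sample_avg_add using gd gb by linarith
    finally show ?thesis by simp
  qed
  have "(3 + K) * B = (1 + K) * B + 2 * B" by (simp add: algebra_simps)
  then show ?thesis unfolding eq using 1 2 3 4 by linarith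
qed

lemma aipw_mean_square_expansion:
  fixes h ah :: "nat \<Rightarrow> real" and L B :: real
  defines "d \<equiv> \<lambda>j. h j - g j" and "b \<equiv> \<lambda>j. ah j - a j"
  assumes L: "l1 p d \<le> L" "l1 p b \<le> L" "C0 * L \<le> 1 / 2" and B: "Q d \<le> B" and W: "0 \<le> W"
  shows "sample_avg n (\<lambda>i. (aipw (linpred p f ah) (propensity p f h) (y i) (t i) (x i)
       - aipw (linpred p f a) (propensity p f g) (y i) (t i) (x i))\<^sup>2)
     \<le> 2 * (1 + 2 * W)\<^sup>2 * (C0 * L)\<^sup>2 + 8 * W * (K * B + R * u * L\<^sup>2)"
proof -
  have CL: "C0 * l1 p c \<le> C0 * L" if "l1 p c \<le> L" for c
    using that params by (intro mult_left_mono) auto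
  have lin1: "\<bar>lin d i\<bar> \<le> 1 / 2" if "i < n" for i
    using abs_lin_le[OF that, of d] L(3) CL[OF L(1)] by linarith
  have "sample_avg n (\<lambda>i. (aipw (linpred p f ah) (propensity p f h) (y i) (t i) (x i)
       - aipw (linpred p f a) (propensity p f g) (y i) (t i) (x i))\<^sup>2)
     \<le> sample_avg n (\<lambda>i. 2 * (1 + 2 * W)\<^sup>2 * (C0 * L)\<^sup>2 + 8 * W * (t i * w i * (r i)\<^sup>2 * (lin d i)\<^sup>2))"
  proof (rule sample_avg_mono)
    fix i assume i: "i < n"
    let ?e = "exp (- lin d i)"
    define A where "A = (1 - t i - t i * w i * ?e) * lin b i"
    define D where "D = t i * w i * (?e - 1) * r i"
    have e: "0 \<le> ?e" "?e \<le> 2" using exp_minus_bounds(2)[OF lin1[OF i]] by auto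
    have wW: "0 \<le> w i" "w i \<le> W" using w_pos[of i] w_le[OF i] by (auto simp: w_def)
    have "w i * ?e \<le> W * 2" using wW e by (intro mult_mono) auto
    moreover have "0 \<le> w i * ?e" using wW e by simp
    ultimately have "\<bar>1 - t i - t i * (w i * ?e)\<bar> \<le> 1 + 2 * W"
      using t01[OF i] W by (cases "t i = 0") (simp_all only: insert_iff empty_iff, auto)
    then have "\<bar>1 - t i - t i * w i * ?e\<bar> \<le> 1 + 2 * W" by (simp add: mult.assoc)
    moreover have "\<bar>lin b i\<bar> \<le> C0 * L" using abs_lin_le[OF i, of b] CL[OF L(2)] by linarith
    ultimately have "\<bar>A\<bar> \<le> (1 + 2 * W) * (C0 * L)"
      unfolding A_def abs_mult using W by (intro mult_mono) auto
    then have A2: "A\<^sup>2 \<le> ((1 + 2 * W) * (C0 * L))\<^sup>2" by (rule abs_le_square_iff[THEN iffD1, OF order_trans]) simp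
    have "\<bar>?e - 1\<bar> \<le> \<bar>2 * lin d i\<bar>" using exp_minus_linear_upper[OF lin1[OF i]] by simp
    then have "(?e - 1)\<^sup>2 \<le> (2 * lin d i)\<^sup>2" by (simp only: abs_le_square_iff)
    then have e2: "(?e - 1)\<^sup>2 \<le> 4 * (lin d i)\<^sup>2" by (simp add: power_mult_distrib)
    have tt: "t i * t i = t i" using t01[OF i] by auto
    have "D\<^sup>2 = (t i * t i) * w i * w i * (r i)\<^sup>2 * (?e - 1)\<^sup>2"
      unfolding D_def by algebra
    also have "\<dots> = (t i * w i * (r i)\<^sup>2) * (w i * (?e - 1)\<^sup>2)" unfolding tt by algebra
    also have "\<dots> \<le> (t i * w i * (r i)\<^sup>2) * (W * (4 * (lin d i)\<^sup>2))"
      using wW e2 W tw_nonneg[OF i] by (intro mult_left_mono mult_mono) auto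
    finally have D2: "D\<^sup>2 \<le> 4 * W * (t i * w i * (r i)\<^sup>2 * (lin d i)\<^sup>2)" by (simp add: mult_ac)
    have AD: "aipw (linpred p f ah) (propensity p f h) (y i) (t i) (x i)
       - aipw (linpred p f a) (propensity p f g) (y i) (t i) (x i) = A + D"
      unfolding aipw_diff d_def[symmetric] b_def[symmetric] A_def D_def by algebra
    have "(A + D)\<^sup>2 \<le> 2 * A\<^sup>2 + 2 * D\<^sup>2"
      using zero_le_power2[of "A - D"] by (simp add: power2_sum power2_diff)
    also have "\<dots> \<le> 2 * ((1 + 2 * W) * (C0 * L))\<^sup>2 + 2 * (4 * W * (t i * w i * (r i)\<^sup>2 * (lin d i)\<^sup>2))"
      using A2 D2 by linarith
    finally show "(aipw (linpred p f ah) (propensity p f h) (y i) (t i) (x i)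
       - aipw (linpred p f a) (propensity p f g) (y i) (t i) (x i))\<^sup>2
       \<le> 2 * (1 + 2 * W)\<^sup>2 * (C0 * L)\<^sup>2 + 8 * W * (t i * w i * (r i)\<^sup>2 * (lin d i)\<^sup>2)"
      unfolding AD by (simp add: power_mult_distrib)
  qed
  also have "\<dots> \<le> 2 * (1 + 2 * W)\<^sup>2 * (C0 * L)\<^sup>2 + 8 * W * sample_avg n (\<lambda>i. t i * w i * (r i)\<^sup>2 * (lin d i)\<^sup>2)"
    unfolding sample_avg_add sample_avg_scale by (intro add_right_mono mult_left_mono sample_avg_const_le) simp_all
  also have "sample_avg n (\<lambda>i. t i * w i * (r i)\<^sup>2 * (lin d i)\<^sup>2) \<le> K * B + R * u * L\<^sup>2"
  proof -
    have "K * Q d \<le> K * B" "R * u * (l1 p d)\<^sup>2 \<le> R * u * L\<^sup>2"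
      using B L params by (auto intro!: mult_left_mono power_mono)
    then show ?thesis using resid_gram'[of d] by linarith
  qed
  finally show ?thesis using W by (simp add: mult_left_mono)
qed

end

text \<open>
  The two stages are chained: the error of the propensity stage (constants \<open>L0\<close>, \<open>B0\<close>) enters the
  outcome stage through the slack \<open>e\<close>. The threshold \<open>\<tau>\<close> on \<open>s u\<close> makes the linear predictors of all
  errors at most 1/2, where the exponential is comparable with its Taylor polynomials.
\<close>

theorem estimator_expansion:
  fixes C0 W dl R K A0 A1 \<nu>0 \<xi>0 \<nu>1 \<xi>1 :: real
  assumes pos: "1 \<le> C0" "0 \<le> W" "0 < dl" "0 \<le> R" "0 \<le> K" "0 < A0" "0 < A1" "1 < \<xi>0" "1 < \<xi>1" "0 < \<nu>0" "0 < \<nu>1"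
    and A0: "8 * dl \<le> A0 * (1 - 1 / \<xi>0)" and A1: "8 * dl \<le> A1 * (1 - 1 / \<xi>1)"
  shows "\<exists>Kf \<tau>. 0 < \<tau> \<and> 0 \<le> Kf \<and> (\<forall>n p (f :: nat \<Rightarrow> 'x \<Rightarrow> real) t y x g a Q u s h ah.
      good_sample n p f t y x g a Q C0 W u dl R K \<longrightarrow> 1 \<le> s \<longrightarrow> s * u \<le> \<tau> \<longrightarrow>
      real (card (active p g)) \<le> s \<longrightarrow> real (card (active p a)) \<le> s \<longrightarrow>
      (\<forall>b. (\<Sum>j\<in>{..p} - active p g. \<bar>b j\<bar>) \<le> \<xi>0 * (\<Sum>j\<in>active p g. \<bar>b j\<bar>) \<longrightarrow>
        \<nu>0\<^sup>2 * (\<Sum>j\<in>active p g. \<bar>b j\<bar>)\<^sup>2 \<le> real (card (active p g)) * Q b) \<longrightarrow>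
      (\<forall>b. (\<Sum>j\<in>{..p} - active p a. \<bar>b j\<bar>) \<le> \<xi>1 * (\<Sum>j\<in>active p a. \<bar>b j\<bar>) \<longrightarrow>
        \<nu>1\<^sup>2 * (\<Sum>j\<in>active p a. \<bar>b j\<bar>)\<^sup>2 \<le> real (card (active p a)) * Q b) \<longrightarrow>
      ((\<exists>c. minimizes (\<lambda>c. loss_cal p f n t x c + A0 * u * l1_pen p c) c) \<longrightarrow>
         minimizes (\<lambda>c. loss_cal p f n t x c + A0 * u * l1_pen p c) h) \<longrightarrow>
      minimizes (\<lambda>c. loss_wl p f n y t x h c + A1 * u * l1_pen p c) ah \<longrightarrow>
      \<bar>mu1_hat n y t x (linpred p f ah) (propensity p f h)
          - mu1_hat n y t x (linpred p f a) (propensity p f g)\<bar> \<le> Kf * (s * u\<^sup>2) \<and>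
      sample_avg n (\<lambda>i. (aipw (linpred p f ah) (propensity p f h) (y i) (t i) (x i)
       - aipw (linpred p f a) (propensity p f g) (y i) (t i) (x i))\<^sup>2) \<le> Kf * (s * u))"
proof -
  define k0 where "k0 = 1 - 1 / \<xi>0"
  define k1 where "k1 = 1 - 1 / \<xi>1"
  have k: "0 < k0" "0 < k1" using pos by (auto simp: k0_def k1_def)
  define L0 where "L0 = 12 * R\<^sup>2 / (A0 * k0) + 24 * A0 / \<nu>0\<^sup>2 + 1"
  define B0 where "B0 = 12 * (3 * R\<^sup>2 + (A0 + 2 * dl) * L0)"
  define e where "e = K * B0 + R * L0\<^sup>2"
  define L1 where "L1 = 4 * (4 * R\<^sup>2 + 8 * e) / (A1 * k1) + 32 * A1 / \<nu>1\<^sup>2 + 1"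
  define B1 where "B1 = 16 * (4 * R\<^sup>2 + 8 * e + (A1 + 2 * dl) * L1)"
  define L where "L = max L0 L1"
  define B where "B = max B0 B1"
  define \<tau> where "\<tau> = min 1 (min (1 / (2 * C0 * L)) (6 * dl / ((R + 1) * L)))"
  define Kf1 where "Kf1 = 2 * dl * L + 2 * R * (1 + B) + (3 + K) * B + 4 * R * L\<^sup>2"
  define Kf2 where "Kf2 = 2 * (1 + 2 * W)\<^sup>2 * (C0 * L)\<^sup>2 + 8 * W * (K * B + R * L\<^sup>2)"
  have L0: "1 \<le> L0" using pos k by (simp add: L0_def)
  have B0: "0 \<le> B0" using pos L0 by (simp add: B0_def)
  have e: "0 \<le> e" using pos B0 by (simp add: e_def)
  have L1: "1 \<le> L1" using pos k e by (simp add: L1_def)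
  have LL: "L0 \<le> L" "L1 \<le> L" "1 \<le> L" using L0 by (auto simp: L_def)
  have BB: "B0 \<le> B" "B1 \<le> B" "0 \<le> B" using B0 by (auto simp: B_def)
  have \<tau>: "0 < \<tau>" using pos LL by (simp add: \<tau>_def)
  have Kf: "0 \<le> Kf1" "0 \<le> Kf2" using pos LL BB by (auto simp: Kf1_def Kf2_def)
  show ?thesis
  proof (rule exI[of _ "max Kf1 Kf2"], rule exI[of _ \<tau>], intro conjI allI impI)
    show "0 < \<tau>" by (rule \<tau>)
    show "0 \<le> max Kf1 Kf2" using Kf by simp
    fix n p :: nat and f :: "nat \<Rightarrow> 'x \<Rightarrow> real" and t y :: "nat \<Rightarrow> real" and x :: "nat \<Rightarrow> 'x"
      and g a h ah :: "nat \<Rightarrow> real" and Q :: "(nat \<Rightarrow> real) \<Rightarrow> real" and u s :: real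
    assume "good_sample n p f t y x g a Q C0 W u dl R K"
    then interpret good_sample n p f t y x g a Q C0 W u dl R K .
    assume s: "1 \<le> s" "s * u \<le> \<tau>"
      and cg: "real (card (active p g)) \<le> s" and ca: "real (card (active p a)) \<le> s"
      and compat0: "\<forall>b. (\<Sum>j\<in>{..p} - active p g. \<bar>b j\<bar>) \<le> \<xi>0 * (\<Sum>j\<in>active p g. \<bar>b j\<bar>) \<longrightarrow>
        \<nu>0\<^sup>2 * (\<Sum>j\<in>active p g. \<bar>b j\<bar>)\<^sup>2 \<le> real (card (active p g)) * Q b"
      and compat1: "\<forall>b. (\<Sum>j\<in>{..p} - active p a. \<bar>b j\<bar>) \<le> \<xi>1 * (\<Sum>j\<in>active p a. \<bar>b j\<bar>) \<longrightarrow>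
        \<nu>1\<^sup>2 * (\<Sum>j\<in>active p a. \<bar>b j\<bar>)\<^sup>2 \<le> real (card (active p a)) * Q b"
      and h: "(\<exists>c. minimizes (\<lambda>c. loss_cal p f n t x c + A0 * u * l1_pen p c) c) \<longrightarrow>
         minimizes (\<lambda>c. loss_cal p f n t x c + A0 * u * l1_pen p c) h"
      and ah: "minimizes (\<lambda>c. loss_wl p f n y t x h c + A1 * u * l1_pen p c) ah"
    have u: "0 < u" by (rule params)
    have su: "0 < s * u" "s * u \<le> 1" using s u by (auto simp: \<tau>_def)
    have su2: "0 \<le> s * u\<^sup>2" using s by simp
    have small: "C0 * (c * (s * u)) \<le> 1 / 2" "R * (c * (s * u)) \<le> 6 * dl" if "0 \<le> c" "c \<le> L" for c
    proof -
      have c: "c * (s * u) \<le> L * \<tau>" using that s su LL by (intro mult_mono) auto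
      have "C0 * (L * \<tau>) \<le> C0 * (L * (1 / (2 * C0 * L)))"
        using pos LL by (intro mult_left_mono) (auto simp: \<tau>_def)
      also have "\<dots> = 1 / 2" using pos LL by simp
      finally show "C0 * (c * (s * u)) \<le> 1 / 2"
        using c pos by (smt (verit) mult_left_mono)
      have "R * (L * \<tau>) \<le> (R + 1) * (L * (6 * dl / ((R + 1) * L)))"
        using pos LL \<tau> by (intro mult_mono) (auto simp: \<tau>_def)
      also have "\<dots> = ((R + 1) * L) * (6 * dl / ((R + 1) * L))" by (simp only: mult.assoc)
      also have "\<dots> = 6 * dl" using pos LL by (subst nonzero_mult_div_cancel_left[symmetric, of "(R + 1) * L"]) simp_all
      finally show "R * (c * (s * u)) \<le> 6 * dl"
        using c pos by (smt (verit) mult_left_mono)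
    qed
    let ?\<rho>0 = "L0 * (s * u)" and ?\<rho>1 = "L1 * (s * u)"
    have us: "c * u \<le> c * (s * u)" "c * u\<^sup>2 \<le> c * (s * u\<^sup>2)" if "0 \<le> c" for c
      using s u that by (auto intro!: mult_left_mono)
    have le0: "12 * R\<^sup>2 * u / (A0 * (1 - 1 / \<xi>0)) + 24 * A0 * u * s / \<nu>0\<^sup>2 < ?\<rho>0"
    proof -
      have "12 * R\<^sup>2 * u / (A0 * k0) = 12 * R\<^sup>2 / (A0 * k0) * u" by simp
      also have "\<dots> \<le> 12 * R\<^sup>2 / (A0 * k0) * (s * u)" using pos k by (intro us) auto
      finally show ?thesis
        using su unfolding L0_def k0_def[symmetric] by (simp add: algebra_simps)
    qed
    have C1: "C0 * ?\<rho>0 \<le> 1" using small(1)[of L0] L0 LL by simp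
    note pl = propensity_localised[OF C1 small(2)[of L0] le0 _ _ _ A0 cg]
    have pl0: "\<exists>c. minimizes (\<lambda>c. loss_cal p f n t x c + A0 * u * l1_pen p c) c"
      by (rule pl(1)) (use L0 LL pos compat0 in auto)
    have h': "minimizes (\<lambda>c. loss_cal p f n t x c + A0 * u * l1_pen p c) h" using h pl0 by blast
    have d1: "l1 p (\<lambda>j. h j - g j) \<le> ?\<rho>0"
      by (rule pl(2)[OF _ _ _ _ _ _ h']) (use L0 LL pos compat0 in auto)
    have d2: "Q (\<lambda>j. h j - g j) \<le> 12 * (3 * R\<^sup>2 * u\<^sup>2 + (A0 + 2 * dl) * u * ?\<rho>0)"
      by (rule pl(3)[OF _ _ _ _ _ _ h']) (use L0 LL pos compat0 in auto)
    have d3: "Q (\<lambda>j. h j - g j) \<le> B0 * (s * u\<^sup>2)"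
    proof -
      have "3 * R\<^sup>2 * u\<^sup>2 \<le> 3 * R\<^sup>2 * (s * u\<^sup>2)" by (rule us) simp
      then show ?thesis using d2 by (simp add: B0_def power2_eq_square algebra_simps)
    qed
    have e2: "K * Q (\<lambda>j. h j - g j) + R * u * (l1 p (\<lambda>j. h j - g j))\<^sup>2 \<le> e * (s * u\<^sup>2)"
    proof -
      have "K * Q (\<lambda>j. h j - g j) \<le> K * (B0 * (s * u\<^sup>2))" using d3 pos by (intro mult_left_mono) auto
      moreover have "R * u * (l1 p (\<lambda>j. h j - g j))\<^sup>2 \<le> R * u * ?\<rho>0\<^sup>2"
        using d1 pos u by (intro mult_left_mono power_mono) auto
      moreover have "R * u * ?\<rho>0\<^sup>2 \<le> R * L0\<^sup>2 * (s * u\<^sup>2)"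
      proof -
        have "R * u * ?\<rho>0\<^sup>2 = (R * L0\<^sup>2 * (s * u\<^sup>2)) * (s * u)" by algebra
        also have "\<dots> \<le> (R * L0\<^sup>2 * (s * u\<^sup>2)) * 1" using su pos su2 by (intro mult_left_mono) auto
        finally show ?thesis by simp
      qed
      ultimately show ?thesis by (simp add: e_def algebra_simps)
    qed
    have le1: "4 * (4 * R\<^sup>2 * u\<^sup>2 + 8 * (e * (s * u\<^sup>2))) / (A1 * (1 - 1 / \<xi>1) * u) + 32 * A1 * u * s / \<nu>1\<^sup>2 < ?\<rho>1"
    proof -
      have "4 * R\<^sup>2 * u\<^sup>2 \<le> 4 * R\<^sup>2 * (s * u\<^sup>2)" by (rule us) simp
      then have "4 * (4 * R\<^sup>2 * u\<^sup>2 + 8 * (e * (s * u\<^sup>2))) \<le> 4 * (4 * R\<^sup>2 + 8 * e) * (s * u\<^sup>2)"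
        by (simp add: algebra_simps)
      then have "4 * (4 * R\<^sup>2 * u\<^sup>2 + 8 * (e * (s * u\<^sup>2))) / (A1 * k1 * u) \<le> 4 * (4 * R\<^sup>2 + 8 * e) * (s * u\<^sup>2) / (A1 * k1 * u)"
        using pos k u by (intro divide_right_mono) auto
      also have "\<dots> = 4 * (4 * R\<^sup>2 + 8 * e) / (A1 * k1) * (s * u)"
        using u by (simp add: power2_eq_square)
      finally show ?thesis
        using su unfolding L1_def k1_def[symmetric] by (simp add: algebra_simps)
    qed
    have Cd: "C0 * l1 p (\<lambda>j. h j - g j) \<le> 1 / 2"
    proof -
      have "C0 * l1 p (\<lambda>j. h j - g j) \<le> C0 * ?\<rho>0" using d1 pos by (intro mult_left_mono) auto
      then show ?thesis using small(1)[of L0] L0 LL by simp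
    qed
    have R1: "R * ?\<rho>1 \<le> 8 * dl" using small(2)[of L1] L1 LL pos by simp
    note ol = outcome_localised[OF Cd e2 R1 le1 _ _ _ A1 ca _ ah]
    have b1: "l1 p (\<lambda>j. ah j - a j) \<le> ?\<rho>1" by (rule ol(1)) (use pos compat1 in auto)
    have b2: "Q (\<lambda>j. ah j - a j) \<le> 16 * (4 * R\<^sup>2 * u\<^sup>2 + 8 * (e * (s * u\<^sup>2)) + (A1 + 2 * dl) * u * ?\<rho>1)"
      by (rule ol(2)) (use pos compat1 in auto)
    have b3: "Q (\<lambda>j. ah j - a j) \<le> B1 * (s * u\<^sup>2)"
    proof -
      have "4 * R\<^sup>2 * u\<^sup>2 \<le> 4 * R\<^sup>2 * (s * u\<^sup>2)" by (rule us) simp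
      then show ?thesis using b2 by (simp add: B1_def power2_eq_square algebra_simps)
    qed
    let ?L = "L * (s * u)" and ?B = "B * (s * u\<^sup>2)"
    have "?\<rho>0 \<le> ?L" "?\<rho>1 \<le> ?L" using LL su by (auto intro!: mult_right_mono)
    then have dL: "l1 p (\<lambda>j. h j - g j) \<le> ?L" "l1 p (\<lambda>j. ah j - a j) \<le> ?L" using d1 b1 by auto
    have "B0 * (s * u\<^sup>2) \<le> ?B" "B1 * (s * u\<^sup>2) \<le> ?B" using BB su2 by (auto intro!: mult_right_mono)
    then have dB: "Q (\<lambda>j. h j - g j) \<le> ?B" "Q (\<lambda>j. ah j - a j) \<le> ?B" using d3 b3 by auto
    have CL: "C0 * ?L \<le> 1 / 2" using small(1)[of L] LL by simp
    have L2: "R * u * ?L\<^sup>2 \<le> R * L\<^sup>2 * (s * u\<^sup>2)"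
    proof -
      have "R * u * ?L\<^sup>2 = (R * L\<^sup>2 * (s * u\<^sup>2)) * (s * u)" by algebra
      also have "\<dots> \<le> (R * L\<^sup>2 * (s * u\<^sup>2)) * 1" using su pos su2 by (intro mult_left_mono) auto
      finally show ?thesis by simp
    qed
    have sB: "2 * R * u * sqrt ?B \<le> 2 * R * (1 + B) * (s * u\<^sup>2)"
    proof -
      have "?B \<le> ((1 + B) * (s * u))\<^sup>2"
      proof -
        have "B * s \<le> (1 + B)\<^sup>2 * s\<^sup>2"
        proof (rule mult_mono)
          show "B \<le> (1 + B)\<^sup>2" using BB by (simp add: power2_eq_square algebra_simps)
          show "s \<le> s\<^sup>2" using s by (simp add: power2_eq_square)
        qed (use s in auto)
        then have "B * s * u\<^sup>2 \<le> (1 + B)\<^sup>2 * s\<^sup>2 * u\<^sup>2" by (rule mult_right_mono) simp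
        then show ?thesis by (simp add: power_mult_distrib mult_ac)
      qed
      then have "sqrt ?B \<le> (1 + B) * (s * u)" using su BB by (intro real_le_lsqrt) auto
      then have "2 * R * u * sqrt ?B \<le> 2 * R * u * ((1 + B) * (s * u))" using pos u by (intro mult_left_mono) auto
      then show ?thesis by (simp add: power2_eq_square algebra_simps)
    qed
    have "\<bar>mu1_hat n y t x (linpred p f ah) (propensity p f h)
          - mu1_hat n y t x (linpred p f a) (propensity p f g)\<bar> \<le> Kf1 * (s * u\<^sup>2)"
    proof -
      have "2 * dl * u * ?L = 2 * dl * L * (s * u\<^sup>2)" by (simp add: power2_eq_square)
      moreover have "4 * R * u * ?L\<^sup>2 \<le> 4 * R * L\<^sup>2 * (s * u\<^sup>2)" using L2 by simp
      moreover have "(3 + K) * ?B = (3 + K) * B * (s * u\<^sup>2)" by simp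
      moreover have "Kf1 * (s * u\<^sup>2) = 2 * dl * L * (s * u\<^sup>2) + 2 * R * (1 + B) * (s * u\<^sup>2)
          + (3 + K) * B * (s * u\<^sup>2) + 4 * R * L\<^sup>2 * (s * u\<^sup>2)"
        unfolding Kf1_def by (simp only: distrib_right)
      ultimately show ?thesis
        using mu1_hat_expansion[OF dL CL dB] sB by linarith
    qed
    also have "\<dots> \<le> max Kf1 Kf2 * (s * u\<^sup>2)" using su2 by (intro mult_right_mono) auto
    finally show "\<bar>mu1_hat n y t x (linpred p f ah) (propensity p f h)
          - mu1_hat n y t x (linpred p f a) (propensity p f g)\<bar> \<le> max Kf1 Kf2 * (s * u\<^sup>2)" .
    have u1: "u \<le> 1" using mult_right_mono[OF s(1), of u] u su by linarith
    have "s * u\<^sup>2 \<le> s * u" using u1 u s by (simp add: power2_eq_square)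
    moreover have "(s * u)\<^sup>2 \<le> s * u"
      using mult_left_mono[of "s * u" 1 "s * u"] su by (simp add: power2_eq_square)
    ultimately have bnds: "(C0 * ?L)\<^sup>2 \<le> (C0 * L)\<^sup>2 * (s * u)" "K * ?B + R * u * ?L\<^sup>2 \<le> (K * B + R * L\<^sup>2) * (s * u)"
    proof -
      assume a: "s * u\<^sup>2 \<le> s * u" "(s * u)\<^sup>2 \<le> s * u"
      have "(C0 * ?L)\<^sup>2 = (C0 * L)\<^sup>2 * (s * u)\<^sup>2" by algebra
      also have "\<dots> \<le> (C0 * L)\<^sup>2 * (s * u)" using a by (intro mult_left_mono) auto
      finally show "(C0 * ?L)\<^sup>2 \<le> (C0 * L)\<^sup>2 * (s * u)" .
      have "(K * B + R * L\<^sup>2) * (s * u\<^sup>2) \<le> (K * B + R * L\<^sup>2) * (s * u)"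
        using pos BB by (intro mult_left_mono[OF a(1)]) auto
      then show "K * ?B + R * u * ?L\<^sup>2 \<le> (K * B + R * L\<^sup>2) * (s * u)"
        using L2 by (simp add: algebra_simps)
    qed
    have "sample_avg n (\<lambda>i. (aipw (linpred p f ah) (propensity p f h) (y i) (t i) (x i)
       - aipw (linpred p f a) (propensity p f g) (y i) (t i) (x i))\<^sup>2)
       \<le> 2 * (1 + 2 * W)\<^sup>2 * (C0 * ?L)\<^sup>2 + 8 * W * (K * ?B + R * u * ?L\<^sup>2)"
      by (rule aipw_mean_square_expansion[OF dL CL dB(1) pos(2)])
    also have "\<dots> \<le> 2 * (1 + 2 * W)\<^sup>2 * ((C0 * L)\<^sup>2 * (s * u)) + 8 * W * ((K * B + R * L\<^sup>2) * (s * u))"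
      using bnds pos by (intro add_mono mult_left_mono) auto
    also have "\<dots> = Kf2 * (s * u)" by (simp add: Kf2_def algebra_simps)
    also have "\<dots> \<le> max Kf1 Kf2 * (s * u)" using su by (intro mult_right_mono) auto
    finally show "sample_avg n (\<lambda>i. (aipw (linpred p f ah) (propensity p f h) (y i) (t i) (x i)
       - aipw (linpred p f a) (propensity p f g) (y i) (t i) (x i))\<^sup>2) \<le> max Kf1 Kf2 * (s * u)" .
  qed
qed


section \<open>Normal limits for triangular arrays\<close>

text \<open>
  The error is explicit and involves the summands only through their second and third absolute
  moments; therefore the rows of an array may have different laws.
\<close>

lemma (in prob_space) char_iid_sum_error:
  fixes X :: "nat \<Rightarrow> 'a \<Rightarrow> real"
  assumes indep: "indep_vars (\<lambda>i. borel) X UNIV"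
    and distr: "\<And>i. distr M borel (X i) = \<mu>"
    and int: "integrable M (X 0)" "integrable M (\<lambda>\<omega>. (X 0 \<omega>)\<^sup>2)" "integrable M (\<lambda>\<omega>. \<bar>X 0 \<omega>\<bar> ^ 3)"
    and mean: "expectation (X 0) = 0" and v: "expectation (\<lambda>\<omega>. (X 0 \<omega>)\<^sup>2) = v"
    and \<rho>: "expectation (\<lambda>\<omega>. \<bar>X 0 \<omega>\<bar> ^ 3) \<le> \<rho>"
    and n: "0 < n" "v * t\<^sup>2 / 2 \<le> real n"
  shows "cmod (char (distr M borel (\<lambda>\<omega>. (\<Sum>i<n. X i \<omega>) / sqrt (real n))) t - exp (- (v * t\<^sup>2 / 2)))
    \<le> \<bar>t\<bar> ^ 3 * \<rho> / sqrt (real n) + 2 * (v * t\<^sup>2 / 2)\<^sup>2 / real n"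
proof -
  have rv [measurable]: "random_variable borel (X i)" for i
    using indep unfolding indep_vars_def2 by simp
  interpret \<mu>: real_distribution \<mu>
    by (subst distr[symmetric, of 0], rule real_distribution_distr, simp)
  define s where "s = t / sqrt (real n)"
  define a where "a = v * t\<^sup>2 / 2"
  have v0: "0 \<le> v" unfolding v[symmetric] by simp
  have a0: "0 \<le> a" "a \<le> real n" using v0 n by (auto simp: a_def)
  have s2: "s\<^sup>2 = t\<^sup>2 / real n" using n by (simp add: s_def power_divide)
  have s2a: "s\<^sup>2 * v / 2 = a / real n" by (simp add: s2 a_def mult.commute)
  have "char (distr M borel (\<lambda>\<omega>. (\<Sum>i<n. X i \<omega>) / sqrt (real n))) t
      = char (distr M borel (\<lambda>\<omega>. \<Sum>i<n. X i \<omega> / sqrt (real n))) t"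
    by (simp add: sum_divide_distrib)
  also have "\<dots> = (\<Prod>i<n. char (distr M borel (\<lambda>\<omega>. X i \<omega> / sqrt (real n))) t)"
    by (rule char_distr_sum)
       (rule indep_vars_compose2[where X = X], rule indep_vars_subset[OF indep], auto)
  also have "\<dots> = (\<Prod>i<n. char \<mu> s)"
  proof (rule prod.cong[OF refl])
    fix i
    show "char (distr M borel (\<lambda>\<omega>. X i \<omega> / sqrt (real n))) t = char \<mu> s"
      unfolding char_def s_def by (subst distr[symmetric, of i]) (auto simp: integral_distr)
  qed
  also have "\<dots> = char \<mu> s ^ n" by simp
  finally have eq: "char (distr M borel (\<lambda>\<omega>. (\<Sum>i<n. X i \<omega>) / sqrt (real n))) t = char \<mu> s ^ n" .
  have "cmod (char \<mu> s - (1 - s\<^sup>2 * v / 2)) \<le> s\<^sup>2 / 6 * expectation (\<lambda>\<omega>. min (6 * (X 0 \<omega>)\<^sup>2) (\<bar>s\<bar> * \<bar>X 0 \<omega>\<bar> ^ 3))"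
    using int mean v by (intro char_approx3') (auto simp: distr)
  also have "expectation (\<lambda>\<omega>. min (6 * (X 0 \<omega>)\<^sup>2) (\<bar>s\<bar> * \<bar>X 0 \<omega>\<bar> ^ 3)) \<le> expectation (\<lambda>\<omega>. \<bar>s\<bar> * \<bar>X 0 \<omega>\<bar> ^ 3)"
    using int by (intro integral_mono') (auto intro: min.cobounded2)
  also have "expectation (\<lambda>\<omega>. \<bar>s\<bar> * \<bar>X 0 \<omega>\<bar> ^ 3) \<le> \<bar>s\<bar> * \<rho>"
    using \<rho> by (simp add: mult_left_mono)
  finally have 1: "cmod (char \<mu> s - (1 - s\<^sup>2 * v / 2)) \<le> s\<^sup>2 / 6 * (\<bar>s\<bar> * \<rho>)"
    by (simp add: mult_left_mono)
  have \<rho>0: "0 \<le> \<rho>" by (rule order_trans[OF _ \<rho>]) simp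
  have 0: "s\<^sup>2 / 6 * (\<bar>s\<bar> * \<rho>) \<le> s\<^sup>2 * (\<bar>s\<bar> * \<rho>)" using \<rho>0 by (intro mult_right_mono) auto
  have 1: "cmod (char \<mu> s - of_real (1 - a / real n)) \<le> s\<^sup>2 * (\<bar>s\<bar> * \<rho>)"
    using order_trans[OF 1 0] unfolding s2a by simp
  have "cmod (of_real (1 - a / real n) - of_real (exp (- (a / real n)))) = \<bar>exp (- (a / real n)) - 1 + a / real n\<bar>"
    by (subst of_real_diff[symmetric], subst norm_of_real) (simp add: abs_if)
  also have "\<dots> \<le> 2 * (a / real n)\<^sup>2"
    using a0 n by (intro exp_minus_quadratic_upper) (simp add: divide_le_eq)
  finally have 2: "cmod (of_real (1 - a / real n) - of_real (exp (- (a / real n)))) \<le> 2 * (a / real n)\<^sup>2" .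
  have "cmod (char \<mu> s - of_real (exp (- (a / real n)))) \<le> s\<^sup>2 * (\<bar>s\<bar> * \<rho>) + 2 * (a / real n)\<^sup>2"
    using norm_triangle_ineq[of "char \<mu> s - of_real (1 - a / real n)"
        "of_real (1 - a / real n) - of_real (exp (- (a / real n)))"] 1 2 by simp
  then have "real n * cmod (char \<mu> s - of_real (exp (- (a / real n))))
      \<le> real n * (s\<^sup>2 * (\<bar>s\<bar> * \<rho>) + 2 * (a / real n)\<^sup>2)"
    by (rule mult_left_mono) simp
  also have "\<dots> = \<bar>t\<bar> ^ 3 * \<rho> / sqrt (real n) + 2 * a\<^sup>2 / real n"
  proof -
    have "real n * (s\<^sup>2 * (\<bar>s\<bar> * \<rho>)) = \<bar>t\<bar> ^ 3 * \<rho> / sqrt (real n)"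
      unfolding s2 using n by (simp add: s_def power3_eq_cube power2_eq_square abs_mult)
    moreover have "real n * (2 * (a / real n)\<^sup>2) = 2 * a\<^sup>2 / real n"
      using n by (simp add: power2_eq_square)
    ultimately show ?thesis by (simp add: distrib_left)
  qed
  finally have 3: "real n * cmod (char \<mu> s - of_real (exp (- (a / real n))))
      \<le> \<bar>t\<bar> ^ 3 * \<rho> / sqrt (real n) + 2 * a\<^sup>2 / real n" .
  have "(of_real (exp (- (a / real n))) :: complex) ^ n = of_real (exp (- a))"
    using n by (simp flip: of_real_power exp_of_nat_mult)
  then have "cmod (char \<mu> s ^ n - of_real (exp (- a)))
      = cmod (char \<mu> s ^ n - of_real (exp (- (a / real n))) ^ n)" by simp
  also have "\<dots> \<le> real n * cmod (char \<mu> s - of_real (exp (- (a / real n))))"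
    using a0 by (intro norm_power_diff \<mu>.cmod_char_le_1) (auto simp: norm_of_real simp del: of_real_exp)
  finally show ?thesis using 3 unfolding eq a_def[symmetric] by simp
qed

lemma real_distribution_normal0: "real_distribution (normal0 v)"
proof -
  interpret S: real_distribution std_normal_distribution by (rule real_dist_normal_dist)
  show ?thesis unfolding normal0_def by (rule S.real_distribution_distr) simp
qed

lemma char_normal0:
  assumes "0 \<le> v"
  shows "char (normal0 v) t = exp (- (v * t\<^sup>2 / 2))"
proof -
  have "char (normal0 v) t = char std_normal_distribution (sqrt v * t)"
    unfolding char_def normal0_def by (subst integral_distr) (auto simp: mult_ac)
  then show ?thesis using assms by (simp add: char_std_normal_distribution power_mult_distrib)
qed

text \<open>
  The target law moves with \<open>n\<close> and may degenerate. Along a subsequence its variance converges, and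
  Levy's theorem gives the same limit for both sequences.
\<close>

lemma conv_in_law_normal0:
  fixes \<mu> :: "nat \<Rightarrow> real measure"
  assumes rd: "\<And>n. real_distribution (\<mu> n)"
    and v: "\<forall>\<^sub>F n in sequentially. 0 \<le> v n \<and> v n \<le> B"
    and char: "\<And>t. (\<lambda>n. char (\<mu> n) t - exp (- (v n * t\<^sup>2 / 2))) \<longlonglongrightarrow> 0"
  shows "conv_in_law \<mu> (\<lambda>n. normal0 (v n))"
  unfolding conv_in_law_def
proof (intro allI impI)
  fix g :: "real \<Rightarrow> real"
  assume g: "continuous_on UNIV g" "bounded (range g)"
  then obtain Bg where Bg: "\<And>x. norm (g x) \<le> Bg" by (auto simp: bounded_iff)
  have gc: "\<And>x. isCont g x" using g(1) by (simp add: continuous_on_eq_continuous_at)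
  define D where "D n = integral\<^sup>L (\<mu> n) g - integral\<^sup>L (normal0 (v n)) g" for n
  have "D \<longlonglongrightarrow> 0"
  proof (rule ccontr)
    assume "\<not> D \<longlonglongrightarrow> 0"
    then obtain e where e: "0 < e" "\<not> (\<forall>\<^sub>F n in sequentially. \<bar>D n\<bar> < e)"
      by (auto simp: tendsto_iff)
    have "\<not> finite {n. e \<le> \<bar>D n\<bar> \<and> 0 \<le> v n \<and> v n \<le> B}"
    proof
      assume "finite {n. e \<le> \<bar>D n\<bar> \<and> 0 \<le> v n \<and> v n \<le> B}"
      then have "\<forall>\<^sub>F n in sequentially. \<not> (e \<le> \<bar>D n\<bar> \<and> 0 \<le> v n \<and> v n \<le> B)"
        by (simp add: eventually_cofinite conj_left_commute flip: cofinite_eq_sequentially)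
      with v have "\<forall>\<^sub>F n in sequentially. \<bar>D n\<bar> < e" by eventually_elim auto
      with e(2) show False by blast
    qed
    then obtain r :: "nat \<Rightarrow> nat" where r: "strict_mono r"
      and rD: "\<And>k. e \<le> \<bar>D (r k)\<bar>" "\<And>k. 0 \<le> v (r k)" "\<And>k. v (r k) \<le> B"
      using infinite_enumerate by (smt (verit) mem_Collect_eq)
    have "bounded (range (v \<circ> r))"
      using rD(2,3) by (intro boundedI[where B = B]) auto
    then obtain l r' where r': "strict_mono (r' :: nat \<Rightarrow> nat)" and l: "((v \<circ> r) \<circ> r') \<longlonglongrightarrow> l"
      using bounded_imp_convergent_subsequence by metis
    define q where "q = r \<circ> r'"
    have q: "strict_mono q" unfolding q_def using r r' by (rule strict_mono_o)
    have vq: "(\<lambda>k. v (q k)) \<longlonglongrightarrow> l" using l by (simp add: q_def comp_def)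
    have vq0: "0 \<le> v (q k)" for k using rD(2) by (simp add: q_def)
    have l0: "0 \<le> l" using vq vq0 by (intro LIMSEQ_le_const) auto
    have ex: "(\<lambda>k. complex_of_real (exp (- (v (q k) * t\<^sup>2 / 2)))) \<longlonglongrightarrow> complex_of_real (exp (- (l * t\<^sup>2 / 2)))" for t
      by (intro tendsto_intros vq) simp_all
    have c1: "(\<lambda>k. char (\<mu> (q k)) t) \<longlonglongrightarrow> char (normal0 l) t" for t
    proof -
      have "(\<lambda>k. char (\<mu> (q k)) t - complex_of_real (exp (- (v (q k) * t\<^sup>2 / 2)))) \<longlonglongrightarrow> 0"
        using LIMSEQ_subseq_LIMSEQ[OF char[of t] q] by (simp add: comp_def)
      from tendsto_add[OF this ex[of t]] show ?thesis by (simp add: char_normal0 l0)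
    qed
    have c2: "(\<lambda>k. char (normal0 (v (q k))) t) \<longlonglongrightarrow> char (normal0 l) t" for t
      using ex[of t] by (simp add: char_normal0 l0 vq0)
    have "weak_conv_m (\<lambda>k. \<mu> (q k)) (normal0 l)"
      by (rule levy_continuity[OF rd real_distribution_normal0 c1])
    from weak_conv_imp_integral_bdd_continuous_conv[OF rd real_distribution_normal0 this gc Bg]
    have i1: "(\<lambda>k. integral\<^sup>L (\<mu> (q k)) g) \<longlonglongrightarrow> integral\<^sup>L (normal0 l) g" .
    have "weak_conv_m (\<lambda>k. normal0 (v (q k))) (normal0 l)"
      by (rule levy_continuity[OF real_distribution_normal0 real_distribution_normal0 c2])
    from weak_conv_imp_integral_bdd_continuous_conv[OF real_distribution_normal0 real_distribution_normal0 this gc Bg]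
    have i2: "(\<lambda>k. integral\<^sup>L (normal0 (v (q k))) g) \<longlonglongrightarrow> integral\<^sup>L (normal0 l) g" .
    have "(\<lambda>k. D (q k)) \<longlonglongrightarrow> 0" unfolding D_def using tendsto_diff[OF i1 i2] by simp
    then have "\<forall>\<^sub>F k in sequentially. \<bar>D (q k)\<bar> < e" using e(1) by (auto simp: tendsto_iff)
    then obtain k where "\<bar>D (q k)\<bar> < e" by (auto simp: eventually_sequentially)
    then show False using rD(1)[of "r' k"] by (simp add: q_def)
  qed
  then show "(\<lambda>n. integral\<^sup>L (\<mu> n) g - integral\<^sup>L (normal0 (v n)) g) \<longlonglongrightarrow> 0"
    by (simp add: D_def[abs_def])
qed

text \<open>
  Slutsky's argument: off an unlikely event the integrands \<open>exp (i t A)\<close> and \<open>exp (i t C)\<close> differ by at most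
  \<open>\<bar>t\<bar> e\<close>.
\<close>

lemma (in prob_space) char_diff_tendsto_0:
  fixes A C :: "nat \<Rightarrow> 'a \<Rightarrow> real"
  assumes rv [measurable]: "\<And>n. random_variable borel (A n)" "\<And>n. random_variable borel (C n)"
    and close: "\<And>e. 0 < e \<Longrightarrow> (\<lambda>n. prob {\<omega>\<in>space M. e < \<bar>A n \<omega> - C n \<omega>\<bar>}) \<longlonglongrightarrow> 0"
  shows "(\<lambda>n. char (distr M borel (A n)) t - char (distr M borel (C n)) t) \<longlonglongrightarrow> 0"
proof (rule tendstoI)
  fix \<epsilon> :: real assume \<epsilon>: "0 < \<epsilon>"
  define e where "e = \<epsilon> / (2 * (\<bar>t\<bar> + 1))"
  have e: "0 < e" "\<bar>t\<bar> * e < \<epsilon> / 2" using \<epsilon> by (auto simp: e_def field_simps)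
  have bound: "cmod (char (distr M borel (A n)) t - char (distr M borel (C n)) t)
      \<le> \<bar>t\<bar> * e + 2 * prob {\<omega>\<in>space M. e < \<bar>A n \<omega> - C n \<omega>\<bar>}" for n
  proof -
    let ?S = "{\<omega>\<in>space M. e < \<bar>A n \<omega> - C n \<omega>\<bar>}"
    have pt: "cmod (iexp (t * A n \<omega>) - iexp (t * C n \<omega>)) \<le> \<bar>t\<bar> * e + 2 * indicator ?S \<omega>"
      if "\<omega> \<in> space M" for \<omega>
    proof -
      have "iexp (t * A n \<omega>) - iexp (t * C n \<omega>) = iexp (t * C n \<omega>) * (iexp (t * (A n \<omega> - C n \<omega>)) - 1)"
        by (simp add: right_diff_distrib flip: exp_add)
      then have eq: "cmod (iexp (t * A n \<omega>) - iexp (t * C n \<omega>)) = cmod (iexp (t * (A n \<omega> - C n \<omega>)) - 1)"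
        by (simp add: norm_mult)
      have b1: "cmod (iexp z - 1) \<le> \<bar>z\<bar>" for z :: real
        using iexp_approx1[of z 0] by simp
      have b2: "cmod (iexp z - 1) \<le> 2" for z :: real
        using norm_triangle_ineq4[of "iexp z" 1] by simp
      show ?thesis
      proof (cases "e < \<bar>A n \<omega> - C n \<omega>\<bar>")
        case True
        have "0 \<le> \<bar>t\<bar> * e" using e by simp
        then show ?thesis
          unfolding eq using True that b2[of "t * (A n \<omega> - C n \<omega>)"] by (simp del: of_real_mult of_real_diff)
      next
        case False
        have "cmod (iexp (t * (A n \<omega> - C n \<omega>)) - 1) \<le> \<bar>t\<bar> * \<bar>A n \<omega> - C n \<omega>\<bar>"
          using b1[of "t * (A n \<omega> - C n \<omega>)"] by (simp add: abs_mult)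
        also have "\<dots> \<le> \<bar>t\<bar> * e" using False by (intro mult_left_mono) auto
        finally show ?thesis unfolding eq using False by simp
      qed
    qed
    have i: "integrable M (\<lambda>\<omega>. iexp (t * A n \<omega>))" "integrable M (\<lambda>\<omega>. iexp (t * C n \<omega>))"
      by (auto intro!: integrable_const_bound[where B = 1])
    have "char (distr M borel (A n)) t - char (distr M borel (C n)) t
        = (CLINT \<omega>|M. iexp (t * A n \<omega>) - iexp (t * C n \<omega>))"
      unfolding char_def using i by (simp add: integral_distr)
    also have "cmod \<dots> \<le> (LINT \<omega>|M. cmod (iexp (t * A n \<omega>) - iexp (t * C n \<omega>)))"
      by (rule integral_norm_bound)
    also have "\<dots> \<le> (LINT \<omega>|M. \<bar>t\<bar> * e + 2 * indicator ?S \<omega>)"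
      using i pt by (intro integral_mono) (auto intro!: integrable_norm integrable_const_bound[where B = "\<bar>t\<bar> * e + 2"]
          simp: e less_imp_le abs_mult split: split_indicator)
    also have "\<dots> = \<bar>t\<bar> * e + 2 * prob ?S"
      by (subst Bochner_Integration.integral_add) (auto simp: prob_space intro!: integrable_const_bound[where B = 2] split: split_indicator)
    finally show ?thesis .
  qed
  have "\<forall>\<^sub>F n in sequentially. prob {\<omega>\<in>space M. e < \<bar>A n \<omega> - C n \<omega>\<bar>} < \<epsilon> / 4"
    using order_tendstoD(2)[OF close[OF e(1)], of "\<epsilon> / 4"] \<epsilon> by simp
  then show "\<forall>\<^sub>F n in sequentially. dist (char (distr M borel (A n)) t - char (distr M borel (C n)) t) 0 < \<epsilon>"
  proof eventually_elim
    case (elim n)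
    then show ?case using bound[of n] e(2) by simp
  qed
qed


section \<open>Coverage of the normal confidence interval\<close>

lemma std_normal_no_atoms: "measure std_normal_distribution {z} = 0"
proof -
  have "emeasure std_normal_distribution {z} = 0"
    by (subst emeasure_density) (auto simp: nn_integral_indicator_singleton)
  then show ?thesis by (simp add: measure_def)
qed

lemma isCont_cdf_std_normal: "isCont (cdf std_normal_distribution) z"
proof -
  interpret S: real_distribution std_normal_distribution by (rule real_dist_normal_dist)
  show ?thesis using S.isCont_cdf std_normal_no_atoms by simp
qed

lemma measure_std_normal_interval:
  assumes "0 < z"
  shows "measure std_normal_distribution {-z..z}
    = cdf std_normal_distribution z - cdf std_normal_distribution (- z)"
proof -
  interpret S: real_distribution std_normal_distribution by (rule real_dist_normal_dist)
  have e: "{..z} = {..-z} \<union> {-z<..z}" "{-z..z} = {-z} \<union> {-z<..z}" using assms by auto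
  have "measure std_normal_distribution {..z} = measure std_normal_distribution {..-z} + measure std_normal_distribution {-z<..z}"
    unfolding e(1) by (rule S.finite_measure_Union) auto
  moreover have "measure std_normal_distribution {-z..z} = measure std_normal_distribution {-z} + measure std_normal_distribution {-z<..z}"
    unfolding e(2) by (rule S.finite_measure_Union) auto
  ultimately show ?thesis by (simp add: cdf_def std_normal_no_atoms)
qed

lemma cdf_std_normal_uminus:
  "cdf std_normal_distribution (- z) = 1 - cdf std_normal_distribution z"
proof -
  interpret S: real_distribution std_normal_distribution by (rule real_dist_normal_dist)
  have d: "distr std_normal_distribution borel uminus = std_normal_distribution"
  proof (rule Levy_uniqueness)
    show "real_distribution (distr std_normal_distribution borel uminus)"
      by (rule S.real_distribution_distr) simp
    show "char (distr std_normal_distribution borel uminus) = char std_normal_distribution"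
    proof
      fix t
      have "char (distr std_normal_distribution borel uminus) t = char std_normal_distribution (- t)"
        unfolding char_def by (subst integral_distr) auto
      then show "char (distr std_normal_distribution borel uminus) t = char std_normal_distribution t"
        by (simp add: char_std_normal_distribution)
    qed
  qed (rule real_dist_normal_dist)
  have "cdf std_normal_distribution (- z) = measure (distr std_normal_distribution borel uminus) {..-z}"
    by (simp add: cdf_def d)
  also have "\<dots> = measure std_normal_distribution {z..}"
    by (subst measure_distr) (auto intro!: arg_cong[where f = "measure std_normal_distribution"])
  also have "\<dots> = measure std_normal_distribution (UNIV - {..<z})"
    by (rule arg_cong[where f = "measure std_normal_distribution"]) auto
  also have "\<dots> = 1 - measure std_normal_distribution {..<z}"
    using S.prob_compl[of "{..<z}"] by simp
  also have "measure std_normal_distribution {..<z} = measure std_normal_distribution {..z}"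
  proof -
    have "{..z} = {..<z} \<union> {z}" by auto
    then show ?thesis by (simp only:, subst S.finite_measure_Union) (auto simp: std_normal_no_atoms)
  qed
  finally show ?thesis by (simp add: cdf_def)
qed

lemma cdf_quantile_std_normal:
  assumes "0 < q" "q < 1"
  shows "cdf std_normal_distribution (quantile std_normal_distribution q) = q"
proof -
  interpret S: real_distribution std_normal_distribution by (rule real_dist_normal_dist)
  let ?F = "cdf std_normal_distribution"
  let ?A = "{x. q \<le> ?F x}"
  have "\<forall>\<^sub>F x in at_top. q < ?F x" using order_tendstoD(1)[OF S.cdf_lim_at_top_prob, of q] assms by simp
  then obtain x1 where "q < ?F x1" by (metis eventually_happens trivial_limit_at_top_linorder)
  then have ne: "?A \<noteq> {}" by (auto intro: less_imp_le)
  have "\<forall>\<^sub>F x in at_bot. ?F x < q" using order_tendstoD(2)[OF S.cdf_lim_at_bot, of q] assms by simp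
  then obtain x0 where x0: "?F x0 < q" by (metis eventually_happens trivial_limit_at_bot_linorder)
  have bd: "bdd_below ?A"
  proof (rule bdd_belowI[of _ x0])
    fix x assume "x \<in> ?A"
    then have "?F x0 < ?F x" using x0 by auto
    then show "x0 \<le> x" using S.cdf_nondecreasing[of x x0] by force
  qed
  have cont: "continuous_on UNIV ?F" using isCont_cdf_std_normal by (simp add: continuous_at_imp_continuous_on)
  have "closed ?A" using cont by (intro closed_Collect_le) auto
  then have "Inf ?A \<in> ?A" using ne bd by (intro closed_contains_Inf)
  then have ge: "q \<le> ?F (Inf ?A)" by simp
  have "?F (Inf ?A) \<le> q"
  proof (rule tendsto_upperbound)
    show "(?F \<longlongrightarrow> ?F (Inf ?A)) (at_left (Inf ?A))"
      using isCont_cdf_std_normal[of "Inf ?A"] by (auto simp: isCont_def intro: tendsto_mono[OF at_le])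
    have "\<forall>\<^sub>F x in at_left (Inf ?A). x < Inf ?A" by (simp add: eventually_at_filter)
    then show "\<forall>\<^sub>F x in at_left (Inf ?A). ?F x \<le> q"
    proof eventually_elim
      case (elim x)
      then have "x \<notin> ?A" using cInf_lower[OF _ bd] by force
      then show ?case by simp
    qed
  qed simp
  with ge show ?thesis by (simp add: quantile_def)
qed

lemma std_normal_quantile_coverage:
  assumes "0 < c" "c < 1"
  shows "0 < quantile std_normal_distribution (1 - c / 2)"
    and "measure std_normal_distribution
      {- quantile std_normal_distribution (1 - c / 2) .. quantile std_normal_distribution (1 - c / 2)} = 1 - c"
proof -
  interpret S: real_distribution std_normal_distribution by (rule real_dist_normal_dist)
  define z where "z = quantile std_normal_distribution (1 - c / 2)"
  have F: "cdf std_normal_distribution z = 1 - c / 2"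
    unfolding z_def using assms by (intro cdf_quantile_std_normal) auto
  have h: "cdf std_normal_distribution 0 = 1 / 2" using cdf_std_normal_uminus[of 0] by simp
  show z: "0 < quantile std_normal_distribution (1 - c / 2)"
    using S.cdf_nondecreasing[of z 0] F h assms unfolding z_def[symmetric] by force
  show "measure std_normal_distribution
      {- quantile std_normal_distribution (1 - c / 2) .. quantile std_normal_distribution (1 - c / 2)} = 1 - c"
    using z unfolding z_def[symmetric]
    by (simp add: measure_std_normal_interval cdf_std_normal_uminus F)
qed

text \<open>
  Replacing the true by an estimated scale: as the limit law has no atoms, the probability of
  \<open>\<bar>U\<bar> \<le> z r\<close> is squeezed between those of \<open>\<bar>U\<bar> \<le> z (1 \<plusminus> \<epsilon>)\<close>.
\<close>

lemma (in prob_space) scaled_interval_coverage: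
  fixes U r :: "nat \<Rightarrow> 'a \<Rightarrow> real"
  assumes rv [measurable]: "\<And>n. random_variable borel (U n)" "\<And>n. random_variable borel (r n)"
    and weak: "weak_conv_m (\<lambda>n. distr M borel (U n)) std_normal_distribution"
    and r: "\<And>e. 0 < e \<Longrightarrow> (\<lambda>n. prob {\<omega>\<in>space M. e < \<bar>r n \<omega> - 1\<bar>}) \<longlonglongrightarrow> 0"
    and z: "0 < z"
  shows "(\<lambda>n. prob {\<omega>\<in>space M. \<bar>U n \<omega>\<bar> \<le> z * r n \<omega>}) \<longlonglongrightarrow> measure std_normal_distribution {-z..z}"
proof -
  interpret S: real_distribution std_normal_distribution by (rule real_dist_normal_dist)
  let ?F = "cdf std_normal_distribution"
  define G where "G a = ?F a - ?F (- a)" for a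
  have lim: "(\<lambda>n. prob {\<omega>\<in>space M. \<bar>U n \<omega>\<bar> \<le> a}) \<longlonglongrightarrow> G a" if a: "0 < a" for a
  proof -
    have fr: "emeasure std_normal_distribution (frontier {-a..a}) = 0"
    proof -
      have "frontier {-a..a} = {-a} \<union> {a}" using a by (simp add: frontier_def) auto
      moreover have "measure std_normal_distribution ({-a} \<union> {a}) = 0"
        using a by (subst S.finite_measure_Union) (auto simp: std_normal_no_atoms)
      ultimately show ?thesis by (simp only: S.emeasure_eq_measure ennreal_0)
    qed
    have "(\<lambda>n. measure (distr M borel (U n)) {-a..a}) \<longlonglongrightarrow> measure std_normal_distribution {-a..a}"
      by (rule weak_conv_imp_continuity_set_conv[OF _ real_dist_normal_dist weak _ fr])
         (auto intro: real_distribution_distr)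
    moreover have "measure (distr M borel (U n)) {-a..a} = prob {\<omega>\<in>space M. \<bar>U n \<omega>\<bar> \<le> a}" for n
      by (subst measure_distr) (auto intro!: arg_cong[where f = prob])
    ultimately show ?thesis using a by (simp add: G_def measure_std_normal_interval)
  qed
  have Gc: "isCont G z"
    unfolding G_def by (intro continuous_intros isCont_o2[OF _ isCont_cdf_std_normal] isCont_cdf_std_normal)
  show ?thesis
    unfolding measure_std_normal_interval[OF z] G_def[symmetric]
  proof (rule tendstoI)
    fix \<epsilon> :: real assume \<epsilon>: "0 < \<epsilon>"
    obtain d where d: "0 < d" "\<And>a. \<bar>a - z\<bar> < d \<Longrightarrow> \<bar>G a - G z\<bar> < \<epsilon> / 3"
      using Gc \<epsilon> unfolding isCont_def LIM_def dist_real_def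
      by (metis abs_0 diff_self divide_pos_pos zero_less_numeral)
    define e where "e = min (1 / 2) (d / (2 * z))"
    have e: "0 < e" "e \<le> 1 / 2" "z * e < d" using d z by (auto simp: e_def min_def field_simps)
    have a: "0 < z * (1 - e)" "0 < z * (1 + e)" using z e by auto
    have Ga: "\<bar>G (z * (1 - e)) - G z\<bar> < \<epsilon> / 3" "\<bar>G (z * (1 + e)) - G z\<bar> < \<epsilon> / 3"
    proof -
      have "z * (1 - e) - z = - (z * e)" "z * (1 + e) - z = z * e" "0 < z * e"
        using e z by (auto simp: algebra_simps)
      then show "\<bar>G (z * (1 - e)) - G z\<bar> < \<epsilon> / 3" "\<bar>G (z * (1 + e)) - G z\<bar> < \<epsilon> / 3"
        using e(3) d(2)[of "z * (1 - e)"] d(2)[of "z * (1 + e)"] by (simp_all only: abs_minus_cancel abs_of_pos)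
    qed
    have "\<forall>\<^sub>F n in sequentially. \<bar>prob {\<omega>\<in>space M. \<bar>U n \<omega>\<bar> \<le> z * (1 - e)} - G (z * (1 - e))\<bar> < \<epsilon> / 3"
      "\<forall>\<^sub>F n in sequentially. \<bar>prob {\<omega>\<in>space M. \<bar>U n \<omega>\<bar> \<le> z * (1 + e)} - G (z * (1 + e))\<bar> < \<epsilon> / 3"
      using tendstoD[OF lim[OF a(1)], of "\<epsilon> / 3"] tendstoD[OF lim[OF a(2)], of "\<epsilon> / 3"] \<epsilon>
      by (auto simp: dist_real_def)
    moreover have "\<forall>\<^sub>F n in sequentially. prob {\<omega>\<in>space M. e < \<bar>r n \<omega> - 1\<bar>} < \<epsilon> / 3"
      using order_tendstoD(2)[OF r[OF e(1)], of "\<epsilon> / 3"] \<epsilon> by simp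
    ultimately show "\<forall>\<^sub>F n in sequentially. dist (prob {\<omega>\<in>space M. \<bar>U n \<omega>\<bar> \<le> z * r n \<omega>}) (G z) < \<epsilon>"
    proof eventually_elim
      case (elim n)
      let ?E = "{\<omega>\<in>space M. \<bar>U n \<omega>\<bar> \<le> z * r n \<omega>}"
      let ?L = "{\<omega>\<in>space M. \<bar>U n \<omega>\<bar> \<le> z * (1 - e)}" and ?H = "{\<omega>\<in>space M. \<bar>U n \<omega>\<bar> \<le> z * (1 + e)}"
      let ?N = "{\<omega>\<in>space M. e < \<bar>r n \<omega> - 1\<bar>}"
      have zm: "z * x \<le> z * y" if "x \<le> y" for x y using that z by simp
      have "?L \<subseteq> ?E \<union> ?N"
      proof
        fix \<omega> assume w: "\<omega> \<in> ?L"
        show "\<omega> \<in> ?E \<union> ?N"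
        proof (cases "e < \<bar>r n \<omega> - 1\<bar>")
          case False
          then have "1 - e \<le> r n \<omega>" by linarith
          then show ?thesis using w zm[of "1 - e" "r n \<omega>"] by auto
        qed (use w in auto)
      qed
      then have "prob ?L \<le> prob (?E \<union> ?N)" by (intro finite_measure_mono) measurable
      also have "\<dots> \<le> prob ?E + prob ?N" by (intro measure_Un_le) measurable
      finally have 1: "prob ?L \<le> prob ?E + prob ?N" .
      have "?E \<subseteq> ?H \<union> ?N"
      proof
        fix \<omega> assume w: "\<omega> \<in> ?E"
        show "\<omega> \<in> ?H \<union> ?N"
        proof (cases "e < \<bar>r n \<omega> - 1\<bar>")
          case False
          then have "r n \<omega> \<le> 1 + e" by linarith
          then show ?thesis using w zm[of "r n \<omega>" "1 + e"] by auto
        qed (use w in auto)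
      qed
      then have "prob ?E \<le> prob (?H \<union> ?N)" by (intro finite_measure_mono) measurable
      also have "\<dots> \<le> prob ?H + prob ?N" by (intro measure_Un_le) measurable
      finally have 2: "prob ?E \<le> prob ?H + prob ?N" .
      show ?case unfolding dist_real_def using 1 2 elim Ga by linarith
    qed
  qed
qed


section \<open>Consequences of unconfoundedness\<close>

context causal_sample
begin

declare Y0_meas [measurable] Y1_meas [measurable] T_meas [measurable] X_meas [measurable]
  pistar_meas [measurable]

abbreviation obs_space :: "(real \<times> real \<times> 'x) measure" where
  "obs_space \<equiv> borel \<Otimes>\<^sub>M (borel \<Otimes>\<^sub>M N)"

definition obs :: "'w \<Rightarrow> real \<times> real \<times> 'x" where
  "obs \<omega> = (observed Y0 Y1 T \<omega>, T \<omega>, X \<omega>)"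

definition Zs :: "nat \<Rightarrow> 's \<Rightarrow> real \<times> real \<times> 'x" where
  "Zs i \<omega> = (Ys i \<omega>, Ts i \<omega>, Xs i \<omega>)"

lemma observed_measurable [measurable]: "observed Y0 Y1 T \<in> borel_measurable P"
  unfolding observed_def[abs_def] by measurable

lemma obs_measurable [measurable]: "obs \<in> P \<rightarrow>\<^sub>M obs_space"
  unfolding obs_def[abs_def] by measurable

lemma Zs_measurable [measurable]: "Zs i \<in> M \<rightarrow>\<^sub>M obs_space"
  using sample_indep unfolding M.indep_vars_def Zs_def[abs_def] by auto

lemma Ys_measurable [measurable]: "Ys i \<in> borel_measurable M"
  and Ts_measurable [measurable]: "Ts i \<in> borel_measurable M"
  and Xs_measurable [measurable]: "Xs i \<in> M \<rightarrow>\<^sub>M N"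
proof -
  have "(\<lambda>\<omega>. fst (Zs i \<omega>)) \<in> borel_measurable M" "(\<lambda>\<omega>. fst (snd (Zs i \<omega>))) \<in> borel_measurable M"
    "(\<lambda>\<omega>. snd (snd (Zs i \<omega>))) \<in> M \<rightarrow>\<^sub>M N"
    by measurable
  then show "Ys i \<in> borel_measurable M" "Ts i \<in> borel_measurable M" "Xs i \<in> M \<rightarrow>\<^sub>M N"
    by (simp_all add: Zs_def)
qed

lemma Zs_indep: "M.indep_vars (\<lambda>_. obs_space) Zs UNIV"
  using sample_indep unfolding Zs_def[abs_def] .

lemma distr_Zs: "distr M obs_space (Zs i) = distr P obs_space obs"
  using sample_distr unfolding Zs_def[abs_def] obs_def[abs_def] .

lemma integral_Zs:
  fixes h :: "real \<times> real \<times> 'x \<Rightarrow> real"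
  assumes [measurable]: "h \<in> borel_measurable obs_space"
  shows "(\<integral>\<omega>. h (Zs i \<omega>) \<partial>M) = (\<integral>\<omega>. h (obs \<omega>) \<partial>P)"
proof -
  have "(\<integral>\<omega>. h (Zs i \<omega>) \<partial>M) = integral\<^sup>L (distr M obs_space (Zs i)) h" by (rule integral_distr[symmetric]) auto
  also have "\<dots> = (\<integral>\<omega>. h (obs \<omega>) \<partial>P)" unfolding distr_Zs by (rule integral_distr) auto
  finally show ?thesis .
qed

lemma integrable_Zs:
  fixes h :: "real \<times> real \<times> 'x \<Rightarrow> real"
  assumes [measurable]: "h \<in> borel_measurable obs_space"
  shows "integrable M (\<lambda>\<omega>. h (Zs i \<omega>)) \<longleftrightarrow> integrable P (\<lambda>\<omega>. h (obs \<omega>))"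
proof -
  have "integrable M (\<lambda>\<omega>. h (Zs i \<omega>)) \<longleftrightarrow> integrable (distr M obs_space (Zs i)) h"
    by (rule integrable_distr_eq[symmetric]) auto
  also have "\<dots> \<longleftrightarrow> integrable P (\<lambda>\<omega>. h (obs \<omega>))"
    unfolding distr_Zs by (rule integrable_distr_eq) auto
  finally show ?thesis .
qed

lemma AE_Zs:
  assumes [measurable]: "Measurable.pred obs_space Pr" and "AE \<omega> in P. Pr (obs \<omega>)"
  shows "AE \<omega> in M. Pr (Zs i \<omega>)"
proof -
  have "AE z in distr P obs_space obs. Pr z"
    using assms(2) by (subst AE_distr_iff) auto
  then have "AE z in distr M obs_space (Zs i). Pr z" unfolding distr_Zs .
  then show ?thesis by (subst (asm) AE_distr_iff) auto
qed

lemma T_cases: "\<omega> \<in> space P \<Longrightarrow> T \<omega> = 0 \<or> T \<omega> = 1"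
  using T_binary by blast

lemma T_bounds: "\<omega> \<in> space P \<Longrightarrow> 0 \<le> T \<omega>" "\<omega> \<in> space P \<Longrightarrow> T \<omega> \<le> 1"
  using T_cases[of \<omega>] by auto

lemma pistar_X_bounds: "\<omega> \<in> space P \<Longrightarrow> 0 < pistar (X \<omega>)" "\<omega> \<in> space P \<Longrightarrow> pistar (X \<omega>) < 1"
  using overlap[of "X \<omega>"] measurable_space[OF X_meas] by auto

lemma T_observed: "\<omega> \<in> space P \<Longrightarrow> T \<omega> * observed Y0 Y1 T \<omega> = T \<omega> * Y1 \<omega>"
  using T_cases[of \<omega>] by (auto simp: observed_def)

lemma subalgebra_sigma_X: "subalgebra P (sigma_X P N X)"
  unfolding subalgebra_def
  using measurable_sets[OF X_meas] by (auto simp: sets_vimage_algebra2 measurable_space[OF X_meas])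

lemma sigma_finite_sigma_X: "sigma_finite_subalgebra P (sigma_X P N X)"
proof -
  interpret finite_measure_subalgebra P "sigma_X P N X"
    by unfold_locales (rule subalgebra_sigma_X)
  show ?thesis ..
qed

lemma measurable_sigma_X: "h \<in> N \<rightarrow>\<^sub>M L \<Longrightarrow> (\<lambda>\<omega>. h (X \<omega>)) \<in> sigma_X P N X \<rightarrow>\<^sub>M L"
  by (rule measurable_compose[OF measurable_vimage_algebra1])
     (use measurable_space[OF X_meas] in auto)

lemma sigma_finite_sigma_TX: "sigma_finite_subalgebra P (sigma_TX P N T X)"
proof -
  have TX: "(\<lambda>\<omega>. (T \<omega>, X \<omega>)) \<in> P \<rightarrow>\<^sub>M borel \<Otimes>\<^sub>M N" by measurable
  have "subalgebra P (sigma_TX P N T X)"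
    unfolding subalgebra_def
    using measurable_sets[OF TX] measurable_space[OF TX] by (auto simp: sets_vimage_algebra2)
  then interpret finite_measure_subalgebra P "sigma_TX P N T X" by unfold_locales
  show ?thesis ..
qed

lemma measurable_sigma_TX:
  "h \<in> borel \<Otimes>\<^sub>M N \<rightarrow>\<^sub>M L \<Longrightarrow> (\<lambda>\<omega>. h (T \<omega>, X \<omega>)) \<in> sigma_TX P N T X \<rightarrow>\<^sub>M L"
  by (rule measurable_compose[OF measurable_vimage_algebra1])
     (use measurable_space[OF X_meas] in \<open>auto simp: space_pair_measure\<close>)

text \<open>
  Unconfoundedness in integrated form: against functions of \<open>(Y\<^sup>1, X)\<close>, treatment may be replaced
  by the propensity score. On rectangles this is the product rule for conditional probabilities;
  the rest is uniqueness of measures.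
\<close>

lemma treated_law_eq:
  "distr (density P (\<lambda>\<omega>. ennreal (T \<omega>))) (borel \<Otimes>\<^sub>M N) (\<lambda>\<omega>. (Y1 \<omega>, X \<omega>))
   = distr (density P (\<lambda>\<omega>. ennreal (pistar (X \<omega>)))) (borel \<Otimes>\<^sub>M N) (\<lambda>\<omega>. (Y1 \<omega>, X \<omega>))"
  (is "?L = ?R")
proof -
  interpret SX: sigma_finite_subalgebra P "sigma_X P N X" by (rule sigma_finite_sigma_X)
  let ?E = "{A \<times> C | A C. A \<in> sets (borel :: real measure) \<and> C \<in> sets N}"
  have em: "emeasure (distr (density P (\<lambda>\<omega>. ennreal (h \<omega>))) (borel \<Otimes>\<^sub>M N) (\<lambda>\<omega>. (Y1 \<omega>, X \<omega>))) (A \<times> C)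
      = ennreal (\<integral>\<omega>. indicator C (X \<omega>) * (h \<omega> * indicator A (Y1 \<omega>)) \<partial>P)"
    if [measurable]: "A \<in> sets borel" "C \<in> sets N" "h \<in> borel_measurable P"
      and h: "\<And>\<omega>. \<omega> \<in> space P \<Longrightarrow> 0 \<le> h \<omega> \<and> h \<omega> \<le> 1" for A C h
  proof -
    have "emeasure (distr (density P (\<lambda>\<omega>. ennreal (h \<omega>))) (borel \<Otimes>\<^sub>M N) (\<lambda>\<omega>. (Y1 \<omega>, X \<omega>))) (A \<times> C)
        = (\<integral>\<^sup>+\<omega>. ennreal (h \<omega>) * indicator ((\<lambda>\<omega>. (Y1 \<omega>, X \<omega>)) -` (A \<times> C) \<inter> space P) \<omega> \<partial>P)"
      by (subst emeasure_distr) (auto simp: emeasure_density)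
    also have "\<dots> = (\<integral>\<^sup>+\<omega>. ennreal (indicator C (X \<omega>) * (h \<omega> * indicator A (Y1 \<omega>))) \<partial>P)"
      by (rule nn_integral_cong) (auto split: split_indicator)
    also have "\<dots> = ennreal (\<integral>\<omega>. indicator C (X \<omega>) * (h \<omega> * indicator A (Y1 \<omega>)) \<partial>P)"
      using h by (intro nn_integral_eq_integral P.integrable_const_bound[where B = 1])
         (auto split: split_indicator)
    finally show ?thesis .
  qed
  show ?thesis
  proof (rule measure_eqI_generator_eq[where E = ?E and \<Omega> = "UNIV \<times> space N" and A = "\<lambda>_. UNIV \<times> space N"])
    show "Int_stable ?E" by (rule Int_stable_pair_measure_generator)
    show "?E \<subseteq> Pow (UNIV \<times> space N)" using sets.sets_into_space[of _ N] by fastforce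
    show "sets ?L = sigma_sets (UNIV \<times> space N) ?E" "sets ?R = sigma_sets (UNIV \<times> space N) ?E"
      by (simp_all add: sets_pair_measure)
    have "UNIV \<times> space N \<in> ?E" by (intro CollectI exI conjI) auto
    then show "range (\<lambda>_. UNIV \<times> space N) \<subseteq> ?E" by (intro image_subsetI)
    show "emeasure ?L (UNIV \<times> space N) \<noteq> \<infinity>" using em[of UNIV "space N" T] T_bounds by simp
    fix D assume "D \<in> ?E"
    then obtain A C where D: "D = A \<times> C" and AC [measurable]: "A \<in> sets borel" "C \<in> sets N" by auto
    let ?c = "\<lambda>B. real_cond_exp P (sigma_X P N X) (indicat_real B)"
    let ?TA = "{\<omega>\<in>space P. T \<omega> \<in> {1} \<and> Y1 \<omega> \<in> A}" and ?A = "{\<omega>\<in>space P. Y1 \<omega> \<in> A}"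
    have [measurable]: "(\<lambda>\<omega>. indicat_real C (X \<omega>)) \<in> borel_measurable (sigma_X P N X)"
      "(\<lambda>\<omega>. indicat_real C (X \<omega>) * pistar (X \<omega>)) \<in> borel_measurable (sigma_X P N X)"
      using measurable_sigma_X[of "\<lambda>x. indicat_real C x"] measurable_sigma_X[of "\<lambda>x. indicat_real C x * pistar x"]
      by auto
    have "(\<integral>\<omega>. indicator C (X \<omega>) * (T \<omega> * indicator A (Y1 \<omega>)) \<partial>P)
        = (\<integral>\<omega>. indicator C (X \<omega>) * indicat_real ?TA \<omega> \<partial>P)"
      by (rule Bochner_Integration.integral_cong) (use T_cases in \<open>auto split: split_indicator\<close>)
    also have "\<dots> = (\<integral>\<omega>. indicator C (X \<omega>) * ?c ?TA \<omega> \<partial>P)"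
      by (rule SX.real_cond_exp_intg(2)[symmetric])
         (auto intro!: P.integrable_const_bound[where B = 1] split: split_indicator)
    also have "\<dots> = (\<integral>\<omega>. (indicator C (X \<omega>) * pistar (X \<omega>)) * ?c ?A \<omega> \<partial>P)"
    proof (rule integral_cong_AE)
      have 1: "AE \<omega> in P. ?c ?TA \<omega> = ?c {\<omega>\<in>space P. T \<omega> \<in> {1}} \<omega> * ?c ?A \<omega>"
        using unconfounded1 AC(1) unfolding cond_indep_given_def by fastforce
      show "AE \<omega> in P. indicator C (X \<omega>) * ?c ?TA \<omega> = indicator C (X \<omega>) * pistar (X \<omega>) * ?c ?A \<omega>"
        using 1 pistar_version by eventually_elim simp
    qed measurable
    also have "\<dots> = (\<integral>\<omega>. (indicator C (X \<omega>) * pistar (X \<omega>)) * indicat_real ?A \<omega> \<partial>P)"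
      using pistar_X_bounds
      by (intro SX.real_cond_exp_intg(2))
         (auto intro!: P.integrable_const_bound[where B = 1] AE_I2 simp: less_imp_le split: split_indicator)
    also have "\<dots> = (\<integral>\<omega>. indicator C (X \<omega>) * (pistar (X \<omega>) * indicator A (Y1 \<omega>)) \<partial>P)"
      by (rule Bochner_Integration.integral_cong) (auto split: split_indicator)
    finally show "emeasure ?L D = emeasure ?R D"
      unfolding D using pistar_X_bounds T_bounds by (subst (1 2) em) (auto intro: less_imp_le)
  qed auto
qed

lemma nn_integral_treated:
  assumes [measurable]: "k \<in> borel_measurable (borel \<Otimes>\<^sub>M N)"
  shows "(\<integral>\<^sup>+\<omega>. ennreal (T \<omega>) * k (Y1 \<omega>, X \<omega>) \<partial>P) = (\<integral>\<^sup>+\<omega>. ennreal (pistar (X \<omega>)) * k (Y1 \<omega>, X \<omega>) \<partial>P)"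
proof -
  have "(\<integral>\<^sup>+\<omega>. ennreal (h \<omega>) * k (Y1 \<omega>, X \<omega>) \<partial>P)
      = integral\<^sup>N (distr (density P (\<lambda>\<omega>. ennreal (h \<omega>))) (borel \<Otimes>\<^sub>M N) (\<lambda>\<omega>. (Y1 \<omega>, X \<omega>))) k"
    if [measurable]: "h \<in> borel_measurable P" for h
    by (subst nn_integral_distr) (auto simp: nn_integral_density)
  from this[of T] this[of "\<lambda>\<omega>. pistar (X \<omega>)"] show ?thesis by (simp add: treated_law_eq)
qed

lemma integral_treated:
  fixes k :: "real \<times> 'x \<Rightarrow> real"
  assumes [measurable]: "k \<in> borel_measurable (borel \<Otimes>\<^sub>M N)"
  shows "(\<integral>\<omega>. T \<omega> * k (Y1 \<omega>, X \<omega>) \<partial>P) = (\<integral>\<omega>. pistar (X \<omega>) * k (Y1 \<omega>, X \<omega>) \<partial>P)"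
proof -
  have "(\<integral>\<omega>. h \<omega> * k (Y1 \<omega>, X \<omega>) \<partial>P)
      = integral\<^sup>L (distr (density P (\<lambda>\<omega>. ennreal (h \<omega>))) (borel \<Otimes>\<^sub>M N) (\<lambda>\<omega>. (Y1 \<omega>, X \<omega>))) k"
    if [measurable]: "h \<in> borel_measurable P" and h: "\<And>\<omega>. \<omega> \<in> space P \<Longrightarrow> 0 \<le> h \<omega>" for h
    using h by (subst integral_distr) (auto simp: integral_density)
  from this[of T] this[of "\<lambda>\<omega>. pistar (X \<omega>)"] show ?thesis
    using T_bounds pistar_X_bounds by (simp add: treated_law_eq less_imp_le)
qed

text \<open>
  Overlap is only pointwise, hence qualitative: no rate for small propensity scores is available.
\<close>

lemma small_propensity_tendsto_0:
  assumes "0 < e"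
  shows "\<exists>c>0. measure P {\<omega>\<in>space P. pistar (X \<omega>) < c} < e"
proof -
  let ?A = "\<lambda>k. {\<omega>\<in>space P. pistar (X \<omega>) < 1 / real (Suc k)}"
  have "(\<lambda>k. measure P (?A k)) \<longlonglongrightarrow> measure P (\<Inter>k. ?A k)"
  proof (rule P.finite_Lim_measure_decseq)
    show "decseq ?A"
    proof (rule decseq_SucI)
      fix k
      have "1 / real (Suc (Suc k)) \<le> 1 / real (Suc k)" by (simp add: frac_le)
      then show "?A (Suc k) \<subseteq> ?A k" by auto
    qed
  qed auto
  moreover have "(\<Inter>k. ?A k) = {}"
  proof (rule equals0I)
    fix \<omega> assume "\<omega> \<in> (\<Inter>k. ?A k)"
    then have w: "\<omega> \<in> space P" "\<And>k. pistar (X \<omega>) < 1 / real (Suc k)" by auto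
    obtain k where "inverse (real (Suc k)) < pistar (X \<omega>)"
      using reals_Archimedean[OF pistar_X_bounds(1)[OF w(1)]] by auto
    then show False using w(2)[of k] by (simp add: inverse_eq_divide)
  qed
  ultimately have "(\<lambda>k. measure P (?A k)) \<longlonglongrightarrow> 0" by simp
  then have "\<forall>\<^sub>F k in sequentially. measure P (?A k) < e" using assms by (rule order_tendstoD(2))
  then obtain k where "measure P (?A k) < e" by (auto simp: eventually_sequentially)
  then show ?thesis by (intro exI[of _ "1 / real (Suc k)"]) auto
qed

end


section \<open>Concentration of sample averages\<close>

lemma power2_le_exp:
  fixes x :: real
  assumes "0 \<le> x"
  shows "x\<^sup>2 \<le> 2 * exp x"
  using exp_lower_Taylor_quadratic[OF assms] assms by simp

lemma exp_quadratic_envelope: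
  fixes x :: real
  shows "exp x \<le> 1 + x + x\<^sup>2 * exp \<bar>x\<bar> / 2"
proof -
  obtain t where t: "\<bar>t\<bar> \<le> \<bar>x\<bar>"
    "exp x = (\<Sum>m<2. x ^ m / fact m) + exp t / fact 2 * x ^ 2"
    using Maclaurin_exp_le[of x 2] by blast
  have "exp t \<le> exp \<bar>x\<bar>" using t(1) by simp
  then have "exp t / 2 * x\<^sup>2 \<le> exp \<bar>x\<bar> / 2 * x\<^sup>2" by (intro mult_right_mono) auto
  then show ?thesis using t(2) by (simp add: numeral_2_eq_2 mult.commute)
qed

text \<open>
  For \<open>\<bar>s\<bar> \<le> 1 / (2 c)\<close> half of the exponential moment dominates \<open>exp \<bar>s Z\<bar>\<close> and the other half
  dominates \<open>Z\<^sup>2\<close>, so that the quadratic remainder of the exponential has mean of order \<open>s\<^sup>2\<close>.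
\<close>

lemma (in prob_space) mgf_le_of_exp_moment:
  fixes Z :: "'a \<Rightarrow> real"
  assumes [measurable]: "random_variable borel Z"
    and int: "integrable M (\<lambda>\<omega>. exp (\<bar>Z \<omega>\<bar> / c))" and C: "expectation (\<lambda>\<omega>. exp (\<bar>Z \<omega>\<bar> / c)) \<le> C"
    and mean: "expectation Z = 0" and c: "0 < c" and s: "\<bar>s\<bar> \<le> 1 / (2 * c)"
  shows "integrable M (\<lambda>\<omega>. exp (s * Z \<omega>))"
    and "expectation (\<lambda>\<omega>. exp (s * Z \<omega>)) \<le> exp (4 * c\<^sup>2 * C * s\<^sup>2)"
proof -
  have sz: "\<bar>s * z\<bar> \<le> \<bar>z\<bar> / (2 * c)" for z :: real
    using mult_right_mono[OF s, of "\<bar>z\<bar>"] by (simp add: abs_mult)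
  have h: "\<bar>z\<bar> / (2 * c) \<le> \<bar>z\<bar> / c" for z :: real
    using c by (intro divide_left_mono) auto
  show int_s: "integrable M (\<lambda>\<omega>. exp (s * Z \<omega>))"
  proof (rule Bochner_Integration.integrable_bound[OF int])
    show "AE \<omega> in M. norm (exp (s * Z \<omega>)) \<le> norm (exp (\<bar>Z \<omega>\<bar> / c))"
      using order_trans[OF sz h] by (auto intro: order_trans[OF abs_ge_self])
  qed simp
  have pt: "exp (s * z) \<le> 1 + s * z + 4 * c\<^sup>2 * s\<^sup>2 * exp (\<bar>z\<bar> / c)" for z :: real
  proof -
    define q where "q = \<bar>z\<bar> / (2 * c)"
    have q: "0 \<le> q" "q + q = \<bar>z\<bar> / c" "z\<^sup>2 = 4 * c\<^sup>2 * q\<^sup>2"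
      using c by (auto simp: q_def power_divide power_mult_distrib)
    have "exp (s * z) \<le> 1 + s * z + (s * z)\<^sup>2 * exp \<bar>s * z\<bar> / 2" by (rule exp_quadratic_envelope)
    also have "(s * z)\<^sup>2 * exp \<bar>s * z\<bar> / 2 \<le> (s * z)\<^sup>2 * exp q / 2"
      using sz[of z] by (intro divide_right_mono mult_left_mono) (auto simp: q_def)
    also have "\<dots> = 2 * s\<^sup>2 * c\<^sup>2 * (q\<^sup>2 * exp q)" by (simp add: power_mult_distrib q(3))
    also have "\<dots> \<le> 2 * s\<^sup>2 * c\<^sup>2 * (2 * exp q * exp q)"
      using power2_le_exp[OF q(1)] by (intro mult_left_mono mult_right_mono) auto
    also have "\<dots> = 4 * c\<^sup>2 * s\<^sup>2 * exp (\<bar>z\<bar> / c)"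
      by (simp add: mult_ac flip: q(2) exp_add)
    finally show ?thesis by simp
  qed
  have "integrable M (\<lambda>\<omega>. \<bar>Z \<omega>\<bar>)"
  proof (rule Bochner_Integration.integrable_bound[OF integrable_mult_right[OF int, of c]])
    have "\<bar>z\<bar> \<le> c * exp (\<bar>z\<bar> / c)" for z :: real
    proof -
      have "\<bar>z\<bar> / c \<le> exp (\<bar>z\<bar> / c)" using exp_ge_add_one_self[of "\<bar>z\<bar> / c"] by linarith
      then show ?thesis using c by (simp add: field_simps)
    qed
    then show "AE \<omega> in M. norm \<bar>Z \<omega>\<bar> \<le> norm (c * exp (\<bar>Z \<omega>\<bar> / c))" using c by simp
  qed simp
  then have iZ: "integrable M Z" by (simp add: integrable_abs_iff)
  have "expectation (\<lambda>\<omega>. exp (s * Z \<omega>))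
      \<le> expectation (\<lambda>\<omega>. 1 + s * Z \<omega> + 4 * c\<^sup>2 * s\<^sup>2 * exp (\<bar>Z \<omega>\<bar> / c))"
    using int_s int iZ pt by (intro integral_mono) auto
  also have "\<dots> = 1 + 4 * c\<^sup>2 * s\<^sup>2 * expectation (\<lambda>\<omega>. exp (\<bar>Z \<omega>\<bar> / c))"
    using int iZ mean by (simp add: prob_space)
  also have "\<dots> \<le> 1 + 4 * c\<^sup>2 * s\<^sup>2 * C" using C by (simp add: mult_left_mono)
  also have "\<dots> \<le> exp (4 * c\<^sup>2 * C * s\<^sup>2)"
    using exp_ge_add_one_self[of "4 * c\<^sup>2 * C * s\<^sup>2"] by (simp add: mult_ac)
  finally show "expectation (\<lambda>\<omega>. exp (s * Z \<omega>)) \<le> exp (4 * c\<^sup>2 * C * s\<^sup>2)" .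
qed

lemma (in prob_space) average_upper_tail:
  fixes Z :: "nat \<Rightarrow> 'a \<Rightarrow> real"
  assumes indep: "indep_vars (\<lambda>_. borel) Z UNIV"
    and int: "\<And>i s. 0 < s \<Longrightarrow> s \<le> s0 \<Longrightarrow> integrable M (\<lambda>\<omega>. exp (s * Z i \<omega>))"
    and mgf: "\<And>i s. 0 < s \<Longrightarrow> s \<le> s0 \<Longrightarrow> expectation (\<lambda>\<omega>. exp (s * Z i \<omega>)) \<le> exp (V * s\<^sup>2)"
    and V: "0 < V" and \<tau>: "0 < \<tau>" "\<tau> / (2 * V) \<le> s0"
  shows "prob {\<omega>\<in>space M. real n * \<tau> \<le> (\<Sum>i<n. Z i \<omega>)} \<le> exp (- (real n * \<tau>\<^sup>2 / (4 * V)))"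
proof -
  have rv [measurable]: "random_variable borel (Z i)" for i
    using indep unfolding indep_vars_def2 by simp
  define s where "s = \<tau> / (2 * V)"
  have s: "0 < s" "s \<le> s0" using V \<tau> by (auto simp: s_def)
  have ind: "indep_vars (\<lambda>_. borel) (\<lambda>i \<omega>. exp (s * Z i \<omega>)) {..<n}"
    by (rule indep_vars_compose2[where X = Z], rule indep_vars_subset[OF indep]) auto
  have ex: "exp (s * (\<Sum>i<n. Z i \<omega>)) = (\<Prod>i<n. exp (s * Z i \<omega>))" for \<omega>
    by (simp add: sum_distrib_left exp_sum)
  have iprod: "integrable M (\<lambda>\<omega>. \<Prod>i<n. exp (s * Z i \<omega>))"
    by (rule indep_vars_integrable[OF _ ind]) (use int s in auto)
  have "prob {\<omega>\<in>space M. real n * \<tau> \<le> (\<Sum>i<n. Z i \<omega>)}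
      \<le> exp (- s * (real n * \<tau>)) * (\<integral>\<omega>\<in>space M. exp (s * (\<Sum>i<n. Z i \<omega>)) \<partial>M)"
    by (rule Chernoff_ineq_ge[OF s(1)])
       (use integrable_mult_indicator[OF sets.top iprod] in \<open>auto simp: ex set_integrable_def\<close>)
  also have "(\<integral>\<omega>\<in>space M. exp (s * (\<Sum>i<n. Z i \<omega>)) \<partial>M) = expectation (\<lambda>\<omega>. \<Prod>i<n. exp (s * Z i \<omega>))"
    unfolding set_lebesgue_integral_def ex by (rule Bochner_Integration.integral_cong) auto
  also have "\<dots> = (\<Prod>i<n. expectation (\<lambda>\<omega>. exp (s * Z i \<omega>)))"
    by (rule indep_vars_lebesgue_integral[OF _ ind]) (use int s in auto)
  also have "\<dots> \<le> (\<Prod>i<n. exp (V * s\<^sup>2))"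
    using mgf[OF s] by (intro prod_mono) auto
  also have "exp (- s * (real n * \<tau>)) * (\<Prod>i<n. exp (V * s\<^sup>2)) = exp (- (real n * \<tau>\<^sup>2 / (4 * V)))"
  proof -
    have "- s * (real n * \<tau>) + real n * (V * s\<^sup>2) = - (real n * \<tau>\<^sup>2 / (4 * V))"
      using V by (simp add: s_def power2_eq_square field_simps)
    then show ?thesis by (simp add: mult_exp_exp flip: exp_of_nat_mult)
  qed
  finally show ?thesis by simp
qed

lemma (in prob_space) average_chebyshev:
  fixes Z :: "nat \<Rightarrow> 'a \<Rightarrow> real"
  assumes indep: "indep_vars (\<lambda>_. borel) Z UNIV"
    and int: "\<And>i. integrable M (\<lambda>\<omega>. (Z i \<omega>)\<^sup>2)"
    and mean: "\<And>i. expectation (Z i) = 0"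
    and v: "\<And>i. expectation (\<lambda>\<omega>. (Z i \<omega>)\<^sup>2) \<le> v" and h: "0 < h" and n: "0 < n"
  shows "prob {\<omega>\<in>space M. h \<le> \<bar>(\<Sum>i<n. Z i \<omega>) / real n\<bar>} \<le> v / (real n * h\<^sup>2)"
proof -
  have rv [measurable]: "random_variable borel (Z i)" for i
    using indep unfolding indep_vars_def2 by simp
  have int1: "integrable M (Z i)" for i by (rule square_integrable_imp_integrable[OF _ int]) simp
  have ind2: "indep_vars (\<lambda>_. borel) Z {i, j}" for i j by (rule indep_vars_subset[OF indep]) simp
  have prod_int: "integrable M (\<lambda>\<omega>. Z i \<omega> * Z j \<omega>)" for i j
  proof (cases "i = j")
    case True
    then show ?thesis using int[of i] by (simp add: power2_eq_square)
  next
    case False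
    then show ?thesis using indep_vars_integrable[OF _ ind2, of i j] int1 by simp
  qed
  have cross: "expectation (\<lambda>\<omega>. Z i \<omega> * Z j \<omega>) = 0" if "i \<noteq> j" for i j
    using indep_vars_lebesgue_integral[OF _ ind2, of i j] int1 that by (simp add: mean)
  let ?S = "\<lambda>\<omega>. (\<Sum>i<n. Z i \<omega>) / real n"
  have sq: "(?S \<omega>)\<^sup>2 = (\<Sum>i<n. \<Sum>j<n. Z i \<omega> * Z j \<omega>) / (real n)\<^sup>2" for \<omega>
    by (simp add: power_divide power2_eq_square sum_product)
  have intS: "integrable M (\<lambda>\<omega>. (?S \<omega>)\<^sup>2)"
    unfolding sq using prod_int by (intro integrable_divide Bochner_Integration.integrable_sum) auto
  have meanS: "expectation ?S = 0"
    using int1 by (simp add: Bochner_Integration.integral_sum mean)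
  have "expectation (\<lambda>\<omega>. (?S \<omega>)\<^sup>2) = (\<Sum>i<n. \<Sum>j<n. expectation (\<lambda>\<omega>. Z i \<omega> * Z j \<omega>)) / (real n)\<^sup>2"
    unfolding sq using prod_int by (simp add: Bochner_Integration.integral_sum)
  also have "(\<Sum>i<n. \<Sum>j<n. expectation (\<lambda>\<omega>. Z i \<omega> * Z j \<omega>)) = (\<Sum>i<n. expectation (\<lambda>\<omega>. (Z i \<omega>)\<^sup>2))"
  proof (rule sum.cong[OF refl])
    fix i assume "i \<in> {..<n}"
    have "(\<Sum>j<n. expectation (\<lambda>\<omega>. Z i \<omega> * Z j \<omega>)) = (\<Sum>j<n. if j = i then expectation (\<lambda>\<omega>. (Z i \<omega>)\<^sup>2) else 0)"
      using cross[of i] by (intro sum.cong) (auto simp: power2_eq_square)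
    then show "(\<Sum>j<n. expectation (\<lambda>\<omega>. Z i \<omega> * Z j \<omega>)) = expectation (\<lambda>\<omega>. (Z i \<omega>)\<^sup>2)"
      using \<open>i \<in> {..<n}\<close> by simp
  qed
  also have "\<dots> \<le> (\<Sum>i<n. v)" by (rule sum_mono) (rule v)
  finally have E: "expectation (\<lambda>\<omega>. (?S \<omega>)\<^sup>2) \<le> v / real n"
    using n by (simp add: divide_right_mono power2_eq_square)
  have "prob {\<omega>\<in>space M. h \<le> \<bar>?S \<omega> - expectation ?S\<bar>} \<le> variance ?S / h\<^sup>2"
    by (rule Chebyshev_inequality) (use intS h in auto)
  also have "\<dots> \<le> v / real n / h\<^sup>2" using E meanS by (intro divide_right_mono) auto
  finally show ?thesis using meanS n by simp
qed

context causal_sample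
begin

text \<open>
  One inequality serves bounded functions, residuals and squared residuals, since all of them have an
  envelope \<open>c (1 + U)\<close>. The constant \<open>C2\<close> pays for centring: the mean of \<open>h\<close> is at most \<open>c C1\<close>.
\<close>

lemma sample_avg_tail:
  fixes h :: "real \<times> real \<times> 'x \<Rightarrow> real" and U :: "'w \<Rightarrow> real"
  assumes hm [measurable]: "h \<in> borel_measurable obs_space" and [measurable]: "U \<in> borel_measurable P"
    and env: "AE \<omega> in P. \<bar>h (obs \<omega>)\<bar> \<le> c * (1 + U \<omega>)"
    and U: "integrable P (\<lambda>\<omega>. exp (U \<omega>))" "(\<integral>\<omega>. exp (U \<omega>) \<partial>P) \<le> C1"
    and C1: "0 < C1" and c: "0 < c" and C2: "C2 = exp (C1 + 1) * C1" and \<tau>: "0 < \<tau>" "\<tau> \<le> 4 * c * C2"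
  shows "measure M {\<omega>\<in>space M. \<tau> \<le> \<bar>sample_avg n (\<lambda>i. h (Zs i \<omega>)) - (\<integral>\<omega>. h (obs \<omega>) \<partial>P)\<bar>}
      \<le> 2 * exp (- (real n * \<tau>\<^sup>2 / (16 * c\<^sup>2 * C2)))"
proof (cases "n = 0")
  case True
  then show ?thesis using order_trans[OF M.prob_le_1, of 2] by simp
next
  case False
  then have n: "0 < n" by simp
  define m where "m = (\<integral>\<omega>. h (obs \<omega>) \<partial>P)"
  have U1: "1 + U \<omega> \<le> exp (U \<omega>)" for \<omega> using exp_ge_add_one_self[of "U \<omega>"] by simp
  have hint: "integrable P (\<lambda>\<omega>. h (obs \<omega>))"
  proof (rule Bochner_Integration.integrable_bound[OF integrable_mult_right[OF U(1), of c]])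
    show "AE \<omega> in P. norm (h (obs \<omega>)) \<le> norm (c * exp (U \<omega>))"
      using env
    proof eventually_elim
      case (elim \<omega>)
      have "c * (1 + U \<omega>) \<le> c * exp (U \<omega>)" using U1 c by (intro mult_left_mono) auto
      then have "\<bar>h (obs \<omega>)\<bar> \<le> c * exp (U \<omega>)" using elim by linarith
      then show ?case using c by simp
    qed
  qed measurable
  have mb: "\<bar>m\<bar> \<le> c * C1"
  proof -
    have "\<bar>m\<bar> \<le> (\<integral>\<omega>. \<bar>h (obs \<omega>)\<bar> \<partial>P)" unfolding m_def by (rule integral_abs_bound)
    also have "\<dots> \<le> (\<integral>\<omega>. c * exp (U \<omega>) \<partial>P)"
    proof (rule integral_mono_AE)
      show "AE \<omega> in P. \<bar>h (obs \<omega>)\<bar> \<le> c * exp (U \<omega>)"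
        using env
      proof eventually_elim
        case (elim \<omega>)
        have "c * (1 + U \<omega>) \<le> c * exp (U \<omega>)" using U1 c by (intro mult_left_mono) auto
        then show ?case using elim by linarith
      qed
    qed (use hint U in auto)
    also have "\<dots> \<le> c * C1" using U c by (simp add: mult_left_mono)
    finally show ?thesis .
  qed
  define e where "e z = h z - m" for z
  have em [measurable]: "e \<in> borel_measurable obs_space" unfolding e_def[abs_def] by measurable
  have expb: "AE \<omega> in P. exp (\<bar>e (obs \<omega>)\<bar> / c) \<le> exp (C1 + 1) * exp (U \<omega>)"
    using env
  proof eventually_elim
    case (elim \<omega>)
    have "\<bar>e (obs \<omega>)\<bar> \<le> c * (1 + U \<omega>) + c * C1" unfolding e_def using elim mb by linarith
    then have "\<bar>e (obs \<omega>)\<bar> / c \<le> C1 + 1 + U \<omega>" using c by (simp add: field_simps)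
    then show ?case by (simp flip: exp_add)
  qed
  have eint: "integrable P (\<lambda>\<omega>. exp (\<bar>e (obs \<omega>)\<bar> / c))"
    by (rule Bochner_Integration.integrable_bound[OF integrable_mult_right[OF U(1), of "exp (C1 + 1)"]])
       (use expb in auto)
  have "(\<integral>\<omega>. exp (\<bar>e (obs \<omega>)\<bar> / c) \<partial>P) \<le> (\<integral>\<omega>. exp (C1 + 1) * exp (U \<omega>) \<partial>P)"
    using eint U expb by (intro integral_mono_AE) auto
  also have "\<dots> \<le> C2" using U by (simp add: C2)
  finally have eC: "(\<integral>\<omega>. exp (\<bar>e (obs \<omega>)\<bar> / c) \<partial>P) \<le> C2" .
  have V0: "0 < 4 * c\<^sup>2 * C2" using c C1 by (simp add: C2)
  have tail: "measure M {\<omega>\<in>space M. real n * \<tau> \<le> (\<Sum>i<n. k * e (Zs i \<omega>))} \<le> exp (- (real n * \<tau>\<^sup>2 / (4 * (4 * c\<^sup>2 * C2))))"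
    if k: "\<bar>k\<bar> = 1" for k
  proof (rule M.average_upper_tail[where ?s0.0 = "1 / (2 * c)"])
    have [measurable]: "(\<lambda>z. k * e z) \<in> borel_measurable obs_space" by measurable
    show "M.indep_vars (\<lambda>_. borel) (\<lambda>i \<omega>. k * e (Zs i \<omega>)) UNIV"
      by (rule M.indep_vars_compose2[OF Zs_indep]) measurable
    have 1: "integrable M (\<lambda>\<omega>. exp (\<bar>k * e (Zs i \<omega>)\<bar> / c))" for i
      using integrable_Zs[of "\<lambda>z. exp (\<bar>k * e z\<bar> / c)" i] eint k by (simp add: abs_mult)
    have 2: "(\<integral>\<omega>. exp (\<bar>k * e (Zs i \<omega>)\<bar> / c) \<partial>M) \<le> C2" for i
      using integral_Zs[of "\<lambda>z. exp (\<bar>k * e z\<bar> / c)" i] eC k by (simp add: abs_mult)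
    have 3: "(\<integral>\<omega>. k * e (Zs i \<omega>) \<partial>M) = 0" for i
      using integral_Zs[of "\<lambda>z. k * e z" i] hint by (simp add: e_def m_def P.prob_space)
    fix i and s :: real assume s: "0 < s" "s \<le> 1 / (2 * c)"
    then have s': "\<bar>s\<bar> \<le> 1 / (2 * c)" by simp
    show "integrable M (\<lambda>\<omega>. exp (s * (k * e (Zs i \<omega>))))"
      "(\<integral>\<omega>. exp (s * (k * e (Zs i \<omega>))) \<partial>M) \<le> exp (4 * c\<^sup>2 * C2 * s\<^sup>2)"
      using M.mgf_le_of_exp_moment[OF _ 1 2 3 c s', of i] by auto
  next
    show "\<tau> / (2 * (4 * c\<^sup>2 * C2)) \<le> 1 / (2 * c)"
      using \<tau> c V0 by (simp add: field_simps power2_eq_square)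
  qed (use V0 \<tau> in auto)
  have avg: "sample_avg n (\<lambda>i. h (Zs i \<omega>)) - m = (\<Sum>i<n. e (Zs i \<omega>)) / real n" for \<omega>
    using n by (simp add: sample_avg_def e_def sum_subtractf diff_divide_distrib)
  let ?A = "\<lambda>k. {\<omega>\<in>space M. real n * \<tau> \<le> (\<Sum>i<n. k * e (Zs i \<omega>))}"
  have "{\<omega>\<in>space M. \<tau> \<le> \<bar>sample_avg n (\<lambda>i. h (Zs i \<omega>)) - m\<bar>} \<subseteq> ?A 1 \<union> ?A (- 1)"
    unfolding avg using n by (auto simp: abs_real_def field_simps sum_negf split: if_splits)
  then have "measure M {\<omega>\<in>space M. \<tau> \<le> \<bar>sample_avg n (\<lambda>i. h (Zs i \<omega>)) - m\<bar>} \<le> measure M (?A 1 \<union> ?A (- 1))"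
    by (intro M.finite_measure_mono) measurable
  also have "\<dots> \<le> measure M (?A 1) + measure M (?A (- 1))" by (intro measure_Un_le) measurable
  finally show ?thesis using tail[of 1] tail[of "- 1"] unfolding m_def[symmetric] by (simp add: mult.assoc)
qed

lemma sample_avg_chebyshev:
  fixes h :: "real \<times> real \<times> 'x \<Rightarrow> real"
  assumes [measurable]: "h \<in> borel_measurable obs_space"
    and int: "integrable P (\<lambda>\<omega>. (h (obs \<omega>))\<^sup>2)" and v: "(\<integral>\<omega>. (h (obs \<omega>))\<^sup>2 \<partial>P) \<le> v"
    and mean: "(\<integral>\<omega>. h (obs \<omega>) \<partial>P) = 0" and \<tau>: "0 < \<tau>" and n: "0 < n"
  shows "measure M {\<omega>\<in>space M. \<tau> \<le> \<bar>sample_avg n (\<lambda>i. h (Zs i \<omega>))\<bar>} \<le> v / (real n * \<tau>\<^sup>2)"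
  unfolding sample_avg_def
proof (rule M.average_chebyshev)
  show "M.indep_vars (\<lambda>_. borel) (\<lambda>i \<omega>. h (Zs i \<omega>)) UNIV"
    by (rule M.indep_vars_compose2[OF Zs_indep]) measurable
  fix i
  show "integrable M (\<lambda>\<omega>. (h (Zs i \<omega>))\<^sup>2)" "(\<integral>\<omega>. (h (Zs i \<omega>))\<^sup>2 \<partial>M) \<le> v" "(\<integral>\<omega>. h (Zs i \<omega>) \<partial>M) = 0"
    using integrable_Zs[of "\<lambda>z. (h z)\<^sup>2" i] integral_Zs[of "\<lambda>z. (h z)\<^sup>2" i] integral_Zs[of h i] int v mean
    by auto
qed (use \<tau> n in auto)

end


section \<open>Population properties of the limiting coefficients\<close>

lemma linear_term_zero_of_nonneg:
  fixes G C d :: real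
  assumes d: "0 < d" and nonneg: "\<And>s. \<bar>s\<bar> \<le> d \<Longrightarrow> 0 \<le> s * G + C * s\<^sup>2"
  shows "G = 0"
proof (rule ccontr)
  assume G: "G \<noteq> 0"
  define e where "e = min (d / \<bar>G\<bar>) (1 / (2 * (\<bar>C\<bar> + 1)))"
  have e: "0 < e" "e * \<bar>G\<bar> \<le> d" "e * \<bar>C\<bar> \<le> 1 / 2"
  proof -
    show "0 < e" using d G by (simp add: e_def)
    have "e * \<bar>G\<bar> \<le> d / \<bar>G\<bar> * \<bar>G\<bar>" by (intro mult_right_mono) (auto simp: e_def)
    then show "e * \<bar>G\<bar> \<le> d" using G by simp
    have "e * \<bar>C\<bar> \<le> 1 / (2 * (\<bar>C\<bar> + 1)) * \<bar>C\<bar>" by (intro mult_right_mono) (auto simp: e_def)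
    also have "\<dots> \<le> 1 / 2" by (simp add: field_simps)
    finally show "e * \<bar>C\<bar> \<le> 1 / 2" .
  qed
  have "0 \<le> (- (e * G)) * G + C * (- (e * G))\<^sup>2"
    using e by (intro nonneg) (simp add: abs_mult)
  also have "\<dots> = e * G\<^sup>2 * (e * C - 1)" by algebra
  finally have "0 \<le> e * G\<^sup>2 * (e * C - 1)" .
  moreover have "e * C - 1 < 0" using e abs_ge_self[of C] mult_left_mono[of C "\<bar>C\<bar>" e] by linarith
  moreover have "0 < e * G\<^sup>2" using e G by simp
  ultimately show False by (simp add: mult_less_0_iff not_less zero_le_mult_iff)
qed

lemma power4_add_le: "(a + b) ^ 4 \<le> 8 * (a ^ 4 + b ^ 4)" for a b :: real
proof -
  have s: "(x + y)\<^sup>2 \<le> 2 * (x\<^sup>2 + y\<^sup>2)" for x y :: real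
    using zero_le_power2[of "x - y"] by (simp add: power2_sum power2_diff)
  have "(a + b) ^ 4 = ((a + b)\<^sup>2)\<^sup>2" by (simp flip: power_mult)
  also have "\<dots> \<le> (2 * (a\<^sup>2 + b\<^sup>2))\<^sup>2" using s[of a b] by (intro power_mono) auto
  also have "\<dots> = 4 * (a\<^sup>2 + b\<^sup>2)\<^sup>2" by algebra
  also have "\<dots> \<le> 4 * (2 * ((a\<^sup>2)\<^sup>2 + (b\<^sup>2)\<^sup>2))" using s[of "a\<^sup>2" "b\<^sup>2"] by linarith
  also have "\<dots> = 8 * (a ^ 4 + b ^ 4)" by (simp flip: power_mult)
  finally show ?thesis .
qed

text \<open>
  One sample size of the asymptotic setting, with the coefficients \<open>g\<close> and \<open>a\<close> that minimise the
  expected losses. All bounds below are explicit in the constants, hence uniform over rows.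
\<close>

locale calibrated_row = causal_sample P M N Y0 Y1 T X pistar Ys Ts Xs
  for P :: "'w measure" and M :: "'s measure" and N :: "'x measure"
    and Y0 Y1 T :: "'w \<Rightarrow> real" and X :: "'w \<Rightarrow> 'x" and pistar :: "'x \<Rightarrow> real"
    and Ys Ts :: "nat \<Rightarrow> 's \<Rightarrow> real" and Xs :: "nat \<Rightarrow> 's \<Rightarrow> 'x" +
  fixes n p :: nat and f :: "nat \<Rightarrow> 'x \<Rightarrow> real" and g a :: "nat \<Rightarrow> real" and C0 B0 D0 D1 :: real
  assumes n_pos: "0 < n"
    and f_meas: "\<And>j. j \<le> p \<Longrightarrow> f j \<in> borel_measurable N"
    and f_bdd: "AE \<omega> in P. \<forall>j\<le>p. \<bar>f j (X \<omega>)\<bar> \<le> C0"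
    and g_ge: "AE \<omega> in P. B0 \<le> linpred p f g (X \<omega>)"
    and resid_tail: "AE \<omega> in P. ennreal (D0\<^sup>2) *
        nn_cond_exp P (sigma_X P N X)
          (\<lambda>\<omega>. ennreal (exp ((Y1 \<omega> - linpred p f a (X \<omega>))\<^sup>2 / D0\<^sup>2) - 1)) \<omega> \<le> ennreal (D1\<^sup>2)"
    and min_g: "minimizes (\<lambda>\<gamma>. \<integral>\<omega>. loss_cal p f n (\<lambda>i. Ts i \<omega>) (\<lambda>i. Xs i \<omega>) \<gamma> \<partial>M) g"
    and min_a: "minimizes (\<lambda>\<alpha>. \<integral>\<omega>. loss_wl p f n (\<lambda>i. Ys i \<omega>) (\<lambda>i. Ts i \<omega>) (\<lambda>i. Xs i \<omega>) g \<alpha> \<partial>M) a"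
    and C0_ge: "1 \<le> C0" and D0_pos: "0 < D0"
begin

abbreviation lin :: "(nat \<Rightarrow> real) \<Rightarrow> 'x \<Rightarrow> real" where "lin \<equiv> linpred p f"
abbreviation w :: "'x \<Rightarrow> real" where "w \<equiv> weight p f g"
definition W :: real where "W = exp (- B0)"
definition R :: "'w \<Rightarrow> real" where "R \<omega> = Y1 \<omega> - lin a (X \<omega>)"
definition U :: "'w \<Rightarrow> real" where "U \<omega> = (R \<omega>)\<^sup>2 / D0\<^sup>2"
definition C1 :: real where "C1 = 1 + D1\<^sup>2 / D0\<^sup>2"

lemma lin_measurable [measurable]: "lin b \<in> borel_measurable N"
  unfolding linpred_def[abs_def] by (intro borel_measurable_sum borel_measurable_times f_meas) auto

lemma weight_measurable [measurable]: "weight p f b \<in> borel_measurable N"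
  unfolding weight_def[abs_def] by measurable

lemma propensity_measurable [measurable]: "propensity p f b \<in> borel_measurable N"
  unfolding propensity_def[abs_def] by measurable

lemma R_measurable [measurable]: "R \<in> borel_measurable P"
  unfolding R_def[abs_def] by measurable

lemma U_measurable [measurable]: "U \<in> borel_measurable P"
  unfolding U_def[abs_def] by measurable

lemma weight_pos: "0 < weight p f b x"
  by (simp add: weight_def)

lemma W_pos: "0 < W"
  by (simp add: W_def)

lemma lin_le: "AE \<omega> in P. \<forall>b. \<bar>lin b (X \<omega>)\<bar> \<le> C0 * l1 p b"
  using f_bdd by eventually_elim (auto intro: abs_linpred_le)

lemma w_le: "AE \<omega> in P. w (X \<omega>) \<le> W"
  using g_ge by eventually_elim (simp add: weight_def W_def)

lemma weight_le: "AE \<omega> in P. weight p f b (X \<omega>) \<le> exp (C0 * l1 p b)"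
  using lin_le
proof eventually_elim
  case (elim \<omega>)
  then have "- lin b (X \<omega>) \<le> C0 * l1 p b" by (meson abs_le_D2)
  then show ?case by (simp add: weight_def)
qed

lemma integrable_of_AE_bound:
  fixes h :: "'w \<Rightarrow> real"
  assumes "h \<in> borel_measurable P" "AE \<omega> in P. \<bar>h \<omega>\<bar> \<le> B"
  shows "integrable P h"
  using assms by (intro P.integrable_const_bound[where B = B]) auto

lemma U_nonneg: "0 \<le> U \<omega>"
  by (simp add: U_def)

text \<open>
  In unconditional form, the exponential moment of the residual may be tested against functions of \<open>X\<close>.
\<close>

lemma resid_cond_bound:
  assumes [measurable]: "h \<in> borel_measurable N"
  shows "(\<integral>\<^sup>+\<omega>. h (X \<omega>) * (ennreal (D0\<^sup>2) * ennreal (exp (U \<omega>) - 1)) \<partial>P) \<le> ennreal (D1\<^sup>2) * (\<integral>\<^sup>+\<omega>. h (X \<omega>) \<partial>P)"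
proof -
  interpret SX: sigma_finite_subalgebra P "sigma_X P N X" by (rule sigma_finite_sigma_X)
  let ?e = "\<lambda>\<omega>. ennreal (exp ((Y1 \<omega> - lin a (X \<omega>))\<^sup>2 / D0\<^sup>2) - 1)"
  have hX [measurable]: "(\<lambda>\<omega>. h (X \<omega>)) \<in> borel_measurable (sigma_X P N X)"
    by (rule measurable_sigma_X) simp
  have "(\<integral>\<^sup>+\<omega>. h (X \<omega>) * (ennreal (D0\<^sup>2) * ennreal (exp (U \<omega>) - 1)) \<partial>P)
      = (\<integral>\<^sup>+\<omega>. (ennreal (D0\<^sup>2) * h (X \<omega>)) * ?e \<omega> \<partial>P)"
    by (rule nn_integral_cong) (simp add: U_def R_def mult_ac)
  also have "\<dots> = (\<integral>\<^sup>+\<omega>. (ennreal (D0\<^sup>2) * h (X \<omega>)) * nn_cond_exp P (sigma_X P N X) ?e \<omega> \<partial>P)"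
    by (rule SX.nn_cond_exp_intg[symmetric]) measurable
  also have "\<dots> \<le> (\<integral>\<^sup>+\<omega>. h (X \<omega>) * ennreal (D1\<^sup>2) \<partial>P)"
    by (rule nn_integral_mono_AE, use resid_tail in eventually_elim)
       (simp add: mult.assoc mult.left_commute[of _ "h _"] mult_left_mono)
  also have "\<dots> = ennreal (D1\<^sup>2) * (\<integral>\<^sup>+\<omega>. h (X \<omega>) \<partial>P)"
    by (subst mult.commute, rule nn_integral_cmult) measurable
  finally show ?thesis .
qed

lemma exp_U_integrable: "integrable P (\<lambda>\<omega>. exp (U \<omega>))"
  and exp_U_le: "(\<integral>\<omega>. exp (U \<omega>) \<partial>P) \<le> C1"
proof -
  have e1: "0 \<le> exp (U \<omega>) - 1" for \<omega> using U_nonneg[of \<omega>] by simp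
  have "(\<integral>\<^sup>+\<omega>. ennreal (1 / D0\<^sup>2) * (ennreal (D0\<^sup>2) * ennreal (exp (U \<omega>) - 1)) \<partial>P)
      \<le> ennreal (D1\<^sup>2) * (\<integral>\<^sup>+\<omega>. ennreal (1 / D0\<^sup>2) \<partial>P)"
    using resid_cond_bound[of "\<lambda>_. ennreal (1 / D0\<^sup>2)"] by simp
  also have "(\<integral>\<^sup>+\<omega>. ennreal (1 / D0\<^sup>2) * (ennreal (D0\<^sup>2) * ennreal (exp (U \<omega>) - 1)) \<partial>P) = (\<integral>\<^sup>+\<omega>. ennreal (exp (U \<omega>) - 1) \<partial>P)"
    using D0_pos e1 by (intro nn_integral_cong) (simp flip: ennreal_mult)
  also have "ennreal (D1\<^sup>2) * (\<integral>\<^sup>+\<omega>. ennreal (1 / D0\<^sup>2) \<partial>P) = ennreal (D1\<^sup>2 / D0\<^sup>2)"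
    by (simp add: P.emeasure_space_1 flip: ennreal_mult)
  finally have le: "(\<integral>\<^sup>+\<omega>. ennreal (exp (U \<omega>) - 1) \<partial>P) \<le> ennreal (D1\<^sup>2 / D0\<^sup>2)" .
  have i: "integrable P (\<lambda>\<omega>. exp (U \<omega>) - 1)"
    using e1 le by (intro integrableI_nonneg) (auto simp: le_less_trans)
  then have "integrable P (\<lambda>\<omega>. (exp (U \<omega>) - 1) + 1)" by (intro Bochner_Integration.integrable_add) auto
  then show i': "integrable P (\<lambda>\<omega>. exp (U \<omega>))" by simp
  have "ennreal (\<integral>\<omega>. exp (U \<omega>) - 1 \<partial>P) \<le> ennreal (D1\<^sup>2 / D0\<^sup>2)"
    using le i e1 by (subst nn_integral_eq_integral[symmetric]) auto
  then have "(\<integral>\<omega>. exp (U \<omega>) - 1 \<partial>P) \<le> D1\<^sup>2 / D0\<^sup>2" by (subst (asm) ennreal_le_iff) auto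
  then show "(\<integral>\<omega>. exp (U \<omega>) \<partial>P) \<le> C1" using i' by (simp add: C1_def P.prob_space)
qed

lemma R_sq_eq: "(R \<omega>)\<^sup>2 = D0\<^sup>2 * U \<omega>"
  using D0_pos by (simp add: U_def)

lemma U_le_exp: "U \<omega> \<le> exp (U \<omega>) - 1"
  using exp_ge_add_one_self[of "U \<omega>"] by linarith

lemma R_sq_integrable: "integrable P (\<lambda>\<omega>. (R \<omega>)\<^sup>2)"
proof -
  have "integrable P U"
    by (rule Bochner_Integration.integrable_bound[OF exp_U_integrable])
       (use U_nonneg U_le_exp in \<open>auto intro!: AE_I2 simp: abs_of_nonneg intro: order_trans[OF U_le_exp]\<close>)
  then show ?thesis unfolding R_sq_eq by simp
qed

lemma R_integrable: "integrable P R"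
  by (rule P.square_integrable_imp_integrable[OF _ R_sq_integrable]) simp

lemma R_pow4_integrable: "integrable P (\<lambda>\<omega>. (R \<omega>) ^ 4)"
  and R_pow4_le: "(\<integral>\<omega>. (R \<omega>) ^ 4 \<partial>P) \<le> 2 * D0 ^ 4 * C1"
proof -
  have le: "(R \<omega>) ^ 4 \<le> 2 * D0 ^ 4 * exp (U \<omega>)" for \<omega>
  proof -
    have "(R \<omega>) ^ 4 = ((R \<omega>)\<^sup>2)\<^sup>2" by (simp flip: power_mult)
    also have "\<dots> = D0 ^ 4 * (U \<omega>)\<^sup>2" unfolding R_sq_eq by (simp add: power_mult_distrib flip: power_mult)
    also have "\<dots> \<le> D0 ^ 4 * (2 * exp (U \<omega>))" using power2_le_exp[OF U_nonneg] by (intro mult_left_mono) auto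
    finally show ?thesis by simp
  qed
  have i: "integrable P (\<lambda>\<omega>. 2 * D0 ^ 4 * exp (U \<omega>))" using exp_U_integrable by simp
  show i4: "integrable P (\<lambda>\<omega>. (R \<omega>) ^ 4)"
    by (rule Bochner_Integration.integrable_bound[OF i]) (use le in \<open>auto intro!: AE_I2\<close>)
  have "(\<integral>\<omega>. (R \<omega>) ^ 4 \<partial>P) \<le> (\<integral>\<omega>. 2 * D0 ^ 4 * exp (U \<omega>) \<partial>P)"
    using i4 i le by (rule integral_mono)
  also have "\<dots> \<le> 2 * D0 ^ 4 * C1" using exp_U_le by (simp add: mult_left_mono)
  finally show "(\<integral>\<omega>. (R \<omega>) ^ 4 \<partial>P) \<le> 2 * D0 ^ 4 * C1" .
qed

lemma Y1_eq: "Y1 \<omega> = lin a (X \<omega>) + R \<omega>"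
  by (simp add: R_def)

lemma Y1_pow4_integrable: "integrable P (\<lambda>\<omega>. (Y1 \<omega>) ^ 4)"
proof (rule Bochner_Integration.integrable_bound)
  let ?B = "(C0 * l1 p a) ^ 4"
  show "integrable P (\<lambda>\<omega>. 8 * (?B + (R \<omega>) ^ 4))" using R_pow4_integrable by simp
  show "AE \<omega> in P. norm (Y1 \<omega> ^ 4) \<le> norm (8 * (?B + (R \<omega>) ^ 4))"
    using lin_le
  proof eventually_elim
    case (elim \<omega>)
    have "\<bar>lin a (X \<omega>)\<bar> ^ 4 \<le> ?B" using elim by (intro power_mono) auto
    then have "lin a (X \<omega>) ^ 4 \<le> ?B" by simp
    then have "Y1 \<omega> ^ 4 \<le> 8 * (?B + (R \<omega>) ^ 4)"
      unfolding Y1_eq[of \<omega>] by (intro order_trans[OF power4_add_le]) simp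
    then show ?case by simp
  qed
qed measurable

lemma Y1_integrable: "integrable P Y1"
proof -
  have "integrable P (\<lambda>\<omega>. lin a (X \<omega>))"
    using lin_le by (intro integrable_of_AE_bound[where B = "C0 * l1 p a"]) auto
  then have "integrable P (\<lambda>\<omega>. lin a (X \<omega>) + R \<omega>)" using R_integrable by (rule Bochner_Integration.integrable_add)
  then show ?thesis by (simp flip: Y1_eq)
qed

text \<open>
  Unconfoundedness removes the treatment indicator, and \<open>U \<le> exp U - 1\<close> bounds the conditional
  second moment by the conditional exponential moment.
\<close>

lemma resid_second_moment:
  assumes [measurable]: "h \<in> borel_measurable N" and h0: "\<And>x. 0 \<le> h x"
    and hb: "AE \<omega> in P. h (X \<omega>) \<le> H"
  shows "integrable P (\<lambda>\<omega>. T \<omega> * h (X \<omega>) * (R \<omega>)\<^sup>2)"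
    and "(\<integral>\<omega>. T \<omega> * h (X \<omega>) * (R \<omega>)\<^sup>2 \<partial>P) \<le> D1\<^sup>2 * (\<integral>\<omega>. T \<omega> * h (X \<omega>) \<partial>P)"
proof -
  have Tb: "AE \<omega> in P. 0 \<le> T \<omega> \<and> T \<omega> \<le> 1" using T_bounds by (intro AE_I2) auto
  show i: "integrable P (\<lambda>\<omega>. T \<omega> * h (X \<omega>) * (R \<omega>)\<^sup>2)"
  proof (rule Bochner_Integration.integrable_bound[OF integrable_mult_right[OF R_sq_integrable, of H]])
    show "AE \<omega> in P. norm (T \<omega> * h (X \<omega>) * (R \<omega>)\<^sup>2) \<le> norm (H * (R \<omega>)\<^sup>2)"
      using hb Tb
    proof eventually_elim
      case (elim \<omega>)
      have "T \<omega> * h (X \<omega>) \<le> 1 * H" using elim h0 by (intro mult_mono) auto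
      moreover have "0 \<le> T \<omega> * h (X \<omega>)" using elim h0 by simp
      ultimately have "\<bar>T \<omega> * h (X \<omega>)\<bar> \<le> \<bar>H\<bar>" by linarith
      then show ?case by (simp add: abs_mult mult_right_mono)
    qed
  qed measurable
  have ih: "integrable P (\<lambda>\<omega>. T \<omega> * h (X \<omega>))"
  proof (rule integrable_of_AE_bound)
    show "AE \<omega> in P. \<bar>T \<omega> * h (X \<omega>)\<bar> \<le> H"
      using hb Tb
    proof eventually_elim
      case (elim \<omega>)
      have "T \<omega> * h (X \<omega>) \<le> 1 * H" using elim h0 by (intro mult_mono) auto
      then show ?case using elim h0 by (simp add: abs_mult)
    qed
  qed measurable
  have pe: "ennreal (T \<omega> * h (X \<omega>) * (R \<omega>)\<^sup>2) = ennreal (T \<omega>) * (ennreal (h (X \<omega>)) * ennreal ((Y1 \<omega> - lin a (X \<omega>))\<^sup>2))"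
    if "\<omega> \<in> space P" for \<omega>
    using T_bounds[OF that] h0 by (simp add: R_def mult.assoc flip: ennreal_mult)
  have "ennreal (\<integral>\<omega>. T \<omega> * h (X \<omega>) * (R \<omega>)\<^sup>2 \<partial>P) = (\<integral>\<^sup>+\<omega>. ennreal (T \<omega> * h (X \<omega>) * (R \<omega>)\<^sup>2) \<partial>P)"
    using i h0 T_bounds by (intro nn_integral_eq_integral[symmetric] AE_I2) auto
  also have "\<dots> = (\<integral>\<^sup>+\<omega>. ennreal (T \<omega>) * (ennreal (h (X \<omega>)) * ennreal ((Y1 \<omega> - lin a (X \<omega>))\<^sup>2)) \<partial>P)"
    using pe by (rule nn_integral_cong)
  also have "\<dots> = (\<integral>\<^sup>+\<omega>. ennreal (pistar (X \<omega>)) * (ennreal (h (X \<omega>)) * ennreal ((Y1 \<omega> - lin a (X \<omega>))\<^sup>2)) \<partial>P)"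
    using nn_integral_treated[of "\<lambda>z. ennreal (h (snd z)) * ennreal ((fst z - lin a (snd z))\<^sup>2)"] by simp
  also have "\<dots> \<le> (\<integral>\<^sup>+\<omega>. (ennreal (pistar (X \<omega>)) * ennreal (h (X \<omega>))) * (ennreal (D0\<^sup>2) * ennreal (exp (U \<omega>) - 1)) \<partial>P)"
  proof (rule nn_integral_mono)
    fix \<omega>
    have "ennreal ((Y1 \<omega> - lin a (X \<omega>))\<^sup>2) \<le> ennreal (D0\<^sup>2) * ennreal (exp (U \<omega>) - 1)"
      using R_sq_eq[of \<omega>] U_le_exp[of \<omega>] U_nonneg[of \<omega>] unfolding R_def
      by (simp add: mult_left_mono flip: ennreal_mult)
    then show "ennreal (pistar (X \<omega>)) * (ennreal (h (X \<omega>)) * ennreal ((Y1 \<omega> - lin a (X \<omega>))\<^sup>2))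
      \<le> (ennreal (pistar (X \<omega>)) * ennreal (h (X \<omega>))) * (ennreal (D0\<^sup>2) * ennreal (exp (U \<omega>) - 1))"
      unfolding mult.assoc by (intro mult_left_mono) auto
  qed
  also have "\<dots> \<le> ennreal (D1\<^sup>2) * (\<integral>\<^sup>+\<omega>. ennreal (pistar (X \<omega>)) * ennreal (h (X \<omega>)) \<partial>P)"
    by (rule resid_cond_bound[of "\<lambda>x. ennreal (pistar x) * ennreal (h x)"]) measurable
  also have "(\<integral>\<^sup>+\<omega>. ennreal (pistar (X \<omega>)) * ennreal (h (X \<omega>)) \<partial>P) = (\<integral>\<^sup>+\<omega>. ennreal (T \<omega>) * ennreal (h (X \<omega>)) \<partial>P)"
    using nn_integral_treated[of "\<lambda>z. ennreal (h (snd z))"] by simp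
  also have "\<dots> = (\<integral>\<^sup>+\<omega>. ennreal (T \<omega> * h (X \<omega>)) \<partial>P)"
    using T_bounds h0 by (intro nn_integral_cong) (simp flip: ennreal_mult)
  also have "\<dots> = ennreal (\<integral>\<omega>. T \<omega> * h (X \<omega>) \<partial>P)"
    using ih h0 T_bounds by (intro nn_integral_eq_integral AE_I2) auto
  also have "ennreal (D1\<^sup>2) * \<dots> = ennreal (D1\<^sup>2 * (\<integral>\<omega>. T \<omega> * h (X \<omega>) \<partial>P))"
    by (simp add: ennreal_mult')
  finally show "(\<integral>\<omega>. T \<omega> * h (X \<omega>) * (R \<omega>)\<^sup>2 \<partial>P) \<le> D1\<^sup>2 * (\<integral>\<omega>. T \<omega> * h (X \<omega>) \<partial>P)"
    using T_bounds h0 by (subst (asm) ennreal_le_iff) (auto intro!: mult_nonneg_nonneg integral_nonneg_AE AE_I2)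
qed


lemma regular_AE: "AE \<omega> in P. \<omega> \<in> space P \<and> (\<forall>b. \<bar>lin b (X \<omega>)\<bar> \<le> C0 * l1 p b)
    \<and> w (X \<omega>) \<le> W \<and> (\<forall>j\<le>p. \<bar>f j (X \<omega>)\<bar> \<le> C0)"
  using lin_le w_le f_bdd AE_space by eventually_elim auto

lemma integral_sample_avg:
  fixes h :: "real \<times> real \<times> 'x \<Rightarrow> real"
  assumes [measurable]: "h \<in> borel_measurable obs_space" and "integrable P (\<lambda>\<omega>. h (obs \<omega>))"
  shows "(\<integral>\<omega>. sample_avg n (\<lambda>i. h (Zs i \<omega>)) \<partial>M) = (\<integral>\<omega>. h (obs \<omega>) \<partial>P)"
  using assms n_pos
  by (simp add: sample_avg_def Bochner_Integration.integral_sum integrable_Zs integral_Zs)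

subsection \<open>Score equations\<close>

definition cal_fun :: "(nat \<Rightarrow> real) \<Rightarrow> real \<times> real \<times> 'x \<Rightarrow> real" where
  "cal_fun b z = (case z of (y, t, x) \<Rightarrow> (1 - t - t * w x) * lin b x)"

definition wl_fun :: "(nat \<Rightarrow> real) \<Rightarrow> real \<times> real \<times> 'x \<Rightarrow> real" where
  "wl_fun b z = (case z of (y, t, x) \<Rightarrow> t * w x * (y - lin a x) * lin b x)"

lemma cal_fun_measurable [measurable]: "cal_fun b \<in> borel_measurable obs_space"
  and wl_fun_measurable [measurable]: "wl_fun b \<in> borel_measurable obs_space"
  unfolding cal_fun_def[abs_def] wl_fun_def[abs_def] by measurable

lemma cal_fun_obs: "cal_fun b (obs \<omega>) = (1 - T \<omega> - T \<omega> * w (X \<omega>)) * lin b (X \<omega>)"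
  by (simp add: cal_fun_def obs_def)

lemma wl_fun_obs: "\<omega> \<in> space P \<Longrightarrow> wl_fun b (obs \<omega>) = T \<omega> * w (X \<omega>) * R \<omega> * lin b (X \<omega>)"
  using T_observed[of \<omega>] by (simp add: wl_fun_def obs_def R_def algebra_simps) algebra

lemma abs_cal_fun_le: "AE \<omega> in P. \<bar>cal_fun b (obs \<omega>)\<bar> \<le> (W + 1) * (C0 * l1 p b)"
  using regular_AE
proof eventually_elim
  case (elim \<omega>)
  have "\<bar>1 - T \<omega> - T \<omega> * w (X \<omega>)\<bar> \<le> W + 1"
    using elim T_cases[of \<omega>] weight_pos[of g "X \<omega>"] W_pos by auto
  then show ?case
    unfolding cal_fun_obs abs_mult using elim W_pos by (intro mult_mono) auto
qed

lemma cal_fun_integrable: "integrable P (\<lambda>\<omega>. cal_fun b (obs \<omega>))"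
  by (rule integrable_of_AE_bound[OF _ abs_cal_fun_le]) measurable

lemma abs_wl_fun_le: "AE \<omega> in P. \<bar>wl_fun b (obs \<omega>)\<bar> \<le> W * (C0 * l1 p b) * \<bar>R \<omega>\<bar>"
  using regular_AE
proof eventually_elim
  case (elim \<omega>)
  have "\<bar>T \<omega> * w (X \<omega>)\<bar> \<le> W" using elim T_cases[of \<omega>] weight_pos[of g "X \<omega>"] W_pos by auto
  then have "\<bar>T \<omega> * w (X \<omega>)\<bar> * \<bar>lin b (X \<omega>)\<bar> \<le> W * (C0 * l1 p b)" using elim W_pos by (intro mult_mono) auto
  then have "\<bar>T \<omega> * w (X \<omega>)\<bar> * \<bar>lin b (X \<omega>)\<bar> * \<bar>R \<omega>\<bar> \<le> W * (C0 * l1 p b) * \<bar>R \<omega>\<bar>" by (rule mult_right_mono) simp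
  moreover have "\<bar>wl_fun b (obs \<omega>)\<bar> = \<bar>T \<omega> * w (X \<omega>)\<bar> * \<bar>lin b (X \<omega>)\<bar> * \<bar>R \<omega>\<bar>"
    using elim wl_fun_obs[of \<omega> b] by (simp add: abs_mult)
  ultimately show ?case by simp
qed

lemma wl_fun_integrable: "integrable P (\<lambda>\<omega>. wl_fun b (obs \<omega>))"
proof (rule Bochner_Integration.integrable_bound)
  show "integrable P (\<lambda>\<omega>. W * (C0 * l1 p b) * \<bar>R \<omega>\<bar>)" using R_integrable by simp
  show "AE \<omega> in P. norm (wl_fun b (obs \<omega>)) \<le> norm (W * (C0 * l1 p b) * \<bar>R \<omega>\<bar>)"
    using abs_wl_fun_le by eventually_elim (auto intro: order_trans[OF _ abs_ge_self])
qed measurable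

lemma Tw_sq_bound: "AE \<omega> in P. \<bar>T \<omega> * w (X \<omega>) * (lin b (X \<omega>))\<^sup>2\<bar> \<le> W * (C0 * l1 p b)\<^sup>2"
  using regular_AE
proof eventually_elim
  case (elim \<omega>)
  have "\<bar>T \<omega> * w (X \<omega>)\<bar> \<le> W" using elim T_cases[of \<omega>] weight_pos[of g "X \<omega>"] W_pos by auto
  moreover have "(lin b (X \<omega>))\<^sup>2 \<le> (C0 * l1 p b)\<^sup>2"
    using elim C0_ge by (intro abs_le_square_iff[THEN iffD1]) (simp add: abs_of_nonneg)
  ultimately show ?case unfolding abs_mult[of "_ * _" "_\<^sup>2"] using W_pos by (intro mult_mono) auto
qed

lemma Tw_sq_integrable: "integrable P (\<lambda>\<omega>. T \<omega> * w (X \<omega>) * (lin b (X \<omega>))\<^sup>2)"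
  by (rule integrable_of_AE_bound[OF _ Tw_sq_bound]) measurable

definition Qf :: "(nat \<Rightarrow> real) \<Rightarrow> real" where
  "Qf b = (\<integral>\<omega>. T \<omega> * w (X \<omega>) * (lin b (X \<omega>))\<^sup>2 \<partial>P)"

lemma Qf_nonneg: "0 \<le> Qf b"
  unfolding Qf_def using T_bounds weight_pos
  by (intro integral_nonneg_AE AE_I2 mult_nonneg_nonneg) (auto intro: less_imp_le)

text \<open>First-order condition for \<open>g\<close>: perturb along \<open>b\<close> and use that the exponential is quadratic near 0.\<close>

lemma cal_score: "(\<integral>\<omega>. cal_fun b (obs \<omega>) \<partial>P) = 0"
proof -
  define r where "r \<gamma> z = (case z of (y :: real, t, x) \<Rightarrow> t * exp (- lin \<gamma> x) + (1 - t) * lin \<gamma> x)" for \<gamma> z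
  have rm [measurable]: "r \<gamma> \<in> borel_measurable obs_space" for \<gamma> unfolding r_def[abs_def] by measurable
  have robs: "r \<gamma> (obs \<omega>) = T \<omega> * weight p f \<gamma> (X \<omega>) + (1 - T \<omega>) * lin \<gamma> (X \<omega>)" for \<gamma> \<omega>
    by (simp add: r_def obs_def weight_def)
  have ri: "integrable P (\<lambda>\<omega>. r \<gamma> (obs \<omega>))" for \<gamma>
  proof (rule integrable_of_AE_bound)
    show "AE \<omega> in P. \<bar>r \<gamma> (obs \<omega>)\<bar> \<le> exp (C0 * l1 p \<gamma>) + C0 * l1 p \<gamma>"
      using regular_AE weight_le[of \<gamma>]
    proof eventually_elim
      case (elim \<omega>)
      have "0 \<le> C0 * l1 p \<gamma>" using C0_ge by simp
      moreover have "\<bar>lin \<gamma> (X \<omega>)\<bar> \<le> C0 * l1 p \<gamma>" using elim by blast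
      moreover have "T \<omega> = 0 \<or> T \<omega> = 1" using elim T_cases[of \<omega>] by blast
      moreover note elim(2) weight_pos[of \<gamma> "X \<omega>"] exp_gt_zero[of "C0 * l1 p \<gamma>"]
      ultimately show ?case unfolding robs by (elim disjE) simp_all
    qed
  qed measurable
  have risk: "(\<integral>\<omega>. loss_cal p f n (\<lambda>i. Ts i \<omega>) (\<lambda>i. Xs i \<omega>) \<gamma> \<partial>M) = (\<integral>\<omega>. r \<gamma> (obs \<omega>) \<partial>P)" for \<gamma>
    using integral_sample_avg[OF rm ri, of \<gamma>] by (simp add: loss_cal_def r_def Zs_def)
  have min: "(\<integral>\<omega>. r g (obs \<omega>) \<partial>P) \<le> (\<integral>\<omega>. r \<gamma> (obs \<omega>) \<partial>P)" for \<gamma>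
    using min_g unfolding risk by (auto simp: is_arg_min_def not_less)
  define L where "L = C0 * l1 p b"
  have L0: "0 \<le> L" using C0_ge by (simp add: L_def)
  show ?thesis
  proof (rule linear_term_zero_of_nonneg[where d = "1 / (L + 1)" and C = "2 * W * L\<^sup>2"])
    show "0 < 1 / (L + 1)" using L0 by simp
    fix s :: real assume s: "\<bar>s\<bar> \<le> 1 / (L + 1)"
    have "AE \<omega> in P. r (\<lambda>j. g j + s * b j) (obs \<omega>) - r g (obs \<omega>) \<le> s * cal_fun b (obs \<omega>) + 2 * W * L\<^sup>2 * s\<^sup>2"
      using regular_AE
    proof eventually_elim
      case (elim \<omega>)
      let ?z = "s * lin b (X \<omega>)"
      have lb: "\<bar>lin b (X \<omega>)\<bar> \<le> L" using elim by (simp add: L_def)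
      have "\<bar>?z\<bar> \<le> 1 / (L + 1) * L" unfolding abs_mult using s lb L0 by (intro mult_mono) auto
      also have "\<dots> \<le> 1" using L0 by simp
      finally have "\<bar>exp (- ?z) - 1 + ?z\<bar> \<le> 2 * ?z\<^sup>2" by (rule exp_minus_quadratic_upper)
      then have "exp (- ?z) - 1 + ?z \<le> 2 * ?z\<^sup>2" by linarith
      also have "\<dots> \<le> 2 * (L\<^sup>2 * s\<^sup>2)"
      proof -
        have "(lin b (X \<omega>))\<^sup>2 \<le> L\<^sup>2" using lb L0 by (intro abs_le_square_iff[THEN iffD1]) simp
        then have "s\<^sup>2 * (lin b (X \<omega>))\<^sup>2 \<le> s\<^sup>2 * L\<^sup>2" by (rule mult_left_mono) simp
        then show ?thesis by (simp only: power_mult_distrib mult.commute[of "L\<^sup>2"] mult_le_cancel_left_pos zero_less_numeral)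
      qed
      finally have q: "exp (- ?z) - 1 + ?z \<le> 2 * (L\<^sup>2 * s\<^sup>2)" .
      have "T \<omega> * w (X \<omega>) * (exp (- ?z) - 1 + ?z) \<le> T \<omega> * w (X \<omega>) * (2 * (L\<^sup>2 * s\<^sup>2))"
        using q elim T_bounds[of \<omega>] weight_pos[of g "X \<omega>"] by (intro mult_left_mono) (auto intro: less_imp_le)
      also have "\<dots> \<le> W * (2 * (L\<^sup>2 * s\<^sup>2))"
        using elim T_cases[of \<omega>] W_pos by (intro mult_right_mono) auto
      finally have "T \<omega> * w (X \<omega>) * (exp (- ?z) - 1 + ?z) \<le> 2 * W * L\<^sup>2 * s\<^sup>2" by simp
      moreover have "r (\<lambda>j. g j + s * b j) (obs \<omega>) - r g (obs \<omega>)
          = s * cal_fun b (obs \<omega>) + T \<omega> * w (X \<omega>) * (exp (- ?z) - 1 + ?z)"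
      proof -
        have we: "weight p f (\<lambda>j. g j + s * b j) (X \<omega>) = w (X \<omega>) * exp (- ?z)"
          by (simp add: weight_def linpred_add linpred_scale flip: exp_add)
        show ?thesis unfolding robs cal_fun_obs linpred_add linpred_scale we by (simp add: algebra_simps)
      qed
      ultimately show ?case by linarith
    qed
    then have "(\<integral>\<omega>. r (\<lambda>j. g j + s * b j) (obs \<omega>) - r g (obs \<omega>) \<partial>P)
        \<le> (\<integral>\<omega>. s * cal_fun b (obs \<omega>) + 2 * W * L\<^sup>2 * s\<^sup>2 \<partial>P)"
      using ri cal_fun_integrable by (intro integral_mono_AE) auto
    then show "0 \<le> s * (\<integral>\<omega>. cal_fun b (obs \<omega>) \<partial>P) + 2 * W * L\<^sup>2 * s\<^sup>2"
      using min[of "\<lambda>j. g j + s * b j"] ri cal_fun_integrable by (simp add: P.prob_space)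
  qed
qed

lemma wl_score: "(\<integral>\<omega>. wl_fun b (obs \<omega>) \<partial>P) = 0"
proof -
  define r where "r \<alpha> z = (case z of (y :: real, t, x) \<Rightarrow> t * w x * (y - lin \<alpha> x)\<^sup>2)" for \<alpha> z
  have rm [measurable]: "r \<alpha> \<in> borel_measurable obs_space" for \<alpha> unfolding r_def[abs_def] by measurable
  have expand: "r (\<lambda>j. a j + c j) (obs \<omega>)
      = T \<omega> * w (X \<omega>) * (R \<omega>)\<^sup>2 - 2 * wl_fun c (obs \<omega>) + T \<omega> * w (X \<omega>) * (lin c (X \<omega>))\<^sup>2"
    if "\<omega> \<in> space P" for c \<omega>
    using T_cases[OF that] unfolding wl_fun_obs[OF that]
    by (auto simp: r_def obs_def linpred_add R_def observed_def power2_eq_square algebra_simps)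
  have i1: "integrable P (\<lambda>\<omega>. T \<omega> * w (X \<omega>) * (R \<omega>)\<^sup>2)"
    by (rule resid_second_moment(1)[OF _ _ w_le]) (auto intro: less_imp_le[OF weight_pos])
  have ie: "integrable P (\<lambda>\<omega>. r (\<lambda>j. a j + c j) (obs \<omega>))"
    and ve: "(\<integral>\<omega>. r (\<lambda>j. a j + c j) (obs \<omega>) \<partial>P)
      = (\<integral>\<omega>. T \<omega> * w (X \<omega>) * (R \<omega>)\<^sup>2 \<partial>P) - 2 * (\<integral>\<omega>. wl_fun c (obs \<omega>) \<partial>P) + Qf c" for c
  proof -
    let ?e = "\<lambda>\<omega>. T \<omega> * w (X \<omega>) * (R \<omega>)\<^sup>2 - 2 * wl_fun c (obs \<omega>) + T \<omega> * w (X \<omega>) * (lin c (X \<omega>))\<^sup>2"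
    have i: "integrable P ?e" using i1 wl_fun_integrable Tw_sq_integrable by simp
    then show "integrable P (\<lambda>\<omega>. r (\<lambda>j. a j + c j) (obs \<omega>))"
      by (rule Bochner_Integration.integrable_cong[THEN iffD1, rotated -1]) (simp_all add: expand)
    have "(\<integral>\<omega>. r (\<lambda>j. a j + c j) (obs \<omega>) \<partial>P) = (\<integral>\<omega>. ?e \<omega> \<partial>P)"
      by (rule Bochner_Integration.integral_cong) (simp_all add: expand)
    then show "(\<integral>\<omega>. r (\<lambda>j. a j + c j) (obs \<omega>) \<partial>P)
      = (\<integral>\<omega>. T \<omega> * w (X \<omega>) * (R \<omega>)\<^sup>2 \<partial>P) - 2 * (\<integral>\<omega>. wl_fun c (obs \<omega>) \<partial>P) + Qf c"
      using i1 wl_fun_integrable Tw_sq_integrable by (simp add: Qf_def)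
  qed
  have risk: "(\<integral>\<omega>. loss_wl p f n (\<lambda>i. Ys i \<omega>) (\<lambda>i. Ts i \<omega>) (\<lambda>i. Xs i \<omega>) g (\<lambda>j. a j + c j) \<partial>M)
      = (\<integral>\<omega>. r (\<lambda>j. a j + c j) (obs \<omega>) \<partial>P) / 2" for c
    using integral_sample_avg[OF rm ie, of c] by (simp add: loss_wl_def r_def Zs_def)
  have min: "(\<integral>\<omega>. r (\<lambda>j. a j + 0) (obs \<omega>) \<partial>P) \<le> (\<integral>\<omega>. r (\<lambda>j. a j + c j) (obs \<omega>) \<partial>P)" for c
  proof -
    have "(\<integral>\<omega>. loss_wl p f n (\<lambda>i. Ys i \<omega>) (\<lambda>i. Ts i \<omega>) (\<lambda>i. Xs i \<omega>) g (\<lambda>j. a j + 0) \<partial>M)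
        \<le> (\<integral>\<omega>. loss_wl p f n (\<lambda>i. Ys i \<omega>) (\<lambda>i. Ts i \<omega>) (\<lambda>i. Xs i \<omega>) g (\<lambda>j. a j + c j) \<partial>M)"
      using min_a by (auto simp: is_arg_min_def not_less)
    then show ?thesis unfolding risk risk[of "\<lambda>_. 0"] by simp
  qed
  have "(\<integral>\<omega>. wl_fun b (obs \<omega>) \<partial>P) * (- 2) = 0"
  proof (rule linear_term_zero_of_nonneg[where d = 1 and C = "Qf b"])
    fix s :: real
    have "wl_fun (\<lambda>j. s * b j) z = s * wl_fun b z" for z
      by (simp add: wl_fun_def linpred_scale split: prod.split)
    moreover have "Qf (\<lambda>j. s * b j) = s\<^sup>2 * Qf b"
      by (simp add: Qf_def linpred_scale power_mult_distrib mult_ac flip: Bochner_Integration.integral_mult_right_zero)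
    moreover have "wl_fun (\<lambda>_. 0) z = 0" "Qf (\<lambda>_. 0) = 0" for z
      by (simp_all add: wl_fun_def Qf_def linpred_def split: prod.split)
    ultimately show "0 \<le> s * ((\<integral>\<omega>. wl_fun b (obs \<omega>) \<partial>P) * (- 2)) + Qf b * s\<^sup>2"
      using min[of "\<lambda>j. s * b j"] ve[of "\<lambda>_. 0"] ve[of "\<lambda>j. s * b j"] by (simp add: mult_ac)
  qed simp
  then show ?thesis by simp
qed

lemma quadratic_form_eq: "(\<Sum>j\<le>p. \<Sum>k\<le>p. b j * Sigma_gamma P T X p f g j k * b k) = Qf b"
proof -
  have i: "integrable P (\<lambda>\<omega>. T \<omega> * w (X \<omega>) * f j (X \<omega>) * f k (X \<omega>))" if "j \<le> p" "k \<le> p" for j k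
  proof (rule integrable_of_AE_bound)
    have [measurable]: "f j \<in> borel_measurable N" "f k \<in> borel_measurable N" using that f_meas by auto
    show "(\<lambda>\<omega>. T \<omega> * w (X \<omega>) * f j (X \<omega>) * f k (X \<omega>)) \<in> borel_measurable P" by measurable
    show "AE \<omega> in P. \<bar>T \<omega> * w (X \<omega>) * f j (X \<omega>) * f k (X \<omega>)\<bar> \<le> W * C0 * C0"
      using regular_AE
    proof eventually_elim
      case (elim \<omega>)
      have "\<bar>T \<omega> * w (X \<omega>)\<bar> \<le> W" using elim T_cases[of \<omega>] weight_pos[of g "X \<omega>"] W_pos by auto
      then show ?case
        unfolding abs_mult[of _ "f j _"] abs_mult[of _ "f k _"]
        using elim that W_pos C0_ge by (intro mult_mono) auto
    qed
  qed
  have "(\<Sum>j\<le>p. \<Sum>k\<le>p. b j * Sigma_gamma P T X p f g j k * b k)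
      = (\<integral>\<omega>. (\<Sum>j\<le>p. \<Sum>k\<le>p. b j * b k * (T \<omega> * w (X \<omega>) * f j (X \<omega>) * f k (X \<omega>))) \<partial>P)"
  proof -
    let ?h = "\<lambda>j k \<omega>. b j * b k * (T \<omega> * w (X \<omega>) * f j (X \<omega>) * f k (X \<omega>))"
    have ih: "integrable P (?h j k)" if "j \<le> p" "k \<le> p" for j k using i[OF that] by simp
    have "(\<Sum>j\<le>p. \<Sum>k\<le>p. b j * Sigma_gamma P T X p f g j k * b k) = (\<Sum>j\<le>p. \<Sum>k\<le>p. \<integral>\<omega>. ?h j k \<omega> \<partial>P)"
      unfolding Bochner_Integration.integral_mult_right_zero Sigma_gamma_def by (simp only: mult_ac)
    also have "\<dots> = (\<Sum>j\<le>p. \<integral>\<omega>. (\<Sum>k\<le>p. ?h j k \<omega>) \<partial>P)"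
      using ih by (intro sum.cong refl Bochner_Integration.integral_sum[symmetric]) auto
    also have "\<dots> = (\<integral>\<omega>. (\<Sum>j\<le>p. \<Sum>k\<le>p. ?h j k \<omega>) \<partial>P)"
      using ih by (intro Bochner_Integration.integral_sum[symmetric] Bochner_Integration.integrable_sum) auto
    finally show ?thesis .
  qed
  also have "\<dots> = Qf b"
    unfolding Qf_def
    by (rule Bochner_Integration.integral_cong)
       (simp_all add: linpred_def power2_eq_square sum_product sum_distrib_left mult_ac)
  finally show ?thesis .
qed


subsection \<open>Second moments of the scores\<close>

text \<open>
  The score equation along \<open>g\<close> itself bounds \<open>E (1 - T) g\<^sup>T f\<close>, because \<open>z exp (- z) \<le> 1\<close>.
  Hence the fitted weights can be small only with small probability.
\<close>

lemma large_predictor_prob: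
  assumes L: "0 < L"
  shows "(\<integral>\<omega>. (1 - T \<omega>) * indicat_real {x. L < lin g x} (X \<omega>) \<partial>P) \<le> (1 + \<bar>B0\<bar>) / L"
proof -
  have i1: "integrable P (\<lambda>\<omega>. (1 - T \<omega>) * indicat_real {x. L < lin g x} (X \<omega>))"
  proof (rule integrable_of_AE_bound[where B = 1])
    have "(\<lambda>\<omega>. (1 - T \<omega>) * (if L < lin g (X \<omega>) then 1 else 0)) \<in> borel_measurable P" by measurable
    then show "(\<lambda>\<omega>. (1 - T \<omega>) * indicat_real {x. L < lin g x} (X \<omega>)) \<in> borel_measurable P"
      by (simp add: indicator_def of_bool_def)
    show "AE \<omega> in P. \<bar>(1 - T \<omega>) * indicat_real {x. L < lin g x} (X \<omega>)\<bar> \<le> 1"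
      using AE_space by eventually_elim (auto dest!: T_cases split: split_indicator)
  qed
  have i2: "integrable P (\<lambda>\<omega>. cal_fun g (obs \<omega>) + 1 + \<bar>B0\<bar>)" using cal_fun_integrable by simp
  have "(\<integral>\<omega>. L * ((1 - T \<omega>) * indicat_real {x. L < lin g x} (X \<omega>)) \<partial>P) \<le> (\<integral>\<omega>. cal_fun g (obs \<omega>) + 1 + \<bar>B0\<bar> \<partial>P)"
  proof (rule integral_mono_AE)
    show "AE \<omega> in P. L * ((1 - T \<omega>) * indicat_real {x. L < lin g x} (X \<omega>)) \<le> cal_fun g (obs \<omega>) + 1 + \<bar>B0\<bar>"
      using regular_AE g_ge
    proof eventually_elim
      case (elim \<omega>)
      let ?z = "lin g (X \<omega>)"
      have "?z \<le> exp ?z" using exp_ge_add_one_self[of ?z] by linarith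
      then have "exp (- ?z) * ?z \<le> exp (- ?z) * exp ?z" by (intro mult_left_mono) auto
      then have "w (X \<omega>) * ?z \<le> 1" by (simp add: weight_def flip: exp_add)
      moreover have "T \<omega> = 0 \<or> T \<omega> = 1" using elim T_cases[of \<omega>] by blast
      ultimately show ?case using elim(2) L unfolding cal_fun_obs
        by (elim disjE) (auto split: split_indicator)
    qed
  qed (use i1 i2 in auto)
  then have "L * (\<integral>\<omega>. (1 - T \<omega>) * indicat_real {x. L < lin g x} (X \<omega>) \<partial>P) \<le> 1 + \<bar>B0\<bar>"
    using cal_score[of g] cal_fun_integrable by (simp add: P.prob_space)
  then show ?thesis using L by (simp add: field_simps)
qed

text \<open>
  On the region where both the propensity score and the fitted weight are bounded below, the controls
  are comparable with the weighted treated, so that the variance of the score is of the order of the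
  quadratic form. The rest of the space has small probability, uniformly over rows.
\<close>

lemma cal_second_moment:
  assumes c: "0 < c" and L: "0 < L"
  shows "integrable P (\<lambda>\<omega>. (cal_fun b (obs \<omega>))\<^sup>2)"
    and "(\<integral>\<omega>. (cal_fun b (obs \<omega>))\<^sup>2 \<partial>P) \<le> (W + exp L / c) * Qf b
      + (C0 * l1 p b)\<^sup>2 * (measure P {\<omega>\<in>space P. pistar (X \<omega>) < c} + (1 + \<bar>B0\<bar>) / L)"
proof -
  show i: "integrable P (\<lambda>\<omega>. (cal_fun b (obs \<omega>))\<^sup>2)"
  proof (rule integrable_of_AE_bound)
    show "AE \<omega> in P. \<bar>(cal_fun b (obs \<omega>))\<^sup>2\<bar> \<le> ((W + 1) * (C0 * l1 p b))\<^sup>2"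
      using abs_cal_fun_le[of b]
    proof eventually_elim
      case (elim \<omega>)
      have "0 \<le> (W + 1) * (C0 * l1 p b)" using W_pos C0_ge by simp
      then have "(cal_fun b (obs \<omega>))\<^sup>2 \<le> ((W + 1) * (C0 * l1 p b))\<^sup>2" using elim
        by (intro abs_le_square_iff[THEN iffD1]) simp
      then show ?case by simp
    qed
  qed measurable
  let ?K = "(C0 * l1 p b)\<^sup>2"
  let ?S = "{x. L < lin g x}" and ?A = "{\<omega>\<in>space P. pistar (X \<omega>) < c}"
  have im: "(\<lambda>\<omega>. indicat_real ?S (X \<omega>)) \<in> borel_measurable P"
  proof -
    have "(\<lambda>\<omega>. if L < lin g (X \<omega>) then 1 else 0 :: real) \<in> borel_measurable P" by measurable
    then show ?thesis by (simp add: indicator_def of_bool_def)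
  qed
  note [measurable] = im
  have i2: "integrable P (\<lambda>\<omega>. pistar (X \<omega>) * (w (X \<omega>) * (lin b (X \<omega>))\<^sup>2))"
  proof (rule integrable_of_AE_bound)
    show "AE \<omega> in P. \<bar>pistar (X \<omega>) * (w (X \<omega>) * (lin b (X \<omega>))\<^sup>2)\<bar> \<le> 1 * (W * ?K)"
      using regular_AE
    proof eventually_elim
      case (elim \<omega>)
      have "(lin b (X \<omega>))\<^sup>2 \<le> ?K" using elim C0_ge by (intro abs_le_square_iff[THEN iffD1]) (simp add: abs_of_nonneg)
      then show ?case
        unfolding abs_mult using elim pistar_X_bounds[of \<omega>] weight_pos[of g "X \<omega>"] W_pos
        by (intro mult_mono) (auto intro: less_imp_le)
    qed
  qed measurable
  have i3: "integrable P (\<lambda>\<omega>. (1 - T \<omega>) * indicat_real ?S (X \<omega>))"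
    by (rule integrable_of_AE_bound[where B = 1], measurable)
       (use AE_space in \<open>eventually_elim, auto dest!: T_cases split: split_indicator\<close>)
  let ?B = "\<lambda>\<omega>. W * (T \<omega> * w (X \<omega>) * (lin b (X \<omega>))\<^sup>2)
      + exp L / c * (pistar (X \<omega>) * (w (X \<omega>) * (lin b (X \<omega>))\<^sup>2))
      + ?K * (indicat_real ?A \<omega> + (1 - T \<omega>) * indicat_real ?S (X \<omega>))"
  have iA: "integrable P (\<lambda>\<omega>. indicat_real ?A \<omega>)" by (rule integrable_of_AE_bound[where B = 1]) auto
  have iB: "integrable P ?B" using Tw_sq_integrable i2 i3 iA by simp
  have "(\<integral>\<omega>. (cal_fun b (obs \<omega>))\<^sup>2 \<partial>P) \<le> (\<integral>\<omega>. ?B \<omega> \<partial>P)"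
  proof (rule integral_mono_AE[OF i iB])
    show "AE \<omega> in P. (cal_fun b (obs \<omega>))\<^sup>2 \<le> ?B \<omega>"
      using regular_AE
    proof eventually_elim
      case (elim \<omega>)
      define l where "l = (lin b (X \<omega>))\<^sup>2"
      define v where "v = w (X \<omega>)"
      have l: "0 \<le> l" "l \<le> ?K" unfolding l_def using elim C0_ge
        by (auto intro!: abs_le_square_iff[THEN iffD1] simp: abs_of_nonneg)
      have v: "0 < v" "v \<le> W" using elim weight_pos[of g "X \<omega>"] by (auto simp: v_def)
      have pi: "0 < pistar (X \<omega>)" using elim pistar_X_bounds by blast
      have n1: "0 \<le> exp L / c * (pistar (X \<omega>) * (v * l))" using c pi v l by simp
      have T01: "T \<omega> = 0 \<or> T \<omega> = 1" using elim T_cases[of \<omega>] by blast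
      have sq: "(cal_fun b (obs \<omega>))\<^sup>2 = (1 - T \<omega> - T \<omega> * v)\<^sup>2 * l"
        unfolding cal_fun_obs l_def v_def by (rule power_mult_distrib)
      show "(cal_fun b (obs \<omega>))\<^sup>2 \<le> ?B \<omega>"
        unfolding sq l_def[symmetric] v_def[symmetric]
      proof (cases "T \<omega> = 1")
        case True
        have "v\<^sup>2 * l \<le> W * (v * l)"
          using v l by (simp add: power2_eq_square mult.assoc mult_right_mono)
        moreover have "0 \<le> ?K * indicat_real ?A \<omega>" by simp
        ultimately have "v\<^sup>2 * l \<le> W * (v * l) + exp L / c * (pistar (X \<omega>) * (v * l)) + ?K * indicat_real ?A \<omega>"
          using n1 by linarith
        then show "(1 - T \<omega> - T \<omega> * v)\<^sup>2 * l \<le> W * (T \<omega> * v * l) + exp L / c * (pistar (X \<omega>) * (v * l))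
            + ?K * (indicat_real ?A \<omega> + (1 - T \<omega>) * indicat_real ?S (X \<omega>))"
          using True by simp
      next
        case False
        then have T0: "T \<omega> = 0" using T01 by simp
        have "l \<le> exp L / c * (pistar (X \<omega>) * (v * l)) + ?K * (indicat_real ?A \<omega> + indicat_real ?S (X \<omega>))"
        proof (cases "pistar (X \<omega>) < c \<or> L < lin g (X \<omega>)")
          case True
          have "?K * 1 \<le> ?K * (indicat_real ?A \<omega> + indicat_real ?S (X \<omega>))"
            using True elim by (intro mult_left_mono) (auto split: split_indicator)
          then show ?thesis using l n1 by linarith
        next
          case False
          have "exp (- L) \<le> v" using False by (simp add: v_def weight_def)
          then have "c * exp (- L) \<le> pistar (X \<omega>) * v" using False c by (intro mult_mono) auto
          then have "exp L / c * (c * exp (- L)) \<le> exp L / c * (pistar (X \<omega>) * v)" using c by (intro mult_left_mono) auto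
          then have "1 \<le> exp L / c * (pistar (X \<omega>) * v)" using c by (simp flip: exp_add)
          then have "1 * l \<le> exp L / c * (pistar (X \<omega>) * v) * l" using l by (intro mult_right_mono) auto
          moreover have "0 \<le> ?K * (indicat_real ?A \<omega> + indicat_real ?S (X \<omega>))" by simp
          ultimately show ?thesis unfolding mult.assoc mult_1 by linarith
        qed
        then show "(1 - T \<omega> - T \<omega> * v)\<^sup>2 * l \<le> W * (T \<omega> * v * l) + exp L / c * (pistar (X \<omega>) * (v * l))
            + ?K * (indicat_real ?A \<omega> + (1 - T \<omega>) * indicat_real ?S (X \<omega>))"
          using T0 by simp
      qed
    qed
  qed
  also have "\<dots> = W * Qf b + exp L / c * (\<integral>\<omega>. pistar (X \<omega>) * (w (X \<omega>) * (lin b (X \<omega>))\<^sup>2) \<partial>P)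
      + ?K * (measure P ?A + (\<integral>\<omega>. (1 - T \<omega>) * indicat_real ?S (X \<omega>) \<partial>P))"
    using Tw_sq_integrable i2 i3 iA by (simp add: Qf_def)
  also have "(\<integral>\<omega>. pistar (X \<omega>) * (w (X \<omega>) * (lin b (X \<omega>))\<^sup>2) \<partial>P) = Qf b"
    using integral_treated[of "\<lambda>z. w (snd z) * (lin b (snd z))\<^sup>2"] by (simp add: Qf_def mult.assoc)
  also have "W * Qf b + exp L / c * Qf b + ?K * (measure P ?A + (\<integral>\<omega>. (1 - T \<omega>) * indicat_real ?S (X \<omega>) \<partial>P))
      \<le> (W + exp L / c) * Qf b + ?K * (measure P ?A + (1 + \<bar>B0\<bar>) / L)"
    using large_predictor_prob[OF L] by (simp add: distrib_right mult_left_mono)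
  finally show "(\<integral>\<omega>. (cal_fun b (obs \<omega>))\<^sup>2 \<partial>P) \<le> (W + exp L / c) * Qf b
      + ?K * (measure P ?A + (1 + \<bar>B0\<bar>) / L)" .
qed

lemma wl_second_moment:
  shows "integrable P (\<lambda>\<omega>. (wl_fun b (obs \<omega>))\<^sup>2)"
    and "(\<integral>\<omega>. (wl_fun b (obs \<omega>))\<^sup>2 \<partial>P) \<le> W * D1\<^sup>2 * Qf b"
proof -
  let ?h = "\<lambda>x. w x * (lin b x)\<^sup>2"
  have hb: "AE \<omega> in P. ?h (X \<omega>) \<le> W * (C0 * l1 p b)\<^sup>2"
    using regular_AE
  proof eventually_elim
    case (elim \<omega>)
    have "(lin b (X \<omega>))\<^sup>2 \<le> (C0 * l1 p b)\<^sup>2" using elim C0_ge by (intro abs_le_square_iff[THEN iffD1]) (simp add: abs_of_nonneg)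
    then show ?case using elim W_pos weight_pos[of g "X \<omega>"] by (intro mult_mono) auto
  qed
  have h0: "0 \<le> ?h x" for x using weight_pos[of g x] by simp
  note r = resid_second_moment[OF _ h0 hb]
  have i1: "integrable P (\<lambda>\<omega>. W * (T \<omega> * ?h (X \<omega>) * (R \<omega>)\<^sup>2))" using r(1) by simp
  have le: "AE \<omega> in P. (wl_fun b (obs \<omega>))\<^sup>2 \<le> W * (T \<omega> * ?h (X \<omega>) * (R \<omega>)\<^sup>2)"
    using regular_AE
  proof eventually_elim
    case (elim \<omega>)
    have tt: "T \<omega> * T \<omega> = T \<omega>" using elim T_cases[of \<omega>] by auto
    have "(wl_fun b (obs \<omega>))\<^sup>2 = (T \<omega> * T \<omega>) * w (X \<omega>) * (?h (X \<omega>) * (R \<omega>)\<^sup>2)"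
      using elim wl_fun_obs[of \<omega> b] by (simp add: power2_eq_square)
    also have "\<dots> = w (X \<omega>) * (T \<omega> * ?h (X \<omega>) * (R \<omega>)\<^sup>2)" unfolding tt by simp
    also have "\<dots> \<le> W * (T \<omega> * ?h (X \<omega>) * (R \<omega>)\<^sup>2)"
      using elim T_bounds[of \<omega>] h0[of "X \<omega>"] by (intro mult_right_mono) auto
    finally show ?case .
  qed
  show i2: "integrable P (\<lambda>\<omega>. (wl_fun b (obs \<omega>))\<^sup>2)"
    by (rule Bochner_Integration.integrable_bound[OF i1], measurable)
       (use le in \<open>eventually_elim, auto intro: order_trans[OF _ abs_ge_self]\<close>)
  have "(\<integral>\<omega>. (wl_fun b (obs \<omega>))\<^sup>2 \<partial>P) \<le> (\<integral>\<omega>. W * (T \<omega> * ?h (X \<omega>) * (R \<omega>)\<^sup>2) \<partial>P)"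
    using i2 i1 le by (rule integral_mono_AE)
  also have "\<dots> \<le> W * (D1\<^sup>2 * (\<integral>\<omega>. T \<omega> * ?h (X \<omega>) \<partial>P))" using r(2) W_pos by (simp add: mult_left_mono)
  also have "(\<integral>\<omega>. T \<omega> * ?h (X \<omega>) \<partial>P) = Qf b" by (simp add: Qf_def mult.assoc)
  finally show "(\<integral>\<omega>. (wl_fun b (obs \<omega>))\<^sup>2 \<partial>P) \<le> W * D1\<^sup>2 * Qf b" by (simp add: mult.assoc)
qed

subsection \<open>The influence function\<close>

definition phi :: "real \<times> real \<times> 'x \<Rightarrow> real" where
  "phi z = (case z of (y, t, x) \<Rightarrow> aipw (lin a) (propensity p f g) y t x)"

lemma phi_measurable [measurable]: "phi \<in> borel_measurable obs_space"
  unfolding phi_def[abs_def] aipw_def by measurable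

lemma phi_obs:
  assumes "\<omega> \<in> space P"
  shows "phi (obs \<omega>) = lin a (X \<omega>) + T \<omega> * (1 + w (X \<omega>)) * R \<omega>"
proof -
  have "phi (obs \<omega>) = T \<omega> * observed Y0 Y1 T \<omega> * (1 + w (X \<omega>)) - (T \<omega> * (1 + w (X \<omega>)) - 1) * lin a (X \<omega>)"
    by (simp add: phi_def obs_def aipw_eq)
  then show ?thesis unfolding T_observed[OF assms] R_def by algebra
qed

lemma phi_minus_Y1: "\<omega> \<in> space P \<Longrightarrow> phi (obs \<omega>) - Y1 \<omega> = (T \<omega> * (1 + w (X \<omega>)) - 1) * R \<omega>"
  using phi_obs[of \<omega>] Y1_eq[of \<omega>] by (simp add: algebra_simps)

text \<open>
  The bound does not involve the coefficients: \<open>phi\<close> differs from the fixed variable \<open>Y1\<close> by a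
  multiple of the residual.
\<close>

lemma phi_pow4:
  shows "integrable P (\<lambda>\<omega>. (phi (obs \<omega>)) ^ 4)"
    and "(\<integral>\<omega>. (phi (obs \<omega>)) ^ 4 \<partial>P) \<le> 8 * (\<integral>\<omega>. (Y1 \<omega>) ^ 4 \<partial>P) + 16 * (W + 1) ^ 4 * D0 ^ 4 * C1"
proof -
  have le: "AE \<omega> in P. (phi (obs \<omega>)) ^ 4 \<le> 8 * (Y1 \<omega>) ^ 4 + 8 * (W + 1) ^ 4 * (R \<omega>) ^ 4"
    using regular_AE
  proof eventually_elim
    case (elim \<omega>)
    let ?d = "(T \<omega> * (1 + w (X \<omega>)) - 1) * R \<omega>"
    have "\<bar>T \<omega> * (1 + w (X \<omega>)) - 1\<bar> \<le> W + 1"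
      using elim T_cases[of \<omega>] weight_pos[of g "X \<omega>"] W_pos by auto
    then have "\<bar>?d\<bar> \<le> (W + 1) * \<bar>R \<omega>\<bar>" unfolding abs_mult by (rule mult_right_mono) simp
    then have "\<bar>?d\<bar> ^ 4 \<le> ((W + 1) * \<bar>R \<omega>\<bar>) ^ 4" by (intro power_mono) auto
    then have "?d ^ 4 \<le> (W + 1) ^ 4 * (R \<omega>) ^ 4" by (simp add: power_mult_distrib)
    then have "8 * (Y1 \<omega> ^ 4 + ?d ^ 4) \<le> 8 * (Y1 \<omega> ^ 4 + (W + 1) ^ 4 * (R \<omega>) ^ 4)" by simp
    moreover have "phi (obs \<omega>) = Y1 \<omega> + ?d" using elim phi_minus_Y1[of \<omega>] by simp
    ultimately have "(phi (obs \<omega>)) ^ 4 \<le> 8 * (Y1 \<omega> ^ 4 + (W + 1) ^ 4 * (R \<omega>) ^ 4)"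
      using power4_add_le[of "Y1 \<omega>" ?d] by simp
    then show ?case by (simp add: distrib_left mult.assoc)
  qed
  have iB: "integrable P (\<lambda>\<omega>. 8 * (Y1 \<omega>) ^ 4 + 8 * (W + 1) ^ 4 * (R \<omega>) ^ 4)"
    using Y1_pow4_integrable R_pow4_integrable by simp
  show i: "integrable P (\<lambda>\<omega>. (phi (obs \<omega>)) ^ 4)"
    by (rule Bochner_Integration.integrable_bound[OF iB], measurable)
       (use le in \<open>eventually_elim, auto intro: order_trans[OF _ abs_ge_self]\<close>)
  have "(\<integral>\<omega>. (phi (obs \<omega>)) ^ 4 \<partial>P) \<le> (\<integral>\<omega>. 8 * (Y1 \<omega>) ^ 4 + 8 * (W + 1) ^ 4 * (R \<omega>) ^ 4 \<partial>P)"
    using i iB le by (rule integral_mono_AE)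
  also have "\<dots> = 8 * (\<integral>\<omega>. (Y1 \<omega>) ^ 4 \<partial>P) + 8 * (W + 1) ^ 4 * (\<integral>\<omega>. (R \<omega>) ^ 4 \<partial>P)"
    using Y1_pow4_integrable R_pow4_integrable by simp
  also have "8 * (W + 1) ^ 4 * (\<integral>\<omega>. (R \<omega>) ^ 4 \<partial>P) \<le> 8 * (W + 1) ^ 4 * (2 * D0 ^ 4 * C1)"
    using R_pow4_le W_pos by (intro mult_left_mono) auto
  finally show "(\<integral>\<omega>. (phi (obs \<omega>)) ^ 4 \<partial>P) \<le> 8 * (\<integral>\<omega>. (Y1 \<omega>) ^ 4 \<partial>P) + 16 * (W + 1) ^ 4 * D0 ^ 4 * C1"
    by (simp add: mult.assoc)
qed

lemma T_factor_R_integrable: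
  assumes [measurable]: "h \<in> borel_measurable N" and "AE \<omega> in P. \<bar>h (X \<omega>)\<bar> \<le> H"
  shows "integrable P (\<lambda>\<omega>. T \<omega> * (h (X \<omega>) * R \<omega>))"
proof (rule Bochner_Integration.integrable_bound)
  show "integrable P (\<lambda>\<omega>. H * \<bar>R \<omega>\<bar>)" using R_integrable by simp
  show "AE \<omega> in P. norm (T \<omega> * (h (X \<omega>) * R \<omega>)) \<le> norm (H * \<bar>R \<omega>\<bar>)"
    using assms(2) AE_space
  proof eventually_elim
    case (elim \<omega>)
    have "\<bar>h (X \<omega>)\<bar> * \<bar>R \<omega>\<bar> \<le> H * \<bar>R \<omega>\<bar>" using elim by (intro mult_right_mono) auto
    moreover have "0 \<le> \<bar>h (X \<omega>)\<bar> * \<bar>R \<omega>\<bar>" by simp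
    ultimately have "\<bar>h (X \<omega>)\<bar> * \<bar>R \<omega>\<bar> \<le> \<bar>H\<bar> * \<bar>R \<omega>\<bar>" "0 \<le> \<bar>H\<bar> * \<bar>R \<omega>\<bar>" by (auto simp: abs_mult[symmetric])
    then show ?case using elim T_cases[of \<omega>] by (auto simp: abs_mult)
  qed
qed measurable

lemma phi_integrable: "integrable P (\<lambda>\<omega>. phi (obs \<omega>))"
proof -
  have b: "AE \<omega> in P. \<bar>1 + w (X \<omega>)\<bar> \<le> 1 + W"
    using regular_AE
  proof eventually_elim
    case (elim \<omega>)
    then show ?case using weight_pos[of g "X \<omega>"] by simp
  qed
  have "integrable P (\<lambda>\<omega>. T \<omega> * ((1 + w (X \<omega>)) * R \<omega>) + (Y1 \<omega> - R \<omega>))"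
    using T_factor_R_integrable[OF _ b] Y1_integrable R_integrable by simp
  then show ?thesis
    by (rule Bochner_Integration.integrable_cong[THEN iffD1, rotated -1])
       (auto simp: phi_obs Y1_eq)
qed

lemma mean_phi_of_resid_mean:
  assumes "(\<integral>\<omega>. (T \<omega> * (1 + w (X \<omega>)) - 1) * R \<omega> \<partial>P) = 0"
  shows "(\<integral>\<omega>. phi (obs \<omega>) \<partial>P) = (\<integral>\<omega>. Y1 \<omega> \<partial>P)"
proof -
  have "(\<integral>\<omega>. phi (obs \<omega>) - Y1 \<omega> \<partial>P) = (\<integral>\<omega>. (T \<omega> * (1 + w (X \<omega>)) - 1) * R \<omega> \<partial>P)"
    by (rule Bochner_Integration.integral_cong) (simp_all add: phi_minus_Y1)
  then show ?thesis using assms phi_integrable Y1_integrable by simp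
qed

text \<open>
  The true coefficients \<open>gs\<close> satisfy the score equation of \<open>g\<close>. Subtracting the two equations along
  \<open>g - gs\<close> gives the mean of a nonnegative function, as \<open>exp (- z)\<close> is monotone; so the weights
  agree on the treated, and \<open>T (1 + w)\<close> has conditional mean 1.
\<close>

lemma mean_phi_correct_ps:
  assumes "correct_ps P X pistar p f"
  shows "(\<integral>\<omega>. phi (obs \<omega>) \<partial>P) = (\<integral>\<omega>. Y1 \<omega> \<partial>P)"
proof -
  obtain gs where gs: "AE \<omega> in P. pistar (X \<omega>) = propensity p f gs (X \<omega>)"
    using assms unfolding correct_ps_def by blast
  define ws where "ws = weight p f gs"
  have [measurable]: "ws \<in> borel_measurable N" unfolding ws_def by measurable
  have ws_pos: "0 < ws x" for x by (simp add: ws_def weight_pos)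
  have pw: "AE \<omega> in P. pistar (X \<omega>) * (1 + ws (X \<omega>)) = 1"
    using gs
  proof eventually_elim
    case (elim \<omega>)
    have "0 < 1 + ws (X \<omega>)" using ws_pos[of "X \<omega>"] by simp
    then show ?case unfolding elim by (simp add: propensity_def ws_def weight_def)
  qed
  have wsb: "AE \<omega> in P. \<bar>1 + ws (X \<omega>)\<bar> \<le> 1 + exp (C0 * l1 p gs)"
    using weight_le[of gs]
  proof eventually_elim
    case (elim \<omega>)
    then show ?case using ws_pos[of "X \<omega>"] by (simp add: ws_def)
  qed
  define b where "b j = g j - gs j" for j
  have bl: "lin b x = lin g x - lin gs x" for x by (simp add: b_def[abs_def] linpred_diff)
  have iT: "integrable P (\<lambda>\<omega>. T \<omega> * ((1 + ws (X \<omega>)) * lin b (X \<omega>)))"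
  proof (rule integrable_of_AE_bound)
    show "AE \<omega> in P. \<bar>T \<omega> * ((1 + ws (X \<omega>)) * lin b (X \<omega>))\<bar> \<le> 1 * ((1 + exp (C0 * l1 p gs)) * (C0 * l1 p b))"
      using regular_AE wsb
    proof eventually_elim
      case (elim \<omega>)
      have "\<bar>T \<omega>\<bar> \<le> 1" using elim T_cases[of \<omega>] by auto
      then show ?case unfolding abs_mult using elim by (intro mult_mono) (auto simp: add_nonneg_nonneg)
    qed
  qed measurable
  have il: "integrable P (\<lambda>\<omega>. lin b (X \<omega>))"
    using lin_le by (intro integrable_of_AE_bound[where B = "C0 * l1 p b"]) auto
  have "(\<integral>\<omega>. T \<omega> * ((1 + ws (X \<omega>)) * lin b (X \<omega>)) \<partial>P) = (\<integral>\<omega>. pistar (X \<omega>) * ((1 + ws (X \<omega>)) * lin b (X \<omega>)) \<partial>P)"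
    using integral_treated[of "\<lambda>z. (1 + ws (snd z)) * lin b (snd z)"] by simp
  also have "\<dots> = (\<integral>\<omega>. lin b (X \<omega>) \<partial>P)"
    by (rule integral_cong_AE, measurable, use pw in eventually_elim) (simp flip: mult.assoc)
  finally have s1: "(\<integral>\<omega>. T \<omega> * ((1 + ws (X \<omega>)) * lin b (X \<omega>)) \<partial>P) = (\<integral>\<omega>. lin b (X \<omega>) \<partial>P)" .
  let ?D = "\<lambda>\<omega>. T \<omega> * ((ws (X \<omega>) - w (X \<omega>)) * lin b (X \<omega>))"
  have Deq: "?D \<omega> = cal_fun b (obs \<omega>) - lin b (X \<omega>) + T \<omega> * ((1 + ws (X \<omega>)) * lin b (X \<omega>))" for \<omega>
    unfolding cal_fun_obs by algebra
  have iD: "integrable P ?D" unfolding Deq using cal_fun_integrable il iT by simp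
  have D0: "(\<integral>\<omega>. ?D \<omega> \<partial>P) = 0"
    unfolding Deq using cal_fun_integrable il iT cal_score[of b] s1 by simp
  have mono: "0 \<le> (exp (- x) - exp (- y)) * (y - x)" for x y :: real
    by (cases "x \<le> y") (auto intro!: mult_nonneg_nonneg mult_nonpos_nonpos)
  have Dnn: "0 \<le> (ws x - w x) * lin b x" for x
    unfolding ws_def weight_def bl by (rule mono)
  have "AE \<omega> in P. ?D \<omega> = 0"
    using iD D0 by (subst (asm) integral_nonneg_eq_0_iff_AE)
      (auto intro!: AE_I2 mult_nonneg_nonneg T_bounds Dnn)
  then have wT: "AE \<omega> in P. T \<omega> * w (X \<omega>) = T \<omega> * ws (X \<omega>)"
  proof eventually_elim
    case (elim \<omega>)
    then consider "T \<omega> = 0" | "ws (X \<omega>) = w (X \<omega>)" | "lin b (X \<omega>) = 0" by auto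
    then show ?case by cases (auto simp: bl ws_def weight_def)
  qed
  have iR: "integrable P (\<lambda>\<omega>. T \<omega> * ((1 + ws (X \<omega>)) * R \<omega>))" by (rule T_factor_R_integrable[OF _ wsb]) measurable
  have "(\<integral>\<omega>. T \<omega> * ((1 + ws (X \<omega>)) * R \<omega>) \<partial>P) = (\<integral>\<omega>. pistar (X \<omega>) * ((1 + ws (X \<omega>)) * R \<omega>) \<partial>P)"
    using integral_treated[of "\<lambda>z. (1 + ws (snd z)) * (fst z - lin a (snd z))"] by (simp add: R_def)
  also have "\<dots> = (\<integral>\<omega>. R \<omega> \<partial>P)"
    by (rule integral_cong_AE, measurable, use pw in eventually_elim) (simp flip: mult.assoc)
  finally have s2: "(\<integral>\<omega>. T \<omega> * ((1 + ws (X \<omega>)) * R \<omega>) \<partial>P) = (\<integral>\<omega>. R \<omega> \<partial>P)" .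
  have "(\<integral>\<omega>. (T \<omega> * (1 + w (X \<omega>)) - 1) * R \<omega> \<partial>P) = (\<integral>\<omega>. T \<omega> * ((1 + ws (X \<omega>)) * R \<omega>) - R \<omega> \<partial>P)"
    by (rule integral_cong_AE, measurable, use wT in eventually_elim) (auto simp: algebra_simps)
  also have "\<dots> = 0" using iR R_integrable s2 by simp
  finally show ?thesis by (rule mean_phi_of_resid_mean)
qed

text \<open>
  The score equation of \<open>a\<close> along \<open>al - a\<close> shows that both predictors agree on the treated. Hence the
  residual of the treated is orthogonal to functions of \<open>X\<close>, and by unconfoundedness and overlap
  the residual itself has mean 0.
\<close>

lemma mean_phi_correct_or:
  assumes "correct_or P N (observed Y0 Y1 T) T X p f"
  shows "(\<integral>\<omega>. phi (obs \<omega>) \<partial>P) = (\<integral>\<omega>. Y1 \<omega> \<partial>P)"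
proof -
  interpret TX: sigma_finite_subalgebra P "sigma_TX P N T X" by (rule sigma_finite_sigma_TX)
  obtain al where al: "AE \<omega> in P. T \<omega> = 1 \<longrightarrow>
      real_cond_exp P (sigma_TX P N T X) (observed Y0 Y1 T) \<omega> = lin al (X \<omega>)"
    using assms unfolding correct_or_def by blast
  \<comment> \<open>The conditional mean of the outcome enters only through bounded functions of \<open>X\<close> on the treated.\<close>
  have cond: "(\<integral>\<omega>. T \<omega> * (h (X \<omega>) * Y1 \<omega>) \<partial>P) = (\<integral>\<omega>. T \<omega> * (h (X \<omega>) * lin al (X \<omega>)) \<partial>P)"
    and condi: "integrable P (\<lambda>\<omega>. T \<omega> * (h (X \<omega>) * Y1 \<omega>))"
    if [measurable]: "h \<in> borel_measurable N" and hb: "AE \<omega> in P. \<bar>h (X \<omega>)\<bar> \<le> H" for h H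
  proof -
    have "AE \<omega> in P. \<bar>h (X \<omega>) * lin a (X \<omega>)\<bar> \<le> H * (C0 * l1 p a)"
      using hb lin_le
    proof eventually_elim
      case (elim \<omega>)
      then show ?case unfolding abs_mult by (intro mult_mono) (auto intro: order_trans[OF abs_ge_zero])
    qed
    then have "AE \<omega> in P. \<bar>T \<omega> * (h (X \<omega>) * lin a (X \<omega>))\<bar> \<le> H * (C0 * l1 p a)"
      using AE_space
    proof eventually_elim
      case (elim \<omega>)
      then show ?case using T_cases[of \<omega>] order_trans[OF abs_ge_zero elim(1)] by auto
    qed
    then have "integrable P (\<lambda>\<omega>. T \<omega> * (h (X \<omega>) * lin a (X \<omega>)))" by (rule integrable_of_AE_bound[rotated]) measurable
    then have "integrable P (\<lambda>\<omega>. T \<omega> * (h (X \<omega>) * lin a (X \<omega>)) + T \<omega> * (h (X \<omega>) * R \<omega>))"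
      using T_factor_R_integrable[OF _ hb] by (intro Bochner_Integration.integrable_add) auto
    then show i: "integrable P (\<lambda>\<omega>. T \<omega> * (h (X \<omega>) * Y1 \<omega>))"
      by (simp add: Y1_eq distrib_left)
    have eqY: "T \<omega> * h (X \<omega>) * observed Y0 Y1 T \<omega> = T \<omega> * (h (X \<omega>) * Y1 \<omega>)" if "\<omega> \<in> space P" for \<omega>
      using T_cases[OF that] by (auto simp: observed_def)
    have i': "integrable P (\<lambda>\<omega>. T \<omega> * h (X \<omega>) * observed Y0 Y1 T \<omega>)"
      using i by (rule Bochner_Integration.integrable_cong[THEN iffD1, rotated -1]) (simp_all add: eqY)
    have hm: "(\<lambda>\<omega>. T \<omega> * h (X \<omega>)) \<in> borel_measurable (sigma_TX P N T X)"
      using measurable_sigma_TX[of "\<lambda>z. fst z * h (snd z)" borel] by simp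
    have "(\<integral>\<omega>. T \<omega> * (h (X \<omega>) * Y1 \<omega>) \<partial>P) = (\<integral>\<omega>. T \<omega> * h (X \<omega>) * observed Y0 Y1 T \<omega> \<partial>P)"
      by (rule Bochner_Integration.integral_cong) (simp_all add: eqY)
    also have "\<dots> = (\<integral>\<omega>. T \<omega> * h (X \<omega>) * real_cond_exp P (sigma_TX P N T X) (observed Y0 Y1 T) \<omega> \<partial>P)"
      by (rule TX.real_cond_exp_intg(2)[OF i' hm, symmetric]) measurable
    also have "\<dots> = (\<integral>\<omega>. T \<omega> * (h (X \<omega>) * lin al (X \<omega>)) \<partial>P)"
    proof (rule integral_cong_AE)
      show "AE \<omega> in P. T \<omega> * h (X \<omega>) * real_cond_exp P (sigma_TX P N T X) (observed Y0 Y1 T) \<omega>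
          = T \<omega> * (h (X \<omega>) * lin al (X \<omega>))"
        using al AE_space
      proof eventually_elim
        case (elim \<omega>)
        then show ?case using T_cases[of \<omega>] by auto
      qed
    qed measurable
    finally show "(\<integral>\<omega>. T \<omega> * (h (X \<omega>) * Y1 \<omega>) \<partial>P) = (\<integral>\<omega>. T \<omega> * (h (X \<omega>) * lin al (X \<omega>)) \<partial>P)" .
  qed
  define b where "b j = al j - a j" for j
  have bl: "lin b x = lin al x - lin a x" for x by (simp add: b_def[abs_def] linpred_diff)
  have hlin: "integrable P (\<lambda>\<omega>. T \<omega> * (h (X \<omega>) * lin c (X \<omega>)))"
    if [measurable]: "h \<in> borel_measurable N" and hb: "AE \<omega> in P. \<bar>h (X \<omega>)\<bar> \<le> H" for h H c
  proof (rule integrable_of_AE_bound)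
    show "AE \<omega> in P. \<bar>T \<omega> * (h (X \<omega>) * lin c (X \<omega>))\<bar> \<le> 1 * (H * (C0 * l1 p c))"
      using hb regular_AE
    proof eventually_elim
      case (elim \<omega>)
      have "\<bar>T \<omega>\<bar> \<le> 1" using elim T_cases[of \<omega>] by auto
      moreover have "0 \<le> H" using elim(1) by linarith
      ultimately show ?case unfolding abs_mult using elim C0_ge by (intro mult_mono) auto
    qed
  qed measurable
  have resid: "(\<integral>\<omega>. T \<omega> * (h (X \<omega>) * R \<omega>) \<partial>P) = (\<integral>\<omega>. T \<omega> * (h (X \<omega>) * lin b (X \<omega>)) \<partial>P)"
    if hm: "h \<in> borel_measurable N" and hb: "AE \<omega> in P. \<bar>h (X \<omega>)\<bar> \<le> H" for h H
  proof -
    have "(\<integral>\<omega>. T \<omega> * (h (X \<omega>) * R \<omega>) \<partial>P) = (\<integral>\<omega>. T \<omega> * (h (X \<omega>) * Y1 \<omega>) - T \<omega> * (h (X \<omega>) * lin a (X \<omega>)) \<partial>P)"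
      by (rule Bochner_Integration.integral_cong) (simp_all add: R_def algebra_simps)
    also have "\<dots> = (\<integral>\<omega>. T \<omega> * (h (X \<omega>) * lin al (X \<omega>)) \<partial>P) - (\<integral>\<omega>. T \<omega> * (h (X \<omega>) * lin a (X \<omega>)) \<partial>P)"
      using cond[OF hm hb] condi[OF hm hb] hlin[OF hm hb] by simp
    also have "\<dots> = (\<integral>\<omega>. T \<omega> * (h (X \<omega>) * lin al (X \<omega>)) - T \<omega> * (h (X \<omega>) * lin a (X \<omega>)) \<partial>P)"
      using hlin[OF hm hb] by simp
    also have "\<dots> = (\<integral>\<omega>. T \<omega> * (h (X \<omega>) * lin b (X \<omega>)) \<partial>P)"
      by (rule Bochner_Integration.integral_cong) (simp_all add: bl algebra_simps)
    finally show ?thesis .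
  qed
  have "Qf b = 0"
  proof -
    have hb: "AE \<omega> in P. \<bar>w (X \<omega>) * lin b (X \<omega>)\<bar> \<le> W * (C0 * l1 p b)"
      using regular_AE
    proof eventually_elim
      case (elim \<omega>)
      then show ?case unfolding abs_mult using W_pos weight_pos[of g "X \<omega>"] by (intro mult_mono) auto
    qed
    have "Qf b = (\<integral>\<omega>. T \<omega> * (w (X \<omega>) * lin b (X \<omega>) * lin b (X \<omega>)) \<partial>P)"
      by (simp add: Qf_def power2_eq_square mult.assoc)
    also have "\<dots> = (\<integral>\<omega>. T \<omega> * (w (X \<omega>) * lin b (X \<omega>) * R \<omega>) \<partial>P)"
      by (rule resid[OF _ hb, symmetric]) measurable
    also have "\<dots> = (\<integral>\<omega>. wl_fun b (obs \<omega>) \<partial>P)"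
      by (rule Bochner_Integration.integral_cong) (simp_all add: wl_fun_obs mult_ac)
    finally show ?thesis using wl_score by simp
  qed
  then have "AE \<omega> in P. T \<omega> * w (X \<omega>) * (lin b (X \<omega>))\<^sup>2 = 0"
    unfolding Qf_def using Tw_sq_integrable
    by (subst (asm) integral_nonneg_eq_0_iff_AE)
       (auto intro!: AE_I2 mult_nonneg_nonneg T_bounds less_imp_le[OF weight_pos])
  then have Tb0: "AE \<omega> in P. T \<omega> * lin b (X \<omega>) = 0"
    by eventually_elim (use weight_pos in \<open>auto simp: less_imp_neq[symmetric]\<close>)
  have resid0: "(\<integral>\<omega>. T \<omega> * (h (X \<omega>) * R \<omega>) \<partial>P) = 0"
    if [measurable]: "h \<in> borel_measurable N" and hb: "AE \<omega> in P. \<bar>h (X \<omega>)\<bar> \<le> H" for h H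
  proof -
    have "(\<integral>\<omega>. T \<omega> * (h (X \<omega>) * R \<omega>) \<partial>P) = (\<integral>\<omega>. T \<omega> * (h (X \<omega>) * lin b (X \<omega>)) \<partial>P)" by (rule resid[OF _ hb]) simp
    also have "\<dots> = (\<integral>\<omega>. 0 \<partial>P)"
      by (rule integral_cong_AE, measurable, use Tb0 in eventually_elim) auto
    finally show ?thesis by simp
  qed
  have wb: "AE \<omega> in P. \<bar>1 + w (X \<omega>)\<bar> \<le> 1 + W"
    using regular_AE
  proof eventually_elim
    case (elim \<omega>)
    then show ?case using weight_pos[of g "X \<omega>"] by simp
  qed
  have m1: "(\<integral>\<omega>. T \<omega> * ((1 + w (X \<omega>)) * R \<omega>) \<partial>P) = 0" by (rule resid0[OF _ wb]) measurable
  \<comment> \<open>Inverse weighting by the true propensity score, truncated to keep the weights bounded.\<close>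
  have mR: "(\<integral>\<omega>. R \<omega> \<partial>P) = 0"
  proof -
    define hk where "hk k x = (if 1 / real (Suc k) \<le> pistar x then 1 / pistar x else 0)" for k x
    have [measurable]: "hk k \<in> borel_measurable N" for k unfolding hk_def[abs_def] by measurable
    have z: "(\<integral>\<omega>. pistar (X \<omega>) * (hk k (X \<omega>) * R \<omega>) \<partial>P) = 0" for k
    proof -
      have "\<bar>hk k x\<bar> \<le> real (Suc k)" for x
      proof (cases "1 / real (Suc k) \<le> pistar x")
        case True
        moreover have "0 < 1 / real (Suc k)" by simp
        ultimately have "0 < pistar x" by linarith
        then show ?thesis using True by (simp add: hk_def field_simps del: of_nat_Suc)
      qed (simp add: hk_def)
      then have hkb: "AE \<omega> in P. \<bar>hk k (X \<omega>)\<bar> \<le> real (Suc k)" by (intro AE_I2)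
      have "(\<integral>\<omega>. T \<omega> * (hk k (X \<omega>) * R \<omega>) \<partial>P) = 0" by (rule resid0[OF _ hkb]) measurable
      then show ?thesis
        using integral_treated[of "\<lambda>z. hk k (snd z) * (fst z - lin a (snd z))"] by (simp add: R_def)
    qed
    have "(\<lambda>k. \<integral>\<omega>. pistar (X \<omega>) * (hk k (X \<omega>) * R \<omega>) \<partial>P) \<longlonglongrightarrow> (\<integral>\<omega>. R \<omega> \<partial>P)"
    proof (rule integral_dominated_convergence[where w = "\<lambda>\<omega>. \<bar>R \<omega>\<bar>"])
      show "integrable P (\<lambda>\<omega>. \<bar>R \<omega>\<bar>)" using R_integrable by simp
      show "AE \<omega> in P. (\<lambda>k. pistar (X \<omega>) * (hk k (X \<omega>) * R \<omega>)) \<longlonglongrightarrow> R \<omega>"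
      proof (rule AE_I2)
        fix \<omega> assume w: "\<omega> \<in> space P"
        note pp = pistar_X_bounds(1)[OF w]
        have "\<forall>\<^sub>F k in sequentially. 1 / real (Suc k) < pistar (X \<omega>)"
          using order_tendstoD(2)[OF LIMSEQ_inverse_real_of_nat pp] by (simp add: inverse_eq_divide)
        then have "\<forall>\<^sub>F k in sequentially. pistar (X \<omega>) * (hk k (X \<omega>) * R \<omega>) = R \<omega>"
          by eventually_elim (use pp in \<open>simp add: hk_def\<close>)
        then show "(\<lambda>k. pistar (X \<omega>) * (hk k (X \<omega>) * R \<omega>)) \<longlonglongrightarrow> R \<omega>" by (rule tendsto_eventually)
      qed
      show "AE \<omega> in P. norm (pistar (X \<omega>) * (hk k (X \<omega>) * R \<omega>)) \<le> \<bar>R \<omega>\<bar>" for k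
      proof (rule AE_I2)
        fix \<omega> assume w: "\<omega> \<in> space P"
        show "norm (pistar (X \<omega>) * (hk k (X \<omega>) * R \<omega>)) \<le> \<bar>R \<omega>\<bar>"
          using pistar_X_bounds(1)[OF w] by (simp add: hk_def abs_mult)
      qed
    qed measurable
    then show ?thesis unfolding z by (simp add: LIMSEQ_const_iff)
  qed
  have "(\<integral>\<omega>. (T \<omega> * (1 + w (X \<omega>)) - 1) * R \<omega> \<partial>P) = (\<integral>\<omega>. T \<omega> * ((1 + w (X \<omega>)) * R \<omega>) - R \<omega> \<partial>P)"
    by (rule Bochner_Integration.integral_cong) (simp_all add: algebra_simps)
  also have "\<dots> = 0" using T_factor_R_integrable[OF _ wb] R_integrable m1 mR by simp
  finally show ?thesis by (rule mean_phi_of_resid_mean)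
qed

end


section \<open>The sample events have high probability\<close>

text \<open>
  Constants of the concentration inequality: \<open>env_const (1 + U)\<close> dominates all summands that occur
  in the gradients and Gram matrices, and averages of \<open>n\<close> summands have tails
  \<open>2 exp (- n \<tau>\<^sup>2 / tail_const)\<close>.
\<close>

definition env_const :: "real \<Rightarrow> real \<Rightarrow> real \<Rightarrow> real" where
  "env_const B0 C0 D0 = (exp (- B0) + 1) * C0\<^sup>2 * (1 + D0\<^sup>2)"

definition mgf_const :: "real \<Rightarrow> real \<Rightarrow> real" where
  "mgf_const D0 D1 = exp ((1 + D1\<^sup>2 / D0\<^sup>2) + 1) * (1 + D1\<^sup>2 / D0\<^sup>2)"

definition tail_const :: "real \<Rightarrow> real \<Rightarrow> real \<Rightarrow> real \<Rightarrow> real" where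
  "tail_const B0 C0 D0 D1 = 16 * (env_const B0 C0 D0)\<^sup>2 * mgf_const D0 D1"

lemma env_const_pos: "1 \<le> C0 \<Longrightarrow> 0 < env_const B0 C0 D0"
  unfolding env_const_def by (intro mult_pos_pos) (auto intro: add_pos_pos add_pos_nonneg)

lemma mgf_const_pos: "0 < mgf_const D0 D1"
  by (simp add: mgf_const_def add_pos_nonneg)

lemma tail_const_pos: "1 \<le> C0 \<Longrightarrow> 0 < tail_const B0 C0 D0 D1"
  using env_const_pos[of C0 B0 D0] mgf_const_pos[of D0 D1] by (simp add: tail_const_def)

definition unit_vec :: "nat \<Rightarrow> nat \<Rightarrow> real" where
  "unit_vec j k = (if k = j then 1 else 0)"

lemma linpred_unit_vec: "j \<le> p \<Longrightarrow> linpred p f (unit_vec j) x = f j x"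
  by (simp add: linpred_def unit_vec_def if_distrib[of "\<lambda>z. z * _"] cong: if_cong)

text \<open>
  Where \<open>Q \<ge> \<theta>\<close> on the unit sphere, the root of \<open>Q\<close> is bounded below and absorbs any
  coordinatewise bound \<open>B\<close>; the small constant \<open>D\<close> is required only on the thin part \<open>Q < \<theta>\<close>.
\<close>

lemma gradient_bound_of_thin_sphere:
  fixes G Q :: "(nat \<Rightarrow> real) \<Rightarrow> real"
  assumes hom: "\<And>c b. G (\<lambda>j. c * b j) = c * G b" "\<And>c b. Q (\<lambda>j. c * b j) = c\<^sup>2 * Q b"
    and coord: "\<And>b. \<bar>G b\<bar> \<le> B * l1 p b"
    and thin: "\<And>b. l1 p b = 1 \<Longrightarrow> Q b < \<theta> \<Longrightarrow> \<bar>G b\<bar> \<le> D"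
    and pos: "0 < \<theta>" "0 \<le> D" "0 \<le> B" "0 \<le> Q b"
  shows "\<bar>G b\<bar> \<le> D * l1 p b + B / sqrt \<theta> * sqrt (Q b)"
proof (cases "l1 p b = 0")
  case True
  then show ?thesis using coord[of b] pos by simp
next
  case False
  define l where "l = l1 p b"
  have l: "0 < l" using False l1_nonneg[of p b] unfolding l_def by linarith
  define c where "c j = 1 / l * b j" for j
  have lc: "l1 p c = 1" unfolding c_def[abs_def] l1_scale using l by (simp add: l_def)
  have bc: "b = (\<lambda>j. l * c j)" using l by (simp add: c_def)
  have Gb: "\<bar>G b\<bar> = l * \<bar>G c\<bar>" unfolding bc hom(1) using l by (simp add: abs_mult)
  have Qb: "Q b = l\<^sup>2 * Q c" unfolding bc hom(2) ..
  show ?thesis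
  proof (cases "Q c < \<theta>")
    case True
    have "l * \<bar>G c\<bar> \<le> l * D" using thin[OF lc True] l by (intro mult_left_mono) auto
    moreover have "0 \<le> B / sqrt \<theta> * sqrt (Q b)" using pos by simp
    ultimately show ?thesis unfolding Gb l_def[symmetric] by (simp add: mult.commute)
  next
    case False
    have "\<bar>G c\<bar> \<le> B" using coord[of c] lc by simp
    also have "B = B / sqrt \<theta> * sqrt \<theta>" using pos by simp
    also have "\<dots> \<le> B / sqrt \<theta> * sqrt (Q c)" using False pos by (intro mult_left_mono) auto
    finally have "l * \<bar>G c\<bar> \<le> l * (B / sqrt \<theta> * sqrt (Q c))" using l by (intro mult_left_mono) auto
    also have "\<dots> = B / sqrt \<theta> * sqrt (Q b)" unfolding Qb using l by (simp add: real_sqrt_mult)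
    finally show ?thesis unfolding Gb using pos l by (simp add: l_def[symmetric] add_increasing)
  qed
qed

text \<open>
  Round the coordinates to a grid and keep one representative of every nonempty cell. In this way the
  points lie in \<open>S\<close> itself, while their number depends only on the mesh and the dimension.
  The set \<open>S\<close> may thus be chosen after the mesh.
\<close>

lemma sphere_representatives:
  fixes S :: "(nat \<Rightarrow> real) set"
  assumes m: "0 < m" and S: "\<And>b. b \<in> S \<Longrightarrow> l1 p b = 1"
  shows "\<exists>D\<subseteq>S. finite D \<and> card D \<le> (2 * m + 1) ^ (p + 1)
     \<and> (\<forall>b\<in>S. \<exists>c\<in>D. l1 p (\<lambda>j. b j - c j) \<le> real (p + 1) / real m)"
proof -
  define rnd :: "(nat \<Rightarrow> real) \<Rightarrow> nat \<Rightarrow> int" where "rnd b = restrict (\<lambda>j. \<lfloor>real m * b j\<rfloor>) {..p}" for b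
  let ?G = "PiE {..p} (\<lambda>_. {- int m .. int m})"
  have rG: "rnd b \<in> ?G" if "b \<in> S" for b
  proof -
    have "- int m \<le> \<lfloor>real m * b j\<rfloor> \<and> \<lfloor>real m * b j\<rfloor> \<le> int m" if "j \<le> p" for j
    proof -
      have "\<bar>b j\<bar> \<le> 1" using abs_coord_le_l1[OF that, of b] S[OF \<open>b \<in> S\<close>] by simp
      then have "\<bar>real m * b j\<bar> \<le> real m * 1" unfolding abs_mult by (intro mult_mono) auto
      then have "- real m \<le> real m * b j" "real m * b j \<le> real m" by auto
      then show ?thesis by (auto simp: le_floor_iff floor_le_iff)
    qed
    then show ?thesis by (auto simp: rnd_def)
  qed
  have fin: "finite (rnd ` S)" by (rule finite_subset[of _ ?G]) (use rG in \<open>auto intro!: finite_PiE\<close>)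
  have "card (rnd ` S) \<le> card ?G" using rG by (intro card_mono finite_PiE) auto
  also have "card ?G = (2 * m + 1) ^ (p + 1)" by (simp add: card_PiE nat_add_distrib nat_mult_distrib)
  finally have cG: "card (rnd ` S) \<le> (2 * m + 1) ^ (p + 1)" .
  define pick where "pick c = (SOME b. b \<in> S \<and> rnd b = c)" for c
  have pick: "pick c \<in> S \<and> rnd (pick c) = c" if "c \<in> rnd ` S" for c
  proof -
    from that have "\<exists>b. b \<in> S \<and> rnd b = c" by (elim imageE) (intro exI conjI, simp_all)
    then show ?thesis unfolding pick_def by (rule someI_ex)
  qed
  show ?thesis
  proof (intro exI[of _ "pick ` rnd ` S"] conjI ballI)
    show "pick ` rnd ` S \<subseteq> S" using pick by (intro image_subsetI) simp
    show "finite (pick ` rnd ` S)" using fin by simp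
    show "card (pick ` rnd ` S) \<le> (2 * m + 1) ^ (p + 1)" using card_image_le[OF fin, of pick] cG by linarith
    fix b assume b: "b \<in> S"
    let ?c = "pick (rnd b)"
    have eq: "rnd ?c = rnd b" using pick[OF imageI[OF b]] by simp
    have "\<bar>b j - ?c j\<bar> \<le> 1 / real m" if j: "j \<le> p" for j
    proof -
      have "\<lfloor>real m * ?c j\<rfloor> = \<lfloor>real m * b j\<rfloor>" using fun_cong[OF eq, of j] j by (simp add: rnd_def)
      then have "\<bar>real m * b j - real m * ?c j\<bar> \<le> 1" by linarith
      then have "real m * \<bar>b j - ?c j\<bar> \<le> 1" by (simp add: abs_mult flip: right_diff_distrib)
      then show ?thesis using m by (simp add: field_simps)
    qed
    then have "l1 p (\<lambda>j. b j - ?c j) \<le> (\<Sum>j\<le>p. 1 / real m)" unfolding l1_def by (intro sum_mono) auto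
    then have "l1 p (\<lambda>j. b j - ?c j) \<le> real (p + 1) / real m" by simp
    then show "\<exists>c\<in>pick ` rnd ` S. l1 p (\<lambda>j. b j - c j) \<le> real (p + 1) / real m"
      by (rule bexI[of _ "pick (rnd b)"]) (intro imageI b)
  qed
qed

lemma sum_abs_product_le:
  fixes b :: "nat \<Rightarrow> real"
  assumes "\<And>j k. j \<le> p \<Longrightarrow> k \<le> p \<Longrightarrow> \<bar>A j k\<bar> \<le> \<tau>"
  shows "\<bar>\<Sum>j\<le>p. \<Sum>k\<le>p. b j * b k * A j k\<bar> \<le> \<tau> * (l1 p b)\<^sup>2"
proof -
  have "\<bar>\<Sum>j\<le>p. \<Sum>k\<le>p. b j * b k * A j k\<bar> \<le> (\<Sum>j\<le>p. \<Sum>k\<le>p. \<bar>b j * b k * A j k\<bar>)"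
    by (rule order_trans[OF sum_abs]) (intro sum_mono sum_abs)
  also have "\<dots> \<le> (\<Sum>j\<le>p. \<Sum>k\<le>p. \<bar>b j\<bar> * \<bar>b k\<bar> * \<tau>)"
    using assms by (intro sum_mono) (simp add: abs_mult mult_left_mono)
  also have "\<dots> = \<tau> * (l1 p b)\<^sup>2"
    by (simp add: l1_def power2_eq_square sum_product sum_distrib_left sum_distrib_right mult_ac)
  finally show ?thesis .
qed

context calibrated_row
begin

definition gram_fun :: "nat \<Rightarrow> nat \<Rightarrow> real \<times> real \<times> 'x \<Rightarrow> real" where
  "gram_fun j k z = (case z of (y, t, x) \<Rightarrow> t * w x * (f j x * f k x))"

definition resid_fun :: "nat \<Rightarrow> nat \<Rightarrow> real \<times> real \<times> 'x \<Rightarrow> real" where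
  "resid_fun j k z = (case z of (y, t, x) \<Rightarrow> t * w x * (y - lin a x)\<^sup>2 * (f j x * f k x))"

lemma gram_fun_measurable: "j \<le> p \<Longrightarrow> k \<le> p \<Longrightarrow> gram_fun j k \<in> borel_measurable obs_space"
  and resid_fun_measurable: "j \<le> p \<Longrightarrow> k \<le> p \<Longrightarrow> resid_fun j k \<in> borel_measurable obs_space"
proof -
  assume "j \<le> p" "k \<le> p"
  then have [measurable]: "f j \<in> borel_measurable N" "f k \<in> borel_measurable N" by (auto intro: f_meas)
  show "gram_fun j k \<in> borel_measurable obs_space" "resid_fun j k \<in> borel_measurable obs_space"
    unfolding gram_fun_def[abs_def] resid_fun_def[abs_def] by measurable
qed

abbreviation env :: real where "env \<equiv> env_const B0 C0 D0"

lemma env_bounds: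
  "(W + 1) * C0 \<le> env" "W * C0\<^sup>2 \<le> env" "W * C0 * D0 \<le> env" "W * C0\<^sup>2 * D0\<^sup>2 \<le> env"
proof -
  have C: "C0 \<le> C0\<^sup>2" using C0_ge by (simp add: power2_eq_square)
  have D: "D0 \<le> 1 + D0\<^sup>2" using zero_le_power2[of "D0 - 1"] D0_pos by (simp add: power2_diff)
  have e: "env = (W + 1) * C0\<^sup>2 * (1 + D0\<^sup>2)" by (simp add: env_const_def W_def)
  have "(W + 1) * C0 * 1 \<le> (W + 1) * C0\<^sup>2 * (1 + D0\<^sup>2)" using C W_pos C0_ge by (intro mult_mono) auto
  then show "(W + 1) * C0 \<le> env" unfolding e by simp
  have "W * C0\<^sup>2 * 1 \<le> (W + 1) * C0\<^sup>2 * (1 + D0\<^sup>2)" using W_pos by (intro mult_mono) auto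
  then show "W * C0\<^sup>2 \<le> env" unfolding e by simp
  show "W * C0 * D0 \<le> env" unfolding e using W_pos C C0_ge D D0_pos by (intro mult_mono) auto
  show "W * C0\<^sup>2 * D0\<^sup>2 \<le> env" unfolding e using W_pos by (intro mult_mono) auto
qed

lemma env_pos: "0 < env"
  by (rule env_const_pos[OF C0_ge])

lemma abs_R_le: "\<bar>R \<omega>\<bar> \<le> D0 * (1 + U \<omega>)"
proof -
  define q where "q = \<bar>R \<omega>\<bar> / D0"
  have q: "\<bar>R \<omega>\<bar> = D0 * q" "U \<omega> = q\<^sup>2" using D0_pos by (auto simp: q_def U_def power_divide)
  have "0 \<le> q" using D0_pos by (simp add: q_def)
  moreover have "2 * q \<le> 1 + q\<^sup>2" using zero_le_power2[of "q - 1"] by (simp add: power2_diff)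
  ultimately have "q \<le> 1 + q\<^sup>2" by linarith
  then show ?thesis unfolding q using D0_pos by simp
qed

lemma envelope_AE:
  assumes "j \<le> p" "k \<le> p"
  shows "AE \<omega> in P. \<bar>cal_fun (unit_vec j) (obs \<omega>)\<bar> \<le> env * (1 + U \<omega>)"
    and "AE \<omega> in P. \<bar>wl_fun (unit_vec j) (obs \<omega>)\<bar> \<le> env * (1 + U \<omega>)"
    and "AE \<omega> in P. \<bar>gram_fun j k (obs \<omega>)\<bar> \<le> env * (1 + U \<omega>)"
    and "AE \<omega> in P. \<bar>resid_fun j k (obs \<omega>)\<bar> \<le> env * (1 + U \<omega>)"
proof -
  have l1u: "l1 p (unit_vec j) = 1" using assms by (simp add: l1_def unit_vec_def if_distrib[of abs] cong: if_cong)
  have eU: "env * 1 \<le> env * (1 + U \<omega>)" "env * U \<omega> \<le> env * (1 + U \<omega>)" for \<omega>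
    using env_pos U_nonneg[of \<omega>] by (auto intro!: mult_left_mono)
  show "AE \<omega> in P. \<bar>cal_fun (unit_vec j) (obs \<omega>)\<bar> \<le> env * (1 + U \<omega>)"
    using abs_cal_fun_le[of "unit_vec j"]
  proof eventually_elim
    case (elim \<omega>)
    then show ?case using env_bounds(1) eU(1)[of \<omega>] unfolding l1u by simp
  qed
  show "AE \<omega> in P. \<bar>wl_fun (unit_vec j) (obs \<omega>)\<bar> \<le> env * (1 + U \<omega>)"
    using abs_wl_fun_le[of "unit_vec j"]
  proof eventually_elim
    case (elim \<omega>)
    have "W * C0 * \<bar>R \<omega>\<bar> \<le> W * C0 * (D0 * (1 + U \<omega>))" using abs_R_le[of \<omega>] W_pos C0_ge by (intro mult_left_mono) auto
    also have "\<dots> = W * C0 * D0 * (1 + U \<omega>)" by simp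
    also have "\<dots> \<le> env * (1 + U \<omega>)" using env_bounds(3) U_nonneg[of \<omega>] by (intro mult_right_mono) auto
    finally show ?case using elim unfolding l1u by simp
  qed
  have TwF: "AE \<omega> in P. \<omega> \<in> space P \<and> \<bar>T \<omega> * w (X \<omega>) * (f j (X \<omega>) * f k (X \<omega>))\<bar> \<le> W * C0\<^sup>2"
    using regular_AE
  proof eventually_elim
    case (elim \<omega>)
    have "\<bar>T \<omega> * w (X \<omega>)\<bar> \<le> W" using elim T_cases[of \<omega>] weight_pos[of g "X \<omega>"] W_pos by auto
    moreover have "\<bar>f j (X \<omega>) * f k (X \<omega>)\<bar> \<le> C0 * C0"
      unfolding abs_mult using elim assms C0_ge by (intro mult_mono) auto
    ultimately show ?case
      unfolding abs_mult[of "_ * _" "_ * _"] power2_eq_square using elim W_pos by (intro conjI mult_mono) auto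
  qed
  show "AE \<omega> in P. \<bar>gram_fun j k (obs \<omega>)\<bar> \<le> env * (1 + U \<omega>)"
    using TwF
  proof eventually_elim
    case (elim \<omega>)
    then show ?case using env_bounds(2) eU(1)[of \<omega>] by (simp add: gram_fun_def obs_def)
  qed
  show "AE \<omega> in P. \<bar>resid_fun j k (obs \<omega>)\<bar> \<le> env * (1 + U \<omega>)"
    using TwF
  proof eventually_elim
    case (elim \<omega>)
    have "resid_fun j k (obs \<omega>) = (T \<omega> * w (X \<omega>) * (f j (X \<omega>) * f k (X \<omega>))) * (D0\<^sup>2 * U \<omega>)"
      using elim T_cases[of \<omega>] unfolding R_sq_eq[symmetric] by (auto simp: resid_fun_def obs_def R_def observed_def)
    then have "\<bar>resid_fun j k (obs \<omega>)\<bar> = \<bar>T \<omega> * w (X \<omega>) * (f j (X \<omega>) * f k (X \<omega>))\<bar> * (D0\<^sup>2 * U \<omega>)"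
      using U_nonneg[of \<omega>] by (simp add: abs_mult)
    also have "\<dots> \<le> W * C0\<^sup>2 * (D0\<^sup>2 * U \<omega>)" using elim U_nonneg[of \<omega>] by (intro mult_right_mono) auto
    also have "\<dots> = W * C0\<^sup>2 * D0\<^sup>2 * U \<omega>" by simp
    also have "\<dots> \<le> env * U \<omega>" using env_bounds(4) U_nonneg[of \<omega>] by (intro mult_right_mono) auto
    finally show ?case using eU(2)[of \<omega>] by linarith
  qed
qed

lemma envelope_tail:
  assumes "h \<in> borel_measurable obs_space" "AE \<omega> in P. \<bar>h (obs \<omega>)\<bar> \<le> env * (1 + U \<omega>)"
    and "0 < \<tau>" "\<tau> \<le> 4 * env * mgf_const D0 D1"
  shows "measure M {\<omega>\<in>space M. \<tau> \<le> \<bar>sample_avg n (\<lambda>i. h (Zs i \<omega>)) - (\<integral>\<omega>. h (obs \<omega>) \<partial>P)\<bar>}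
      \<le> 2 * exp (- (real n * \<tau>\<^sup>2 / tail_const B0 C0 D0 D1))"
  unfolding tail_const_def
  by (rule sample_avg_tail[OF assms(1) U_measurable assms(2) exp_U_integrable exp_U_le _ env_pos _ assms(3,4)])
     (auto simp: mgf_const_def C1_def add_pos_nonneg)

definition coords_close :: "real \<Rightarrow> 's \<Rightarrow> bool" where
  "coords_close \<tau> \<omega> \<longleftrightarrow> (\<forall>j\<le>p. \<bar>sample_avg n (\<lambda>i. cal_fun (unit_vec j) (Zs i \<omega>))\<bar> \<le> \<tau>
      \<and> \<bar>sample_avg n (\<lambda>i. wl_fun (unit_vec j) (Zs i \<omega>))\<bar> \<le> \<tau>
      \<and> (\<forall>k\<le>p. \<bar>sample_avg n (\<lambda>i. gram_fun j k (Zs i \<omega>)) - (\<integral>\<omega>. gram_fun j k (obs \<omega>) \<partial>P)\<bar> \<le> \<tau>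
           \<and> \<bar>sample_avg n (\<lambda>i. resid_fun j k (Zs i \<omega>)) - (\<integral>\<omega>. resid_fun j k (obs \<omega>) \<partial>P)\<bar> \<le> \<tau>))"

text \<open>
  There are at most \<open>4 p\<^sup>4\<close> coordinates and pairs of coordinates, each of which fails with probability
  at most \<open>2 / p\<^bsup>k+4\<^esup>\<close>.
\<close>

lemma coords_close_prob:
  fixes k :: nat
  assumes p2: "2 \<le> p" and \<kappa>: "0 < \<kappa>" "tail_const B0 C0 D0 D1 * (real k + 4) \<le> \<kappa>\<^sup>2"
    and small: "\<kappa> * sqrt (ln (real p) / real n) \<le> 4 * env * mgf_const D0 D1"
  shows "\<exists>\<Omega>\<in>sets M. 1 - 8 / real p ^ k \<le> measure M \<Omega>
      \<and> (\<forall>\<omega>\<in>\<Omega>. \<omega> \<in> space M \<and> coords_close (\<kappa> * sqrt (ln (real p) / real n)) \<omega>)"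
proof -
  define \<tau> where "\<tau> = \<kappa> * sqrt (ln (real p) / real n)"
  let ?CC = "tail_const B0 C0 D0 D1"
  have lnp: "0 < ln (real p)" using p2 by simp
  have \<tau>: "0 < \<tau>" using \<kappa> lnp n_pos by (simp add: \<tau>_def)
  define bad where "bad h = {\<omega>\<in>space M. \<tau> \<le> \<bar>sample_avg n (\<lambda>i. h (Zs i \<omega>)) - (\<integral>\<omega>. h (obs \<omega>) \<partial>P)\<bar>}" for h
  define HH where "HH = (\<lambda>j. cal_fun (unit_vec j)) ` {..p} \<union> (\<lambda>j. wl_fun (unit_vec j)) ` {..p}
      \<union> (\<lambda>(j, k). gram_fun j k) ` ({..p} \<times> {..p}) \<union> (\<lambda>(j, k). resid_fun j k) ` ({..p} \<times> {..p})"
  have HH: "h \<in> borel_measurable obs_space \<and> (AE \<omega> in P. \<bar>h (obs \<omega>)\<bar> \<le> env * (1 + U \<omega>))" if "h \<in> HH" for h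
    using that envelope_AE gram_fun_measurable resid_fun_measurable by (auto simp: HH_def)
  have fin: "finite HH" by (simp add: HH_def)
  have cardHH: "real (card HH) \<le> 4 * real p ^ 4"
  proof -
    have "card HH \<le> card {..p} + card {..p} + card ({..p} \<times> {..p}) + card ({..p} \<times> {..p})"
      unfolding HH_def by (intro order_trans[OF card_Un_le] add_mono card_image_le) auto
    also have "\<dots> = 2 * (p + 1) + 2 * (p + 1)\<^sup>2" by (simp add: power2_eq_square)
    also have "\<dots> \<le> 4 * (p + 1)\<^sup>2" by (simp add: power2_eq_square)
    also have "\<dots> \<le> 4 * (p\<^sup>2)\<^sup>2"
    proof -
      have "2 * p \<le> p * p" using p2 by (intro mult_right_mono) auto
      then have "p + 1 \<le> p\<^sup>2" using p2 unfolding power2_eq_square by linarith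
      then show ?thesis by (intro mult_left_mono power_mono) auto
    qed
    finally have "card HH \<le> 4 * p ^ 4" by (simp flip: power_mult)
    then have "real (card HH) \<le> real (4 * p ^ 4)" by (simp only: of_nat_le_iff)
    then show ?thesis by simp
  qed
  have badm: "bad h \<in> sets M" if "h \<in> HH" for h
  proof -
    have [measurable]: "h \<in> borel_measurable obs_space" using HH[OF that] by simp
    show ?thesis unfolding bad_def sample_avg_def by measurable
  qed
  have bade: "measure M (bad h) \<le> 2 / real p ^ (k + 4)" if "h \<in> HH" for h
  proof -
    have "measure M (bad h) \<le> 2 * exp (- (real n * \<tau>\<^sup>2 / ?CC))"
      unfolding bad_def using HH[OF that] \<tau> small by (intro envelope_tail) (auto simp: \<tau>_def)
    also have "real n * \<tau>\<^sup>2 = \<kappa>\<^sup>2 * ln (real p)"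
      using n_pos lnp by (simp add: \<tau>_def power_mult_distrib)
    also have "2 * exp (- (\<kappa>\<^sup>2 * ln (real p) / ?CC)) \<le> 2 * exp (- (real (k + 4) * ln (real p)))"
    proof -
      have "real k + 4 \<le> \<kappa>\<^sup>2 / ?CC"
        using \<kappa>(2) tail_const_pos[OF C0_ge] by (simp add: pos_le_divide_eq mult.commute)
      then have "(real k + 4) * ln (real p) \<le> \<kappa>\<^sup>2 / ?CC * ln (real p)" using lnp by (intro mult_right_mono) auto
      then show ?thesis by simp
    qed
    also have "exp (- (real (k + 4) * ln (real p))) = 1 / real p ^ (k + 4)"
      using p2 by (simp add: exp_minus inverse_eq_divide exp_of_nat_mult del: of_nat_add)
    finally show ?thesis by simp
  qed
  let ?\<Omega> = "space M - (\<Union>h\<in>HH. bad h)"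
  have "measure M (\<Union>h\<in>HH. bad h) \<le> (\<Sum>h\<in>HH. measure M (bad h))"
    using badm fin by (intro M.finite_measure_subadditive_finite) auto
  also have "\<dots> \<le> (\<Sum>h\<in>HH. 2 / real p ^ (k + 4))" using bade by (intro sum_mono) auto
  also have "\<dots> = real (card HH) * (2 / real p ^ (k + 4))" by simp
  also have "\<dots> \<le> 4 * real p ^ 4 * (2 / real p ^ (k + 4))" using cardHH by (intro mult_right_mono) auto
  also have "\<dots> = 8 / real p ^ k" using p2 by (simp add: power_add)
  finally have "measure M (\<Union>h\<in>HH. bad h) \<le> 8 / real p ^ k" .
  moreover have um: "(\<Union>h\<in>HH. bad h) \<in> sets M" using badm fin by auto
  ultimately have "1 - 8 / real p ^ k \<le> measure M ?\<Omega>" by (simp add: M.prob_compl)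
  moreover have "?\<Omega> \<in> sets M" using um by auto
  moreover have "\<omega> \<in> space M \<and> coords_close \<tau> \<omega>" if "\<omega> \<in> ?\<Omega>" for \<omega>
  proof -
    have c: "\<bar>sample_avg n (\<lambda>i. h (Zs i \<omega>)) - (\<integral>\<omega>. h (obs \<omega>) \<partial>P)\<bar> \<le> \<tau>" if "h \<in> HH" for h
      using \<open>\<omega> \<in> ?\<Omega>\<close> that by (auto simp: bad_def)
    have "cal_fun (unit_vec j) \<in> HH" "wl_fun (unit_vec j) \<in> HH" if "j \<le> p" for j
      using that by (auto simp: HH_def)
    moreover have "gram_fun j k \<in> HH" "resid_fun j k \<in> HH" if "j \<le> p" "k \<le> p" for j k
      using that by (force simp: HH_def)+
    ultimately show ?thesis
      using that c[of "cal_fun (unit_vec _)"] c[of "wl_fun (unit_vec _)"] c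
      by (auto simp: coords_close_def cal_score wl_score)
  qed
  ultimately show ?thesis unfolding \<tau>_def by blast
qed


lemma cal_fun_diff: "cal_fun (\<lambda>j. b j - c j) z = cal_fun b z - cal_fun c z"
  by (simp add: cal_fun_def linpred_diff algebra_simps split: prod.split)

lemma wl_fun_diff: "wl_fun (\<lambda>j. b j - c j) z = wl_fun b z - wl_fun c z"
  by (simp add: wl_fun_def linpred_diff algebra_simps split: prod.split)

lemma cal_fun_scale: "cal_fun (\<lambda>j. c * b j) z = c * cal_fun b z"
  by (simp add: cal_fun_def linpred_scale split: prod.split)

lemma wl_fun_scale: "wl_fun (\<lambda>j. c * b j) z = c * wl_fun b z"
  by (simp add: wl_fun_def linpred_scale split: prod.split)

lemma Qf_scale: "Qf (\<lambda>j. c * b j) = c\<^sup>2 * Qf b"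
  by (simp add: Qf_def linpred_scale power_mult_distrib mult.left_commute[of _ "c\<^sup>2"])

lemma cal_fun_coords: "cal_fun b z = (\<Sum>j\<le>p. b j * cal_fun (unit_vec j) z)"
  and wl_fun_coords: "wl_fun b z = (\<Sum>j\<le>p. b j * wl_fun (unit_vec j) z)"
proof -
  obtain y t x where z: "z = (y, t, x)" by (cases z)
  show "cal_fun b z = (\<Sum>j\<le>p. b j * cal_fun (unit_vec j) z)"
    by (simp add: z cal_fun_def linpred_unit_vec linpred_def[of p f b] sum_distrib_left sum_distrib_right mult_ac)
  show "wl_fun b z = (\<Sum>j\<le>p. b j * wl_fun (unit_vec j) z)"
    by (simp add: z wl_fun_def linpred_unit_vec linpred_def[of p f b] sum_distrib_left mult_ac)
qed

lemma abs_avg_le_l1: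
  assumes lin: "\<And>z. F b z = (\<Sum>j\<le>p. b j * F (unit_vec j) z)"
    and c: "\<And>j. j \<le> p \<Longrightarrow> \<bar>sample_avg n (\<lambda>i. F (unit_vec j) (zz i))\<bar> \<le> \<tau>"
  shows "\<bar>sample_avg n (\<lambda>i. F b (zz i))\<bar> \<le> \<tau> * l1 p b"
proof -
  have "sample_avg n (\<lambda>i. F b (zz i)) = (\<Sum>j\<le>p. b j * sample_avg n (\<lambda>i. F (unit_vec j) (zz i)))"
    unfolding lin sample_avg_sum sample_avg_scale ..
  also have "\<bar>\<dots>\<bar> \<le> (\<Sum>j\<le>p. \<bar>b j * sample_avg n (\<lambda>i. F (unit_vec j) (zz i))\<bar>)" by (rule sum_abs)
  also have "\<dots> \<le> (\<Sum>j\<le>p. \<bar>b j\<bar> * \<tau>)" using c by (intro sum_mono) (simp add: abs_mult mult_left_mono)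
  also have "\<dots> = \<tau> * l1 p b" by (simp add: l1_def sum_distrib_left mult.commute)
  finally show ?thesis .
qed

text \<open>
  In low dimension the stochastic gradient is controlled on the thin part of the sphere by
  Chebyshev's inequality at finitely many representatives.
\<close>

lemma thin_sphere_event:
  fixes F :: "(nat \<Rightarrow> real) \<Rightarrow> real \<times> real \<times> 'x \<Rightarrow> real"
  assumes diff: "\<And>b c z. F (\<lambda>j. b j - c j) z = F b z - F c z"
    and meas [measurable]: "\<And>b. F b \<in> borel_measurable obs_space"
    and mean: "\<And>b. (\<integral>\<omega>. F b (obs \<omega>) \<partial>P) = 0"
    and int: "\<And>b. integrable P (\<lambda>\<omega>. (F b (obs \<omega>))\<^sup>2)"
    and v: "\<And>b. l1 p b = 1 \<Longrightarrow> Qf b < \<theta> \<Longrightarrow> (\<integral>\<omega>. (F b (obs \<omega>))\<^sup>2 \<partial>P) \<le> v" "0 \<le> v"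
    and m: "0 < m" and h: "0 < h"
  shows "\<exists>\<Omega>\<in>sets M. 1 - real ((2 * m + 1) ^ (p + 1)) * (v / (real n * h\<^sup>2)) \<le> measure M \<Omega>
    \<and> (\<forall>\<omega>\<in>\<Omega>. \<omega> \<in> space M \<and> (\<forall>B b. (\<forall>c. \<bar>sample_avg n (\<lambda>i. F c (Zs i \<omega>))\<bar> \<le> B * l1 p c) \<longrightarrow> 0 \<le> B \<longrightarrow>
          l1 p b = 1 \<longrightarrow> Qf b < \<theta> \<longrightarrow> \<bar>sample_avg n (\<lambda>i. F b (Zs i \<omega>))\<bar> \<le> h + B * (real (p + 1) / real m)))"
proof -
  let ?S = "{b. l1 p b = 1 \<and> Qf b < \<theta>}"
  obtain D where D: "D \<subseteq> ?S" "finite D" "card D \<le> (2 * m + 1) ^ (p + 1)"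
    and net: "\<And>b. b \<in> ?S \<Longrightarrow> \<exists>c\<in>D. l1 p (\<lambda>j. b j - c j) \<le> real (p + 1) / real m"
    using sphere_representatives[OF m, of ?S p] by auto
  define bad where "bad c = {\<omega>\<in>space M. h \<le> \<bar>sample_avg n (\<lambda>i. F c (Zs i \<omega>))\<bar>}" for c
  have badm: "bad c \<in> sets M" for c unfolding bad_def sample_avg_def by measurable
  have badp: "measure M (bad c) \<le> v / (real n * h\<^sup>2)" if "c \<in> D" for c
    unfolding bad_def using D(1) that by (intro sample_avg_chebyshev int mean v(1) h n_pos) auto
  have um: "(\<Union>c\<in>D. bad c) \<in> sets M" using badm D(2) by auto
  have "measure M (\<Union>c\<in>D. bad c) \<le> (\<Sum>c\<in>D. measure M (bad c))"
    using badm D(2) by (intro M.finite_measure_subadditive_finite) auto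
  also have "\<dots> \<le> (\<Sum>c\<in>D. v / (real n * h\<^sup>2))" using badp by (intro sum_mono) auto
  also have "\<dots> = real (card D) * (v / (real n * h\<^sup>2))" by simp
  also have "\<dots> \<le> real ((2 * m + 1) ^ (p + 1)) * (v / (real n * h\<^sup>2))"
    using D(3) v(2) by (intro mult_right_mono) (auto simp only: of_nat_le_iff intro!: divide_nonneg_nonneg mult_nonneg_nonneg, auto)
  finally have "1 - real ((2 * m + 1) ^ (p + 1)) * (v / (real n * h\<^sup>2)) \<le> measure M (space M - (\<Union>c\<in>D. bad c))"
    using um by (simp add: M.prob_compl)
  moreover have "space M - (\<Union>c\<in>D. bad c) \<in> sets M" using um by auto
  moreover have "\<bar>sample_avg n (\<lambda>i. F b (Zs i \<omega>))\<bar> \<le> h + B * (real (p + 1) / real m)"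
    if w: "\<omega> \<in> space M - (\<Union>c\<in>D. bad c)" and B: "\<forall>c. \<bar>sample_avg n (\<lambda>i. F c (Zs i \<omega>))\<bar> \<le> B * l1 p c" "0 \<le> B"
      and b: "l1 p b = 1" "Qf b < \<theta>" for \<omega> B b
  proof -
    obtain c where c: "c \<in> D" "l1 p (\<lambda>j. b j - c j) \<le> real (p + 1) / real m" using net[of b] b by auto
    have "sample_avg n (\<lambda>i. F b (Zs i \<omega>)) = sample_avg n (\<lambda>i. F c (Zs i \<omega>)) + sample_avg n (\<lambda>i. F (\<lambda>j. b j - c j) (Zs i \<omega>))"
      unfolding diff sample_avg_diff by simp
    moreover have "\<bar>sample_avg n (\<lambda>i. F c (Zs i \<omega>))\<bar> < h" using w c(1) by (auto simp: bad_def)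
    moreover have "\<bar>sample_avg n (\<lambda>i. F (\<lambda>j. b j - c j) (Zs i \<omega>))\<bar> \<le> B * (real (p + 1) / real m)"
      using B c(2) by (intro order_trans[OF B(1)[rule_format]] mult_left_mono)
    ultimately show ?thesis by linarith
  qed
  ultimately show ?thesis
    by (intro bexI[of _ "space M - (\<Union>c\<in>D. bad c)"] conjI ballI allI impI) simp_all
qed

definition regular_obs :: "real \<times> real \<times> 'x \<Rightarrow> bool" where
  "regular_obs z = (case z of (y, t, x) \<Rightarrow> (t = 0 \<or> t = 1) \<and> (\<forall>j\<le>p. \<bar>f j x\<bar> \<le> C0) \<and> w x \<le> W)"

lemma regular_sample_event:
  "\<exists>\<Omega>\<in>sets M. measure M \<Omega> = 1 \<and> (\<forall>\<omega>\<in>\<Omega>. \<omega> \<in> space M \<and> (\<forall>i. regular_obs (Zs i \<omega>)))"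
proof -
  have m: "Measurable.pred obs_space regular_obs"
  proof -
    have "Measurable.pred obs_space (\<lambda>z. \<bar>f j (snd (snd z))\<bar> \<le> C0)" if "j \<in> {..p}" for j
    proof -
      have [measurable]: "f j \<in> borel_measurable N" using that f_meas by simp
      show ?thesis by measurable
    qed
    then have f: "Measurable.pred obs_space (\<lambda>z. \<forall>j\<in>{..p}. \<bar>f j (snd (snd z))\<bar> \<le> C0)"
      by (intro pred_intros_finite) auto
    have t: "Measurable.pred obs_space (\<lambda>z. fst (snd z) = 0 \<or> fst (snd z) = 1)" by measurable
    have v: "Measurable.pred obs_space (\<lambda>z. w (snd (snd z)) \<le> W)" by measurable
    have eq: "regular_obs = (\<lambda>z. (fst (snd z) = 0 \<or> fst (snd z) = 1)
        \<and> (\<forall>j\<in>{..p}. \<bar>f j (snd (snd z))\<bar> \<le> C0) \<and> w (snd (snd z)) \<le> W)"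
      by (rule ext) (auto simp: regular_obs_def)
    show ?thesis unfolding eq by (intro pred_intros_logic f t v)
  qed
  have "AE \<omega> in P. regular_obs (obs \<omega>)"
    using regular_AE
  proof eventually_elim
    case (elim \<omega>)
    then show ?case using T_cases[of \<omega>] by (simp add: regular_obs_def obs_def)
  qed
  then have "AE \<omega> in M. \<forall>i. regular_obs (Zs i \<omega>)"
    using AE_Zs[OF m] by (simp add: AE_all_countable)
  then obtain A where A: "A \<in> null_sets M" "\<And>\<omega>. \<omega> \<in> space M - A \<Longrightarrow> \<forall>i. regular_obs (Zs i \<omega>)"
    by (rule AE_E3) blast
  have "measure M (space M - A) = 1"
    using A(1) by (subst M.prob_compl) (auto simp: null_sets_def measure_def)
  then show ?thesis using A by (intro bexI[of _ "space M - A"]) (auto simp: null_sets_def)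
qed

lemma good_sample_of_events:
  fixes R1 Rc u dl :: real
  defines "Q \<equiv> \<lambda>b. \<Sum>j\<le>p. \<Sum>k\<le>p. b j * Sigma_gamma P T X p f g j k * b k"
  assumes reg: "\<And>i. regular_obs (Zs i \<omega>)" and close: "coords_close (R1 * u) \<omega>" and R: "0 \<le> R1" "R1 \<le> Rc"
    and u: "0 < u" and dl: "0 < dl"
    and cal: "\<And>b. \<bar>sample_avg n (\<lambda>i. cal_fun b (Zs i \<omega>))\<bar> \<le> dl * u * l1 p b + Rc * u * sqrt (Qf b)"
    and wl: "\<And>b. \<bar>sample_avg n (\<lambda>i. wl_fun b (Zs i \<omega>))\<bar> \<le> dl * u * l1 p b + Rc * u * sqrt (Qf b)"
  shows "good_sample n p f (\<lambda>i. Ts i \<omega>) (\<lambda>i. Ys i \<omega>) (\<lambda>i. Xs i \<omega>) g a Q C0 (exp (- B0)) u dl Rc (D1\<^sup>2)"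
proof -
  have Q: "Q b = Qf b" for b unfolding Q_def by (rule quadratic_form_eq)
  have R1Rc: "R1 * u * z \<le> Rc * u * z" if "0 \<le> z" for z
    using R u that by (intro mult_right_mono) auto
  have gram: "\<bar>sample_avg n (\<lambda>i. Ts i \<omega> * w (Xs i \<omega>) * (lin b (Xs i \<omega>))\<^sup>2) - Qf b\<bar> \<le> R1 * u * (l1 p b)\<^sup>2" for b
  proof -
    have lin: "t * w x * (lin b x)\<^sup>2 = (\<Sum>j\<le>p. \<Sum>k\<le>p. b j * b k * gram_fun j k (y, t, x))" for y t x
      by (simp add: gram_fun_def linpred_def[of p f b] power2_eq_square sum_product sum_distrib_left mult_ac)
    have "sample_avg n (\<lambda>i. Ts i \<omega> * w (Xs i \<omega>) * (lin b (Xs i \<omega>))\<^sup>2)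
        = sample_avg n (\<lambda>i. \<Sum>j\<le>p. \<Sum>k\<le>p. b j * b k * gram_fun j k (Zs i \<omega>))"
      by (rule sample_avg_cong) (simp only: Zs_def lin)
    also have "\<dots> = (\<Sum>j\<le>p. \<Sum>k\<le>p. b j * b k * sample_avg n (\<lambda>i. gram_fun j k (Zs i \<omega>)))"
      by (simp only: sample_avg_sum sample_avg_scale)
    finally have 1: "sample_avg n (\<lambda>i. Ts i \<omega> * w (Xs i \<omega>) * (lin b (Xs i \<omega>))\<^sup>2) = \<dots>" .
    have S: "Sigma_gamma P T X p f g j k = (\<integral>\<omega>. gram_fun j k (obs \<omega>) \<partial>P)" for j k
      by (simp add: Sigma_gamma_def gram_fun_def obs_def mult.assoc)
    have 2: "Qf b = (\<Sum>j\<le>p. \<Sum>k\<le>p. b j * b k * (\<integral>\<omega>. gram_fun j k (obs \<omega>) \<partial>P))"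
      unfolding quadratic_form_eq[symmetric] S by (simp only: mult_ac)
    have "\<bar>\<Sum>j\<le>p. \<Sum>k\<le>p. b j * b k * (sample_avg n (\<lambda>i. gram_fun j k (Zs i \<omega>)) - (\<integral>\<omega>. gram_fun j k (obs \<omega>) \<partial>P))\<bar>
        \<le> R1 * u * (l1 p b)\<^sup>2"
      by (rule sum_abs_product_le) (use close in \<open>auto simp: coords_close_def\<close>)
    then show ?thesis unfolding 1 2 by (simp add: right_diff_distrib sum_subtractf)
  qed
  have resid: "sample_avg n (\<lambda>i. Ts i \<omega> * w (Xs i \<omega>) * (Ys i \<omega> - lin a (Xs i \<omega>))\<^sup>2 * (lin b (Xs i \<omega>))\<^sup>2)
      \<le> D1\<^sup>2 * Qf b + R1 * u * (l1 p b)\<^sup>2" for b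
  proof -
    have lin: "t * w x * (y - lin a x)\<^sup>2 * (lin b x)\<^sup>2 = (\<Sum>j\<le>p. \<Sum>k\<le>p. b j * b k * resid_fun j k (y, t, x))" for y t x
      by (simp add: resid_fun_def linpred_def[of p f b] power2_eq_square[of "sum _ _"] sum_product sum_distrib_left mult_ac)
    have "sample_avg n (\<lambda>i. Ts i \<omega> * w (Xs i \<omega>) * (Ys i \<omega> - lin a (Xs i \<omega>))\<^sup>2 * (lin b (Xs i \<omega>))\<^sup>2)
        = sample_avg n (\<lambda>i. \<Sum>j\<le>p. \<Sum>k\<le>p. b j * b k * resid_fun j k (Zs i \<omega>))"
      by (rule sample_avg_cong) (simp only: Zs_def lin)
    also have "\<dots> = (\<Sum>j\<le>p. \<Sum>k\<le>p. b j * b k * sample_avg n (\<lambda>i. resid_fun j k (Zs i \<omega>)))"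
      by (simp only: sample_avg_sum sample_avg_scale)
    finally have 1: "sample_avg n (\<lambda>i. Ts i \<omega> * w (Xs i \<omega>) * (Ys i \<omega> - lin a (Xs i \<omega>))\<^sup>2 * (lin b (Xs i \<omega>))\<^sup>2) = \<dots>" .
    have ir: "integrable P (\<lambda>\<omega>. resid_fun j k (obs \<omega>))" if jk: "j \<le> p" "k \<le> p" for j k
    proof (rule Bochner_Integration.integrable_bound)
      show "integrable P (\<lambda>\<omega>. env * (exp (U \<omega>)))" using exp_U_integrable by simp
      show "(\<lambda>\<omega>. resid_fun j k (obs \<omega>)) \<in> borel_measurable P"
        using measurable_compose[OF obs_measurable resid_fun_measurable[OF jk]] .
      show "AE \<omega> in P. norm (resid_fun j k (obs \<omega>)) \<le> norm (env * exp (U \<omega>))"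
        using envelope_AE(4)[OF jk]
      proof eventually_elim
        case (elim \<omega>)
        have "env * (1 + U \<omega>) \<le> env * exp (U \<omega>)" using U_le_exp[of \<omega>] env_pos by (intro mult_left_mono) auto
        then have "\<bar>resid_fun j k (obs \<omega>)\<bar> \<le> env * exp (U \<omega>)" using elim by linarith
        then show ?case using env_pos by simp
      qed
    qed
    have "(\<Sum>j\<le>p. \<Sum>k\<le>p. b j * b k * (\<integral>\<omega>. resid_fun j k (obs \<omega>) \<partial>P))
        = (\<Sum>j\<le>p. \<Sum>k\<le>p. \<integral>\<omega>. b j * b k * resid_fun j k (obs \<omega>) \<partial>P)" by simp
    also have "\<dots> = (\<Sum>j\<le>p. \<integral>\<omega>. (\<Sum>k\<le>p. b j * b k * resid_fun j k (obs \<omega>)) \<partial>P)"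
      using ir by (intro sum.cong refl Bochner_Integration.integral_sum[symmetric]) auto
    also have "\<dots> = (\<integral>\<omega>. (\<Sum>j\<le>p. \<Sum>k\<le>p. b j * b k * resid_fun j k (obs \<omega>)) \<partial>P)"
      using ir by (intro Bochner_Integration.integral_sum[symmetric] Bochner_Integration.integrable_sum) auto
    also have "\<dots> = (\<integral>\<omega>. T \<omega> * (w (X \<omega>) * (lin b (X \<omega>))\<^sup>2) * (R \<omega>)\<^sup>2 \<partial>P)"
    proof (rule Bochner_Integration.integral_cong[OF refl])
      fix \<omega> assume w: "\<omega> \<in> space P"
      show "(\<Sum>j\<le>p. \<Sum>k\<le>p. b j * b k * resid_fun j k (obs \<omega>)) = T \<omega> * (w (X \<omega>) * (lin b (X \<omega>))\<^sup>2) * (R \<omega>)\<^sup>2"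
        unfolding obs_def lin[symmetric] using T_cases[OF w] by (auto simp: observed_def R_def)
    qed
    also have "\<dots> \<le> D1\<^sup>2 * (\<integral>\<omega>. T \<omega> * (w (X \<omega>) * (lin b (X \<omega>))\<^sup>2) \<partial>P)"
    proof (rule resid_second_moment(2)[where h = "\<lambda>x. w x * (lin b x)\<^sup>2" and H = "W * (C0 * l1 p b)\<^sup>2"])
      show "AE \<omega> in P. w (X \<omega>) * (lin b (X \<omega>))\<^sup>2 \<le> W * (C0 * l1 p b)\<^sup>2"
        using regular_AE
      proof eventually_elim
        case (elim \<omega>)
        have "(lin b (X \<omega>))\<^sup>2 \<le> (C0 * l1 p b)\<^sup>2" using elim C0_ge by (intro abs_le_square_iff[THEN iffD1]) (simp add: abs_of_nonneg)
        then show ?case using elim W_pos weight_pos[of g "X \<omega>"] by (intro mult_mono) auto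
      qed
    qed (auto intro!: mult_nonneg_nonneg less_imp_le[OF weight_pos])
    also have "(\<integral>\<omega>. T \<omega> * (w (X \<omega>) * (lin b (X \<omega>))\<^sup>2) \<partial>P) = Qf b" by (simp add: Qf_def mult.assoc)
    finally have 2: "(\<Sum>j\<le>p. \<Sum>k\<le>p. b j * b k * (\<integral>\<omega>. resid_fun j k (obs \<omega>) \<partial>P)) \<le> D1\<^sup>2 * Qf b" .
    have "\<bar>\<Sum>j\<le>p. \<Sum>k\<le>p. b j * b k * (sample_avg n (\<lambda>i. resid_fun j k (Zs i \<omega>)) - (\<integral>\<omega>. resid_fun j k (obs \<omega>) \<partial>P))\<bar>
        \<le> R1 * u * (l1 p b)\<^sup>2"
      by (rule sum_abs_product_le) (use close in \<open>auto simp: coords_close_def\<close>)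
    then show ?thesis using 2 unfolding 1 by (simp add: right_diff_distrib sum_subtractf)
  qed
  have rg: "Ts i \<omega> = 0 \<or> Ts i \<omega> = 1" "\<And>j. j \<le> p \<Longrightarrow> \<bar>f j (Xs i \<omega>)\<bar> \<le> C0" "w (Xs i \<omega>) \<le> W" for i
    using reg[of i] by (auto simp: regular_obs_def Zs_def)
  show ?thesis
  proof (unfold_locales, goal_cases)
    case (10 b)
    then show ?case using cal[of b] by (simp add: cal_fun_def Zs_def Q)
  next
    case (11 b)
    then show ?case using wl[of b] by (simp add: wl_fun_def Zs_def Q)
  next
    case (12 b)
    then show ?case using order_trans[OF gram[of b] R1Rc] by (simp add: Q)
  next
    case (13 b)
    then show ?case using resid[of b] R1Rc[of "(l1 p b)\<^sup>2"] by (simp add: Q)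
  qed (use rg C0_ge u dl R Qf_nonneg in \<open>auto simp: Q W_def\<close>)
qed

end


lemma (in prob_space) prob_Int_ge:
  assumes "A \<in> events" "B \<in> events"
  shows "prob A + prob B - 1 \<le> prob (A \<inter> B)"
proof -
  have "prob A \<le> prob ((A \<inter> B) \<union> (space M - B))"
    using assms sets.sets_into_space[of A M] by (intro finite_measure_mono) auto
  also have "\<dots> \<le> prob (A \<inter> B) + prob (space M - B)" using assms by (intro measure_Un_le) auto
  also have "prob (space M - B) = 1 - prob B" using assms by (simp add: prob_compl)
  finally show ?thesis by simp
qed

context causal_sample
begin

text \<open>
  Uniformly over sample sizes, dimensions and regressors, the sample behaves well with probability
  close to 1, provided the rate is small. In high dimension the union bound alone dominates the
  gradients by the penalty. Below a threshold dimension its failure probability is not small;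
  there the thin-sphere argument takes over.
\<close>

theorem good_sample_uniform:
  fixes C0 B0 D0 D1 \<eta> dl :: real
  assumes C0: "1 \<le> C0" and \<eta>: "0 < \<eta>"
    and dl: "0 < dl" "tail_const B0 C0 D0 D1 * 5 \<le> dl\<^sup>2"
  shows "\<exists>Rc\<ge>0. \<exists>u0>0. \<forall>n p (f :: nat \<Rightarrow> 'x \<Rightarrow> real) g a.
      calibrated_row P M N Y0 Y1 T X pistar Ys Ts Xs n p f g a C0 B0 D0 D1 \<longrightarrow> 2 \<le> p \<longrightarrow>
      sqrt (ln (real p) / real n) \<le> u0 \<longrightarrow>
      (\<exists>\<Omega>\<in>sets M. 1 - \<eta> \<le> measure M \<Omega> \<and> (\<forall>\<omega>\<in>\<Omega>. \<omega> \<in> space M \<and>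
         good_sample n p f (\<lambda>i. Ts i \<omega>) (\<lambda>i. Ys i \<omega>) (\<lambda>i. Xs i \<omega>) g a
           (\<lambda>b. \<Sum>j\<le>p. \<Sum>k\<le>p. b j * Sigma_gamma P T X p f g j k * b k)
           C0 (exp (- B0)) (sqrt (ln (real p) / real n)) dl Rc (D1\<^sup>2)))"
proof -
  let ?CC = "tail_const B0 C0 D0 D1" and ?E = "env_const B0 C0 D0" and ?W = "exp (- B0)"
  have CC: "0 < ?CC" by (rule tail_const_pos[OF C0])
  have E: "0 < 4 * ?E * mgf_const D0 D1" using env_const_pos[OF C0] mgf_const_pos by simp
  \<comment> \<open>\<open>R1\<close> makes the union bound hold with probability near 1 in every dimension, as \<open>p \<ge> 2\<close>.\<close>
  obtain k :: nat where k: "8 / 2 ^ k \<le> \<eta> / 4"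
  proof -
    obtain k :: nat where "(1 / 2 :: real) ^ k < \<eta> / 32" using real_arch_pow_inv[of "\<eta> / 32" "1 / 2"] \<eta> by auto
    then show ?thesis using that[of k] by (simp add: power_one_over field_simps)
  qed
  define R1 where "R1 = sqrt (?CC * (real k + 4))"
  have R1: "0 < R1" "?CC * (real k + 4) \<le> R1\<^sup>2" using CC by (auto simp: R1_def)
  \<comment> \<open>Above dimension \<open>K\<close> the union bound holds even at the level \<open>dl\<close> of the penalty.\<close>
  obtain K :: nat where K: "0 < K" "32 / \<eta> \<le> real K"
  proof -
    obtain K0 :: nat where "32 / \<eta> \<le> real K0" using real_arch_simple by blast
    then show ?thesis using that[of "Suc K0"] by simp
  qed
  \<comment> \<open>The mesh \<open>1 / m\<close> is fixed first, then the admissible variance \<open>v\<close> at the \<open>NN\<close> representatives,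
    and last the thickness \<open>\<theta>\<close>; \<open>NN\<close> is uniform in the set that \<open>\<theta>\<close> cuts out.\<close>
  obtain m :: nat where m: "0 < m" "R1 * real (K + 1) / real m \<le> dl / 2"
  proof -
    obtain m0 :: nat where "2 * R1 * real (K + 1) / dl \<le> real m0" using real_arch_simple by blast
    then have "2 * R1 * real (K + 1) / dl \<le> real (Suc m0)" by simp
    then show ?thesis using that[of "Suc m0"] dl(1) by (simp add: field_simps del: of_nat_Suc of_nat_add)
  qed
  define NN where "NN = real ((2 * m + 1) ^ (K + 1))"
  have NN: "0 < NN" unfolding NN_def by (simp only: of_nat_0_less_iff zero_less_power zero_less_Suc add_gr_0 zero_less_one simp_thms)
  define v where "v = \<eta> * dl\<^sup>2 * ln 2 / (16 * NN)"
  have v: "0 < v" using \<eta> dl NN by (simp add: v_def)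
  define L where "L = 4 * C0\<^sup>2 * (1 + \<bar>B0\<bar>) / v"
  have L: "0 < L" using C0 v by (simp add: L_def add_pos_nonneg)
  have Lv: "C0\<^sup>2 * ((1 + \<bar>B0\<bar>) / L) = v / 4"
  proof -
    have "C0\<^sup>2 * (q / (4 * C0\<^sup>2 * q / v)) = v / 4" if "0 < q" for q
      using that C0 v by (simp add: field_simps)
    from this[of "1 + \<bar>B0\<bar>"] show ?thesis by (simp add: L_def add_pos_nonneg)
  qed
  obtain c where c: "0 < c" "measure P {\<omega>\<in>space P. pistar (X \<omega>) < c} < v / (4 * C0\<^sup>2)"
    using small_propensity_tendsto_0[of "v / (4 * C0\<^sup>2)"] v C0 by auto
  have cv: "C0\<^sup>2 * measure P {\<omega>\<in>space P. pistar (X \<omega>) < c} \<le> v / 4"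
    using c(2) C0 by (simp add: field_simps)
  define \<theta> where "\<theta> = v / (2 * (?W + exp L / c + ?W * D1\<^sup>2))"
  have den: "0 < ?W + exp L / c + ?W * D1\<^sup>2" using c by (simp add: add_pos_nonneg)
  have \<theta>: "0 < \<theta>" using v den by (simp add: \<theta>_def)
  have \<theta>v: "(?W + exp L / c) * \<theta> \<le> v / 2" "?W * D1\<^sup>2 * \<theta> \<le> v"
  proof -
    have eq: "(?W + exp L / c + ?W * D1\<^sup>2) * \<theta> = v / 2"
    proof -
      have "q * (v / (2 * q)) = v / 2" if "0 < q" for q using that by simp
      from this[OF den] show ?thesis by (simp only: \<theta>_def)
    qed
    have "(?W + exp L / c) * \<theta> \<le> (?W + exp L / c + ?W * D1\<^sup>2) * \<theta>" using \<theta> by (intro mult_right_mono) auto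
    then show "(?W + exp L / c) * \<theta> \<le> v / 2" using eq by simp
    have "?W * D1\<^sup>2 * \<theta> \<le> (?W + exp L / c + ?W * D1\<^sup>2) * \<theta>" using \<theta> c by (intro mult_right_mono) auto
    also have "\<dots> \<le> v" unfolding eq using v by simp
    finally show "?W * D1\<^sup>2 * \<theta> \<le> v" .
  qed
  define Rc where "Rc = max R1 (R1 / sqrt \<theta>)"
  have Rc: "0 \<le> Rc" "R1 \<le> Rc" "R1 / sqrt \<theta> \<le> Rc" using R1 by (auto simp: Rc_def)
  define u0 where "u0 = min (4 * ?E * mgf_const D0 D1 / R1) (4 * ?E * mgf_const D0 D1 / dl)"
  have u0: "0 < u0" using E R1 dl by (simp add: u0_def)
  show ?thesis
  proof (rule exI[of _ Rc], intro conjI Rc(1), rule exI[of _ u0], intro conjI u0 allI impI)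
    fix n p :: nat and f :: "nat \<Rightarrow> 'x \<Rightarrow> real" and g a :: "nat \<Rightarrow> real"
    assume "calibrated_row P M N Y0 Y1 T X pistar Ys Ts Xs n p f g a C0 B0 D0 D1"
    then interpret calibrated_row P M N Y0 Y1 T X pistar Ys Ts Xs n p f g a C0 B0 D0 D1 .
    assume p2: "2 \<le> p" and us: "sqrt (ln (real p) / real n) \<le> u0"
    define u where "u = sqrt (ln (real p) / real n)"
    have lnp: "ln 2 \<le> ln (real p)" "0 < ln (real p)" using p2 by auto
    have u: "0 < u" using lnp n_pos by (simp add: u_def)
    have nu: "real n * u\<^sup>2 = ln (real p)" using n_pos lnp by (simp add: u_def)
    have small: "R1 * u \<le> 4 * env * mgf_const D0 D1" "dl * u \<le> 4 * env * mgf_const D0 D1"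
    proof -
      have "u \<le> 4 * ?E * mgf_const D0 D1 / R1" "u \<le> 4 * ?E * mgf_const D0 D1 / dl"
        using us by (auto simp: u_def u0_def)
      then show "R1 * u \<le> 4 * env * mgf_const D0 D1" "dl * u \<le> 4 * env * mgf_const D0 D1"
        using R1(1) dl(1) by (simp_all add: field_simps)
    qed
    obtain \<Omega>1 where \<Omega>1: "\<Omega>1 \<in> sets M" "1 - 8 / real p ^ k \<le> measure M \<Omega>1"
      "\<And>\<omega>. \<omega> \<in> \<Omega>1 \<Longrightarrow> coords_close (R1 * u) \<omega>"
      using coords_close_prob[OF p2 R1 small(1)[unfolded u_def]] by (auto simp: u_def)
    have "8 / real p ^ k \<le> 8 / 2 ^ k" using p2 by (intro divide_left_mono power_mono) auto
    then have \<Omega>1p: "1 - \<eta> / 4 \<le> measure M \<Omega>1" using \<Omega>1(2) k by linarith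
    obtain \<Omega>r where \<Omega>r: "\<Omega>r \<in> sets M" "measure M \<Omega>r = 1"
      "\<And>\<omega>. \<omega> \<in> \<Omega>r \<Longrightarrow> \<omega> \<in> space M \<and> (\<forall>i. regular_obs (Zs i \<omega>))"
      using regular_sample_event by auto
    have close1: "\<bar>sample_avg n (\<lambda>i. cal_fun b (Zs i \<omega>))\<bar> \<le> \<tau> * l1 p b"
      "\<bar>sample_avg n (\<lambda>i. wl_fun b (Zs i \<omega>))\<bar> \<le> \<tau> * l1 p b" if "coords_close \<tau> \<omega>" for \<tau> b \<omega>
      using abs_avg_le_l1[of cal_fun b "\<lambda>i. Zs i \<omega>" \<tau>, OF cal_fun_coords]
        abs_avg_le_l1[of wl_fun b "\<lambda>i. Zs i \<omega>" \<tau>, OF wl_fun_coords] that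
      by (simp_all add: coords_close_def)
    have sq: "0 \<le> Rc * u * sqrt (Qf b)" for b using Rc(1) u Qf_nonneg[of b] by simp
    have "\<exists>\<Omega>2\<in>sets M. 1 - \<eta> / 2 \<le> measure M \<Omega>2 \<and> (\<forall>\<omega>\<in>\<Omega>2. coords_close (R1 * u) \<omega> \<longrightarrow> (\<forall>b.
        \<bar>sample_avg n (\<lambda>i. cal_fun b (Zs i \<omega>))\<bar> \<le> dl * u * l1 p b + Rc * u * sqrt (Qf b) \<and>
        \<bar>sample_avg n (\<lambda>i. wl_fun b (Zs i \<omega>))\<bar> \<le> dl * u * l1 p b + Rc * u * sqrt (Qf b)))"
    proof (cases "p \<le> K")
      case False
      have dl5: "?CC * (real 1 + 4) \<le> dl\<^sup>2" using dl(2) by simp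
      obtain \<Omega>2 where \<Omega>2: "\<Omega>2 \<in> sets M" "1 - 8 / real p ^ 1 \<le> measure M \<Omega>2"
        "\<And>\<omega>. \<omega> \<in> \<Omega>2 \<Longrightarrow> coords_close (dl * u) \<omega>"
        using coords_close_prob[OF p2 dl(1) dl5 small(2)[unfolded u_def]] by (auto simp: u_def)
      have "32 / \<eta> \<le> real p" using False K by linarith
      then have "8 / real p \<le> \<eta> / 4" using \<eta> p2 by (simp add: field_simps)
      then have "1 - \<eta> / 2 \<le> measure M \<Omega>2" using \<Omega>2(2) \<eta> by simp
      moreover have "\<bar>sample_avg n (\<lambda>i. cal_fun b (Zs i \<omega>))\<bar> \<le> dl * u * l1 p b + Rc * u * sqrt (Qf b)"
        "\<bar>sample_avg n (\<lambda>i. wl_fun b (Zs i \<omega>))\<bar> \<le> dl * u * l1 p b + Rc * u * sqrt (Qf b)"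
        if "\<omega> \<in> \<Omega>2" for \<omega> b
        using close1[OF \<Omega>2(3)[OF that], of b] sq[of b] by linarith+
      ultimately show ?thesis using \<Omega>2(1) by (intro bexI[of _ \<Omega>2]) auto
    next
      case True
      define h where "h = dl * u / 2"
      have h: "0 < h" using dl u by (simp add: h_def)
      have fail: "real ((2 * m + 1) ^ (p + 1)) * (v / (real n * h\<^sup>2)) \<le> \<eta> / 4"
      proof -
        have "real n * h\<^sup>2 = dl\<^sup>2 * ln (real p) / 4"
          by (simp add: h_def power_mult_distrib power_divide flip: nu)
        also have "\<dots> \<ge> dl\<^sup>2 * ln 2 / 4" using lnp by (intro divide_right_mono mult_left_mono) auto
        finally have "v / (real n * h\<^sup>2) \<le> v / (dl\<^sup>2 * ln 2 / 4)"
          using v dl n_pos h by (intro divide_left_mono mult_pos_pos) auto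
        also have "\<dots> = \<eta> / (4 * NN)" using dl NN by (simp add: v_def field_simps)
        finally have 1: "v / (real n * h\<^sup>2) \<le> \<eta> / (4 * NN)" .
        have "(2 * m + 1) ^ (p + 1) \<le> (2 * m + 1) ^ (K + 1)" using True by (intro power_increasing) auto
        then have "real ((2 * m + 1) ^ (p + 1)) \<le> NN" unfolding NN_def by (simp only: of_nat_le_iff)
        then have "real ((2 * m + 1) ^ (p + 1)) * (v / (real n * h\<^sup>2)) \<le> NN * (\<eta> / (4 * NN))"
          using 1 v NN by (intro mult_mono) auto
        then show ?thesis using NN by simp
      qed
      have Bm: "h + R1 * u * (real (p + 1) / real m) \<le> dl * u"
      proof -
        have "R1 * (real (p + 1) / real m) \<le> R1 * (real (K + 1) / real m)"
          using True R1(1) by (intro mult_left_mono divide_right_mono) auto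
        also have "\<dots> \<le> dl / 2" using m(2) by (simp only: times_divide_eq_right)
        finally have "R1 * (real (p + 1) / real m) \<le> dl / 2" .
        then have "R1 * (real (p + 1) / real m) * u \<le> dl / 2 * u" using u by (intro mult_right_mono) auto
        moreover have "R1 * u * (real (p + 1) / real m) = R1 * (real (p + 1) / real m) * u" by (simp only: mult_ac)
        moreover have "dl / 2 * u + h = dl * u" by (simp add: h_def)
        ultimately show ?thesis by linarith
      qed
      have vc: "(\<integral>\<omega>. (cal_fun b (obs \<omega>))\<^sup>2 \<partial>P) \<le> v" if b: "l1 p b = 1" "Qf b < \<theta>" for b
      proof -
        have 1: "(\<integral>\<omega>. (cal_fun b (obs \<omega>))\<^sup>2 \<partial>P) \<le> (W + exp L / c) * Qf b
          + (C0 * l1 p b)\<^sup>2 * (measure P {\<omega>\<in>space P. pistar (X \<omega>) < c} + (1 + \<bar>B0\<bar>) / L)"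
          by (rule cal_second_moment(2)[OF c(1) L])
        have 2: "(W + exp L / c) * Qf b \<le> (W + exp L / c) * \<theta>"
          using b(2) W_pos c by (intro mult_left_mono) auto
        have f: "(\<integral>\<omega>. (cal_fun b (obs \<omega>))\<^sup>2 \<partial>P) \<le> (?W + exp L / c) * \<theta>
          + C0\<^sup>2 * (measure P {\<omega>\<in>space P. pistar (X \<omega>) < c} + (1 + \<bar>B0\<bar>) / L)"
          using order_trans[OF 1 add_right_mono[OF 2]] unfolding b(1) mult_1_right W_def .
        have gen: "e \<le> v" if "e \<le> x + c2 * (y + z)" "x \<le> v / 2" "c2 * y \<le> v / 4" "c2 * z = v / 4" for e x c2 y z
          using that by (simp add: distrib_left)
        show ?thesis by (rule gen[OF f \<theta>v(1) cv Lv])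
      qed
      have vw: "(\<integral>\<omega>. (wl_fun b (obs \<omega>))\<^sup>2 \<partial>P) \<le> v" if b: "l1 p b = 1" "Qf b < \<theta>" for b
      proof -
        have 1: "W * D1\<^sup>2 * Qf b \<le> W * D1\<^sup>2 * \<theta>" using b(2) W_pos by (intro mult_left_mono) auto
        have 2: "W * D1\<^sup>2 * \<theta> \<le> v" using \<theta>v(2) unfolding W_def .
        show ?thesis by (rule order_trans[OF wl_second_moment(2) order_trans[OF 1 2]])
      qed
      obtain \<Omega>c where \<Omega>c: "\<Omega>c \<in> sets M" "1 - real ((2 * m + 1) ^ (p + 1)) * (v / (real n * h\<^sup>2)) \<le> measure M \<Omega>c"
        "\<And>\<omega> B b. \<omega> \<in> \<Omega>c \<Longrightarrow> (\<forall>c. \<bar>sample_avg n (\<lambda>i. cal_fun c (Zs i \<omega>))\<bar> \<le> B * l1 p c) \<Longrightarrow> 0 \<le> B \<Longrightarrow>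
          l1 p b = 1 \<Longrightarrow> Qf b < \<theta> \<Longrightarrow> \<bar>sample_avg n (\<lambda>i. cal_fun b (Zs i \<omega>))\<bar> \<le> h + B * (real (p + 1) / real m)"
        using thin_sphere_event[of cal_fun \<theta> v m h, OF cal_fun_diff cal_fun_measurable cal_score
            cal_second_moment(1)[OF c(1) L] vc less_imp_le[OF v] m(1) h] by blast
      obtain \<Omega>w where \<Omega>w: "\<Omega>w \<in> sets M" "1 - real ((2 * m + 1) ^ (p + 1)) * (v / (real n * h\<^sup>2)) \<le> measure M \<Omega>w"
        "\<And>\<omega> B b. \<omega> \<in> \<Omega>w \<Longrightarrow> (\<forall>c. \<bar>sample_avg n (\<lambda>i. wl_fun c (Zs i \<omega>))\<bar> \<le> B * l1 p c) \<Longrightarrow> 0 \<le> B \<Longrightarrow>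
          l1 p b = 1 \<Longrightarrow> Qf b < \<theta> \<Longrightarrow> \<bar>sample_avg n (\<lambda>i. wl_fun b (Zs i \<omega>))\<bar> \<le> h + B * (real (p + 1) / real m)"
        using thin_sphere_event[of wl_fun \<theta> v m h, OF wl_fun_diff wl_fun_measurable wl_score
            wl_second_moment(1) vw less_imp_le[OF v] m(1) h] by blast
      show ?thesis
      proof (intro bexI[of _ "\<Omega>c \<inter> \<Omega>w"] conjI ballI impI allI)
        show "1 - \<eta> / 2 \<le> measure M (\<Omega>c \<inter> \<Omega>w)"
          using M.prob_Int_ge[OF \<Omega>c(1) \<Omega>w(1)] \<Omega>c(2) \<Omega>w(2) fail by linarith
        show "\<Omega>c \<inter> \<Omega>w \<in> sets M" using \<Omega>c(1) \<Omega>w(1) by auto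
        fix \<omega> b assume w: "\<omega> \<in> \<Omega>c \<inter> \<Omega>w" and cl: "coords_close (R1 * u) \<omega>"
        have B0: "0 \<le> R1 * u" using R1 u by simp
        have Rs: "R1 * u / sqrt \<theta> * sqrt (Qf b) \<le> Rc * u * sqrt (Qf b)"
          using mult_right_mono[OF Rc(3), of "u * sqrt (Qf b)"] u Qf_nonneg[of b] by simp
        have dlu: "0 \<le> dl * u" using dl u by simp
        have "\<bar>sample_avg n (\<lambda>i. cal_fun b (Zs i \<omega>))\<bar> \<le> dl * u * l1 p b + R1 * u / sqrt \<theta> * sqrt (Qf b)"
        proof (rule gradient_bound_of_thin_sphere[where Q = Qf])
          fix b assume b: "l1 p b = 1" "Qf b < \<theta>"
          have "\<bar>sample_avg n (\<lambda>i. cal_fun b (Zs i \<omega>))\<bar> \<le> h + R1 * u * (real (p + 1) / real m)"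
            by (rule \<Omega>c(3)) (use w close1(1)[OF cl] B0 b in auto)
          then show "\<bar>sample_avg n (\<lambda>i. cal_fun b (Zs i \<omega>))\<bar> \<le> dl * u" using Bm by linarith
        qed (use close1(1)[OF cl] \<theta> dlu B0 Qf_nonneg Qf_scale in \<open>auto simp: cal_fun_scale sample_avg_scale\<close>)
        then show "\<bar>sample_avg n (\<lambda>i. cal_fun b (Zs i \<omega>))\<bar> \<le> dl * u * l1 p b + Rc * u * sqrt (Qf b)"
          using Rs by linarith
        have "\<bar>sample_avg n (\<lambda>i. wl_fun b (Zs i \<omega>))\<bar> \<le> dl * u * l1 p b + R1 * u / sqrt \<theta> * sqrt (Qf b)"
        proof (rule gradient_bound_of_thin_sphere[where Q = Qf])
          fix b assume b: "l1 p b = 1" "Qf b < \<theta>"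
          have "\<bar>sample_avg n (\<lambda>i. wl_fun b (Zs i \<omega>))\<bar> \<le> h + R1 * u * (real (p + 1) / real m)"
            by (rule \<Omega>w(3)) (use w close1(2)[OF cl] B0 b in auto)
          then show "\<bar>sample_avg n (\<lambda>i. wl_fun b (Zs i \<omega>))\<bar> \<le> dl * u" using Bm by linarith
        qed (use close1(2)[OF cl] \<theta> dlu B0 Qf_nonneg Qf_scale in \<open>auto simp: wl_fun_scale sample_avg_scale\<close>)
        then show "\<bar>sample_avg n (\<lambda>i. wl_fun b (Zs i \<omega>))\<bar> \<le> dl * u * l1 p b + Rc * u * sqrt (Qf b)"
          using Rs by linarith
      qed
    qed
    then obtain \<Omega>2 where \<Omega>2: "\<Omega>2 \<in> sets M" "1 - \<eta> / 2 \<le> measure M \<Omega>2"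
      "\<And>\<omega> b. \<omega> \<in> \<Omega>2 \<Longrightarrow> coords_close (R1 * u) \<omega> \<Longrightarrow>
        \<bar>sample_avg n (\<lambda>i. cal_fun b (Zs i \<omega>))\<bar> \<le> dl * u * l1 p b + Rc * u * sqrt (Qf b)"
      "\<And>\<omega> b. \<omega> \<in> \<Omega>2 \<Longrightarrow> coords_close (R1 * u) \<omega> \<Longrightarrow>
        \<bar>sample_avg n (\<lambda>i. wl_fun b (Zs i \<omega>))\<bar> \<le> dl * u * l1 p b + Rc * u * sqrt (Qf b)"
      by blast
    let ?\<Omega> = "\<Omega>1 \<inter> \<Omega>2 \<inter> \<Omega>r"
    have m12: "\<Omega>1 \<inter> \<Omega>2 \<in> sets M" using \<Omega>1(1) \<Omega>2(1) by auto
    have "1 - \<eta> \<le> measure M ?\<Omega>"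
      using M.prob_Int_ge[OF m12 \<Omega>r(1)] M.prob_Int_ge[OF \<Omega>1(1) \<Omega>2(1)] \<Omega>1p \<Omega>2(2) \<Omega>r(2) \<eta> by linarith
    moreover have "?\<Omega> \<in> sets M" using m12 \<Omega>r(1) by auto
    moreover have "\<omega> \<in> space M \<and> good_sample n p f (\<lambda>i. Ts i \<omega>) (\<lambda>i. Ys i \<omega>) (\<lambda>i. Xs i \<omega>) g a
           (\<lambda>b. \<Sum>j\<le>p. \<Sum>k\<le>p. b j * Sigma_gamma P T X p f g j k * b k) C0 (exp (- B0)) u dl Rc (D1\<^sup>2)"
      if w: "\<omega> \<in> ?\<Omega>" for \<omega>
    proof -
      have cl: "coords_close (R1 * u) \<omega>" using \<Omega>1(3) w by blast
      show ?thesis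
        using \<Omega>r(3)[of \<omega>] w R1(1) Rc(2) u dl(1) \<Omega>2(3,4)[OF _ cl]
        by (intro conjI good_sample_of_events[OF _ cl]) auto
    qed
    ultimately show "\<exists>\<Omega>\<in>sets M. 1 - \<eta> \<le> measure M \<Omega> \<and> (\<forall>\<omega>\<in>\<Omega>. \<omega> \<in> space M \<and>
         good_sample n p f (\<lambda>i. Ts i \<omega>) (\<lambda>i. Ys i \<omega>) (\<lambda>i. Xs i \<omega>) g a
           (\<lambda>b. \<Sum>j\<le>p. \<Sum>k\<le>p. b j * Sigma_gamma P T X p f g j k * b k)
           C0 (exp (- B0)) (sqrt (ln (real p) / real n)) dl Rc (D1\<^sup>2))"
      unfolding u_def[symmetric] by (intro bexI[of _ ?\<Omega>]) auto
  qed
qed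

end


section \<open>Asymptotics\<close>

text \<open>
  The level of the gradients in high dimension. The factor 5 leaves failure probability \<open>8 / p\<close> in
  \<open>coords_close_prob\<close>.
\<close>

definition penalty_const :: "real \<Rightarrow> real \<Rightarrow> real \<Rightarrow> real \<Rightarrow> real" where
  "penalty_const B0 C0 D0 D1 = sqrt (5 * tail_const B0 C0 D0 D1)"

lemma abs_pow3_le: "\<bar>x\<bar> ^ 3 \<le> 1 + x ^ 4" for x :: real
proof (cases "\<bar>x\<bar> \<le> 1")
  case True
  then have "\<bar>x\<bar> ^ 3 \<le> 1" by (simp add: power_le_one)
  moreover have "0 \<le> x ^ 4" by simp
  ultimately show ?thesis by linarith
next
  case False
  then have "\<bar>x\<bar> ^ 3 \<le> \<bar>x\<bar> ^ 4" by (intro power_increasing) auto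
  then show ?thesis by simp
qed

lemma sq_le_pow4: "x\<^sup>2 \<le> 1 + x ^ 4" for x :: real
proof -
  have "0 \<le> (x\<^sup>2 - 1)\<^sup>2 + x\<^sup>2" by simp
  then have "x\<^sup>2 \<le> 1 + (x\<^sup>2)\<^sup>2" by (simp add: power2_diff)
  then show ?thesis by (simp flip: power_mult)
qed

text \<open>
  Centring at \<open>c\<close> instead of the sample mean costs the square of their distance, and replacing \<open>b\<close> by
  \<open>a\<close> costs a cross term that Cauchy-Schwarz controls.
\<close>

lemma sample_variance_close:
  fixes a b :: "nat \<Rightarrow> real"
  assumes n: "0 < n" and ms: "sample_avg n (\<lambda>i. (a i - b i)\<^sup>2) \<le> \<epsilon>\<^sup>2"
    and m: "\<bar>sample_avg n a - sample_avg n b\<bar> \<le> \<epsilon>" "\<bar>sample_avg n b - c\<bar> \<le> \<epsilon>"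
    and V: "\<bar>sample_avg n (\<lambda>i. (b i - c)\<^sup>2) - V\<bar> \<le> \<epsilon>" "V \<le> B" and \<epsilon>: "0 \<le> \<epsilon>" "\<epsilon> \<le> 1" and B: "0 \<le> B"
  shows "\<bar>sample_avg n (\<lambda>i. (a i - sample_avg n a)\<^sup>2) - V\<bar> \<le> (2 * B + 10) * \<epsilon>"
proof -
  let ?A = "sample_avg n a"
  have 1: "sample_avg n (\<lambda>i. (a i - ?A)\<^sup>2) = sample_avg n (\<lambda>i. (a i - c)\<^sup>2) - (?A - c)\<^sup>2"
  proof -
    have "(a i - ?A)\<^sup>2 = (a i - c)\<^sup>2 - 2 * (?A - c) * a i + (?A\<^sup>2 - c\<^sup>2)" for i by algebra
    then have "sample_avg n (\<lambda>i. (a i - ?A)\<^sup>2)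
        = sample_avg n (\<lambda>i. (a i - c)\<^sup>2 - 2 * (?A - c) * a i + (?A\<^sup>2 - c\<^sup>2))" by simp
    also have "\<dots> = sample_avg n (\<lambda>i. (a i - c)\<^sup>2) - 2 * (?A - c) * ?A + (?A\<^sup>2 - c\<^sup>2)"
      using n by (simp only: sample_avg_add sample_avg_diff sample_avg_scale sample_avg_const)
    also have "\<dots> = sample_avg n (\<lambda>i. (a i - c)\<^sup>2) - (?A - c)\<^sup>2" by algebra
    finally show ?thesis .
  qed
  have 2: "sample_avg n (\<lambda>i. (a i - c)\<^sup>2) = sample_avg n (\<lambda>i. (a i - b i)\<^sup>2)
      + 2 * sample_avg n (\<lambda>i. (a i - b i) * (b i - c)) + sample_avg n (\<lambda>i. (b i - c)\<^sup>2)"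
  proof -
    have "(a i - c)\<^sup>2 = (a i - b i)\<^sup>2 + 2 * ((a i - b i) * (b i - c)) + (b i - c)\<^sup>2" for i by algebra
    then show ?thesis by (simp only: sample_avg_add sample_avg_scale)
  qed
  have 3: "\<bar>sample_avg n (\<lambda>i. (a i - b i) * (b i - c))\<bar> \<le> \<epsilon> * (B + 2)"
  proof -
    have "\<bar>sample_avg n (\<lambda>i. (a i - b i) * (b i - c))\<bar> \<le> sample_avg n (\<lambda>i. \<bar>(a i - b i) * (b i - c)\<bar>)"
      by (rule abs_sample_avg_le)
    also have "\<dots> \<le> sqrt (sample_avg n (\<lambda>i. (a i - b i)\<^sup>2)) * sqrt (sample_avg n (\<lambda>i. (b i - c)\<^sup>2))"
      by (rule sample_avg_cauchy_schwarz)
    also have "\<dots> \<le> \<epsilon> * (B + 2)"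
    proof (rule mult_mono)
      show "sqrt (sample_avg n (\<lambda>i. (a i - b i)\<^sup>2)) \<le> \<epsilon>" using ms \<epsilon> by (intro real_le_lsqrt) (auto intro: sample_avg_nonneg)
      have "sample_avg n (\<lambda>i. (b i - c)\<^sup>2) \<le> B + 1" using V \<epsilon> by linarith
      also have "\<dots> \<le> (B + 2)\<^sup>2" using B by (simp add: power2_eq_square algebra_simps)
      finally show "sqrt (sample_avg n (\<lambda>i. (b i - c)\<^sup>2)) \<le> B + 2" using B by (intro real_le_lsqrt) (auto intro: sample_avg_nonneg)
    qed (use \<epsilon> in \<open>auto intro!: real_sqrt_ge_zero sample_avg_nonneg\<close>)
    finally show ?thesis .
  qed
  have ee: "\<epsilon>\<^sup>2 \<le> \<epsilon>" using \<epsilon> by (simp add: power2_eq_square mult_left_le)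
  have 4: "(?A - c)\<^sup>2 \<le> 4 * \<epsilon>"
  proof -
    have "\<bar>?A - c\<bar> \<le> 2 * \<epsilon>" using m by linarith
    then have "(?A - c)\<^sup>2 \<le> (2 * \<epsilon>)\<^sup>2" using \<epsilon> by (intro abs_le_square_iff[THEN iffD1]) simp
    then show ?thesis using ee by (simp add: power_mult_distrib)
  qed
  have 5: "0 \<le> sample_avg n (\<lambda>i. (a i - b i)\<^sup>2)" by (rule sample_avg_nonneg) simp
  have "(2 * B + 10) * \<epsilon> = 2 * (\<epsilon> * (B + 2)) + 6 * \<epsilon>" by algebra
  then show ?thesis unfolding 1 2 using ms ee 3 4 5 V(1) zero_le_power2[of "?A - c"] by linarith
qed

locale asymptotic_setting = causal_sample P M N Y0 Y1 T X pistar Ys Ts Xs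
  for P :: "'w measure" and M :: "'s measure" and N :: "'x measure"
    and Y0 Y1 T :: "'w \<Rightarrow> real" and X :: "'w \<Rightarrow> 'x" and pistar :: "'x \<Rightarrow> real"
    and Ys Ts :: "nat \<Rightarrow> 's \<Rightarrow> real" and Xs :: "nat \<Rightarrow> 's \<Rightarrow> 'x" +
  fixes C0 B0 \<nu>0 \<xi>0 \<eta>0 D0 D1 \<nu>1 \<xi>1 \<eta>1 A0d A1d :: real
    and p :: "nat \<Rightarrow> nat" and f :: "nat \<Rightarrow> nat \<Rightarrow> 'x \<Rightarrow> real"
    and gbar abar :: "nat \<Rightarrow> nat \<Rightarrow> real" and ghat ahat :: "nat \<Rightarrow> 's \<Rightarrow> nat \<Rightarrow> real"
  assumes const_pos: "1 \<le> C0" "0 < \<nu>0" "1 < \<xi>0" "0 < D0" "0 < D1" "0 < \<nu>1" "1 < \<xi>1"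
    and A0d: "0 < A0d" "8 * penalty_const B0 C0 D0 D1 \<le> A0d * (1 - 1 / \<xi>0)"
    and A1d: "0 < A1d" "8 * penalty_const B0 C0 D0 D1 \<le> A1d * (1 - 1 / \<xi>1)"
    and p_ge: "\<And>n. 2 \<le> p n"
    and f_measurable: "\<And>n j. j \<le> p n \<Longrightarrow> f n j \<in> borel_measurable N"
    and ghat_measurable: "\<And>n j. j \<le> p n \<Longrightarrow> (\<lambda>\<omega>. ghat n \<omega> j) \<in> borel_measurable M"
    and ahat_measurable: "\<And>n j. j \<le> p n \<Longrightarrow> (\<lambda>\<omega>. ahat n \<omega> j) \<in> borel_measurable M"
    and ghat_min: "\<And>n. AE \<omega> in M.
      (\<exists>\<gamma>. minimizes (\<lambda>\<gamma>. loss_cal (p n) (f n) n (\<lambda>i. Ts i \<omega>) (\<lambda>i. Xs i \<omega>) \<gamma>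
         + A0d * sqrt (ln (real (p n)) / real n) * l1_pen (p n) \<gamma>) \<gamma>) \<longrightarrow>
      minimizes (\<lambda>\<gamma>. loss_cal (p n) (f n) n (\<lambda>i. Ts i \<omega>) (\<lambda>i. Xs i \<omega>) \<gamma>
         + A0d * sqrt (ln (real (p n)) / real n) * l1_pen (p n) \<gamma>) (ghat n \<omega>)"
    and ahat_min: "\<And>n. AE \<omega> in M.
      minimizes (\<lambda>\<alpha>. loss_wl (p n) (f n) n (\<lambda>i. Ys i \<omega>) (\<lambda>i. Ts i \<omega>) (\<lambda>i. Xs i \<omega>) (ghat n \<omega>) \<alpha>
         + A1d * sqrt (ln (real (p n)) / real n) * l1_pen (p n) \<alpha>) (ahat n \<omega>)"
    and limits: "\<forall>\<^sub>F n in sequentially.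
      minimizes (\<lambda>\<gamma>. \<integral>\<omega>. loss_cal (p n) (f n) n (\<lambda>i. Ts i \<omega>) (\<lambda>i. Xs i \<omega>) \<gamma> \<partial>M) (gbar n) \<and>
      minimizes (\<lambda>\<alpha>. \<integral>\<omega>. loss_wl (p n) (f n) n (\<lambda>i. Ys i \<omega>) (\<lambda>i. Ts i \<omega>) (\<lambda>i. Xs i \<omega>) (gbar n) \<alpha> \<partial>M) (abar n) \<and>
      assumption1 C0 B0 \<nu>0 \<xi>0 \<eta>0 P T X n (p n) (f n) (gbar n) (A0d * sqrt (ln (real (p n)) / real n)) \<and>
      assumption2 C0 B0 D0 D1 \<nu>1 \<xi>1 \<eta>1 P N Y1 T X n (p n) (f n) (gbar n) (abar n)"
    and sparse: "(\<lambda>n. real (card (active (p n) (gbar n)) + card (active (p n) (abar n))) * ln (real (p n)))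
      \<in> o(\<lambda>n. sqrt (real n))"
    and correct: "(\<forall>\<^sub>F n in sequentially. correct_ps P X pistar (p n) (f n)) \<or>
      (\<forall>\<^sub>F n in sequentially. correct_or P N (observed Y0 Y1 T) T X (p n) (f n))"
begin

abbreviation u :: "nat \<Rightarrow> real" where "u n \<equiv> sqrt (ln (real (p n)) / real n)"
definition s :: "nat \<Rightarrow> real" where
  "s n = real (card (active (p n) (gbar n)) + card (active (p n) (abar n)))"
abbreviation row :: "nat \<Rightarrow> bool" where
  "row n \<equiv> calibrated_row P M N Y0 Y1 T X pistar Ys Ts Xs n (p n) (f n) (gbar n) (abar n) C0 B0 D0 D1"
definition mu1 :: real where "mu1 = (\<integral>\<omega>. Y1 \<omega> \<partial>P)"

definition ph :: "nat \<Rightarrow> real \<times> real \<times> 'x \<Rightarrow> real" where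
  "ph n z = (case z of (y, t, x) \<Rightarrow>
     aipw (linpred (p n) (f n) (abar n)) (propensity (p n) (f n) (gbar n)) y t x)"

definition phat :: "nat \<Rightarrow> 's \<Rightarrow> nat \<Rightarrow> real" where
  "phat n \<omega> i = aipw (linpred (p n) (f n) (ahat n \<omega>)) (propensity (p n) (f n) (ghat n \<omega>)) (Ys i \<omega>) (Ts i \<omega>) (Xs i \<omega>)"

definition muhat :: "nat \<Rightarrow> 's \<Rightarrow> real" where "muhat n \<omega> = sample_avg n (phat n \<omega>)"
definition mubar :: "nat \<Rightarrow> 's \<Rightarrow> real" where "mubar n \<omega> = sample_avg n (\<lambda>i. ph n (Zs i \<omega>))"
definition Vhat :: "nat \<Rightarrow> 's \<Rightarrow> real" where
  "Vhat n \<omega> = sample_avg n (\<lambda>i. (phat n \<omega> i - muhat n \<omega>)\<^sup>2)"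
definition V :: "nat \<Rightarrow> real" where
  "V n = prob_space.variance P (\<lambda>\<omega>. ph n (obs \<omega>))"

lemma ph_measurable [measurable]: "ph n \<in> borel_measurable obs_space"
proof -
  have [measurable]: "linpred (p n) (f n) b \<in> borel_measurable N" for b
    unfolding linpred_def[abs_def] by (intro borel_measurable_sum borel_measurable_times f_measurable) auto
  then show ?thesis unfolding ph_def[abs_def] aipw_def propensity_def by measurable
qed

lemma phat_measurable [measurable]: "(\<lambda>\<omega>. phat n \<omega> i) \<in> borel_measurable M"
proof -
  have [measurable]: "(\<lambda>\<omega>. linpred (p n) (f n) (h n \<omega>) (Xs i \<omega>)) \<in> borel_measurable M"
    if "\<And>j. j \<le> p n \<Longrightarrow> (\<lambda>\<omega>. h n \<omega> j) \<in> borel_measurable M" for h :: "nat \<Rightarrow> 's \<Rightarrow> nat \<Rightarrow> real"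
    unfolding linpred_def
    by (intro borel_measurable_sum borel_measurable_times that measurable_compose[OF Xs_measurable f_measurable]) auto
  note [measurable] = this[OF ghat_measurable] this[OF ahat_measurable]
  show ?thesis unfolding phat_def aipw_def propensity_def by measurable
qed

lemma muhat_measurable [measurable]: "muhat n \<in> borel_measurable M"
  unfolding muhat_def[abs_def] sample_avg_def by measurable

lemma mubar_measurable [measurable]: "mubar n \<in> borel_measurable M"
  unfolding mubar_def[abs_def] sample_avg_def by measurable

lemma Vhat_measurable [measurable]: "Vhat n \<in> borel_measurable M"
  unfolding Vhat_def[abs_def] sample_avg_def by measurable

lemma eventually_row: "\<forall>\<^sub>F n in sequentially. row n"
  using limits eventually_gt_at_top[of 0]
proof eventually_elim
  case (elim n)
  then show ?case
    using const_pos by unfold_locales (auto simp: assumption1_def assumption2_def f_measurable)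
qed

lemma eventually_compatible: "\<forall>\<^sub>F n in sequentially.
    compatibility (p n) (Sigma_gamma P T X (p n) (f n) (gbar n)) (active (p n) (gbar n)) \<nu>0 \<xi>0 \<and>
    compatibility (p n) (Sigma_gamma P T X (p n) (f n) (gbar n)) (active (p n) (abar n)) \<nu>1 \<xi>1"
  using limits by eventually_elim (simp add: assumption1_def assumption2_def)

subsection \<open>Rates\<close>

lemma s_ge: "1 \<le> s n"
  using one_le_card_active[of "p n" "gbar n"] by (simp add: s_def)

lemma sparse_lim: "(\<lambda>n. s n * ln (real (p n)) / sqrt (real n)) \<longlonglongrightarrow> 0"
  using smalloD_tendsto[OF sparse] by (simp add: s_def)

lemma root_n_rate: "(\<lambda>n. sqrt (real n) * (s n * (u n)\<^sup>2)) \<longlonglongrightarrow> 0"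
proof (rule Lim_transform_eventually[OF sparse_lim])
  show "\<forall>\<^sub>F n in sequentially. s n * ln (real (p n)) / sqrt (real n) = sqrt (real n) * (s n * (u n)\<^sup>2)"
    using eventually_gt_at_top[of 0]
  proof eventually_elim
    case (elim n)
    have "0 \<le> ln (real (p n))" using p_ge[of n] by simp
    then have "(u n)\<^sup>2 = ln (real (p n)) / (sqrt (real n) * sqrt (real n))" using elim by simp
    then show ?case using elim by (simp add: field_simps)
  qed
qed

lemma rate: "(\<lambda>n. s n * u n) \<longlonglongrightarrow> 0"
proof (rule Lim_null_comparison)
  show "(\<lambda>n. s n * ln (real (p n)) / sqrt (real n) * (1 / sqrt (ln 2))) \<longlonglongrightarrow> 0"
    using tendsto_mult_right[OF sparse_lim, of "1 / sqrt (ln 2)"] by (simp add: mult.commute)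
  show "\<forall>\<^sub>F n in sequentially. norm (s n * u n) \<le> s n * ln (real (p n)) / sqrt (real n) * (1 / sqrt (ln 2))"
  proof (rule always_eventually, rule allI)
    fix n
    have l: "ln 2 \<le> ln (real (p n))" "0 < ln (2 :: real)" using p_ge[of n] by auto
    then have l0: "0 \<le> ln (real (p n))" by linarith
    have "sqrt (ln 2) * sqrt (ln (real (p n))) \<le> sqrt (ln (real (p n))) * sqrt (ln (real (p n)))"
      using l l0 by (intro mult_right_mono) auto
    then have "sqrt (ln 2) * sqrt (ln (real (p n))) \<le> ln (real (p n))" using l0 by simp
    then have "sqrt (ln (real (p n))) \<le> ln (real (p n)) * (1 / sqrt (ln 2))" using l(2) by (simp add: field_simps)
    then have "s n * sqrt (ln (real (p n))) / sqrt (real n) \<le> s n * (ln (real (p n)) * (1 / sqrt (ln 2))) / sqrt (real n)"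
      using s_ge[of n] by (intro divide_right_mono mult_left_mono) auto
    moreover have "norm (s n * u n) = s n * sqrt (ln (real (p n))) / sqrt (real n)"
      using s_ge[of n] l0 by (simp add: real_sqrt_divide abs_mult)
    ultimately show "norm (s n * u n) \<le> s n * ln (real (p n)) / sqrt (real n) * (1 / sqrt (ln 2))" by (simp add: mult_ac)
  qed
qed

subsection \<open>Comparison with the oracle estimator\<close>

text \<open>
  Here \<open>mubar\<close> is the oracle estimator with the limiting coefficients. The constant \<open>Kf\<close> depends on
  the confidence level \<open>\<eta>\<close>, which is harmless since the rates tend to 0.
\<close>

lemma estimators_close:
  assumes \<eta>: "0 < \<eta>"
  shows "\<exists>Kf\<ge>0. \<forall>\<^sub>F n in sequentially. \<exists>\<Omega>\<in>sets M. 1 - \<eta> \<le> measure M \<Omega> \<and> (\<forall>\<omega>\<in>\<Omega>.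
      \<bar>muhat n \<omega> - mubar n \<omega>\<bar> \<le> Kf * (s n * (u n)\<^sup>2) \<and>
      sample_avg n (\<lambda>i. (phat n \<omega> i - ph n (Zs i \<omega>))\<^sup>2) \<le> Kf * (s n * u n))"
proof -
  define dl where "dl = penalty_const B0 C0 D0 D1"
  have CC: "0 < tail_const B0 C0 D0 D1" by (rule tail_const_pos[OF const_pos(1)])
  have dl: "0 < dl" "tail_const B0 C0 D0 D1 * 5 \<le> dl\<^sup>2" using CC by (auto simp: dl_def penalty_const_def)
  obtain Rc u0 where Rc: "0 \<le> Rc" and u0: "0 < u0"
    and good: "\<And>n p (f :: nat \<Rightarrow> 'x \<Rightarrow> real) g a.
      calibrated_row P M N Y0 Y1 T X pistar Ys Ts Xs n p f g a C0 B0 D0 D1 \<Longrightarrow> 2 \<le> p \<Longrightarrow>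
      sqrt (ln (real p) / real n) \<le> u0 \<Longrightarrow>
      \<exists>\<Omega>\<in>sets M. 1 - \<eta> \<le> measure M \<Omega> \<and> (\<forall>\<omega>\<in>\<Omega>. \<omega> \<in> space M \<and>
         good_sample n p f (\<lambda>i. Ts i \<omega>) (\<lambda>i. Ys i \<omega>) (\<lambda>i. Xs i \<omega>) g a
           (\<lambda>b. \<Sum>j\<le>p. \<Sum>k\<le>p. b j * Sigma_gamma P T X p f g j k * b k)
           C0 (exp (- B0)) (sqrt (ln (real p) / real n)) dl Rc (D1\<^sup>2))"
    using good_sample_uniform[OF const_pos(1) \<eta> dl] by blast
  obtain Kf \<tau> where \<tau>: "0 < \<tau>" and Kf: "0 \<le> Kf"
    and expansion: "\<And>n p (f :: nat \<Rightarrow> 'x \<Rightarrow> real) t y x g a Q u s h ah.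
      good_sample n p f t y x g a Q C0 (exp (- B0)) u dl Rc (D1\<^sup>2) \<Longrightarrow> 1 \<le> s \<Longrightarrow> s * u \<le> \<tau> \<Longrightarrow>
      real (card (active p g)) \<le> s \<Longrightarrow> real (card (active p a)) \<le> s \<Longrightarrow>
      \<forall>b. (\<Sum>j\<in>{..p} - active p g. \<bar>b j\<bar>) \<le> \<xi>0 * (\<Sum>j\<in>active p g. \<bar>b j\<bar>) \<longrightarrow>
        \<nu>0\<^sup>2 * (\<Sum>j\<in>active p g. \<bar>b j\<bar>)\<^sup>2 \<le> real (card (active p g)) * Q b \<Longrightarrow>
      \<forall>b. (\<Sum>j\<in>{..p} - active p a. \<bar>b j\<bar>) \<le> \<xi>1 * (\<Sum>j\<in>active p a. \<bar>b j\<bar>) \<longrightarrow>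
        \<nu>1\<^sup>2 * (\<Sum>j\<in>active p a. \<bar>b j\<bar>)\<^sup>2 \<le> real (card (active p a)) * Q b \<Longrightarrow>
      (\<exists>c. minimizes (\<lambda>c. loss_cal p f n t x c + A0d * u * l1_pen p c) c) \<longrightarrow>
         minimizes (\<lambda>c. loss_cal p f n t x c + A0d * u * l1_pen p c) h \<Longrightarrow>
      minimizes (\<lambda>c. loss_wl p f n y t x h c + A1d * u * l1_pen p c) ah \<Longrightarrow>
      \<bar>mu1_hat n y t x (linpred p f ah) (propensity p f h)
          - mu1_hat n y t x (linpred p f a) (propensity p f g)\<bar> \<le> Kf * (s * u\<^sup>2) \<and>
      sample_avg n (\<lambda>i. (aipw (linpred p f ah) (propensity p f h) (y i) (t i) (x i)
       - aipw (linpred p f a) (propensity p f g) (y i) (t i) (x i))\<^sup>2) \<le> Kf * (s * u)"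
    using estimator_expansion[OF const_pos(1) less_imp_le[OF exp_gt_zero] dl(1) Rc zero_le_power2
        A0d(1) A1d(1) const_pos(3,7,2,6) A0d(2)[folded dl_def] A1d(2)[folded dl_def], of "- B0" D1]
    by (elim exE conjE) blast
  have small: "\<forall>\<^sub>F n in sequentially. s n * u n < min u0 \<tau>"
    using order_tendstoD(2)[OF rate, of "min u0 \<tau>"] u0 \<tau> by simp
  have "\<forall>\<^sub>F n in sequentially. \<exists>\<Omega>\<in>sets M. 1 - \<eta> \<le> measure M \<Omega> \<and> (\<forall>\<omega>\<in>\<Omega>.
      \<bar>muhat n \<omega> - mubar n \<omega>\<bar> \<le> Kf * (s n * (u n)\<^sup>2) \<and>
      sample_avg n (\<lambda>i. (phat n \<omega> i - ph n (Zs i \<omega>))\<^sup>2) \<le> Kf * (s n * u n))"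
    using small eventually_row eventually_compatible
  proof eventually_elim
    case (elim n)
    have u_nn: "0 \<le> u n" using p_ge[of n] by simp
    have "1 * u n \<le> s n * u n" using s_ge[of n] u_nn by (intro mult_right_mono)
    then have un: "u n \<le> u0" using elim(1) by simp
    obtain \<Omega> where \<Omega>: "\<Omega> \<in> sets M" "1 - \<eta> \<le> measure M \<Omega>"
      and gs: "\<And>\<omega>. \<omega> \<in> \<Omega> \<Longrightarrow> \<omega> \<in> space M \<and> good_sample n (p n) (f n) (\<lambda>i. Ts i \<omega>) (\<lambda>i. Ys i \<omega>) (\<lambda>i. Xs i \<omega>) (gbar n) (abar n)
           (\<lambda>b. \<Sum>j\<le>p n. \<Sum>k\<le>p n. b j * Sigma_gamma P T X (p n) (f n) (gbar n) j k * b k)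
           C0 (exp (- B0)) (u n) dl Rc (D1\<^sup>2)"
      using good[OF elim(2) p_ge un] by blast
    have "AE \<omega> in M. ((\<exists>\<gamma>. minimizes (\<lambda>\<gamma>. loss_cal (p n) (f n) n (\<lambda>i. Ts i \<omega>) (\<lambda>i. Xs i \<omega>) \<gamma>
         + A0d * u n * l1_pen (p n) \<gamma>) \<gamma>) \<longrightarrow>
      minimizes (\<lambda>\<gamma>. loss_cal (p n) (f n) n (\<lambda>i. Ts i \<omega>) (\<lambda>i. Xs i \<omega>) \<gamma>
         + A0d * u n * l1_pen (p n) \<gamma>) (ghat n \<omega>)) \<and>
      minimizes (\<lambda>\<alpha>. loss_wl (p n) (f n) n (\<lambda>i. Ys i \<omega>) (\<lambda>i. Ts i \<omega>) (\<lambda>i. Xs i \<omega>) (ghat n \<omega>) \<alpha>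
         + A1d * u n * l1_pen (p n) \<alpha>) (ahat n \<omega>)"
      by (rule AE_conjI[OF ghat_min ahat_min])
    then obtain A where A: "A \<in> null_sets M"
      and mins: "\<And>\<omega>. \<omega> \<in> space M - A \<Longrightarrow> ((\<exists>\<gamma>. minimizes (\<lambda>\<gamma>. loss_cal (p n) (f n) n (\<lambda>i. Ts i \<omega>) (\<lambda>i. Xs i \<omega>) \<gamma>
         + A0d * u n * l1_pen (p n) \<gamma>) \<gamma>) \<longrightarrow>
      minimizes (\<lambda>\<gamma>. loss_cal (p n) (f n) n (\<lambda>i. Ts i \<omega>) (\<lambda>i. Xs i \<omega>) \<gamma>
         + A0d * u n * l1_pen (p n) \<gamma>) (ghat n \<omega>)) \<and>
      minimizes (\<lambda>\<alpha>. loss_wl (p n) (f n) n (\<lambda>i. Ys i \<omega>) (\<lambda>i. Ts i \<omega>) (\<lambda>i. Xs i \<omega>) (ghat n \<omega>) \<alpha>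
         + A1d * u n * l1_pen (p n) \<alpha>) (ahat n \<omega>)"
      by (rule AE_E3) blast
    have mA: "measure M (\<Omega> - A) = measure M \<Omega>"
      unfolding measure_def using emeasure_Diff_null_set[OF A \<Omega>(1)] by simp
    show ?case
    proof (rule bexI[of _ "\<Omega> - A"], intro conjI ballI)
      show "\<Omega> - A \<in> sets M" using \<Omega>(1) A by (auto simp: null_sets_def)
      show "1 - \<eta> \<le> measure M (\<Omega> - A)" using mA \<Omega>(2) by simp
      fix \<omega> assume w: "\<omega> \<in> \<Omega> - A"
      then have gs': "good_sample n (p n) (f n) (\<lambda>i. Ts i \<omega>) (\<lambda>i. Ys i \<omega>) (\<lambda>i. Xs i \<omega>) (gbar n) (abar n)
           (\<lambda>b. \<Sum>j\<le>p n. \<Sum>k\<le>p n. b j * Sigma_gamma P T X (p n) (f n) (gbar n) j k * b k)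
           C0 (exp (- B0)) (u n) dl Rc (D1\<^sup>2)" and wA: "\<omega> \<in> space M - A"
        using gs[of \<omega>] by auto
      have c1: "real (card (active (p n) (gbar n))) \<le> s n" "real (card (active (p n) (abar n))) \<le> s n"
        by (auto simp: s_def)
      have su: "s n * u n \<le> \<tau>" using elim(1) by simp
      note ex = expansion[OF gs' s_ge su c1 elim(3)[THEN conjunct1, unfolded compatibility_def]
          elim(3)[THEN conjunct2, unfolded compatibility_def] mins[OF wA, THEN conjunct1] mins[OF wA, THEN conjunct2]]
      have ex': "\<bar>mu1_hat n (\<lambda>i. Ys i \<omega>) (\<lambda>i. Ts i \<omega>) (\<lambda>i. Xs i \<omega>) (linpred (p n) (f n) (ahat n \<omega>)) (propensity (p n) (f n) (ghat n \<omega>))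
          - mu1_hat n (\<lambda>i. Ys i \<omega>) (\<lambda>i. Ts i \<omega>) (\<lambda>i. Xs i \<omega>) (linpred (p n) (f n) (abar n)) (propensity (p n) (f n) (gbar n))\<bar> \<le> Kf * (s n * (u n)\<^sup>2) \<and>
        sample_avg n (\<lambda>i. (aipw (linpred (p n) (f n) (ahat n \<omega>)) (propensity (p n) (f n) (ghat n \<omega>)) (Ys i \<omega>) (Ts i \<omega>) (Xs i \<omega>)
         - aipw (linpred (p n) (f n) (abar n)) (propensity (p n) (f n) (gbar n)) (Ys i \<omega>) (Ts i \<omega>) (Xs i \<omega>))\<^sup>2) \<le> Kf * (s n * u n)"
        by (rule ex)
      show "\<bar>muhat n \<omega> - mubar n \<omega>\<bar> \<le> Kf * (s n * (u n)\<^sup>2)"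
        using ex'[THEN conjunct1] by (simp only: muhat_def mubar_def phat_def[abs_def] ph_def Zs_def mu1_hat_def prod.case)
      show "sample_avg n (\<lambda>i. (phat n \<omega> i - ph n (Zs i \<omega>))\<^sup>2) \<le> Kf * (s n * u n)"
        using ex'[THEN conjunct2] by (simp only: phat_def ph_def Zs_def prod.case)
    qed
  qed
  then show ?thesis using Kf by blast
qed


lemma prob_tendsto_0I:
  fixes A :: "nat \<Rightarrow> 's set"
  assumes "\<And>\<eta>. 0 < \<eta> \<Longrightarrow> \<forall>\<^sub>F n in sequentially. measure M (A n) \<le> \<eta>"
  shows "(\<lambda>n. measure M (A n)) \<longlonglongrightarrow> 0"
proof (rule tendstoI)
  fix e :: real assume "0 < e"
  then have "\<forall>\<^sub>F n in sequentially. measure M (A n) \<le> e / 2" by (intro assms) simp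
  then show "\<forall>\<^sub>F n in sequentially. dist (measure M (A n)) 0 < e"
    by eventually_elim (use \<open>0 < e\<close> in \<open>simp add: measure_nonneg\<close>)
qed

lemma muhat_close:
  assumes e: "0 < e"
  shows "(\<lambda>n. measure M {\<omega>\<in>space M. e < \<bar>sqrt (real n) * (muhat n \<omega> - mu1) - sqrt (real n) * (mubar n \<omega> - mu1)\<bar>}) \<longlonglongrightarrow> 0"
proof (rule prob_tendsto_0I)
  fix \<eta> :: real assume \<eta>: "0 < \<eta>"
  obtain Kf where Kf: "0 \<le> Kf" and ev: "\<forall>\<^sub>F n in sequentially. \<exists>\<Omega>\<in>sets M. 1 - \<eta> \<le> measure M \<Omega> \<and> (\<forall>\<omega>\<in>\<Omega>.
      \<bar>muhat n \<omega> - mubar n \<omega>\<bar> \<le> Kf * (s n * (u n)\<^sup>2) \<and>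
      sample_avg n (\<lambda>i. (phat n \<omega> i - ph n (Zs i \<omega>))\<^sup>2) \<le> Kf * (s n * u n))"
    using estimators_close[OF \<eta>] by blast
  have "(\<lambda>n. Kf * (sqrt (real n) * (s n * (u n)\<^sup>2))) \<longlonglongrightarrow> 0"
    using tendsto_mult_right_zero[OF root_n_rate] by blast
  then have "\<forall>\<^sub>F n in sequentially. Kf * (sqrt (real n) * (s n * (u n)\<^sup>2)) < e" using e by (rule order_tendstoD(2))
  with ev show "\<forall>\<^sub>F n in sequentially. measure M {\<omega>\<in>space M. e < \<bar>sqrt (real n) * (muhat n \<omega> - mu1) - sqrt (real n) * (mubar n \<omega> - mu1)\<bar>} \<le> \<eta>"
  proof eventually_elim
    case (elim n)
    then obtain \<Omega> where \<Omega>: "\<Omega> \<in> sets M" "1 - \<eta> \<le> measure M \<Omega>"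
      and b: "\<And>\<omega>. \<omega> \<in> \<Omega> \<Longrightarrow> \<bar>muhat n \<omega> - mubar n \<omega>\<bar> \<le> Kf * (s n * (u n)\<^sup>2)" by blast
    let ?B = "{\<omega>\<in>space M. e < \<bar>sqrt (real n) * (muhat n \<omega> - mu1) - sqrt (real n) * (mubar n \<omega> - mu1)\<bar>}"
    have "?B \<subseteq> space M - \<Omega>"
    proof
      fix \<omega> assume w: "\<omega> \<in> ?B"
      have "\<omega> \<notin> \<Omega>"
      proof
        assume "\<omega> \<in> \<Omega>"
        have eq: "sqrt (real n) * (muhat n \<omega> - mu1) - sqrt (real n) * (mubar n \<omega> - mu1) = sqrt (real n) * (muhat n \<omega> - mubar n \<omega>)"
          by (simp add: algebra_simps)
        have "\<bar>sqrt (real n) * (muhat n \<omega> - mubar n \<omega>)\<bar> \<le> sqrt (real n) * (Kf * (s n * (u n)\<^sup>2))"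
          unfolding abs_mult using b[OF \<open>\<omega> \<in> \<Omega>\<close>] by (intro mult_mono) auto
        also have "\<dots> = Kf * (sqrt (real n) * (s n * (u n)\<^sup>2))" by (simp only: mult_ac)
        finally have "\<bar>sqrt (real n) * (muhat n \<omega> - mubar n \<omega>)\<bar> < e" using elim(2) by linarith
        moreover have "e < \<bar>sqrt (real n) * (muhat n \<omega> - mubar n \<omega>)\<bar>" using w by (simp only: mem_Collect_eq eq)
        ultimately show False by linarith
      qed
      then show "\<omega> \<in> space M - \<Omega>" using w by simp
    qed
    then have "measure M ?B \<le> measure M (space M - \<Omega>)" using \<Omega>(1) by (intro M.finite_measure_mono) auto
    then show ?case using \<Omega> by (simp add: M.prob_compl)
  qed
qed

subsection \<open>Moments of the influence functions\<close>

text \<open>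
  A bound on the centred fourth moments that is the same for all rows. It exists because \<open>Y1\<close>,
  being a bounded predictor plus a sub-gaussian residual, has a fourth moment.
\<close>

definition B4 :: real where
  "B4 = 8 * ((8 * (\<integral>\<omega>. (Y1 \<omega>) ^ 4 \<partial>P) + 16 * (exp (- B0) + 1) ^ 4 * D0 ^ 4 * (1 + D1\<^sup>2 / D0\<^sup>2)) + mu1 ^ 4)"

lemma B4_nonneg: "0 \<le> B4"
  unfolding B4_def by (intro mult_nonneg_nonneg add_nonneg_nonneg integral_nonneg_AE AE_I2) auto

definition centred_moments :: "nat \<Rightarrow> bool" where
  "centred_moments n \<longleftrightarrow> 0 < n \<and> (\<integral>\<omega>. ph n (obs \<omega>) \<partial>P) = mu1 \<and> integrable P (\<lambda>\<omega>. ph n (obs \<omega>))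
     \<and> integrable P (\<lambda>\<omega>. (ph n (obs \<omega>) - mu1) ^ 4) \<and> (\<integral>\<omega>. (ph n (obs \<omega>) - mu1) ^ 4 \<partial>P) \<le> B4"

lemma eventually_centred_moments: "\<forall>\<^sub>F n in sequentially. centred_moments n"
proof -
  have "\<forall>\<^sub>F n in sequentially. row n \<and> (correct_ps P X pistar (p n) (f n)
      \<or> correct_or P N (observed Y0 Y1 T) T X (p n) (f n))"
    using correct
  proof
    assume "\<forall>\<^sub>F n in sequentially. correct_ps P X pistar (p n) (f n)"
    with eventually_row show ?thesis by eventually_elim simp
  next
    assume "\<forall>\<^sub>F n in sequentially. correct_or P N (observed Y0 Y1 T) T X (p n) (f n)"
    with eventually_row show ?thesis by eventually_elim simp
  qed
  then show ?thesis
  proof eventually_elim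
    case (elim n)
    then interpret R: calibrated_row P M N Y0 Y1 T X pistar Ys Ts Xs n "p n" "f n" "gbar n" "abar n" C0 B0 D0 D1
      by blast
    have ph: "ph n = R.phi" by (rule ext) (simp add: ph_def R.phi_def)
    have mean: "(\<integral>\<omega>. ph n (obs \<omega>) \<partial>P) = mu1"
      unfolding ph mu1_def using elim R.mean_phi_correct_ps R.mean_phi_correct_or by blast
    have le: "(ph n (obs \<omega>) - mu1) ^ 4 \<le> 8 * ((ph n (obs \<omega>)) ^ 4 + mu1 ^ 4)" for \<omega>
      using power4_add_le[of "ph n (obs \<omega>)" "- mu1"] by simp
    have iB: "integrable P (\<lambda>\<omega>. 8 * ((ph n (obs \<omega>)) ^ 4 + mu1 ^ 4))"
      unfolding ph using R.phi_pow4(1) by simp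
    have i4: "integrable P (\<lambda>\<omega>. (ph n (obs \<omega>) - mu1) ^ 4)"
      by (rule Bochner_Integration.integrable_bound[OF iB]) (use le in \<open>auto intro!: AE_I2\<close>)
    have "(\<integral>\<omega>. (ph n (obs \<omega>) - mu1) ^ 4 \<partial>P) \<le> (\<integral>\<omega>. 8 * ((ph n (obs \<omega>)) ^ 4 + mu1 ^ 4) \<partial>P)"
      using i4 iB le by (rule integral_mono)
    also have "\<dots> = 8 * ((\<integral>\<omega>. (ph n (obs \<omega>)) ^ 4 \<partial>P) + mu1 ^ 4)"
      unfolding ph using R.phi_pow4(1) by (simp add: P.prob_space)
    also have "\<dots> \<le> B4"
      unfolding B4_def ph using R.phi_pow4(2) by (simp add: R.W_def R.C1_def)
    finally show ?case
      unfolding centred_moments_def using R.n_pos mean i4 R.phi_integrable by (simp add: ph)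
  qed
qed

lemma V_eq: "centred_moments n \<Longrightarrow> V n = (\<integral>\<omega>. (ph n (obs \<omega>) - mu1)\<^sup>2 \<partial>P)"
  by (simp add: V_def centred_moments_def)

lemma centred_integrable:
  assumes "centred_moments n"
  shows "integrable P (\<lambda>\<omega>. (ph n (obs \<omega>) - mu1)\<^sup>2)" "integrable P (\<lambda>\<omega>. \<bar>ph n (obs \<omega>) - mu1\<bar> ^ 3)"
    and "V n \<le> 1 + B4" "0 \<le> V n" "(\<integral>\<omega>. \<bar>ph n (obs \<omega>) - mu1\<bar> ^ 3 \<partial>P) \<le> 1 + B4"
proof -
  have i: "integrable P (\<lambda>\<omega>. 1 + (ph n (obs \<omega>) - mu1) ^ 4)" using assms by (simp add: centred_moments_def)
  show i2: "integrable P (\<lambda>\<omega>. (ph n (obs \<omega>) - mu1)\<^sup>2)"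
    by (rule Bochner_Integration.integrable_bound[OF i])
       (auto intro!: AE_I2 order_trans[OF sq_le_pow4])
  show i3: "integrable P (\<lambda>\<omega>. \<bar>ph n (obs \<omega>) - mu1\<bar> ^ 3)"
    by (rule Bochner_Integration.integrable_bound[OF i])
       (auto intro!: AE_I2 order_trans[OF abs_pow3_le])
  have B: "(\<integral>\<omega>. 1 + (ph n (obs \<omega>) - mu1) ^ 4 \<partial>P) \<le> 1 + B4"
    using assms by (simp add: centred_moments_def P.prob_space)
  show "V n \<le> 1 + B4" unfolding V_eq[OF assms] by (rule order_trans[OF integral_mono[OF i2 i sq_le_pow4] B])
  show "0 \<le> V n" unfolding V_eq[OF assms] by simp
  show "(\<integral>\<omega>. \<bar>ph n (obs \<omega>) - mu1\<bar> ^ 3 \<partial>P) \<le> 1 + B4"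
    by (rule order_trans[OF integral_mono[OF i3 i abs_pow3_le] B])
qed

subsection \<open>Asymptotic normality\<close>

text \<open>
  The argument \<open>t\<close> may vary with \<open>n\<close>, so that the limit applies also to the sum divided by its
  standard deviation.
\<close>

lemma char_oracle:
  assumes tb: "\<forall>\<^sub>F n in sequentially. \<bar>t n\<bar> \<le> \<tau>"
  shows "(\<lambda>n. char (distr M borel (\<lambda>\<omega>. sqrt (real n) * (mubar n \<omega> - mu1))) (t n)
      - exp (- (V n * (t n)\<^sup>2 / 2))) \<longlonglongrightarrow> 0"
proof (rule Lim_null_comparison)
  define c where "c = (1 + B4) * \<tau>\<^sup>2 / 2"
  show "(\<lambda>n. \<tau> ^ 3 * (1 + B4) / sqrt (real n) + 2 * c\<^sup>2 / real n) \<longlonglongrightarrow> 0"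
  proof (rule tendsto_eq_rhs[OF tendsto_add])
    show "(\<lambda>n. 2 * c\<^sup>2 / real n) \<longlonglongrightarrow> 0" by (rule lim_const_over_n)
    show "(\<lambda>n. \<tau> ^ 3 * (1 + B4) / sqrt (real n)) \<longlonglongrightarrow> 0"
      by (rule real_tendsto_divide_at_top[OF tendsto_const])
         (rule filterlim_compose[OF sqrt_at_top filterlim_real_sequentially])
  qed simp
  have big: "\<forall>\<^sub>F n in sequentially. c \<le> real n"
    using eventually_ge_at_top[of "nat \<lceil>c\<rceil>"] by eventually_elim linarith
  show "\<forall>\<^sub>F n in sequentially. norm (char (distr M borel (\<lambda>\<omega>. sqrt (real n) * (mubar n \<omega> - mu1))) (t n)
      - exp (- (V n * (t n)\<^sup>2 / 2))) \<le> \<tau> ^ 3 * (1 + B4) / sqrt (real n) + 2 * c\<^sup>2 / real n"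
    using eventually_centred_moments tb big
  proof eventually_elim
    case (elim n)
    have n: "0 < n" using elim(1) by (simp add: centred_moments_def)
    define e where "e z = ph n z - mu1" for z
    have em [measurable]: "e \<in> borel_measurable obs_space" unfolding e_def[abs_def] by measurable
    note ci = centred_integrable[OF elim(1)]
    have sum: "sqrt (real n) * (mubar n \<omega> - mu1) = (\<Sum>i<n. e (Zs i \<omega>)) / sqrt (real n)" for \<omega>
    proof -
      have "mubar n \<omega> - mu1 = (\<Sum>i<n. e (Zs i \<omega>)) / real n"
        using n by (simp add: mubar_def sample_avg_def e_def sum_subtractf diff_divide_distrib)
      moreover have "q * (S / (q * q)) = S / q" if "0 < q" for q S :: real using that by simp
      ultimately show ?thesis using n by (metis of_nat_0_less_iff of_nat_0_le_iff real_sqrt_gt_0_iff real_sqrt_mult_self abs_of_nonneg)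
    qed
    have t2: "(t n)\<^sup>2 \<le> \<tau>\<^sup>2" using elim(2) by (intro abs_le_square_iff[THEN iffD1]) simp
    have Vt: "V n * (t n)\<^sup>2 / 2 \<le> c" unfolding c_def
      using ci(3,4) t2 B4_nonneg by (intro divide_right_mono mult_mono) auto
    have "cmod (char (distr M borel (\<lambda>\<omega>. (\<Sum>i<n. e (Zs i \<omega>)) / sqrt (real n))) (t n) - exp (- (V n * (t n)\<^sup>2 / 2)))
      \<le> \<bar>t n\<bar> ^ 3 * (1 + B4) / sqrt (real n) + 2 * (V n * (t n)\<^sup>2 / 2)\<^sup>2 / real n"
    proof (rule M.char_iid_sum_error[where \<mu> = "distr P borel (\<lambda>\<omega>. e (obs \<omega>))"])
      show "M.indep_vars (\<lambda>i. borel) (\<lambda>i \<omega>. e (Zs i \<omega>)) UNIV"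
        by (rule M.indep_vars_compose2[OF Zs_indep]) measurable
      show "distr M borel (\<lambda>\<omega>. e (Zs i \<omega>)) = distr P borel (\<lambda>\<omega>. e (obs \<omega>))" for i
      proof -
        have "distr M borel (\<lambda>\<omega>. e (Zs i \<omega>)) = distr (distr M obs_space (Zs i)) borel e"
          by (subst distr_distr) (auto simp: comp_def)
        also have "\<dots> = distr P borel (\<lambda>\<omega>. e (obs \<omega>))"
          unfolding distr_Zs by (subst distr_distr) (auto simp: comp_def)
        finally show ?thesis .
      qed
      show "integrable M (\<lambda>\<omega>. e (Zs 0 \<omega>))"
        using integrable_Zs[of e 0] elim(1) by (simp add: centred_moments_def e_def)
      show "integrable M (\<lambda>\<omega>. (e (Zs 0 \<omega>))\<^sup>2)"
        using integrable_Zs[of "\<lambda>z. (e z)\<^sup>2" 0] ci by (simp add: e_def)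
      show "integrable M (\<lambda>\<omega>. \<bar>e (Zs 0 \<omega>)\<bar> ^ 3)"
        using integrable_Zs[of "\<lambda>z. \<bar>e z\<bar> ^ 3" 0] ci by (simp add: e_def)
      show "(\<integral>\<omega>. e (Zs 0 \<omega>) \<partial>M) = 0"
        using integral_Zs[of e 0] elim(1) by (simp add: centred_moments_def e_def P.prob_space)
      show "(\<integral>\<omega>. (e (Zs 0 \<omega>))\<^sup>2 \<partial>M) = V n"
        using integral_Zs[of "\<lambda>z. (e z)\<^sup>2" 0] V_eq[OF elim(1)] by (simp add: e_def)
      show "(\<integral>\<omega>. \<bar>e (Zs 0 \<omega>)\<bar> ^ 3 \<partial>M) \<le> 1 + B4"
        using integral_Zs[of "\<lambda>z. \<bar>e z\<bar> ^ 3" 0] ci by (simp add: e_def)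
      show "V n * (t n)\<^sup>2 / 2 \<le> real n" using Vt elim(3) by linarith
    qed (rule n)
    also have "\<dots> \<le> \<tau> ^ 3 * (1 + B4) / sqrt (real n) + 2 * c\<^sup>2 / real n"
    proof (intro add_mono divide_right_mono mult_right_mono mult_left_mono)
      show "\<bar>t n\<bar> ^ 3 \<le> \<tau> ^ 3" using elim(2) by (intro power_mono) auto
      show "(V n * (t n)\<^sup>2 / 2)\<^sup>2 \<le> c\<^sup>2" using Vt ci(4) by (intro power_mono) auto
    qed (use B4_nonneg in auto)
    finally show ?case unfolding sum .
  qed
qed

theorem asymptotic_normality:
  "conv_in_law (\<lambda>n. distr M borel (\<lambda>\<omega>. sqrt (real n) * (muhat n \<omega> - mu1))) (\<lambda>n. normal0 (V n))"
proof (rule conv_in_law_normal0)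
  show "real_distribution (distr M borel (\<lambda>\<omega>. sqrt (real n) * (muhat n \<omega> - mu1)))" for n
    by (rule M.real_distribution_distr) measurable
  show "\<forall>\<^sub>F n in sequentially. 0 \<le> V n \<and> V n \<le> 1 + B4"
    using eventually_centred_moments by eventually_elim (use centred_integrable in auto)
  fix t :: real
  have 1: "(\<lambda>n. char (distr M borel (\<lambda>\<omega>. sqrt (real n) * (muhat n \<omega> - mu1))) t
      - char (distr M borel (\<lambda>\<omega>. sqrt (real n) * (mubar n \<omega> - mu1))) t) \<longlonglongrightarrow> 0"
    by (rule M.char_diff_tendsto_0[OF _ _ muhat_close]) measurable
  have 2: "(\<lambda>n. char (distr M borel (\<lambda>\<omega>. sqrt (real n) * (mubar n \<omega> - mu1))) t - exp (- (V n * t\<^sup>2 / 2))) \<longlonglongrightarrow> 0"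
    by (rule char_oracle[of "\<lambda>_. t" "\<bar>t\<bar>"]) simp
  show "(\<lambda>n. char (distr M borel (\<lambda>\<omega>. sqrt (real n) * (muhat n \<omega> - mu1))) t - exp (- (V n * t\<^sup>2 / 2))) \<longlonglongrightarrow> 0"
    using tendsto_add[OF 1 2] by simp
qed

subsection \<open>Consistency of the variance estimator\<close>

theorem variance_consistency:
  assumes e: "0 < e"
  shows "(\<lambda>n. measure M {\<omega>\<in>space M. e < \<bar>Vhat n \<omega> - V n\<bar>}) \<longlonglongrightarrow> 0"
proof (rule prob_tendsto_0I)
  fix \<eta> :: real assume \<eta>: "0 < \<eta>"
  define c where "c = 2 * (1 + B4) + 10"
  define \<epsilon> where "\<epsilon> = min 1 (e / c)"
  have c: "0 < c" using B4_nonneg by (simp add: c_def)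
  have \<epsilon>: "0 < \<epsilon>" "\<epsilon> \<le> 1" "c * \<epsilon> \<le> e" using e c by (auto simp: \<epsilon>_def min_def field_simps)
  have \<eta>3: "0 < \<eta> / 3" using \<eta> by simp
  obtain Kf where Kf: "0 \<le> Kf" and ev: "\<forall>\<^sub>F n in sequentially. \<exists>\<Omega>\<in>sets M. 1 - \<eta> / 3 \<le> measure M \<Omega> \<and> (\<forall>\<omega>\<in>\<Omega>.
      \<bar>muhat n \<omega> - mubar n \<omega>\<bar> \<le> Kf * (s n * (u n)\<^sup>2) \<and>
      sample_avg n (\<lambda>i. (phat n \<omega> i - ph n (Zs i \<omega>))\<^sup>2) \<le> Kf * (s n * u n))"
    using estimators_close[OF \<eta>3] by blast
  have "(\<lambda>n. Kf * (s n * u n)) \<longlonglongrightarrow> 0" using tendsto_mult_right_zero[OF rate] by blast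
  then have r1: "\<forall>\<^sub>F n in sequentially. Kf * (s n * u n) < \<epsilon>\<^sup>2" using \<epsilon> by (intro order_tendstoD(2)) auto
  have "(\<lambda>n. Kf * (sqrt (real n) * (s n * (u n)\<^sup>2))) \<longlonglongrightarrow> 0"
    using tendsto_mult_right_zero[OF root_n_rate] by blast
  then have r2: "\<forall>\<^sub>F n in sequentially. Kf * (sqrt (real n) * (s n * (u n)\<^sup>2)) < \<epsilon>" using \<epsilon> by (intro order_tendstoD(2)) auto
  have "(\<lambda>n. (1 + B4) / \<epsilon>\<^sup>2 / real n) \<longlonglongrightarrow> 0" by (rule lim_const_over_n)
  then have r3: "\<forall>\<^sub>F n in sequentially. (1 + B4) / \<epsilon>\<^sup>2 / real n < \<eta> / 3" using \<eta>3 by (rule order_tendstoD(2))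
  show "\<forall>\<^sub>F n in sequentially. measure M {\<omega>\<in>space M. e < \<bar>Vhat n \<omega> - V n\<bar>} \<le> \<eta>"
    using ev r1 r2 r3 eventually_centred_moments
  proof eventually_elim
    case (elim n)
    note cm = elim(5)
    note ci = centred_integrable[OF cm]
    have n: "0 < n" using cm by (simp add: centred_moments_def)
    obtain \<Omega> where \<Omega>: "\<Omega> \<in> sets M" "1 - \<eta> / 3 \<le> measure M \<Omega>"
      and b1: "\<And>\<omega>. \<omega> \<in> \<Omega> \<Longrightarrow> \<bar>muhat n \<omega> - mubar n \<omega>\<bar> \<le> Kf * (s n * (u n)\<^sup>2)"
      and b2: "\<And>\<omega>. \<omega> \<in> \<Omega> \<Longrightarrow> sample_avg n (\<lambda>i. (phat n \<omega> i - ph n (Zs i \<omega>))\<^sup>2) \<le> Kf * (s n * u n)"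
      using elim(1) by blast
    let ?h1 = "\<lambda>z. ph n z - mu1" and ?h2 = "\<lambda>z. (ph n z - mu1)\<^sup>2 - V n"
    have q: "(1 + B4) / (real n * \<epsilon>\<^sup>2) \<le> \<eta> / 3" using elim(4) by (simp add: mult.commute)
    let ?B1 = "{\<omega>\<in>space M. \<epsilon> \<le> \<bar>sample_avg n (\<lambda>i. ?h1 (Zs i \<omega>))\<bar>}"
    let ?B2 = "{\<omega>\<in>space M. \<epsilon> \<le> \<bar>sample_avg n (\<lambda>i. ?h2 (Zs i \<omega>))\<bar>}"
    have B1: "measure M ?B1 \<le> \<eta> / 3"
    proof (rule order_trans[OF _ q], rule sample_avg_chebyshev)
      show "(\<integral>\<omega>. (?h1 (obs \<omega>))\<^sup>2 \<partial>P) \<le> 1 + B4" using ci(3) V_eq[OF cm] by simp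
      show "(\<integral>\<omega>. ?h1 (obs \<omega>) \<partial>P) = 0" using cm by (simp add: centred_moments_def P.prob_space)
    qed (use ci \<epsilon> n in auto)
    have B2: "measure M ?B2 \<le> \<eta> / 3"
    proof (rule order_trans[OF _ q], rule sample_avg_chebyshev)
      have i4: "integrable P (\<lambda>\<omega>. (ph n (obs \<omega>) - mu1) ^ 4)" using cm by (simp add: centred_moments_def)
      have eq: "(?h2 z)\<^sup>2 = (ph n z - mu1) ^ 4 - 2 * V n * (ph n z - mu1)\<^sup>2 + (V n)\<^sup>2" for z
        by algebra
      show "integrable P (\<lambda>\<omega>. (?h2 (obs \<omega>))\<^sup>2)" unfolding eq using i4 ci(1) by simp
      have "(\<integral>\<omega>. (?h2 (obs \<omega>))\<^sup>2 \<partial>P) = (\<integral>\<omega>. (ph n (obs \<omega>) - mu1) ^ 4 \<partial>P) - 2 * V n * V n + (V n)\<^sup>2"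
        unfolding eq using i4 ci(1) V_eq[OF cm] by (simp add: P.prob_space)
      also have "\<dots> \<le> 1 + B4"
      proof -
        have "(\<integral>\<omega>. (ph n (obs \<omega>) - mu1) ^ 4 \<partial>P) \<le> B4" using cm by (simp add: centred_moments_def)
        moreover have "2 * V n * V n = 2 * (V n)\<^sup>2" by (simp add: power2_eq_square)
        ultimately show ?thesis using zero_le_power2[of "V n"] by linarith
      qed
      finally show "(\<integral>\<omega>. (?h2 (obs \<omega>))\<^sup>2 \<partial>P) \<le> 1 + B4" .
      show "(\<integral>\<omega>. ?h2 (obs \<omega>) \<partial>P) = 0" using ci(1) V_eq[OF cm] by (simp add: P.prob_space)
    qed (use \<epsilon> n in auto)
    have Bm: "?B1 \<in> sets M" "?B2 \<in> sets M" unfolding sample_avg_def by measurable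
    let ?E = "{\<omega>\<in>space M. e < \<bar>Vhat n \<omega> - V n\<bar>}"
    have "?E \<subseteq> (space M - \<Omega>) \<union> (?B1 \<union> ?B2)"
    proof
      fix \<omega> assume w: "\<omega> \<in> ?E"
      show "\<omega> \<in> (space M - \<Omega>) \<union> (?B1 \<union> ?B2)"
      proof (rule ccontr)
        assume "\<not> ?thesis"
        then have w': "\<omega> \<in> \<Omega>" "\<bar>sample_avg n (\<lambda>i. ?h1 (Zs i \<omega>))\<bar> < \<epsilon>" "\<bar>sample_avg n (\<lambda>i. ?h2 (Zs i \<omega>))\<bar> < \<epsilon>"
          using w by auto
        have "\<bar>Vhat n \<omega> - V n\<bar> \<le> (2 * (1 + B4) + 10) * \<epsilon>"
          unfolding Vhat_def muhat_def
        proof (rule sample_variance_close[where b = "\<lambda>i. ph n (Zs i \<omega>)" and c = mu1])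
          show "sample_avg n (\<lambda>i. (phat n \<omega> i - ph n (Zs i \<omega>))\<^sup>2) \<le> \<epsilon>\<^sup>2"
            using b2[OF w'(1)] elim(2) by linarith
          have "1 * (Kf * (s n * (u n)\<^sup>2)) \<le> sqrt (real n) * (Kf * (s n * (u n)\<^sup>2))"
            using n Kf s_ge[of n] by (intro mult_right_mono) auto
          also have "\<dots> = Kf * (sqrt (real n) * (s n * (u n)\<^sup>2))" by (simp only: mult_ac)
          finally have "Kf * (s n * (u n)\<^sup>2) \<le> \<epsilon>" using elim(3) by linarith
          then show "\<bar>sample_avg n (phat n \<omega>) - sample_avg n (\<lambda>i. ph n (Zs i \<omega>))\<bar> \<le> \<epsilon>"
            using b1[OF w'(1)] by (simp add: muhat_def mubar_def)
          show "\<bar>sample_avg n (\<lambda>i. ph n (Zs i \<omega>)) - mu1\<bar> \<le> \<epsilon>"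
            using w'(2) n by (simp add: sample_avg_diff sample_avg_const)
          show "\<bar>sample_avg n (\<lambda>i. (ph n (Zs i \<omega>) - mu1)\<^sup>2) - V n\<bar> \<le> \<epsilon>"
            using w'(3) n by (simp add: sample_avg_diff sample_avg_const)
        qed (use n ci \<epsilon> B4_nonneg in auto)
        also have "\<dots> \<le> e" using \<epsilon>(3) by (simp add: c_def)
        finally show False using w by simp
      qed
    qed
    then have "measure M ?E \<le> measure M ((space M - \<Omega>) \<union> (?B1 \<union> ?B2))"
      using \<Omega>(1) Bm by (intro M.finite_measure_mono) auto
    also have "\<dots> \<le> measure M (space M - \<Omega>) + (measure M ?B1 + measure M ?B2)"
      using \<Omega>(1) Bm by (intro order_trans[OF measure_Un_le] add_left_mono measure_Un_le) auto
    also have "\<dots> \<le> \<eta>" using \<Omega> B1 B2 by (simp add: M.prob_compl)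
    finally show ?case .
  qed
qed

subsection \<open>Confidence intervals\<close>

theorem interval_coverage:
  assumes v0: "0 < v" and vV: "\<forall>\<^sub>F n in sequentially. v \<le> V n" and c: "0 < c" "c < 1"
  defines "z \<equiv> quantile std_normal_distribution (1 - c / 2)"
  shows "(\<lambda>n. measure M {\<omega>\<in>space M. muhat n \<omega> - z * sqrt (Vhat n \<omega> / real n) \<le> mu1
      \<and> mu1 \<le> muhat n \<omega> + z * sqrt (Vhat n \<omega> / real n)}) \<longlonglongrightarrow> 1 - c"
proof -
  have z: "0 < z" unfolding z_def by (rule std_normal_quantile_coverage(1)[OF c])
  define U where "U n \<omega> = sqrt (real n) * (muhat n \<omega> - mu1) / sqrt (V n)" for n \<omega>
  define C where "C n \<omega> = sqrt (real n) * (mubar n \<omega> - mu1) / sqrt (V n)" for n \<omega>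
  define r where "r n \<omega> = sqrt (Vhat n \<omega> / V n)" for n \<omega>
  have rv [measurable]: "U n \<in> borel_measurable M" "C n \<in> borel_measurable M" "r n \<in> borel_measurable M" for n
    unfolding U_def[abs_def] C_def[abs_def] r_def[abs_def] by measurable
  have close: "(\<lambda>n. measure M {\<omega>\<in>space M. e < \<bar>U n \<omega> - C n \<omega>\<bar>}) \<longlonglongrightarrow> 0" if e: "0 < e" for e
  proof (rule tendsto_sandwich[OF _ _ tendsto_const muhat_close])
    show "0 < e * sqrt v" using e v0 by simp
    show "\<forall>\<^sub>F n in sequentially. 0 \<le> measure M {\<omega>\<in>space M. e < \<bar>U n \<omega> - C n \<omega>\<bar>}" by simp
    show "\<forall>\<^sub>F n in sequentially. measure M {\<omega>\<in>space M. e < \<bar>U n \<omega> - C n \<omega>\<bar>}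
        \<le> measure M {\<omega>\<in>space M. e * sqrt v < \<bar>sqrt (real n) * (muhat n \<omega> - mu1) - sqrt (real n) * (mubar n \<omega> - mu1)\<bar>}"
      using vV
    proof eventually_elim
      case (elim n)
      have Vp: "0 < V n" using elim v0 by linarith
      show ?case
      proof (rule M.finite_measure_mono)
        show "{\<omega>\<in>space M. e < \<bar>U n \<omega> - C n \<omega>\<bar>}
          \<subseteq> {\<omega>\<in>space M. e * sqrt v < \<bar>sqrt (real n) * (muhat n \<omega> - mu1) - sqrt (real n) * (mubar n \<omega> - mu1)\<bar>}"
        proof
          fix \<omega> assume w: "\<omega> \<in> {\<omega>\<in>space M. e < \<bar>U n \<omega> - C n \<omega>\<bar>}"
          let ?d = "sqrt (real n) * (muhat n \<omega> - mu1) - sqrt (real n) * (mubar n \<omega> - mu1)"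
          have "U n \<omega> - C n \<omega> = ?d / sqrt (V n)" unfolding U_def C_def by (simp add: diff_divide_distrib)
          then have "\<bar>U n \<omega> - C n \<omega>\<bar> = \<bar>?d\<bar> / sqrt (V n)" using Vp by simp
          then have "e * sqrt (V n) < \<bar>?d\<bar>" using w Vp by (simp add: pos_less_divide_eq)
          moreover have "e * sqrt v \<le> e * sqrt (V n)" using elim e by (intro mult_left_mono) auto
          ultimately show "\<omega> \<in> {\<omega>\<in>space M. e * sqrt v < \<bar>sqrt (real n) * (muhat n \<omega> - mu1) - sqrt (real n) * (mubar n \<omega> - mu1)\<bar>}"
            using w by simp
        qed
      qed measurable
    qed
  qed
  have weak: "weak_conv_m (\<lambda>n. distr M borel (U n)) std_normal_distribution"
  proof (rule levy_continuity[OF _ real_dist_normal_dist])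
    show "real_distribution (distr M borel (U n))" for n by (rule M.real_distribution_distr) measurable
    fix t :: real
    define tn where "tn n = t / sqrt (V n)" for n
    have tb: "\<forall>\<^sub>F n in sequentially. \<bar>tn n\<bar> \<le> \<bar>t\<bar> / sqrt v"
      using vV
    proof eventually_elim
      case (elim n)
      then show ?case using v0 by (simp add: tn_def frac_le)
    qed
    have 1: "(\<lambda>n. char (distr M borel (U n)) t - char (distr M borel (C n)) t) \<longlonglongrightarrow> 0"
      by (rule M.char_diff_tendsto_0[OF rv(1,2) close])
    have "(\<lambda>n. char (distr M borel (C n)) t - exp (- (t\<^sup>2 / 2))) \<longlonglongrightarrow> 0"
    proof (rule Lim_transform_eventually[OF char_oracle[OF tb]])
      show "\<forall>\<^sub>F n in sequentially. char (distr M borel (\<lambda>\<omega>. sqrt (real n) * (mubar n \<omega> - mu1))) (tn n)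
          - exp (- (V n * (tn n)\<^sup>2 / 2)) = char (distr M borel (C n)) t - exp (- (t\<^sup>2 / 2))"
        using vV
      proof eventually_elim
        case (elim n)
        have Vp: "0 < V n" using elim v0 by linarith
        have "char (distr M borel (\<lambda>\<omega>. sqrt (real n) * (mubar n \<omega> - mu1))) (tn n) = char (distr M borel (C n)) t"
          unfolding char_def tn_def C_def by (subst (1 2) integral_distr) (auto simp: C_def)
        moreover have "V n * (tn n)\<^sup>2 = t\<^sup>2" using Vp by (simp add: tn_def power_divide)
        ultimately show ?case by simp
      qed
    qed
    from tendsto_add[OF 1 this] have "(\<lambda>n. char (distr M borel (U n)) t - exp (- (t\<^sup>2 / 2))) \<longlonglongrightarrow> 0" by simp
    then show "(\<lambda>n. char (distr M borel (U n)) t) \<longlonglongrightarrow> char std_normal_distribution t"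
      by (simp add: char_std_normal_distribution LIM_zero_iff)
  qed
  have r1: "(\<lambda>n. measure M {\<omega>\<in>space M. e < \<bar>r n \<omega> - 1\<bar>}) \<longlonglongrightarrow> 0" if e: "0 < e" for e
  proof (rule tendsto_sandwich[OF _ _ tendsto_const variance_consistency])
    show "0 < e * v" using e v0 by simp
    show "\<forall>\<^sub>F n in sequentially. 0 \<le> measure M {\<omega>\<in>space M. e < \<bar>r n \<omega> - 1\<bar>}" by simp
    show "\<forall>\<^sub>F n in sequentially. measure M {\<omega>\<in>space M. e < \<bar>r n \<omega> - 1\<bar>} \<le> measure M {\<omega>\<in>space M. e * v < \<bar>Vhat n \<omega> - V n\<bar>}"
      using vV
    proof eventually_elim
      case (elim n)
      have Vp: "0 < V n" using elim v0 by linarith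
      show ?case
      proof (rule M.finite_measure_mono)
        show "{\<omega>\<in>space M. e < \<bar>r n \<omega> - 1\<bar>} \<subseteq> {\<omega>\<in>space M. e * v < \<bar>Vhat n \<omega> - V n\<bar>}"
        proof
          fix \<omega> assume w: "\<omega> \<in> {\<omega>\<in>space M. e < \<bar>r n \<omega> - 1\<bar>}"
          have Vh: "0 \<le> Vhat n \<omega>" unfolding Vhat_def by (rule sample_avg_nonneg) simp
          have r0: "0 \<le> r n \<omega>" using Vh Vp by (simp add: r_def)
          have r2: "(r n \<omega>)\<^sup>2 = Vhat n \<omega> / V n" using Vh Vp by (simp add: r_def)
          have "\<bar>r n \<omega> - 1\<bar> * 1 \<le> \<bar>r n \<omega> - 1\<bar> * (r n \<omega> + 1)" using r0 by (intro mult_left_mono) auto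
          also have "\<dots> = \<bar>(r n \<omega> - 1) * (r n \<omega> + 1)\<bar>" using r0 by (simp add: abs_mult)
          also have "(r n \<omega> - 1) * (r n \<omega> + 1) = (r n \<omega>)\<^sup>2 - 1" by algebra
          also have "\<dots> = (Vhat n \<omega> - V n) / V n" unfolding r2 using Vp by (simp add: diff_divide_distrib)
          finally have "\<bar>r n \<omega> - 1\<bar> \<le> \<bar>Vhat n \<omega> - V n\<bar> / V n" using Vp by simp
          then have "e < \<bar>Vhat n \<omega> - V n\<bar> / V n" using w by simp
          then have "e * V n < \<bar>Vhat n \<omega> - V n\<bar>" using Vp by (simp add: pos_less_divide_eq)
          moreover have "e * v \<le> e * V n" using elim e by (intro mult_left_mono) auto
          ultimately show "\<omega> \<in> {\<omega>\<in>space M. e * v < \<bar>Vhat n \<omega> - V n\<bar>}" using w by simp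
        qed
      qed measurable
    qed
  qed
  have lim: "(\<lambda>n. measure M {\<omega>\<in>space M. \<bar>U n \<omega>\<bar> \<le> z * r n \<omega>}) \<longlonglongrightarrow> 1 - c"
    using M.scaled_interval_coverage[OF rv(1,3) weak r1 z]
    unfolding z_def std_normal_quantile_coverage(2)[OF c] .
  show ?thesis
  proof (rule Lim_transform_eventually[OF lim])
    show "\<forall>\<^sub>F n in sequentially. measure M {\<omega>\<in>space M. \<bar>U n \<omega>\<bar> \<le> z * r n \<omega>}
      = measure M {\<omega>\<in>space M. muhat n \<omega> - z * sqrt (Vhat n \<omega> / real n) \<le> mu1
          \<and> mu1 \<le> muhat n \<omega> + z * sqrt (Vhat n \<omega> / real n)}"
      using vV eventually_gt_at_top[of 0]
    proof eventually_elim
      case (elim n)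
      have Vp: "0 < V n" using elim v0 by linarith
      have n: "0 < sqrt (real n)" using elim by simp
      have "(\<bar>U n \<omega>\<bar> \<le> z * r n \<omega>) = (muhat n \<omega> - z * sqrt (Vhat n \<omega> / real n) \<le> mu1
          \<and> mu1 \<le> muhat n \<omega> + z * sqrt (Vhat n \<omega> / real n))" for \<omega>
      proof -
        let ?q = "z * sqrt (Vhat n \<omega> / real n)"
        have "(\<bar>U n \<omega>\<bar> \<le> z * r n \<omega>) = (sqrt (real n) * \<bar>muhat n \<omega> - mu1\<bar> / sqrt (V n) \<le> z * sqrt (Vhat n \<omega>) / sqrt (V n))"
          unfolding U_def r_def using Vp by (simp add: abs_mult real_sqrt_divide)
        also have "\<dots> = (sqrt (real n) * \<bar>muhat n \<omega> - mu1\<bar> \<le> z * sqrt (Vhat n \<omega>))"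
          using Vp by (simp add: divide_le_cancel)
        also have "\<dots> = (\<bar>muhat n \<omega> - mu1\<bar> \<le> ?q)"
          using n by (simp add: real_sqrt_divide pos_le_divide_eq mult.commute)
        also have "\<dots> = (muhat n \<omega> - ?q \<le> mu1 \<and> mu1 \<le> muhat n \<omega> + ?q)" by (auto simp: abs_le_iff)
        finally show ?thesis .
      qed
      then show ?case by simp
    qed
  qed
qed

end


section \<open>Choice of the tuning constants\<close>

text \<open>
  The penalty has to dominate the gradient level \<open>dl\<close> by the factor \<open>8 / (1 - 1 / \<xi>)\<close>, which leaves
  room inside the cone of the compatibility condition. This fixes both constants in terms of the
  given bounds alone.
\<close>

theorem proposition1:
  fixes C0 B0 \<nu>0 \<xi>0 \<eta>0 D0 D1 \<nu>1 \<xi>1 \<eta>1 :: real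
  assumes "1 \<le> C0" "0 < \<nu>0" "1 < \<xi>0" "0 < \<eta>0"
    and "0 < D0" "0 < D1" "0 < \<nu>1" "1 < \<xi>1" "0 < \<eta>1" "\<eta>1 < 1"
  shows "\<exists>A0min A1min. \<forall>A0d\<ge>A0min. \<forall>A1d\<ge>A1min.
        \<forall>(P :: 'w measure) (M :: 's measure) (N :: 'x measure) Y0 Y1 T X pistar Ys Ts Xs
          (p :: nat \<Rightarrow> nat) (f :: nat \<Rightarrow> nat \<Rightarrow> 'x \<Rightarrow> real)
          (gbar :: nat \<Rightarrow> nat \<Rightarrow> real) (abar :: nat \<Rightarrow> nat \<Rightarrow> real)
          (ghat :: nat \<Rightarrow> 's \<Rightarrow> nat \<Rightarrow> real) (ahat :: nat \<Rightarrow> 's \<Rightarrow> nat \<Rightarrow> real).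
        let lam0 = (\<lambda>n. A0d * sqrt (ln (real (p n)) / real n));
            lam1 = (\<lambda>n. A1d * sqrt (ln (real (p n)) / real n));
            Y = observed Y0 Y1 T;
            mu1 = (\<integral>\<omega>. Y1 \<omega> \<partial>P);
            pibar = (\<lambda>n. propensity (p n) (f n) (gbar n));
            mbar = (\<lambda>n. linpred (p n) (f n) (abar n));
            pihat = (\<lambda>n \<omega>. propensity (p n) (f n) (ghat n \<omega>));
            mhat = (\<lambda>n \<omega>. linpred (p n) (f n) (ahat n \<omega>));
            V = (\<lambda>n. prob_space.variance P (\<lambda>\<omega>. aipw (mbar n) (pibar n) (Y \<omega>) (T \<omega>) (X \<omega>)));
            muhat = (\<lambda>n \<omega>. mu1_hat n (\<lambda>i. Ys i \<omega>) (\<lambda>i. Ts i \<omega>) (\<lambda>i. Xs i \<omega>) (mhat n \<omega>) (pihat n \<omega>));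
            Vhat = (\<lambda>n \<omega>. V_hat n (\<lambda>i. Ys i \<omega>) (\<lambda>i. Ts i \<omega>) (\<lambda>i. Xs i \<omega>) (mhat n \<omega>) (pihat n \<omega>))
        in
          causal_sample P M N Y0 Y1 T X pistar Ys Ts Xs \<and>
          (\<forall>n. 2 \<le> p n) \<and>
          (\<forall>n. \<forall>j\<le>p n. f n j \<in> borel_measurable N) \<and>
          (\<forall>n. \<forall>x\<in>space N. f n 0 x = 1) \<and>
          (\<forall>n. \<forall>j\<le>p n. (\<lambda>\<omega>. ghat n \<omega> j) \<in> borel_measurable M) \<and>
          (\<forall>n. \<forall>j\<le>p n. (\<lambda>\<omega>. ahat n \<omega> j) \<in> borel_measurable M) \<and>
          (\<forall>n. AE \<omega> in M.
             let obj = (\<lambda>\<gamma>. loss_cal (p n) (f n) n (\<lambda>i. Ts i \<omega>) (\<lambda>i. Xs i \<omega>) \<gamma>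
                              + lam0 n * l1_pen (p n) \<gamma>)
             in (\<exists>\<gamma>. minimizes obj \<gamma>) \<longrightarrow> minimizes obj (ghat n \<omega>)) \<and>
          (\<forall>n. AE \<omega> in M.
             minimizes (\<lambda>\<alpha>. loss_wl (p n) (f n) n (\<lambda>i. Ys i \<omega>) (\<lambda>i. Ts i \<omega>) (\<lambda>i. Xs i \<omega>) (ghat n \<omega>) \<alpha>
                              + lam1 n * l1_pen (p n) \<alpha>) (ahat n \<omega>)) \<and>
          (\<forall>\<^sub>F n in sequentially.
             minimizes (\<lambda>\<gamma>. \<integral>\<omega>. loss_cal (p n) (f n) n (\<lambda>i. Ts i \<omega>) (\<lambda>i. Xs i \<omega>) \<gamma> \<partial>M) (gbar n) \<and>
             minimizes (\<lambda>\<alpha>. \<integral>\<omega>. loss_wl (p n) (f n) n (\<lambda>i. Ys i \<omega>) (\<lambda>i. Ts i \<omega>) (\<lambda>i. Xs i \<omega>)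
                                   (gbar n) \<alpha> \<partial>M) (abar n) \<and>
             assumption1 C0 B0 \<nu>0 \<xi>0 \<eta>0 P T X n (p n) (f n) (gbar n) (lam0 n) \<and>
             assumption2 C0 B0 D0 D1 \<nu>1 \<xi>1 \<eta>1 P N Y1 T X n (p n) (f n) (gbar n) (abar n)) \<and>
          (\<lambda>n. real (card (active (p n) (gbar n)) + card (active (p n) (abar n))) * ln (real (p n)))
             \<in> o(\<lambda>n. sqrt (real n)) \<and>
          ((\<forall>\<^sub>F n in sequentially. correct_ps P X pistar (p n) (f n)) \<or>
           (\<forall>\<^sub>F n in sequentially. correct_or P N Y T X (p n) (f n)))
          \<longrightarrow>
          conv_in_law (\<lambda>n. distr M borel (\<lambda>\<omega>. sqrt (real n) * (muhat n \<omega> - mu1)))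
                      (\<lambda>n. normal0 (V n)) \<and>
          (\<forall>e>0. (\<lambda>n. measure M {\<omega>\<in>space M. \<bar>Vhat n \<omega> - V n\<bar> > e}) \<longlonglongrightarrow> 0) \<and>
          ((\<exists>v>0. \<forall>\<^sub>F n in sequentially. v \<le> V n) \<longrightarrow>
           (\<forall>c. 0 < c \<and> c < 1 \<longrightarrow>
             (let z = quantile std_normal_distribution (1 - c / 2) in
              (\<lambda>n. measure M {\<omega>\<in>space M.
                     muhat n \<omega> - z * sqrt (Vhat n \<omega> / real n) \<le> mu1 \<and>
                     mu1 \<le> muhat n \<omega> + z * sqrt (Vhat n \<omega> / real n)}) \<longlonglongrightarrow> 1 - c)))"
proof -
  define dl where "dl = penalty_const B0 C0 D0 D1"
  have dl: "0 < dl"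
    using tail_const_pos[OF assms(1), of B0 D0 D1] by (simp add: dl_def penalty_const_def)
  have k: "0 < 1 - 1 / \<xi>0" "0 < 1 - 1 / \<xi>1" using assms(3,8) by simp_all
  have tuning: "0 < A \<and> 8 * dl \<le> A * \<kappa>" if "8 * dl / \<kappa> \<le> A" "0 < \<kappa>" for A \<kappa>
  proof -
    have "0 < 8 * dl / \<kappa>" using dl that(2) by simp
    then have "0 < A" using that(1) by linarith
    then show ?thesis using that by (simp add: pos_divide_le_eq)
  qed
  show ?thesis
    unfolding Let_def
  proof (rule exI[of _ "8 * dl / (1 - 1 / \<xi>0)"], rule exI[of _ "8 * dl / (1 - 1 / \<xi>1)"], intro allI impI, goal_cases)
    case (1 A0d A1d P M N Y0 Y1 T X pistar Ys Ts Xs p f gbar abar ghat ahat)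
    interpret asymptotic_setting P M N Y0 Y1 T X pistar Ys Ts Xs C0 B0 \<nu>0 \<xi>0 \<eta>0 D0 D1 \<nu>1 \<xi>1 \<eta>1
        A0d A1d p f gbar abar ghat ahat
      using 1(3) tuning[OF 1(1) k(1)] tuning[OF 1(2) k(2)] assms
      unfolding asymptotic_setting_def asymptotic_setting_axioms_def dl_def by (elim conjE) (intro conjI allI impI; simp)
    have mu: "muhat n \<omega> = mu1_hat n (\<lambda>i. Ys i \<omega>) (\<lambda>i. Ts i \<omega>) (\<lambda>i. Xs i \<omega>)
        (linpred (p n) (f n) (ahat n \<omega>)) (propensity (p n) (f n) (ghat n \<omega>))" for n \<omega>
      by (simp add: muhat_def phat_def[abs_def] mu1_hat_def)
    have Vh: "Vhat n \<omega> = V_hat n (\<lambda>i. Ys i \<omega>) (\<lambda>i. Ts i \<omega>) (\<lambda>i. Xs i \<omega>)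
        (linpred (p n) (f n) (ahat n \<omega>)) (propensity (p n) (f n) (ghat n \<omega>))" for n \<omega>
      by (simp add: Vhat_def V_hat_def phat_def mu)
    have V: "V n = prob_space.variance P (\<lambda>\<omega>. aipw (linpred (p n) (f n) (abar n))
        (propensity (p n) (f n) (gbar n)) (observed Y0 Y1 T \<omega>) (T \<omega>) (X \<omega>))" for n
      by (simp add: V_def ph_def obs_def)
    show ?case
      unfolding mu[symmetric] Vh[symmetric] V[symmetric] mu1_def[symmetric]
      using asymptotic_normality variance_consistency interval_coverage by blast
  qed
qed

end
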